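(* Let $q\in[0,1)$, let $\{X_t\}_{t\ge0}$ be the canonical $q$-Brownian motion on the $q$-Fock space, with associated non-commutative probability space $(\mathcal{A},\varphi)$, let $\mathbb{X}^{2,S}$ be the Stratonovich product Lévy area above $X$ and $\mathbb{X}^S:=(X,\mathbb{X}^{2,S})$. Fix $\gamma\in(1/3,1/2)$. For all $0\le s<t$ and every adapted controlled biprocess $\mathbf{U}\in\mathbf{Q}_X([s,t])$ with decomposition $$\delta\mathbf{U}_{uv}=\delta X_{uv}\sharp\mathcal{U}^{X,1}_u+\mathcal{U}^{X,2}_u\sharp\delta X_{uv}+\mathbf{U}^\flat_{uv},\qquad s\le u<v\le t,$$ it holds that $$\int_s^t\mathbf{U}_u\sharp\mathrm{d}\mathbb{X}^S_u=\int_s^t\mathbf{U}_u\sharp\mathrm{d}X_u+\frac12\int_s^t(\mathrm{Id}\times\Gamma_q\times\mathrm{Id})[\mathcal{U}^{X,1}_u+\mathcal{U}^{X,2}_u]\,\mathrm{d}u\qquad\text{in }L^2(\varphi),$$ where the left-hand side is the rough integral and the first term on the right-hand side is the product Itô integral.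
   Context: Canonical $q$-Brownian motion: on the $q$-Fock space over $L^2(\mathbb{R}_+;\mathbb{C})$ (completion of $\mathbb{C}\Omega\oplus\bigoplus_{n\ge1}H^{\otimes n}$, $H=L^2(\mathbb{R}_+;\mathbb{C})$, for $\langle f_1\otimes\cdots\otimes f_n,g_1\otimes\cdots\otimes g_m\rangle_q=\mathbf{1}_{n=m}\sum_{\sigma\in S_n}q^{\mathrm{inv}(\sigma)}\prod_i\langle f_i,g_{\sigma(i)}\rangle$, where $\mathrm{inv}(\sigma)$ is the number of inversions), $X_t:=a(\mathbf{1}_{[0,t]})+a^\ast(\mathbf{1}_{[0,t]})$ with $a^\ast(f)$ the left creation operator and $a(f)$ its adjoint; $\mathcal{A}$ is the von Neumann algebra generated by $\{X_t\}_{t\ge0}$ and $\varphi=\langle\Omega,\cdot\,\Omega\rangle_q$ is the (faithful, tracial) vacuum state. $\|\cdot\|$ is the operator norm; $L^2(\varphi)$ is the completion of $\mathcal{A}$ for $\langle U,V\rangle=\varphi(UV^\ast)$. Notation: $\delta g_{st}:=g_t-g_s$. $\mathcal{A}_t$ is the operator-norm closure of the unital algebra generated by $\{X_s\}_{s\le t}$; $\mathcal{B}_t$ is the von Neumann algebra generated by $\{X_s\}_{s\le t}$; $\varphi(U|\mathcal{B}_t)$ is the unique $Z\in\mathcal{B}_t$ with $\varphi(ZW^\ast)=\varphi(UW^\ast)$ for all $W\in\mathcal{B}_t$. $\hat\otimes$ is the projective tensor product (with projective norm, also denoted $\|\cdot\|$), $\mathcal{A}^{\hat\otimes3}=\mathcal{A}\hat\otimes\mathcal{A}\hat\otimes\mathcal{A}$.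 The symbol $\sharp$ denotes the continuous linear extensions of $(U_1\otimes U_2)\sharp Y:=U_1YU_2$, $\ Y\sharp(U_1\otimes U_2\otimes U_3):=(U_1YU_2)\otimes U_3$, $\ (U_1\otimes U_2\otimes U_3)\sharp Y:=U_1\otimes(U_2YU_3)$. A biprocess (resp. triprocess) is a map from an interval to $\mathcal{A}\hat\otimes\mathcal{A}$ (resp. $\mathcal{A}^{\hat\otimes3}$); it is adapted if its value at time $u$ lies in $\mathcal{A}_u\hat\otimes\mathcal{A}_u$ (resp. $\mathcal{A}_u^{\hat\otimes3}$). Hölder spaces, for $V=\mathcal{A}^{\hat\otimes n}$: $\mathcal{C}_1^\alpha(I;V)$ is the set of continuous $h:I\to V$ with $\sup_{u<v}\|\delta h_{uv}\|/|v-u|^\alpha<\infty$; $\mathcal{C}_2^\alpha(I;V)$ is the set of continuous $h:\{(u,v)\in I^2:u\le v\}\to V$ vanishing on the diagonal with $\sup_{u<v}\|h_{uv}\|/|v-u|^\alpha<\infty$. Adapted controlled biprocess: $\mathbf{Q}_X(I)$ is the set of adapted biprocesses $\mathbf{U}\in\mathcal{C}_1^\gamma(I;\mathcal{A}\hat\otimes\mathcal{A})$ with increments $\delta\mathbf{U}_{uv}=\delta X_{uv}\sharp\mathcal{U}^{X,1}_u+\mathcal{U}^{X,2}_u\sharp\delta X_{uv}+\mathbf{U}^\flat_{uv}$, $u<v\in I$, for some adapted triprocesses $\mathcal{U}^{X,1},\mathcal{U}^{X,2}\in\mathcal{C}_1^\gamma(I;\mathcal{A}^{\hat\otimes3})$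 and some $\mathbf{U}^\flat\in\mathcal{C}_2^{2\gamma}(I;\mathcal{A}\hat\otimes\mathcal{A})$. Second quantization: $\Gamma_q:\bigcup_{t\ge0}\mathcal{A}_t\to\mathcal{A}$, $\Gamma_q(U):=\varphi(\delta X_{s,s+1}\,U\,\delta X_{s,s+1}\,|\,\mathcal{B}_s)$ for $U\in\mathcal{A}_s$ (independent of the choice of $s$ with $U\in\mathcal{A}_s$). $\mathrm{Id}\times\Gamma_q\times\mathrm{Id}$ is the continuous extension, from $\bigcup_{u\ge0}\mathcal{A}_u^{\hat\otimes3}$ to $L^2(\varphi)$, of $U_1\otimes U_2\otimes U_3\mapsto U_1\Gamma_q(U_2)U_3$. Product Itô integral: an adapted biprocess $\mathbf{V}$ on $I$ is Itô integrable against $X$ if the Riemann sums $\sum_{t_i\in\Delta}\mathbf{V}_{t_i}\sharp\delta X_{t_it_{i+1}}$ converge in $L^2(\varphi)$ as the mesh of the partition $\Delta$ of $I$ tends to $0$; the limit is denoted $\int_I\mathbf{V}_u\sharp\mathrm{d}X_u$. (Every adapted controlled biprocess on a bounded interval is Itô integrable.) Stratonovich product Lévy area: with $X^n$ the linear interpolation of $X$ along the dyadic points $i/2^n$, $i\ge0$, and $\mathbb{X}^{2,n}_{st}[\mathbf{U}]:=\int_s^t(\mathbf{U}\sharp\delta X^n_{su})\,\mathrm{d}X^n_u$ (Lebesgue integral), $\mathbb{X}^{2,S}_{st}[\mathbf{U}]:=\lim_n\mathbb{X}^{2,n}_{st}[\mathbf{U}]$ in operator norm for $\mathbf{U}\in\mathcal{A}_s\hat\otimes\mathcal{A}_s$.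 It is known that the limit exists, that for every $T>0$ and $\gamma'\in(0,1/2)$ one has $\sup_{0\le s<t\le T}\sup_{\mathbf{U}\neq0}\|\mathbb{X}^{2,n}_{st}[\mathbf{U}]-\mathbb{X}^{2,S}_{st}[\mathbf{U}]\|/(|t-s|^{2\gamma'}\|\mathbf{U}\|)\to0$, that $\|\mathbb{X}^{2,S}_{st}[\mathbf{U}]\|\le c_{\gamma',T}|t-s|^{2\gamma'}\|\mathbf{U}\|$ for $\mathbf{U}\in\mathcal{A}_s\hat\otimes\mathcal{A}_s$, $0\le s<t\le T$, with $\mathbb{X}^{2,S}_{st}[\mathbf{U}]\in\mathcal{A}_t$, and that for $s<u<t$, $\mathbb{X}^{2,S}_{st}[\mathbf{U}]-\mathbb{X}^{2,S}_{su}[\mathbf{U}]-\mathbb{X}^{2,S}_{ut}[\mathbf{U}]=(\mathbf{U}\sharp\delta X_{su})\,\delta X_{ut}$. Rough integral: for $\mathbf{U}\in\mathbf{Q}_X([s,t])$ with increments $\delta\mathbf{U}_{uv}=\delta X_{uv}\sharp\mathcal{U}^{X,1}_u+\mathcal{U}^{X,2}_u\sharp\delta X_{uv}+\mathbf{U}^\flat_{uv}$, $s\le u<v\le t$ (where $\mathcal{U}^{X,1},\mathcal{U}^{X,2}\in\mathcal{C}_1^\gamma([s,t];\mathcal{A}^{\hat\otimes3})$ are adapted triprocesses and $\mathbf{U}^\flat\in\mathcal{C}_2^{2\gamma}([s,t];\mathcal{A}\hat\otimes\mathcal{A})$), $\int_s^t\mathbf{U}_u\sharp\mathrm{d}\mathbb{X}^S_u$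 is the limit in $\mathcal{A}$ (operator norm), which is known to exist, of the corrected Riemann sums $$\sum_{t_i\in\Delta}\Big\{\mathbf{U}_{t_i}\sharp\delta X_{t_it_{i+1}}+[\mathbb{X}^{2,S}_{t_it_{i+1}}\times\mathrm{Id}](\mathcal{U}^{X,1}_{t_i})+[\mathrm{Id}\times\mathbb{X}^{2,S,\ast}_{t_it_{i+1}}](\mathcal{U}^{X,2}_{t_i})\Big\}$$ as the mesh of the subdivision $\Delta$ of $[s,t]$ tends to $0$, where $[\mathbb{X}^{2,S}_{uv}\times\mathrm{Id}](U_1\otimes U_2\otimes U_3):=\mathbb{X}^{2,S}_{uv}[U_1\otimes U_2]\,U_3$, $\ [\mathrm{Id}\times\mathbb{X}^{2,S,\ast}_{uv}](U_1\otimes U_2\otimes U_3):=U_1\,\mathbb{X}^{2,S,\ast}_{uv}[U_2\otimes U_3]$ and $\mathbb{X}^{2,S,\ast}_{uv}[U\otimes V]:=\big(\mathbb{X}^{2,S}_{uv}[V^\ast\otimes U^\ast]\big)^\ast$ (extended by linearity and continuity). *)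

theory Defs
  imports "HOL-Analysis.Analysis" "HOL-Combinatorics.Permutations" "HOL-Library.Function_Algebras"
begin

section \<open>Complex Hilbert spaces and bounded operators\<close>

text \<open>The inner product is conjugate-linear in its first and linear in its second argument.\<close>

class complex_hilbert = banach +
  fixes scaleC :: "complex \<Rightarrow> 'a \<Rightarrow> 'a" (infixr "*\<^sub>C" 75)
    and cinner :: "'a \<Rightarrow> 'a \<Rightarrow> complex"
  assumes scaleC_add_right: "c *\<^sub>C (x + y) = c *\<^sub>C x + c *\<^sub>C y"
    and scaleC_add_left: "(c + d) *\<^sub>C x = c *\<^sub>C x + d *\<^sub>C x"
    and scaleC_scaleC: "c *\<^sub>C d *\<^sub>C x = (c * d) *\<^sub>C x"
    and scaleR_scaleC: "r *\<^sub>R x = complex_of_real r *\<^sub>C x"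
    and cinner_commute: "cinner x y = cnj (cinner y x)"
    and cinner_add_right: "cinner x (y + z) = cinner x y + cinner x z"
    and cinner_scaleC_right: "cinner x (c *\<^sub>C y) = c * cinner x y"
    and cinner_self: "cinner x x = complex_of_real ((norm x)\<^sup>2)"

lemma norm_scaleC: "norm (c *\<^sub>C x) = cmod c * norm (x :: 'a :: complex_hilbert)"
proof -
  have "cinner (c *\<^sub>C x) x = cnj c * cinner x x"
    by (metis cinner_commute cinner_scaleC_right complex_cnj_mult)
  hence "cinner (c *\<^sub>C x) (c *\<^sub>C x) = c * cnj c * cinner x x"
    by (simp add: cinner_scaleC_right)
  hence "complex_of_real ((norm (c *\<^sub>C x))\<^sup>2) = complex_of_real ((cmod c * norm x)\<^sup>2)"
    by (simp add: cinner_self complex_norm_square[symmetric] power_mult_distrib)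
  hence "(norm (c *\<^sub>C x))\<^sup>2 = (cmod c * norm x)\<^sup>2"
    using of_real_eq_iff by blast
  thus ?thesis
    by (simp add: power2_eq_iff_nonneg)
qed

text \<open>
  Operators are bounded real-linear maps of the library; all algebras below consist of
  the complex-linear ones among them. Composition is \<open>o\<^sub>L\<close>.
\<close>

type_synonym 'f op = "'f \<Rightarrow>\<^sub>L 'f"

definition clinear_ops :: "'f::complex_hilbert op set" where
  "clinear_ops = {T. \<forall>c x. blinfun_apply T (c *\<^sub>C x) = c *\<^sub>C blinfun_apply T x}"

lift_definition op_scaleC :: "complex \<Rightarrow> 'f::complex_hilbert op \<Rightarrow> 'f op"
  is "\<lambda>c T x. c *\<^sub>C T x"
proof -
  fix c :: complex and T :: "'f \<Rightarrow> 'f"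
  assume "bounded_linear T"
  moreover have "bounded_linear (\<lambda>x::'f. c *\<^sub>C x)"
    by (rule bounded_linear_intro[where K = "cmod c"])
      (simp_all add: scaleC_add_right scaleR_scaleC scaleC_scaleC norm_scaleC mult.commute)
  ultimately show "bounded_linear (\<lambda>x. c *\<^sub>C T x)"
    using bounded_linear_compose by blast
qed

definition adj :: "'f::complex_hilbert op \<Rightarrow> 'f op" where
  "adj T = (THE S. \<forall>x y. cinner (blinfun_apply S x) y = cinner x (blinfun_apply T y))"

definition commutant :: "'f::complex_hilbert op set \<Rightarrow> 'f op set" where
  "commutant M = {T \<in> clinear_ops. \<forall>S\<in>M. S o\<^sub>L T = T o\<^sub>L S}"

definition von_neumann_algebra :: "'f::complex_hilbert op set \<Rightarrow> bool" where
  "von_neumann_algebra M \<longleftrightarrow>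
     M \<subseteq> clinear_ops \<and> adj ` M \<subseteq> M \<and> commutant (commutant M) = M"

definition vN_generated :: "'f::complex_hilbert op set \<Rightarrow> 'f op set" where
  "vN_generated S = \<Inter> {M. von_neumann_algebra M \<and> S \<subseteq> M}"

inductive_set alg_generated :: "'f::complex_hilbert op set \<Rightarrow> 'f op set"
  for S :: "'f::complex_hilbert op set" where
  unit: "id_blinfun \<in> alg_generated S"
| gen: "T \<in> S \<Longrightarrow> T \<in> alg_generated S"
| scale: "T \<in> alg_generated S \<Longrightarrow> op_scaleC c T \<in> alg_generated S"
| add: "T \<in> alg_generated S \<Longrightarrow> T' \<in> alg_generated S \<Longrightarrow> T + T' \<in> alg_generated S"
| mult: "T \<in> alg_generated S \<Longrightarrow> T' \<in> alg_generated S \<Longrightarrow> T o\<^sub>L T' \<in> alg_generated S"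


section \<open>The q-Fock space\<close>

text \<open>Elements of \<open>L\<^sup>2(\<real>\<^sub>+; \<complex>)\<close> are given by representatives.\<close>

definition L2_fun :: "(real \<Rightarrow> complex) set" where
  "L2_fun = {f \<in> borel_measurable (lebesgue_on {0..}).
               integrable (lebesgue_on {0..}) (\<lambda>x. (cmod (f x))\<^sup>2)}"

definition L2_inner :: "(real \<Rightarrow> complex) \<Rightarrow> (real \<Rightarrow> complex) \<Rightarrow> complex" where
  "L2_inner f g = (\<integral>x. cnj (f x) * g x \<partial>lebesgue_on {0..})"

definition perm_inv :: "nat \<Rightarrow> (nat \<Rightarrow> nat) \<Rightarrow> nat" where
  "perm_inv n \<sigma> = card {(i, k). i < k \<and> k < n \<and> \<sigma> k < \<sigma> i}"

definition q_inner ::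
  "real \<Rightarrow> (real \<Rightarrow> complex) list \<Rightarrow> (real \<Rightarrow> complex) list \<Rightarrow> complex" where
  "q_inner q fs gs =
     (if length fs = length gs
      then \<Sum>\<sigma> | \<sigma> permutes {..<length fs}.
             complex_of_real (q ^ perm_inv (length fs) \<sigma>) *
             (\<Prod>i<length fs. L2_inner (fs ! i) (gs ! \<sigma> i))
      else 0)"

text \<open>
  A Hilbert space \<open>'f\<close> together with a map \<open>\<Theta>\<close> sending a word \<open>[f\<^sub>1, \<dots>, f\<^sub>n]\<close> to the elementary
  tensor \<open>f\<^sub>1 \<otimes> \<dots> \<otimes> f\<^sub>n\<close> (and \<open>[]\<close> to the vacuum \<open>\<Omega>\<close>) is the completion of the algebraic Fock
  space for the q-inner product iff \<open>\<Theta>\<close> realises this inner product and its complex linear span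
  is dense. Multilinearity of \<open>\<Theta>\<close>, and its insensitivity to the choice of representatives, follow
  from the inner product formula, since \<open>'f\<close> is separated; the pair is thus determined up to
  a unique unitary.
\<close>

definition q_fock_space ::
  "real \<Rightarrow> ((real \<Rightarrow> complex) list \<Rightarrow> 'f::complex_hilbert) \<Rightarrow> bool" where
  "q_fock_space q \<Theta> \<longleftrightarrow>
     (\<forall>fs\<in>lists L2_fun. \<forall>gs\<in>lists L2_fun. cinner (\<Theta> fs) (\<Theta> gs) = q_inner q fs gs) \<and>
     closure {\<Sum>i<n. c i *\<^sub>C \<Theta> (w i) | (n::nat) c w. \<forall>i<n. w i \<in> lists L2_fun} = UNIV"

type_synonym 'f fock = "(real \<Rightarrow> complex) list \<Rightarrow> 'f"

definition creation :: "'f::complex_hilbert fock \<Rightarrow> (real \<Rightarrow> complex) \<Rightarrow> 'f op" where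
  "creation \<Theta> f =
     (THE T. T \<in> clinear_ops \<and> (\<forall>w\<in>lists L2_fun. blinfun_apply T (\<Theta> w) = \<Theta> (f # w)))"

definition annihilation :: "'f::complex_hilbert fock \<Rightarrow> (real \<Rightarrow> complex) \<Rightarrow> 'f op" where
  "annihilation \<Theta> f = adj (creation \<Theta> f)"

definition qBM :: "'f::complex_hilbert fock \<Rightarrow> real \<Rightarrow> 'f op" where
  "qBM \<Theta> t = annihilation \<Theta> (indicator {0..t}) + creation \<Theta> (indicator {0..t})"

definition vacuum_state :: "'f::complex_hilbert fock \<Rightarrow> 'f op \<Rightarrow> complex" where
  "vacuum_state \<Theta> T = cinner (\<Theta> []) (blinfun_apply T (\<Theta> []))"

definition qA :: "'f::complex_hilbert fock \<Rightarrow> 'f op set" where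
  "qA \<Theta> = vN_generated (qBM \<Theta> ` {0..})"

definition qA_upto :: "'f::complex_hilbert fock \<Rightarrow> real \<Rightarrow> 'f op set" where
  "qA_upto \<Theta> t = closure (alg_generated (qBM \<Theta> ` {0..t}))"

definition qB_upto :: "'f::complex_hilbert fock \<Rightarrow> real \<Rightarrow> 'f op set" where
  "qB_upto \<Theta> t = vN_generated (qBM \<Theta> ` {0..t})"

definition dX :: "'f::complex_hilbert fock \<Rightarrow> real \<Rightarrow> real \<Rightarrow> 'f op" where
  "dX \<Theta> s t = qBM \<Theta> t - qBM \<Theta> s"

text \<open>
  \<open>L\<^sup>2(\<phi>)\<close>: a Hilbert space with an isometric map from the algebra with dense range.
  The form \<open>\<langle>U,V\<rangle> = \<phi>(U V\<^sup>*)\<close> is linear in its first argument, hence the order of the arguments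
  of \<^const>\<open>cinner\<close>. Linearity of the embedding follows from the isometry.
\<close>

definition L2_completion ::
  "'f::complex_hilbert fock \<Rightarrow> ('f op \<Rightarrow> 'l::complex_hilbert) \<Rightarrow> bool" where
  "L2_completion \<Theta> \<eta> \<longleftrightarrow>
     (\<forall>U\<in>qA \<Theta>. \<forall>V\<in>qA \<Theta>. cinner (\<eta> V) (\<eta> U) = vacuum_state \<Theta> (U o\<^sub>L adj V)) \<and>
     closure (\<eta> ` qA \<Theta>) = UNIV"

definition cond_exp :: "'f::complex_hilbert fock \<Rightarrow> 'f op set \<Rightarrow> 'f op \<Rightarrow> 'f op" where
  "cond_exp \<Theta> M U =
     (THE Z. Z \<in> M \<and>
        (\<forall>W\<in>M. vacuum_state \<Theta> (Z o\<^sub>L adj W) = vacuum_state \<Theta> (U o\<^sub>L adj W)))"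

definition Gamma_q :: "'f::complex_hilbert fock \<Rightarrow> 'f op \<Rightarrow> 'f op" where
  "Gamma_q \<Theta> U =
     (THE Z. \<forall>s\<ge>0. U \<in> qA_upto \<Theta> s \<longrightarrow>
        Z = cond_exp \<Theta> (qB_upto \<Theta> s) (dX \<Theta> s (s + 1) o\<^sub>L U o\<^sub>L dX \<Theta> s (s + 1)))"


section \<open>Projective tensor powers\<close>

text \<open>
  The n-fold projective tensor power of a Banach space \<open>A\<close> of operators is realised inside
  the dual of the space of bounded complex n-linear forms on \<open>A\<close>, an elementary tensor
  \<open>a\<^sub>1 \<otimes> \<dots> \<otimes> a\<^sub>n\<close> being evaluation at \<open>[a\<^sub>1, \<dots>, a\<^sub>n]\<close>. The elements of the completed tensor power
  are the sums of absolutely convergent series of elementary tensors, and the projective norm is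
  the infimum of the sums of the products of norms over all such series.
\<close>

type_synonym 'f tensor = "('f op list \<Rightarrow> complex) \<Rightarrow> complex"

definition bounded_forms :: "'f::complex_hilbert op set \<Rightarrow> nat \<Rightarrow> ('f op list \<Rightarrow> complex) set" where
  "bounded_forms A n =
     {B. (\<forall>as. length as = n \<and> set as \<subseteq> A \<longrightarrow> (\<forall>i<n. \<forall>x\<in>A. \<forall>y\<in>A. \<forall>c.
            B (as[i := x + y]) = B (as[i := x]) + B (as[i := y]) \<and>
            B (as[i := op_scaleC c x]) = c * B (as[i := x]))) \<and>
         (\<exists>C. \<forall>as. length as = n \<and> set as \<subseteq> A \<longrightarrow> cmod (B as) \<le> C * prod_list (map norm as))}"

definition elem_tensor :: "'f::complex_hilbert op set \<Rightarrow> 'f op list \<Rightarrow> 'f tensor" where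
  "elem_tensor A as = (\<lambda>B. if B \<in> bounded_forms A (length as) then B as else 0)"

text \<open>
  The tensor \<open>u\<close> over \<open>A\<close> is the sum of the absolutely convergent series of the elementary tensors
  \<open>as 0, as 1, \<dots>\<close>, all of whose entries lie in \<open>S\<close>.
\<close>

definition represents ::
  "'f::complex_hilbert op set \<Rightarrow> nat \<Rightarrow> 'f op set \<Rightarrow> (nat \<Rightarrow> 'f op list) \<Rightarrow> 'f tensor \<Rightarrow> bool" where
  "represents A n S as u \<longleftrightarrow>
     (\<forall>i. length (as i) = n \<and> set (as i) \<subseteq> S) \<and>
     summable (\<lambda>i. prod_list (map norm (as i))) \<and>
     u = (\<lambda>B. if B \<in> bounded_forms A n then \<Sum>i. B (as i) else 0)"

text \<open>
  The (canonical image in the tensor power of \<open>A\<close> of the) projective tensor power of the closed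
  subspace \<open>S \<subseteq> A\<close>.
\<close>

definition proj_tensor :: "'f::complex_hilbert op set \<Rightarrow> nat \<Rightarrow> 'f op set \<Rightarrow> 'f tensor set" where
  "proj_tensor A n S = {u. \<exists>as. represents A n S as u}"

definition proj_norm :: "'f::complex_hilbert op set \<Rightarrow> nat \<Rightarrow> 'f tensor \<Rightarrow> real" where
  "proj_norm A n u = Inf {\<Sum>i. prod_list (map norm (as i)) | as. represents A n A as u}"

text \<open>
  Continuous linear extension of a multilinear map \<open>\<Phi>\<close>, defined on elementary tensors with entries
  in a member of \<open>\<S>\<close>, to the projective tensor powers of the members of \<open>\<S>\<close>.
\<close>

definition tensor_ext ::
  "'f::complex_hilbert op set \<Rightarrow> nat \<Rightarrow> 'f op set set \<Rightarrow> ('f op list \<Rightarrow> 'b::real_normed_vector) \<Rightarrow>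
   'f tensor \<Rightarrow> 'b" where
  "tensor_ext A n \<S> \<Phi> u =
     (THE z. \<forall>S\<in>\<S>. \<forall>as. represents A n S as u \<longrightarrow> (\<lambda>i. \<Phi> (as i)) sums z)"

definition sharp :: "'f::complex_hilbert op set \<Rightarrow> 'f tensor \<Rightarrow> 'f op \<Rightarrow> 'f op" where
  "sharp A u Y = tensor_ext A 2 {A} (\<lambda>as. (as ! 0) o\<^sub>L Y o\<^sub>L (as ! 1)) u"

text \<open>\<open>Y \<sharp> (U\<^sub>1 \<otimes> U\<^sub>2 \<otimes> U\<^sub>3) = (U\<^sub>1 Y U\<^sub>2) \<otimes> U\<^sub>3\<close>\<close>

definition sharp_left :: "'f::complex_hilbert op set \<Rightarrow> 'f op \<Rightarrow> 'f tensor \<Rightarrow> 'f tensor" where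
  "sharp_left A Y u =
     (THE z. \<forall>as. represents A 3 A as u \<longrightarrow>
        represents A 2 A (\<lambda>i. [(as i ! 0) o\<^sub>L Y o\<^sub>L (as i ! 1), as i ! 2]) z)"

text \<open>\<open>(U\<^sub>1 \<otimes> U\<^sub>2 \<otimes> U\<^sub>3) \<sharp> Y = U\<^sub>1 \<otimes> (U\<^sub>2 Y U\<^sub>3)\<close>\<close>

definition sharp_right :: "'f::complex_hilbert op set \<Rightarrow> 'f tensor \<Rightarrow> 'f op \<Rightarrow> 'f tensor" where
  "sharp_right A u Y =
     (THE z. \<forall>as. represents A 3 A as u \<longrightarrow>
        represents A 2 A (\<lambda>i. [as i ! 0, (as i ! 1) o\<^sub>L Y o\<^sub>L (as i ! 2)]) z)"

definition holder1 ::
  "'f::complex_hilbert op set \<Rightarrow> nat \<Rightarrow> real \<Rightarrow> real set \<Rightarrow> (real \<Rightarrow> 'f tensor) \<Rightarrow> bool" where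
  "holder1 A n \<alpha> I h \<longleftrightarrow>
     (\<forall>u\<in>I. h u \<in> proj_tensor A n A) \<and>
     (\<forall>u\<in>I. \<forall>e>0. \<exists>d>0. \<forall>v\<in>I. \<bar>v - u\<bar> < d \<longrightarrow> proj_norm A n (h v - h u) < e) \<and>
     (\<exists>C. \<forall>u\<in>I. \<forall>v\<in>I. u < v \<longrightarrow> proj_norm A n (h v - h u) \<le> C * \<bar>v - u\<bar> powr \<alpha>)"

definition holder2 ::
  "'f::complex_hilbert op set \<Rightarrow> nat \<Rightarrow> real \<Rightarrow> real set \<Rightarrow> (real \<Rightarrow> real \<Rightarrow> 'f tensor) \<Rightarrow> bool" where
  "holder2 A n \<alpha> I h \<longleftrightarrow>
     (\<forall>u\<in>I. \<forall>v\<in>I. u \<le> v \<longrightarrow> h u v \<in> proj_tensor A n A) \<and>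
     (\<forall>u\<in>I. \<forall>v\<in>I. u \<le> v \<longrightarrow> (\<forall>e>0. \<exists>d>0. \<forall>u'\<in>I. \<forall>v'\<in>I.
        u' \<le> v' \<and> \<bar>u' - u\<bar> < d \<and> \<bar>v' - v\<bar> < d \<longrightarrow> proj_norm A n (h u' v' - h u v) < e)) \<and>
     (\<forall>u\<in>I. h u u = 0) \<and>
     (\<exists>C. \<forall>u\<in>I. \<forall>v\<in>I. u < v \<longrightarrow> proj_norm A n (h u v) \<le> C * \<bar>v - u\<bar> powr \<alpha>)"


section \<open>Controlled biprocesses and integrals\<close>

definition adapted ::
  "'f::complex_hilbert fock \<Rightarrow> nat \<Rightarrow> real set \<Rightarrow> (real \<Rightarrow> 'f tensor) \<Rightarrow> bool" where
  "adapted \<Theta> n I h \<longleftrightarrow> (\<forall>u\<in>I. h u \<in> proj_tensor (qA \<Theta>) n (qA_upto \<Theta> u))"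

definition controlled_biprocess ::
  "'f::complex_hilbert fock \<Rightarrow> real \<Rightarrow> real set \<Rightarrow> (real \<Rightarrow> 'f tensor) \<Rightarrow>
   (real \<Rightarrow> 'f tensor) \<Rightarrow> (real \<Rightarrow> 'f tensor) \<Rightarrow> (real \<Rightarrow> real \<Rightarrow> 'f tensor) \<Rightarrow> bool" where
  "controlled_biprocess \<Theta> \<gamma> I U U1 U2 Uflat \<longleftrightarrow>
     adapted \<Theta> 2 I U \<and> holder1 (qA \<Theta>) 2 \<gamma> I U \<and>
     adapted \<Theta> 3 I U1 \<and> holder1 (qA \<Theta>) 3 \<gamma> I U1 \<and>
     adapted \<Theta> 3 I U2 \<and> holder1 (qA \<Theta>) 3 \<gamma> I U2 \<and>
     holder2 (qA \<Theta>) 2 (2 * \<gamma>) I Uflat \<and>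
     (\<forall>u\<in>I. \<forall>v\<in>I. u < v \<longrightarrow>
        U v - U u = sharp_left (qA \<Theta>) (dX \<Theta> u v) (U1 u)
                  + sharp_right (qA \<Theta>) (U2 u) (dX \<Theta> u v) + Uflat u v)"

text \<open>Linear interpolation along the dyadic points of order n.\<close>

definition qBM_interp :: "'f::complex_hilbert fock \<Rightarrow> nat \<Rightarrow> real \<Rightarrow> 'f op" where
  "qBM_interp \<Theta> n t =
     (let i = real_of_int \<lfloor>2 ^ n * t\<rfloor>
      in qBM \<Theta> (i / 2 ^ n) + (2 ^ n * t - i) *\<^sub>R dX \<Theta> (i / 2 ^ n) ((i + 1) / 2 ^ n))"

text \<open>
  The derivative of the interpolation exists off the dyadic points; the integrand is piecewise
  affine, so the library's integral of Banach space valued functions is the Lebesgue integral here.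
\<close>

definition area_n :: "'f::complex_hilbert fock \<Rightarrow> nat \<Rightarrow> real \<Rightarrow> real \<Rightarrow> 'f tensor \<Rightarrow> 'f op" where
  "area_n \<Theta> n s t U =
     integral {s..t} (\<lambda>u. sharp (qA \<Theta>) U (qBM_interp \<Theta> n u - qBM_interp \<Theta> n s)
                            o\<^sub>L vector_derivative (qBM_interp \<Theta> n) (at u))"

definition area_S :: "'f::complex_hilbert fock \<Rightarrow> real \<Rightarrow> real \<Rightarrow> 'f tensor \<Rightarrow> 'f op" where
  "area_S \<Theta> s t U = lim (\<lambda>n. area_n \<Theta> n s t U)"

text \<open>The value of the adjoint area on the elementary tensor \<open>a \<otimes> b\<close>.\<close>

definition area_S_star :: "'f::complex_hilbert fock \<Rightarrow> real \<Rightarrow> real \<Rightarrow> 'f op \<Rightarrow> 'f op \<Rightarrow> 'f op" where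
  "area_S_star \<Theta> s t a b = adj (area_S \<Theta> s t (elem_tensor (qA \<Theta>) [adj b, adj a]))"

definition area_S_id :: "'f::complex_hilbert fock \<Rightarrow> real \<Rightarrow> real \<Rightarrow> 'f tensor \<Rightarrow> 'f op" where
  "area_S_id \<Theta> s t =
     tensor_ext (qA \<Theta>) 3 {qA_upto \<Theta> s}
       (\<lambda>as. area_S \<Theta> s t (elem_tensor (qA \<Theta>) [as ! 0, as ! 1]) o\<^sub>L (as ! 2))"

definition id_area_S_star :: "'f::complex_hilbert fock \<Rightarrow> real \<Rightarrow> real \<Rightarrow> 'f tensor \<Rightarrow> 'f op" where
  "id_area_S_star \<Theta> s t =
     tensor_ext (qA \<Theta>) 3 {qA_upto \<Theta> s}
       (\<lambda>as. (as ! 0) o\<^sub>L area_S_star \<Theta> s t (as ! 1) (as ! 2))"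

definition id_Gamma_id ::
  "'f::complex_hilbert fock \<Rightarrow> ('f op \<Rightarrow> 'l::complex_hilbert) \<Rightarrow> 'f tensor \<Rightarrow> 'l" where
  "id_Gamma_id \<Theta> \<eta> =
     tensor_ext (qA \<Theta>) 3 (qA_upto \<Theta> ` {0..})
       (\<lambda>as. \<eta> ((as ! 0) o\<^sub>L Gamma_q \<Theta> (as ! 1) o\<^sub>L (as ! 2)))"

text \<open>Partitions of \<open>[s,t]\<close> are strictly increasing lists of points from \<open>s\<close> to \<open>t\<close>.\<close>

definition partitions :: "real \<Rightarrow> real \<Rightarrow> real list set" where
  "partitions s t = {ts. ts \<noteq> [] \<and> sorted_wrt (<) ts \<and> hd ts = s \<and> last ts = t}"

definition mesh_to_0 :: "real \<Rightarrow> real \<Rightarrow> real list filter" where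
  "mesh_to_0 s t =
     (INF e\<in>{0<..}. principal {ts \<in> partitions s t. \<forall>i<length ts - 1. ts ! Suc i - ts ! i < e})"

definition partition_sum :: "(real \<Rightarrow> real \<Rightarrow> 'b::comm_monoid_add) \<Rightarrow> real list \<Rightarrow> 'b" where
  "partition_sum F ts = (\<Sum>i<length ts - 1. F (ts ! i) (ts ! Suc i))"

definition ito_integral ::
  "'f::complex_hilbert fock \<Rightarrow> ('f op \<Rightarrow> 'l::complex_hilbert) \<Rightarrow> real \<Rightarrow> real \<Rightarrow>
   (real \<Rightarrow> 'f tensor) \<Rightarrow> 'l" where
  "ito_integral \<Theta> \<eta> s t V =
     Lim (mesh_to_0 s t) (\<lambda>ts. \<eta> (partition_sum (\<lambda>u v. sharp (qA \<Theta>) (V u) (dX \<Theta> u v)) ts))"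

definition rough_integral ::
  "'f::complex_hilbert fock \<Rightarrow> real \<Rightarrow> real \<Rightarrow>
   (real \<Rightarrow> 'f tensor) \<Rightarrow> (real \<Rightarrow> 'f tensor) \<Rightarrow> (real \<Rightarrow> 'f tensor) \<Rightarrow> 'f op" where
  "rough_integral \<Theta> s t U U1 U2 =
     Lim (mesh_to_0 s t)
       (partition_sum (\<lambda>u v. sharp (qA \<Theta>) (U u) (dX \<Theta> u v)
                             + area_S_id \<Theta> u v (U1 u) + id_area_S_star \<Theta> u v (U2 u)))"

end

theory Submission
  imports Defs
begin

text \<open>
  For an operator \<open>b\<close> of the past of \<open>s\<close> and future increments \<open>u, v\<close>, moving the annihilation part of \<open>X(u)\<close>
  through \<open>b\<close> gives \<open>X(u) b X(v) = \<langle>u, v\<rangle> \<Gamma>(b) + \<close> terms that vanish between past vectors. All terms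
  make sense for every bounded \<open>b\<close>, and since creation and annihilation operators of orthogonal families
  form bounded rows and columns, the refinements of the dyadic area sums converge in norm. The limit is
  the Stratonovich area; it is bounded by \<open>C (t - s) |b|\<close>, also for \<open>b\<close> outside the past, as the
  projective norm over the whole algebra demands. Between past vectors, the area is \<open>(t - s) \<Gamma>(b) / 2\<close>.
  Hence the compensated sums are the Ito sums plus Riemann sums of the correction plus
  increments that are orthogonal in \<open>L\<^sup>2(\<phi>)\<close> and of size \<open>O(t - s)\<close>, which disappear with the mesh.
  The compensated sums converge in norm by the sewing lemma.
\<close>

section \<open>Riesz representation, adjoints of complex-linear operators, bicommutants\<close>

section \<open>Hilbert spaces, adjoints and von Neumann algebras\<close>

text \<open>A future annihilator does not commute with past operators: on its way through a word it
  collects a factor q from each letter. The obstacle is removed by a factorisation. Let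
  \<open>G\<close> be the second quantisation of an isometry that dilates multiplication by q on
  functions up to s and moves functions after s to a fresh copy. Then \<open>an u\<close> equals
  \<open>adj G\<close> times an operator \<open>AV s u\<close> that commutes with the past algebra,
  so \<open>an u\<close> times b becomes \<open>adj G\<close> times b times \<open>AV s u\<close>.
  Commuting \<open>AV s u\<close> with a creation operator produces \<Gamma>(b) as the compression
  of b by \<open>G\<close>. The price is that \<open>AV s u\<close> is not an annihilator, and it
  must be bounded together with its column sums. For this, words are sent to labelled words in which
  the lines between future letters bear names; there it acts as an ordinary annihilator, averaged
  over the names.

  Fields acting at the right end of a word commute with the algebra and generate a dense set from
  the vacuum. Hence the membership of \<Gamma>(b) in the past algebra can be read off from its value
  at the vacuum.\<close>

lemma cinner_add_left: "cinner (x + y) z = cinner x z + cinner (y::'a::complex_hilbert) z"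
  by (metis cinner_add_right cinner_commute complex_cnj_add)

lemma cinner_scaleC_left: "cinner (c *\<^sub>C x) y = cnj c * cinner (x::'a::complex_hilbert) y"
  by (metis cinner_commute cinner_scaleC_right complex_cnj_mult)

lemma scaleC_zero_left [simp]: "0 *\<^sub>C x = (0::'a::complex_hilbert)"
  using norm_scaleC[of 0 x] by simp

lemma scaleC_zero_right [simp]: "c *\<^sub>C (0::'a::complex_hilbert) = 0"
  using norm_scaleC[of c "0::'a"] by simp

lemma scaleC_one [simp]: "1 *\<^sub>C (x::'a::complex_hilbert) = x"
  using scaleR_scaleC[of 1 x] by simp

lemma scaleC_minus1: "(-1) *\<^sub>C (x::'a::complex_hilbert) = - x"
  using scaleR_scaleC[of "-1" x] by simp

lemma scaleC_minus_left: "(- c) *\<^sub>C (x::'a::complex_hilbert) = - (c *\<^sub>C x)"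
  by (metis add_eq_0_iff ab_left_minus scaleC_add_left scaleC_zero_left)

lemma scaleC_minus_right: "c *\<^sub>C (- x) = - (c *\<^sub>C (x::'a::complex_hilbert))"
  by (metis mult_minus1_right scaleC_minus1 scaleC_minus_left scaleC_scaleC)

lemma scaleC_diff_right: "c *\<^sub>C (x - y) = c *\<^sub>C x - c *\<^sub>C (y::'a::complex_hilbert)"
  by (metis (no_types, lifting) diff_conv_add_uminus scaleC_add_right scaleC_minus_right)

lemma scaleC_sum_right: "c *\<^sub>C sum f A = (\<Sum>i\<in>A. c *\<^sub>C (f i :: 'a::complex_hilbert))"
  by (induction A rule: infinite_finite_induct) (auto simp: scaleC_add_right)

lemma cinner_zero_left [simp]: "cinner 0 (x::'a::complex_hilbert) = 0"
  using cinner_scaleC_left[of 0 x x] by simp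

lemma cinner_zero_right [simp]: "cinner (x::'a::complex_hilbert) 0 = 0"
  using cinner_scaleC_right[of x 0 x] by simp

lemma cinner_minus_right: "cinner x (- y) = - cinner x (y::'a::complex_hilbert)"
  using cinner_scaleC_right[of x "-1" y] by (simp add: scaleC_minus1)

lemma cinner_diff_right: "cinner x (y - z) = cinner x y - cinner x (z::'a::complex_hilbert)"
  by (metis (no_types, lifting) diff_conv_add_uminus cinner_add_right cinner_minus_right)

lemma cinner_scaleR_left: "cinner (r *\<^sub>R x) y = of_real r * cinner x (y::'a::complex_hilbert)"
  by (simp add: scaleR_scaleC cinner_scaleC_left)

lemma cinner_scaleR_right: "cinner x (r *\<^sub>R y) = of_real r * cinner x (y::'a::complex_hilbert)"
  by (simp add: scaleR_scaleC cinner_scaleC_right)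

lemma cinner_sum_left: "cinner (sum f A) y = (\<Sum>i\<in>A. cinner (f i) (y::'a::complex_hilbert))"
  by (induction A rule: infinite_finite_induct) (auto simp: cinner_add_left)

lemma cinner_sum_right: "cinner y (sum f A) = (\<Sum>i\<in>A. cinner (y::'a::complex_hilbert) (f i))"
  by (induction A rule: infinite_finite_induct) (auto simp: cinner_add_right)

lemma norm_sq_add: "(norm (x + y))\<^sup>2 = (norm x)\<^sup>2 + (norm y)\<^sup>2 + 2 * Re (cinner x (y::'a::complex_hilbert))"
proof -
  have "complex_of_real ((norm (x + y))\<^sup>2) = cinner x x + cinner y y + (cinner x y + cnj (cinner x y))"
    by (metis (no_types, lifting) add.assoc add.left_commute cinner_add_left cinner_add_right
        cinner_commute cinner_self add.commute)
  hence "(norm (x + y))\<^sup>2 = Re (cinner x x + cinner y y + (cinner x y + cnj (cinner x y)))"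
    by (metis Re_complex_of_real)
  thus ?thesis by (simp add: cinner_self)
qed

lemma norm_sq_Re: "(norm (x::'a::complex_hilbert))\<^sup>2 = Re (cinner x x)"
  by (simp add: cinner_self)

lemma cmod_cinner_le: "cmod (cinner x y) \<le> norm x * norm (y::'a::complex_hilbert)"
proof (cases "y = 0")
  case False
  define c where "c = cinner y x / cinner y y"
  have yy: "cinner y y \<noteq> 0" using False by (simp add: cinner_self)
  let ?z = "x - c *\<^sub>C y"
  have z0: "cinner y ?z = 0"
    using yy by (simp add: cinner_diff_right cinner_scaleC_right c_def)
  have "x = c *\<^sub>C y + ?z" by simp
  hence "(norm x)\<^sup>2 = (norm (c *\<^sub>C y))\<^sup>2 + (norm ?z)\<^sup>2 + 2 * Re (cinner (c *\<^sub>C y) ?z)"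
    by (metis norm_sq_add)
  hence "(norm x)\<^sup>2 \<ge> (norm (c *\<^sub>C y))\<^sup>2" by (simp add: cinner_scaleC_left z0)
  hence "norm x \<ge> norm (c *\<^sub>C y)" using power2_le_imp_le norm_ge_zero by blast
  moreover have "cinner y x = c * cinner y y" using yy by (simp add: c_def)
  hence "cmod (cinner y x) = cmod c * (norm y)\<^sup>2"
    by (simp add: norm_mult cinner_self norm_power)
  hence "cmod (cinner y x) = norm (c *\<^sub>C y) * norm y"
    by (simp add: norm_scaleC power2_eq_square mult_ac)
  ultimately show ?thesis
    by (metis cinner_commute complex_mod_cnj mult_right_mono norm_ge_zero)
qed simp

lemma cinner_eqI: "(\<And>y. cinner y x = cinner y z) \<Longrightarrow> x = (z::'a::complex_hilbert)"
proof -
  assume "\<And>y. cinner y x = cinner y z"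
  hence "cinner (x - z) (x - z) = 0" by (metis cinner_diff_right diff_self)
  thus ?thesis by (simp add: cinner_self)
qed

lemma bounded_linear_cinner_right: "bounded_linear (\<lambda>y. cinner (x::'a::complex_hilbert) y)"
  by (rule bounded_linear_intro[where K = "norm x"])
    (auto simp: cinner_add_right cinner_scaleR_right cmod_cinner_le scaleR_conv_of_real
      intro: order_trans[OF cmod_cinner_le] simp: mult.commute)

lemma bounded_linear_cinner_left: "bounded_linear (\<lambda>x. cinner x (y::'a::complex_hilbert))"
  by (rule bounded_linear_intro[where K = "norm y"])
    (auto simp: cinner_add_left cinner_scaleR_left cmod_cinner_le scaleR_conv_of_real)

lemmas tendsto_cinner_right = bounded_linear.tendsto[OF bounded_linear_cinner_right]
lemma bounded_linear_scaleC: "bounded_linear (\<lambda>x::'a::complex_hilbert. c *\<^sub>C x)"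
  by (rule bounded_linear_intro[where K = "cmod c"])
    (simp_all add: scaleC_add_right scaleR_scaleC scaleC_scaleC norm_scaleC mult.commute)

lemmas tendsto_scaleC = bounded_linear.tendsto[OF bounded_linear_scaleC]

lemma parallelogram: "(norm (x + y))\<^sup>2 + (norm (x - y))\<^sup>2
    = 2 * (norm x)\<^sup>2 + 2 * (norm (y::'a::complex_hilbert))\<^sup>2"
  using norm_sq_add[of x y] norm_sq_add[of x "-y"] by (simp add: cinner_minus_right)

lemma norm_le_if_cinner_le:
  assumes "\<And>y. cmod (cinner y x) \<le> C * norm y" "0 \<le> C"
  shows "norm (x::'a::complex_hilbert) \<le> C"
proof (cases "x = 0")
  case False
  have "norm x * norm x \<le> C * norm x"
    using assms(1)[of x] by (simp add: cinner_self power2_eq_square norm_mult)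
  thus ?thesis using False by simp
qed (use assms in auto)

text \<open>The representing vector is proportional to the point of least norm on the affine
  hyperplane where \<phi> equals 1: the parallelogram identity makes a minimising sequence converge,
  and minimality makes the limit orthogonal to the kernel of \<phi>.\<close>

lemma riesz:
  fixes \<phi> :: "'a::complex_hilbert \<Rightarrow> complex"
  assumes bl: "bounded_linear \<phi>" and cl: "\<And>c x. \<phi> (c *\<^sub>C x) = c * \<phi> x"
  shows "\<exists>z. \<forall>y. \<phi> y = cinner z y"
proof (cases "\<forall>x. \<phi> x = 0")
  case True thus ?thesis by (intro exI[of _ 0]) simp
next
  case False
  interpret bounded_linear \<phi> by (rule bl)
  define A where "A = {x. \<phi> x = 1}"
  from False obtain x0 where x0: "\<phi> x0 \<noteq> 0" by blast
  hence "(1 / \<phi> x0) *\<^sub>C x0 \<in> A" by (simp add: A_def cl)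
  hence Ane: "A \<noteq> {}" by blast
  define d where "d = Inf (norm ` A)"
  have bdd: "bdd_below (norm ` A)" by (intro bdd_belowI[of _ 0]) auto
  have dle: "d \<le> norm x" if "x \<in> A" for x
    unfolding d_def using bdd that by (intro cInf_lower) auto
  have d0: "0 \<le> d" unfolding d_def using Ane by (intro cInf_greatest) auto
  have "\<exists>x\<in>A. norm x < d + 1 / real (Suc n)" for n
  proof -
    have "d < d + 1 / real (Suc n)" by simp
    thus ?thesis using cInf_lessD[of "norm ` A" "d + 1 / real (Suc n)"] Ane unfolding d_def by auto
  qed
  then obtain X where X: "\<And>n. X n \<in> A" "\<And>n. norm (X n) < d + 1 / real (Suc n)" by metis
  have est: "(norm (X m - X n))\<^sup>2 \<le> 2 * (norm (X m))\<^sup>2 + 2 * (norm (X n))\<^sup>2 - 4 * d\<^sup>2" for m n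
  proof -
    \<comment> \<open>The midpoint stays on the hyperplane, so its norm is at least d; the
      parallelogram identity turns this into closeness of \<open>X m\<close> and
      \<open>X n\<close>.\<close>
    have "(1/2) *\<^sub>R (X m + X n) \<in> A"
      using X(1)[of m] X(1)[of n] by (simp add: A_def scaleR add scaleR_conv_of_real)
    hence "d \<le> norm ((1/2) *\<^sub>R (X m + X n))" by (rule dle)
    hence "2 * d \<le> norm (X m + X n)" by simp
    hence "(2 * d)\<^sup>2 \<le> (norm (X m + X n))\<^sup>2" using d0 by (intro power_mono) auto
    thus ?thesis using parallelogram[of "X m" "X n"] by (simp add: power_mult_distrib)
  qed
  have lim0: "(\<lambda>n. (d + 1 / real (Suc n))\<^sup>2 - d\<^sup>2) \<longlonglongrightarrow> (d + 0)\<^sup>2 - d\<^sup>2"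
    by (intro tendsto_intros LIMSEQ_Suc[OF lim_1_over_n])
  have "Cauchy X"
  proof (rule CauchyI)
    fix e :: real assume e: "0 < e"
    have "eventually (\<lambda>n. (d + 1 / real (Suc n))\<^sup>2 - d\<^sup>2 < e\<^sup>2 / 4) sequentially"
      using order_tendstoD(2)[OF lim0, of "e\<^sup>2/4"] e by simp
    then obtain M where M: "\<And>n. n \<ge> M \<Longrightarrow> (d + 1 / real (Suc n))\<^sup>2 - d\<^sup>2 < e\<^sup>2 / 4"
      by (auto simp: eventually_sequentially)
    show "\<exists>M. \<forall>m\<ge>M. \<forall>n\<ge>M. norm (X m - X n) < e"
    proof (intro exI allI impI)
      fix m n assume mn: "m \<ge> M" "n \<ge> M"
      have "(norm (X k))\<^sup>2 < d\<^sup>2 + e\<^sup>2/4" if "k \<ge> M" for k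
        using power_strict_mono[OF X(2)[of k], of 2] M[OF that] by simp
      from this[OF mn(1)] this[OF mn(2)]
      have "(norm (X m - X n))\<^sup>2 < e\<^sup>2" using est[of m n] by linarith
      thus "norm (X m - X n) < e" using e power_less_imp_less_base by fastforce
    qed
  qed
  then obtain z where z: "X \<longlonglongrightarrow> z" using convergent_eq_Cauchy by blast
  have zA: "\<phi> z = 1"
    using LIMSEQ_unique[OF tendsto[OF z]] X(1) by (simp add: A_def)
  have "norm z \<le> d + 0"
    by (rule LIMSEQ_le[OF tendsto_norm[OF z]
        tendsto_add[OF tendsto_const LIMSEQ_Suc[OF lim_1_over_n]]]) (use X(2) less_imp_le in blast)
  hence nz: "norm z = d" using dle[of z] zA by (simp add: A_def)
  have orth: "cinner z y = 0" if "\<phi> y = 0" for y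
  proof (rule ccontr)
    assume ne: "cinner z y \<noteq> 0"
    hence yn: "norm y \<noteq> 0" by auto
    \<comment> \<open>The coefficient that makes z + t y shortest; if z and y were not orthogonal,
      its norm would drop below d.\<close>
    define t where "t = - cinner y z / cinner y y"
    have "z + t *\<^sub>C y \<in> A" by (simp add: A_def add cl that zA)
    hence "d \<le> norm (z + t *\<^sub>C y)" by (rule dle)
    hence "d\<^sup>2 \<le> (norm (z + t *\<^sub>C y))\<^sup>2" using d0 by (intro power_mono)
    also have "\<dots> = d\<^sup>2 + (cmod t)\<^sup>2 * (norm y)\<^sup>2 + 2 * Re (t * cinner z y)"
      by (simp add: norm_sq_add nz norm_scaleC power_mult_distrib cinner_scaleC_right)
    also have "t * cinner z y = - of_real ((cmod (cinner z y))\<^sup>2 / (norm y)\<^sup>2)"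
      unfolding t_def cinner_commute[of y z] using complex_norm_square[of "cinner z y"] by (simp add: cinner_self mult.commute)
    also have "cmod t = cmod (cinner z y) / (norm y)\<^sup>2"
      unfolding t_def by (subst cinner_commute) (simp add: cinner_self norm_divide norm_power)
    finally have "2 * (cmod (cinner z y))\<^sup>2 / (norm y)\<^sup>2 \<le> (cmod (cinner z y) / (norm y)\<^sup>2)\<^sup>2 * (norm y)\<^sup>2"
      by simp
    also have "\<dots> = (cmod (cinner z y))\<^sup>2 / (norm y)\<^sup>2"
      using yn by (simp add: power2_eq_square)
    finally have "2 * ((cmod (cinner z y))\<^sup>2 / (norm y)\<^sup>2) \<le> (cmod (cinner z y))\<^sup>2 / (norm y)\<^sup>2" by simp
    moreover have "(cmod (cinner z y))\<^sup>2 / (norm y)\<^sup>2 > 0" using ne yn by simp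
    ultimately show False by linarith
  qed
  have zz: "cinner z z \<noteq> 0" using zA zero by (auto simp: cinner_self)
  show ?thesis
  proof (intro exI allI)
    fix y
    have "\<phi> (y - \<phi> y *\<^sub>C z) = 0" by (simp add: diff cl zA)
    from orth[OF this] have "cinner z y = \<phi> y * cinner z z"
      by (simp add: cinner_diff_right cinner_scaleC_right)
    thus "\<phi> y = cinner ((1 / cnj (cinner z z)) *\<^sub>C z) y" using zz by (simp add: cinner_scaleC_left)
  qed
qed

lemma clinear_opsD: "T \<in> clinear_ops \<Longrightarrow> blinfun_apply T (c *\<^sub>C x) = c *\<^sub>C blinfun_apply T x"
  by (simp add: clinear_ops_def)

lemma op_scaleC_apply [simp]: "blinfun_apply (op_scaleC c T) x = c *\<^sub>C blinfun_apply T x"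
  by transfer simp

lemma adj_unique:
  assumes "\<And>x y. cinner (blinfun_apply S x) y = cinner x (blinfun_apply T y)"
  shows "adj T = S"
  unfolding adj_def
proof (rule the_equality)
  fix S' assume "\<forall>x y. cinner (blinfun_apply S' x) y = cinner x (blinfun_apply T y)"
  hence "\<And>x y. cinner y (blinfun_apply S' x) = cinner y (blinfun_apply S x)"
    using assms by (metis cinner_commute)
  thus "S' = S" by (intro blinfun_eqI cinner_eqI)
qed (use assms in blast)

text \<open>\<open>adj\<close> is a definite description, so it carries meaning only where a formal
  adjoint exists. Riesz asks for a complex-linear functional, whence the restriction to
  \<open>clinear_ops\<close>.\<close>

lemma adj_exists:
  assumes T: "T \<in> clinear_ops"
  shows "\<exists>S. \<forall>x y. cinner (blinfun_apply S x) y = cinner x (blinfun_apply T y)"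
proof -
  have "\<exists>z. \<forall>y. cinner x (blinfun_apply T y) = cinner z y" for x
    by (rule riesz)
      (auto intro: bounded_linear_compose[OF bounded_linear_cinner_right blinfun.bounded_linear_right]
        simp: clinear_opsD[OF T] cinner_scaleC_right)
  then obtain S where S: "\<And>x y. cinner x (blinfun_apply T y) = cinner (S x) y" by metis
  have "bounded_linear S"
  proof (rule bounded_linear_intro[where K = "norm T"])
    fix x y r
    show "S (x + y) = S x + S y"
      by (rule cinner_eqI) (metis S cinner_add_left cinner_commute)
    show "S (r *\<^sub>R x) = r *\<^sub>R S x"
      by (rule cinner_eqI) (metis S cinner_scaleR_left cinner_commute)
    show "norm (S x) \<le> norm x * norm T"
    proof (rule norm_le_if_cinner_le)
      fix y
      have "cmod (cinner y (S x)) = cmod (cinner x (blinfun_apply T y))"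
        by (metis S cinner_commute complex_mod_cnj)
      also have "\<dots> \<le> norm x * (norm T * norm y)"
        by (meson cmod_cinner_le mult_left_mono norm_blinfun norm_ge_zero order_trans)
      finally show "cmod (cinner y (S x)) \<le> norm x * norm T * norm y" by (simp add: mult.assoc)
    qed simp
  qed
  thus ?thesis by (intro exI[of _ "Blinfun S"]) (simp add: bounded_linear_Blinfun_apply S)
qed

lemma cinner_adj:
  assumes "T \<in> clinear_ops"
  shows "cinner (blinfun_apply (adj T) x) y = cinner x (blinfun_apply T y)"
  using adj_exists[OF assms] adj_unique by metis

lemma cinner_adj':
  assumes "T \<in> clinear_ops"
  shows "cinner x (blinfun_apply (adj T) y) = cinner (blinfun_apply T x) y"
  by (metis cinner_adj[OF assms] cinner_commute)

lemma adj_clinear [simp]: "T \<in> clinear_ops \<Longrightarrow> adj T \<in> clinear_ops"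
  unfolding clinear_ops_def[of] mem_Collect_eq
  by (intro allI cinner_eqI)
    (simp add: cinner_adj' clinear_ops_def cinner_scaleC_right)

lemma adj_adj [simp]: "T \<in> clinear_ops \<Longrightarrow> adj (adj T) = T"
  by (intro adj_unique) (simp add: cinner_adj')

lemma adj_comp: "S \<in> clinear_ops \<Longrightarrow> T \<in> clinear_ops \<Longrightarrow> adj (S o\<^sub>L T) = adj T o\<^sub>L adj S"
  by (intro adj_unique) (simp add: cinner_adj)

lemma adj_add: "S \<in> clinear_ops \<Longrightarrow> T \<in> clinear_ops \<Longrightarrow> adj (S + T) = adj S + adj T"
  by (intro adj_unique)
    (simp add: cinner_adj blinfun.add_left cinner_add_left cinner_add_right)

lemma adj_scaleC: "T \<in> clinear_ops \<Longrightarrow> adj (op_scaleC c T) = op_scaleC (cnj c) (adj T)"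
  by (intro adj_unique) (simp add: cinner_adj cinner_scaleC_left cinner_scaleC_right)

lemma adj_scaleR: "T \<in> clinear_ops \<Longrightarrow> adj (r *\<^sub>R T) = r *\<^sub>R adj T"
  by (intro adj_unique)
    (simp add: cinner_adj blinfun.scaleR_left cinner_scaleR_left cinner_scaleR_right)

lemma adj_id [simp]: "adj id_blinfun = id_blinfun"
  by (intro adj_unique) simp

lemma norm_adj_le: "T \<in> clinear_ops \<Longrightarrow> norm (adj T) \<le> norm T"
proof (rule norm_blinfun_bound)
  fix x assume T: "T \<in> clinear_ops"
  show "norm (blinfun_apply (adj T) x) \<le> norm T * norm x"
  proof (rule norm_le_if_cinner_le)
    fix y
    have "cmod (cinner y (blinfun_apply (adj T) x)) \<le> norm (blinfun_apply T y) * norm x"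
      by (simp add: cinner_adj'[OF T] cmod_cinner_le)
    also have "\<dots> \<le> norm T * norm y * norm x"
      by (intro mult_right_mono norm_blinfun norm_ge_zero)
    finally show "cmod (cinner y (blinfun_apply (adj T) x)) \<le> norm T * norm x * norm y"
      by (simp add: mult_ac)
  qed simp
qed simp

lemma norm_adj: "T \<in> clinear_ops \<Longrightarrow> norm (adj T) = norm T"
  by (metis adj_adj adj_clinear antisym norm_adj_le)

lemma op_scaleC_real: "op_scaleC (of_real r) T = r *\<^sub>R T"
  by (rule blinfun_eqI) (simp add: scaleR_scaleC blinfun.scaleR_left)

lemma norm_op_scaleC: "norm (op_scaleC c T) \<le> cmod c * norm T"
  by (rule norm_blinfun_bound)
    (auto simp: norm_scaleC mult.assoc intro!: mult_left_mono norm_blinfun)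

lemma bounded_linear_op_scaleC: "bounded_linear (op_scaleC c)"
  by (rule bounded_linear_intro[where K = "cmod c"])
    (auto intro!: blinfun_eqI simp: blinfun.add_left blinfun.scaleR_left scaleC_add_right
      scaleR_scaleC scaleC_scaleC mult.commute norm_op_scaleC)

lemma clinear_ops_simps [simp]:
  "id_blinfun \<in> clinear_ops" "0 \<in> clinear_ops"
  "S \<in> clinear_ops \<Longrightarrow> T \<in> clinear_ops \<Longrightarrow> S + T \<in> clinear_ops"
  "S \<in> clinear_ops \<Longrightarrow> T \<in> clinear_ops \<Longrightarrow> S - T \<in> clinear_ops"
  "S \<in> clinear_ops \<Longrightarrow> T \<in> clinear_ops \<Longrightarrow> S o\<^sub>L T \<in> clinear_ops"
  "T \<in> clinear_ops \<Longrightarrow> op_scaleC c T \<in> clinear_ops"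
  "T \<in> clinear_ops \<Longrightarrow> r *\<^sub>R T \<in> clinear_ops"
  by (auto simp: clinear_ops_def blinfun.add_left blinfun.diff_left blinfun.scaleR_left scaleC_add_right scaleC_diff_right
      scaleR_scaleC scaleC_scaleC mult.commute)

lemma clinear_ops_sum: "(\<And>i. i \<in> A \<Longrightarrow> f i \<in> clinear_ops) \<Longrightarrow> sum f A \<in> clinear_ops"
  by (induction A rule: infinite_finite_induct) auto

lemma clinear_ops_limit:
  assumes "F \<noteq> bot" "(f \<longlongrightarrow> T) F" "\<And>x. f x \<in> clinear_ops"
  shows "T \<in> clinear_ops"
proof -
  have "blinfun_apply T (c *\<^sub>C x) = c *\<^sub>C blinfun_apply T x" for c x
  proof (rule tendsto_unique[OF assms(1)])
    show "((\<lambda>n. blinfun_apply (f n) (c *\<^sub>C x)) \<longlongrightarrow> blinfun_apply T (c *\<^sub>C x)) F"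
      by (intro tendsto_intros assms)
    have "((\<lambda>n. c *\<^sub>C blinfun_apply (f n) x) \<longlongrightarrow> c *\<^sub>C blinfun_apply T x) F"
      by (intro tendsto_scaleC tendsto_intros assms)
    thus "((\<lambda>n. blinfun_apply (f n) (c *\<^sub>C x)) \<longlongrightarrow> c *\<^sub>C blinfun_apply T x) F"
      using assms(3) by (simp add: clinear_opsD)
  qed
  thus ?thesis by (simp add: clinear_ops_def)
qed

text \<open>Taking adjoints is additive and isometric on \<open>clinear_ops\<close>, hence
  continuous.\<close>

lemma adj_limit:
  assumes "F \<noteq> bot" "(f \<longlongrightarrow> T) F" "\<And>x. f x \<in> clinear_ops"
  shows "((\<lambda>x. adj (f x)) \<longlongrightarrow> adj T) F"
proof -
  have T: "T \<in> clinear_ops" by (rule clinear_ops_limit[OF assms])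
  have "adj (f x) - adj T = adj (f x - T)" for x
    using adj_add[OF assms(3)[of x], of "-1 *\<^sub>R T"] adj_scaleR[OF T, of "-1"] T
    by (simp del: clinear_ops_simps add: clinear_ops_simps(7)[of T "-1", simplified])
  hence "norm (adj (f x) - adj T) \<le> norm (f x - T)" for x
    using norm_adj_le[of "f x - T"] T assms(3) by simp
  thus ?thesis
    using assms(2) by (simp add: tendsto_iff dist_norm)
      (smt (verit, best) eventually_mono)
qed

lemma op_eq_iff: "S = T \<longleftrightarrow> (\<forall>x. blinfun_apply S x = blinfun_apply T x)"
  by (auto intro: blinfun_eqI)

text \<open>Membership in \<open>commutant (commutant S)\<close> is an intersection of kernels, whence all closure properties.\<close>

lemma commutant_closed:
  shows "id_blinfun \<in> commutant M"
    and "S \<in> commutant M \<Longrightarrow> T \<in> commutant M \<Longrightarrow> S + T \<in> commutant M"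
    and "S \<in> commutant M \<Longrightarrow> T \<in> commutant M \<Longrightarrow> S o\<^sub>L T \<in> commutant M"
    and "M \<subseteq> clinear_ops \<Longrightarrow> T \<in> commutant M \<Longrightarrow> op_scaleC c T \<in> commutant M"
    and "F \<noteq> bot \<Longrightarrow> (f \<longlongrightarrow> T) F \<Longrightarrow> (\<And>x. f x \<in> commutant M) \<Longrightarrow> T \<in> commutant M"
proof -
  assume F: "F \<noteq> bot" and lim: "(f \<longlongrightarrow> T) F" and f: "\<And>x. f x \<in> commutant M"
  have "S o\<^sub>L T = T o\<^sub>L S" if "S \<in> M" for S
  proof (rule tendsto_unique[OF F])
    show "((\<lambda>x. S o\<^sub>L f x) \<longlongrightarrow> S o\<^sub>L T) F"
      by (intro bounded_bilinear.tendsto[OF bounded_bilinear_blinfun_compose] tendsto_intros lim)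
    have "((\<lambda>x. f x o\<^sub>L S) \<longlongrightarrow> T o\<^sub>L S) F"
      by (intro bounded_bilinear.tendsto[OF bounded_bilinear_blinfun_compose] tendsto_intros lim)
    thus "((\<lambda>x. S o\<^sub>L f x) \<longlongrightarrow> T o\<^sub>L S) F"
      using f that by (simp add: commutant_def)
  qed
  thus "T \<in> commutant M"
    using clinear_ops_limit[OF F lim] f by (simp add: commutant_def)
qed (auto simp: commutant_def op_eq_iff blinfun.add_left blinfun.add_right clinear_opsD subset_iff)

lemma commutant_clinear: "commutant M \<subseteq> clinear_ops"
  by (auto simp: commutant_def)

lemma vN_subset: "von_neumann_algebra M \<Longrightarrow> M = commutant (commutant M)"
  by (simp add: von_neumann_algebra_def)

lemma vN_closed:
  assumes "von_neumann_algebra M"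
  shows "id_blinfun \<in> M" "S \<in> M \<Longrightarrow> T \<in> M \<Longrightarrow> S + T \<in> M" "S \<in> M \<Longrightarrow> T \<in> M \<Longrightarrow> S o\<^sub>L T \<in> M"
    "T \<in> M \<Longrightarrow> op_scaleC c T \<in> M" "F \<noteq> bot \<Longrightarrow> (f \<longlongrightarrow> T) F \<Longrightarrow> (\<And>x. f x \<in> M) \<Longrightarrow> T \<in> M"
    "T \<in> M \<Longrightarrow> adj T \<in> M" "T \<in> M \<Longrightarrow> T \<in> clinear_ops"
  using commutant_closed(1-4)[where M = "commutant M"] commutant_clinear[of M] vN_subset[OF assms]
    assms commutant_closed(5)[of F f T "commutant M"]
  by (auto simp: von_neumann_algebra_def)

lemma vN_generated_closed:
  shows "id_blinfun \<in> vN_generated X"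
    "S \<in> vN_generated X \<Longrightarrow> T \<in> vN_generated X \<Longrightarrow> S + T \<in> vN_generated X"
    "S \<in> vN_generated X \<Longrightarrow> T \<in> vN_generated X \<Longrightarrow> S o\<^sub>L T \<in> vN_generated X"
    "T \<in> vN_generated X \<Longrightarrow> op_scaleC c T \<in> vN_generated X"
    "F \<noteq> bot \<Longrightarrow> (f \<longlongrightarrow> T) F \<Longrightarrow> (\<And>x. f x \<in> vN_generated X) \<Longrightarrow> T \<in> vN_generated X"
    "T \<in> vN_generated X \<Longrightarrow> adj T \<in> vN_generated X"
  unfolding vN_generated_def Inter_iff
  by (blast intro: vN_closed)+

lemma vN_generated_mem: "x \<in> X \<Longrightarrow> x \<in> vN_generated X"
  unfolding vN_generated_def by blast

text \<open>\<open>vN_generated\<close> is an intersection, which would be the set of all operators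
  if no von Neumann algebra contained the generators. For a self-adjoint set of complex-linear
  operators the bicommutant is such an algebra.\<close>

lemma vN_bicommutant:
  assumes "X \<subseteq> clinear_ops" "adj ` X \<subseteq> X"
  shows "von_neumann_algebra (commutant (commutant X))"
  unfolding von_neumann_algebra_def
proof (intro conjI)
  have adj_comm: "adj T \<in> commutant M" if "T \<in> commutant M" "M \<subseteq> clinear_ops" "adj ` M \<subseteq> M" for T M
  proof -
    have T: "T \<in> clinear_ops" using that by (auto simp: commutant_def)
    have "S o\<^sub>L adj T = adj T o\<^sub>L S" if S: "S \<in> M" for S
    proof -
      have Sc: "S \<in> clinear_ops" and aS: "adj S \<in> M" using S \<open>M \<subseteq> _\<close> \<open>adj ` M \<subseteq> M\<close> by auto
      have "adj S o\<^sub>L T = T o\<^sub>L adj S" using \<open>T \<in> commutant M\<close> aS by (auto simp: commutant_def)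
      hence "adj (adj S o\<^sub>L T) = adj (T o\<^sub>L adj S)" by simp
      thus ?thesis using Sc T by (simp add: adj_comp)
    qed
    thus ?thesis using T by (simp add: commutant_def)
  qed
  show "commutant (commutant X) \<subseteq> clinear_ops" by (auto simp: commutant_def)
  have 1: "adj ` commutant X \<subseteq> commutant X" using adj_comm assms by blast
  show "adj ` commutant (commutant X) \<subseteq> commutant (commutant X)"
    using adj_comm[of _ "commutant X"] 1 commutant_clinear by blast
  \<comment> \<open>Taking commutants reverses inclusions, and a set lies in its bicommutant; this
    Galois connection makes repeated bicommutants stable.\<close>
  have sub: "M \<subseteq> clinear_ops \<Longrightarrow> M \<subseteq> commutant (commutant M)" for M :: "'a op set"
    by (auto simp: commutant_def)
  have anti: "M \<subseteq> N \<Longrightarrow> commutant N \<subseteq> commutant M" for M N :: "'a op set"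
    by (auto simp: commutant_def)
  show "commutant (commutant (commutant (commutant X))) = commutant (commutant X)"
    by (intro antisym anti sub) (auto simp: commutant_clinear assms)
qed

lemma vN_generated_subset_bicommutant:
  assumes "X \<subseteq> clinear_ops" "adj ` X \<subseteq> X"
  shows "vN_generated X \<subseteq> commutant (commutant X)"
proof -
  have "X \<subseteq> commutant (commutant X)" using assms(1) by (auto simp: commutant_def)
  thus ?thesis unfolding vN_generated_def using vN_bicommutant[OF assms] by blast
qed

lemma vN_generated_clinear:
  assumes "X \<subseteq> clinear_ops" "adj ` X \<subseteq> X" "T \<in> vN_generated X" shows "T \<in> clinear_ops"
  using vN_generated_subset_bicommutant[OF assms(1,2)] commutant_clinear assms(3) by blast

lemma vN_generated_mono: "X \<subseteq> Y \<Longrightarrow> vN_generated X \<subseteq> vN_generated Y"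
  unfolding vN_generated_def by blast

section \<open>The one-particle space and its isometric copies with orthogonal ranges\<close>

section \<open>Square-integrable functions on the half-line\<close>

abbreviation half_line :: "real measure" where "half_line \<equiv> lebesgue_on {0..}"

lemma L2_fun_measurable [measurable_dest]: "f \<in> L2_fun \<Longrightarrow> f \<in> borel_measurable half_line"
  by (simp add: L2_fun_def)

lemma L2_fun_integrable: "f \<in> L2_fun \<Longrightarrow> integrable half_line (\<lambda>x. (cmod (f x))\<^sup>2)"
  by (simp add: L2_fun_def)

lemma L2_integrable_mult:
  assumes "f \<in> L2_fun" "g \<in> L2_fun"
  shows "integrable half_line (\<lambda>x. cnj (f x) * g x)"
proof (rule Bochner_Integration.integrable_bound[OF Bochner_Integration.integrable_add[OF
      L2_fun_integrable[OF assms(1)] L2_fun_integrable[OF assms(2)]]])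
  note [measurable] = assms[THEN L2_fun_measurable]
  have "(\<lambda>x. cnj (f x)) \<in> borel_measurable half_line"
    by (rule borel_measurable_continuous_on[OF continuous_on_cnj[OF continuous_on_id]]) measurable
  thus "(\<lambda>x. cnj (f x) * g x) \<in> borel_measurable half_line" by measurable
  have "cmod (cnj a * b) \<le> (cmod a)\<^sup>2 + (cmod b)\<^sup>2" for a b
  proof -
    have "0 \<le> cmod a * cmod b" by simp
    thus ?thesis using sum_squares_bound[of "cmod a" "cmod b"] by (simp only: norm_mult complex_mod_cnj)
  qed
  thus "AE x in half_line. norm (cnj (f x) * g x) \<le> norm ((cmod (f x))\<^sup>2 + (cmod (g x))\<^sup>2)"
    by (intro AE_I2) (simp add: abs_of_nonneg)
qed

lemma L2_fun_add [simp]: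
  assumes "f \<in> L2_fun" "g \<in> L2_fun" shows "(\<lambda>x. f x + g x) \<in> L2_fun"
proof -
  note [measurable] = assms[THEN L2_fun_measurable]
  have "integrable half_line (\<lambda>x. (cmod (f x + g x))\<^sup>2)"
  proof (rule Bochner_Integration.integrable_bound)
    show "integrable half_line (\<lambda>x. 2 * (cmod (f x))\<^sup>2 + 2 * (cmod (g x))\<^sup>2)"
      using assms[THEN L2_fun_integrable] by simp
    have "(cmod (a + b))\<^sup>2 \<le> 2 * (cmod a)\<^sup>2 + 2 * (cmod b)\<^sup>2" for a b
    proof -
      have "(cmod (a + b))\<^sup>2 \<le> (cmod a + cmod b)\<^sup>2" by (intro power_mono norm_triangle_ineq) simp
      thus ?thesis using sum_squares_bound[of "cmod a" "cmod b"] by (simp add: power2_sum)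
    qed
    thus "AE x in half_line. norm ((cmod (f x + g x))\<^sup>2) \<le> norm (2 * (cmod (f x))\<^sup>2 + 2 * (cmod (g x))\<^sup>2)"
      by (intro AE_I2) (simp add: abs_of_nonneg)
  qed measurable
  thus ?thesis by (simp add: L2_fun_def)
qed

lemma L2_fun_scale [simp]: "f \<in> L2_fun \<Longrightarrow> (\<lambda>x. c * f x) \<in> L2_fun"
  by (auto simp: L2_fun_def norm_mult power_mult_distrib)

lemma L2_fun_zero [simp]: "(\<lambda>x. 0) \<in> L2_fun"
  by (simp add: L2_fun_def)

lemma L2_fun_restrict [simp]:
  assumes "f \<in> L2_fun" "S \<in> sets lebesgue" shows "(\<lambda>x. indicator S x * f x) \<in> L2_fun"
proof -
  note [measurable] = assms(1)[THEN L2_fun_measurable]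
  have [measurable]: "indicator S \<in> borel_measurable half_line"
    using assms(2) by (intro borel_measurable_indicator') (auto simp: sets_restrict_space)
  have "integrable half_line (\<lambda>x. (cmod (indicator S x * f x))\<^sup>2)"
    by (rule Bochner_Integration.integrable_bound[OF L2_fun_integrable[OF assms(1)]])
      (measurable, auto intro!: AE_I2 simp: indicator_def)
  moreover have "(\<lambda>x. indicator S x * f x) \<in> borel_measurable half_line" by measurable
  ultimately show ?thesis by (simp add: L2_fun_def)
qed

lemma L2_fun_indicator [simp]:
  assumes "S \<in> lmeasurable" shows "(indicator S :: real \<Rightarrow> complex) \<in> L2_fun"
proof -
  have "integrable half_line (\<lambda>x. indicat_real S x)"
    using assms by (intro integrable_restrict_space[THEN iffD2])
      (auto simp: indicator_inter_arith[symmetric] mult.commute fmeasurable_Int_fmeasurable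
        intro!: lmeasurable_iff_integrable[THEN iffD1])
  moreover have "(cmod (indicator S x))\<^sup>2 = indicat_real S x" for x by (auto simp: indicator_def)
  moreover have "indicator S \<in> borel_measurable half_line"
    using assms by (intro borel_measurable_indicator') (auto simp: sets_restrict_space)
  ultimately show ?thesis by (simp add: L2_fun_def)
qed

lemma L2_inner_add_right:
  "f \<in> L2_fun \<Longrightarrow> g \<in> L2_fun \<Longrightarrow> h \<in> L2_fun \<Longrightarrow>
    L2_inner f (\<lambda>x. g x + h x) = L2_inner f g + L2_inner f h"
  unfolding L2_inner_def by (simp add: ring_distribs L2_integrable_mult)

lemma L2_inner_scale_right: "L2_inner f (\<lambda>x. c * g x) = c * L2_inner f g"
  unfolding L2_inner_def by (simp add: mult.left_commute)

lemma L2_inner_commute: "L2_inner f g = cnj (L2_inner g f)"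
  unfolding L2_inner_def Bochner_Integration.integral_cnj[symmetric]
  by (intro Bochner_Integration.integral_cong refl) (simp add: mult.commute)

lemma L2_inner_add_left:
  "f \<in> L2_fun \<Longrightarrow> g \<in> L2_fun \<Longrightarrow> h \<in> L2_fun \<Longrightarrow>
    L2_inner (\<lambda>x. f x + g x) h = L2_inner f h + L2_inner g h"
  by (subst (1 2 3) L2_inner_commute) (simp add: L2_inner_add_right)

lemma L2_inner_scale_left: "L2_inner (\<lambda>x. c * f x) g = cnj c * L2_inner f g"
  by (subst (1 2) L2_inner_commute) (simp add: L2_inner_scale_right)

lemma L2_inner_zero [simp]: "L2_inner (\<lambda>x. 0) f = 0" "L2_inner f (\<lambda>x. 0) = 0"
  by (simp_all add: L2_inner_def)

lemma L2_inner_disjoint: "(\<And>x. x \<ge> 0 \<Longrightarrow> f x = 0 \<or> g x = 0) \<Longrightarrow> L2_inner f g = 0"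
  unfolding L2_inner_def by (rule integral_eq_zero_AE, rule AE_I2) auto

lemma L2_inner_real:
  assumes "\<And>x. f x \<in> \<real>" "\<And>x. g x \<in> \<real>" shows "L2_inner f g \<in> \<real>"
proof -
  have "cnj (L2_inner f g) = L2_inner f g"
    unfolding L2_inner_def Bochner_Integration.integral_cnj[symmetric]
    using assms by (intro Bochner_Integration.integral_cong refl) (simp add: Reals_cnj_iff[THEN iffD1])
  thus ?thesis by (simp add: Reals_cnj_iff)
qed

abbreviation ivl :: "real \<Rightarrow> real \<Rightarrow> real \<Rightarrow> complex" where
  "ivl u v \<equiv> indicator {u<..v}"

lemma L2_inner_indicator:
  assumes "A \<in> lmeasurable" "B \<in> lmeasurable"
  shows "L2_inner (indicator A) (indicator B) = measure lebesgue (A \<inter> B \<inter> {0..})"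
proof -
  have "L2_inner (indicator A) (indicator B) = (\<integral>x. complex_of_real (indicat_real (A \<inter> B) x) \<partial>half_line)"
    unfolding L2_inner_def by (intro Bochner_Integration.integral_cong refl) (auto simp: indicator_def)
  also have "\<dots> = complex_of_real (\<integral>x. indicat_real (A \<inter> B) x \<partial>half_line)" by simp
  also have "(\<integral>x. indicat_real (A \<inter> B) x \<partial>half_line)
      = (\<integral>x. indicator {0..} x *\<^sub>R indicat_real (A \<inter> B) x \<partial>lebesgue)"
    by (rule integral_restrict_space) simp
  also have "\<dots> = (\<integral>x. indicat_real (A \<inter> B \<inter> {0..}) x \<partial>lebesgue)"
    by (rule arg_cong[where f = "integral\<^sup>L lebesgue"]) (auto simp: indicator_def fun_eq_iff)
  also have "\<dots> = measure lebesgue (A \<inter> B \<inter> {0..})" by simp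
  finally show ?thesis .
qed

lemma interval_lmeasurable [simp]: "{u<..v} \<in> lmeasurable" "{u..v} \<in> lmeasurable" for u v :: real
  by (rule bounded_set_imp_lmeasurable; simp)+

lemma L2_inner_ivl:
  assumes "0 \<le> u" "u \<le> v" shows "L2_inner (ivl u v) (ivl u v) = of_real (v - u)"
proof -
  have "{u<..v} \<inter> {u<..v} \<inter> {0..} = {u<..v}" using assms by auto
  thus ?thesis using assms by (subst L2_inner_indicator) simp_all
qed

text \<open>
  The points of the unit intervals \<open>[d + 2m + j, d + 2m + j + 1)\<close> are moved to \<open>[m, m + 1)\<close>.
  Composition with this map yields, for \<open>j = 0, 1\<close>, isometries of \<open>L\<^sup>2(\<real>\<^sub>+)\<close> with orthogonal ranges.
\<close>

definition comb :: "real \<Rightarrow> int \<Rightarrow> real set" where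
  "comb d j = {x. x \<ge> d \<and> \<lfloor>x - d\<rfloor> mod 2 = j}"

definition fold_comb :: "real \<Rightarrow> int \<Rightarrow> real \<Rightarrow> real" where
  "fold_comb d j x = x - d - of_int ((\<lfloor>x - d\<rfloor> + j) div 2)"

definition spread :: "real \<Rightarrow> int \<Rightarrow> (real \<Rightarrow> complex) \<Rightarrow> real \<Rightarrow> complex" where
  "spread d j f x = (if x \<in> comb d j then f (fold_comb d j x) else 0)"

text \<open>On the m-th tooth of the comb the folding is a translation by d + m + j to the left, so
  a preimage consists of translated unit slices.\<close>

lemma fold_comb_vimage:
  assumes A: "A \<subseteq> {0..}" and j: "j \<in> {0, 1}"
  shows "fold_comb d j -` A \<inter> comb d j = (\<Union>m::nat. (+) (d + real m + of_int j) ` (A \<inter> {real m..<real m + 1}))"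
proof (intro set_eqI iffI)
  fix x assume x: "x \<in> fold_comb d j -` A \<inter> comb d j"
  define k where "k = \<lfloor>x - d\<rfloor>"
  have k: "k mod 2 = j" "k \<ge> 0" using x by (auto simp: comb_def k_def)
  define m where "m = nat (k div 2)"
  have km: "k = 2 * int m + j" using k unfolding m_def using div_mult_mod_eq[of k 2] by simp
  have "(k + j) div 2 = int m + j" using km j by auto
  hence f: "fold_comb d j x = x - (d + real m + of_int j)" by (simp add: fold_comb_def k_def)
  have "of_int k \<le> x - d" "x - d < of_int k + 1" unfolding k_def by linarith+
  hence "fold_comb d j x \<in> A \<inter> {real m..<real m + 1}" using x f km by auto
  moreover have "x = (d + real m + of_int j) + fold_comb d j x" using f by simp
  ultimately show "x \<in> (\<Union>m::nat. (+) (d + real m + of_int j) ` (A \<inter> {real m..<real m + 1}))" by blast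
next
  fix x assume "x \<in> (\<Union>m::nat. (+) (d + real m + of_int j) ` (A \<inter> {real m..<real m + 1}))"
  then obtain m :: nat and y :: real where y: "y \<in> A" "real m \<le> y" "y < real m + 1"
    "x = d + real m + of_int j + y" by auto
  have fl: "\<lfloor>x - d\<rfloor> = 2 * int m + j" using y by (intro floor_unique) auto
  have "(2 * int m + j + j) div 2 = int m + j" using j by auto
  hence "fold_comb d j x = y" using fl y by (simp add: fold_comb_def)
  moreover have "x \<in> comb d j" using j fl y by (auto simp: comb_def)
  ultimately show "x \<in> fold_comb d j -` A \<inter> comb d j" using y by auto
qed

lemma comb_lebesgue: "j \<in> {0, 1} \<Longrightarrow> comb d j \<in> sets lebesgue"
proof -
  have "(\<lambda>x. \<lfloor>x - d\<rfloor> mod 2) \<in> borel \<rightarrow>\<^sub>M count_space UNIV" by measurable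
  hence "comb d j \<in> sets borel" unfolding comb_def by measurable
  thus ?thesis by simp
qed

text \<open>The teeth are translated one by one onto the unit slices [m, m + 1), which tile the
  half-line; translation invariance and countable additivity do the rest.\<close>

lemma
  assumes j: "j \<in> {0, 1}"
  shows fold_comb_measurable: "fold_comb d j \<in> lebesgue_on (comb d j) \<rightarrow>\<^sub>M half_line"
    and fold_comb_distr: "distr (lebesgue_on (comb d j)) half_line (fold_comb d j) = half_line"
proof -
  have piece: "(+) (d + real m + of_int j) ` (A \<inter> {real m..<real m + 1}) \<in> sets lebesgue" if "A \<in> sets half_line" for m::nat and A
    using that by (intro lebesgue_sets_translation sets.Int) (auto simp: sets_restrict_space)
  have vim: "fold_comb d j -` A \<inter> comb d j = (\<Union>m::nat. (+) (d + real m + of_int j) ` (A \<inter> {real m..<real m + 1}))"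
    if "A \<in> sets half_line" for A
    using that j by (intro fold_comb_vimage) (auto simp: sets_restrict_space)
  have sub: "fold_comb d j -` A \<inter> comb d j \<in> sets lebesgue" if "A \<in> sets half_line" for A
    unfolding vim[OF that] using piece[OF that] by (intro sets.countable_UN) auto
  have c: "comb d j \<in> sets lebesgue" by (rule comb_lebesgue[OF j])
  show meas: "fold_comb d j \<in> lebesgue_on (comb d j) \<rightarrow>\<^sub>M half_line"
  proof (rule measurableI)
    fix x assume "x \<in> space (lebesgue_on (comb d j))"
    hence "x \<in> comb d j" by simp
    hence x: "0 \<le> x - d" "\<lfloor>x - d\<rfloor> mod 2 = j" by (auto simp: comb_def)
    have "0 \<le> \<lfloor>x - d\<rfloor>" using x by simp
    hence "(\<lfloor>x - d\<rfloor> + j) div 2 \<le> \<lfloor>x - d\<rfloor>"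
      using j x(2) unfolding insert_iff empty_iff by presburger
    hence "of_int ((\<lfloor>x - d\<rfloor> + j) div 2) \<le> x - d" by (simp add: le_floor_iff)
    thus "fold_comb d j x \<in> space half_line" by (simp add: fold_comb_def)
  next
    fix A assume A: "A \<in> sets half_line"
    have "fold_comb d j -` A \<inter> comb d j \<in> sets lebesgue" by (rule sub[OF A])
    thus "fold_comb d j -` A \<inter> space (lebesgue_on (comb d j)) \<in> sets (lebesgue_on (comb d j))"
      using c by (auto simp: sets_restrict_space_iff)
  qed
  show "distr (lebesgue_on (comb d j)) half_line (fold_comb d j) = half_line"
  proof (rule measure_eqI)
    fix A assume "A \<in> sets (distr (lebesgue_on (comb d j)) half_line (fold_comb d j))"
    hence A: "A \<in> sets half_line" by simp
    hence AL: "A \<in> sets lebesgue" "A \<subseteq> {0..}" by (auto simp: sets_restrict_space)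
    have "emeasure (distr (lebesgue_on (comb d j)) half_line (fold_comb d j)) A
        = emeasure lebesgue (fold_comb d j -` A \<inter> comb d j)"
      using A meas c by (simp add: emeasure_distr emeasure_restrict_space)
    also have "\<dots> = emeasure lebesgue (\<Union>m::nat. (+) (d + real m + of_int j) ` (A \<inter> {real m..<real m + 1}))"
      by (simp add: vim[OF A])
    also have "\<dots> = (\<Sum>m. emeasure lebesgue ((+) (d + real m + of_int j) ` (A \<inter> {real m..<real m + 1})))"
    proof (rule suminf_emeasure[symmetric])
      show "range (\<lambda>m::nat. (+) (d + real m + of_int j) ` (A \<inter> {real m..<real m + 1})) \<subseteq> sets lebesgue"
        using piece[OF A] by auto
      show "disjoint_family (\<lambda>m::nat. (+) (d + real m + of_int j) ` (A \<inter> {real m..<real m + 1}))"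
      proof (unfold disjoint_family_on_def, intro ballI impI)
        fix m n :: nat assume "m \<noteq> n"
        have False if "x \<in> (+) (d + real m + of_int j) ` (A \<inter> {real m..<real m + 1})"
          "x \<in> (+) (d + real n + of_int j) ` (A \<inter> {real n..<real n + 1})" for x
        proof -
          have "real (2 * m) \<le> x - d - j" "x - d - j < real (2*m) + 1" using that(1) by auto
          moreover have "real (2 * n) \<le> x - d - j" "x - d - j < real (2*n) + 1" using that(2) by auto
          ultimately show False using \<open>m \<noteq> n\<close> by linarith
        qed
        thus "(+) (d + real m + of_int j) ` (A \<inter> {real m..<real m + 1}) \<inter> (+) (d + real n + of_int j) ` (A \<inter> {real n..<real n + 1}) = {}"
          by blast
      qed
    qed
    also have "\<dots> = (\<Sum>m. emeasure lebesgue (A \<inter> {real m..<real m + 1}))"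
    proof (rule arg_cong[where f = suminf], rule ext)
      fix m :: nat
      show "emeasure lebesgue ((+) (d + real m + of_int j) ` (A \<inter> {real m..<real m + 1})) = emeasure lebesgue (A \<inter> {real m..<real m + 1})"
        using emeasure_lebesgue_affine[of 1 "d + real m + of_int j" "A \<inter> {real m..<real m + 1}"]
        by (simp add: add.commute cong: image_cong_simp)
    qed
    also have "\<dots> = emeasure lebesgue (\<Union>m::nat. A \<inter> {real m..<real m + 1})"
    proof (rule suminf_emeasure)
      show "disjoint_family (\<lambda>m::nat. A \<inter> {real m..<real m + 1})"
      proof (unfold disjoint_family_on_def, intro ballI impI)
        fix m n :: nat assume "m \<noteq> n"
        have False if "real m \<le> x" "x < real m + 1" "real n \<le> x" "x < real n + 1" for x
          using that \<open>m \<noteq> n\<close> by linarith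
        thus "A \<inter> {real m..<real m + 1} \<inter> (A \<inter> {real n..<real n + 1}) = {}" by auto
      qed
    qed (use AL in auto)
    also have "(\<Union>m::nat. A \<inter> {real m..<real m + 1}) = A"
    proof (intro equalityI subsetI)
      fix x assume "x \<in> A"
      hence "real (nat \<lfloor>x\<rfloor>) \<le> x" "x < real (nat \<lfloor>x\<rfloor>) + 1" using AL(2) by (auto simp: subset_iff)
      thus "x \<in> (\<Union>m::nat. A \<inter> {real m..<real m + 1})" using \<open>x \<in> A\<close> by auto
    qed auto
    also have "emeasure lebesgue A = emeasure half_line A"
      using AL by (simp add: emeasure_restrict_space)
    finally show "emeasure (distr (lebesgue_on (comb d j)) half_line (fold_comb d j)) A = emeasure half_line A" .
  qed simp
qed

text \<open>Change of variables along the measure-preserving folding; this is what makes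
  \<open>spread\<close> an isometry.\<close>

lemma
  fixes F :: "real \<Rightarrow> 'b::euclidean_space"
  assumes j: "j \<in> {0, 1}" and d: "0 \<le> d" and F: "F \<in> borel_measurable half_line"
  defines "G \<equiv> \<lambda>x. if x \<in> comb d j then F (fold_comb d j x) else 0"
  shows spread_borel: "G \<in> borel_measurable half_line"
    and spread_integrable: "integrable half_line F \<Longrightarrow> integrable half_line G"
    and spread_integral: "integral\<^sup>L half_line G = integral\<^sup>L half_line F"
proof -
  note [measurable] = fold_comb_measurable[OF j, of d] F
  have sub: "comb d j \<subseteq> {0..}" using d by (auto simp: comb_def)
  have c: "comb d j \<in> sets lebesgue" by (rule comb_lebesgue[OF j])
  have c': "comb d j \<inter> space half_line \<in> sets half_line" using c sub by (auto simp: sets_restrict_space_iff)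
  have G: "G = (\<lambda>x. indicator (comb d j) x *\<^sub>R F (fold_comb d j x))" by (auto simp: G_def)
  have r: "restrict_space half_line (comb d j) = lebesgue_on (comb d j)"
    using sub by (subst restrict_restrict_space) (auto simp: c Int_absorb1)
  have FT: "(\<lambda>x. F (fold_comb d j x)) \<in> borel_measurable (lebesgue_on (comb d j))" by measurable
  show "G \<in> borel_measurable half_line"
    unfolding G using borel_measurable_restrict_space_iff[OF c', of "\<lambda>x. F (fold_comb d j x)"] FT r
    by (simp add: scaleR_conv_of_real)
  show "integrable half_line G" if "integrable half_line F"
    unfolding G integrable_restrict_space[OF c', symmetric] r
    using that fold_comb_distr[OF j, of d] integrable_distr[OF fold_comb_measurable[OF j], of d F]
    by simp
  show "integral\<^sup>L half_line G = integral\<^sup>L half_line F"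
    unfolding G integral_restrict_space[OF c', symmetric] r
    using fold_comb_distr[OF j, of d] integral_distr[OF fold_comb_measurable[OF j] F, of d] by simp
qed

lemma spread_L2 [simp]:
  assumes "j \<in> {0, 1}" "0 \<le> d" "f \<in> L2_fun" shows "spread d j f \<in> L2_fun"
proof -
  have 1: "(\<lambda>x. (cmod (spread d j f x))\<^sup>2) = (\<lambda>x. if x \<in> comb d j then (cmod (f (fold_comb d j x)))\<^sup>2 else 0)"
    by (auto simp: spread_def)
  show ?thesis
    unfolding L2_fun_def mem_Collect_eq 1
    using assms spread_borel[OF assms(1,2), of f] spread_integrable[OF assms(1,2), of "\<lambda>x. (cmod (f x))\<^sup>2"]
    by (simp add: L2_fun_def spread_def[abs_def])
qed

lemma L2_inner_spread:
  assumes "j \<in> {0, 1}" "0 \<le> d" "f \<in> L2_fun" "g \<in> L2_fun"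
  shows "L2_inner (spread d j f) (spread d j g) = L2_inner f g"
proof -
  have 1: "(\<lambda>x. cnj (spread d j f x) * spread d j g x)
     = (\<lambda>x. if x \<in> comb d j then (\<lambda>y. cnj (f y) * g y) (fold_comb d j x) else 0)"
    by (auto simp: spread_def)
  show ?thesis unfolding L2_inner_def 1
    using L2_integrable_mult[OF assms(3,4)] by (intro spread_integral assms) auto
qed

lemma L2_inner_spread_orth: "L2_inner (spread d 0 f) (spread d 1 g) = 0" "L2_inner (spread d 1 f) (spread d 0 g) = 0"
  by (intro L2_inner_disjoint; auto simp: spread_def comb_def)+

lemma spread_add: "spread d j (\<lambda>x. f x + g x) = (\<lambda>x. spread d j f x + spread d j g x)"
  and spread_scale: "spread d j (\<lambda>x. c * f x) = (\<lambda>x. c * spread d j f x)"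
  by (auto simp: spread_def)

lemma spread_real: "(\<And>x. f x \<in> \<real>) \<Longrightarrow> spread d j f x \<in> \<real>"
  by (simp add: spread_def)

lemma spread_support: "x < d \<Longrightarrow> spread d j f x = 0"
  by (simp add: spread_def comb_def)

section \<open>Inversions of permutations: expansion along a letter and reversal\<close>

section \<open>The q-inner product of words\<close>

definition del :: "nat \<Rightarrow> 'a list \<Rightarrow> 'a list" where
  "del r w = take r w @ drop (Suc r) w"

lemma length_del: "r < length w \<Longrightarrow> length (del r w) = length w - 1"
  by (simp add: del_def)

lemma del_0 [simp]: "del 0 (x # w) = w" and del_Suc [simp]: "del (Suc r) (x # w) = x # del r w"
  by (simp_all add: del_def)

lemma set_del: "set (del r w) \<subseteq> set w"
  unfolding del_def by (auto dest: in_set_takeD in_set_dropD)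

lemma del_map: "del r (map f w) = map f (del r w)"
  by (simp add: del_def take_map drop_map)

lemma nth_del: "r < length w \<Longrightarrow> j < length w - 1 \<Longrightarrow> del r w ! j = w ! (if j < r then j else Suc j)"
  by (auto simp: del_def nth_append min_def)

text \<open>A permutation of n + 1 positions is the image r of the position 0 together with a
  permutation of the rest, relabelled so that r is skipped. This pair of maps indexes the expansion
  of a q-inner product along its first letter.\<close>

definition ins_perm :: "nat \<Rightarrow> nat \<Rightarrow> (nat \<Rightarrow> nat) \<Rightarrow> nat \<Rightarrow> nat" where
  "ins_perm n r \<tau> i = (case i of 0 \<Rightarrow> r
     | Suc i \<Rightarrow> if i < n then (if \<tau> i < r then \<tau> i else Suc (\<tau> i)) else Suc i)"

definition del_perm :: "nat \<Rightarrow> (nat \<Rightarrow> nat) \<Rightarrow> nat \<Rightarrow> nat" where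
  "del_perm n \<sigma> i = (if i < n then (if \<sigma> (Suc i) < \<sigma> 0 then \<sigma> (Suc i) else \<sigma> (Suc i) - 1) else i)"

lemma ins_perm_permutes:
  assumes \<tau>: "\<tau> permutes {..<n}" and r: "r \<le> n" shows "ins_perm n r \<tau> permutes {..<Suc n}"
proof (rule bij_imp_permutes)
  have lt: "\<tau> i < n \<longleftrightarrow> i < n" for i using permutes_in_image[OF \<tau>, of i] by simp
  have inj: "inj_on (ins_perm n r \<tau>) {..<Suc n}"
  proof (rule inj_onI)
    have ij: "\<tau> i = \<tau> j \<longleftrightarrow> i = j" for i j using permutes_inj[OF \<tau>] by (simp add: inj_eq)
    fix i j assume "i \<in> {..<Suc n}" "j \<in> {..<Suc n}" "ins_perm n r \<tau> i = ins_perm n r \<tau> j"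
    thus "i = j" by (cases i; cases j) (auto simp: ins_perm_def ij split: if_splits)
  qed
  moreover have "ins_perm n r \<tau> ` {..<Suc n} \<subseteq> {..<Suc n}"
  proof
    fix k assume "k \<in> ins_perm n r \<tau> ` {..<Suc n}"
    then obtain i where i: "i < Suc n" "k = ins_perm n r \<tau> i" by auto
    thus "k \<in> {..<Suc n}" using r lt[of "i - 1"] by (cases i) (auto simp: ins_perm_def)
  qed
  ultimately show "bij_betw (ins_perm n r \<tau>) {..<Suc n} {..<Suc n}"
    by (metis bij_betw_def endo_inj_surj finite_lessThan)
qed (auto simp: ins_perm_def split: nat.splits)

lemma del_perm_permutes:
  assumes \<sigma>: "\<sigma> permutes {..<Suc n}" shows "del_perm n \<sigma> permutes {..<n}"
proof (rule bij_imp_permutes)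
  have lt: "\<sigma> i < Suc n \<longleftrightarrow> i < Suc n" for i using permutes_in_image[OF \<sigma>, of i] by simp
  have ij: "\<sigma> i = \<sigma> j \<longleftrightarrow> i = j" for i j using permutes_inj[OF \<sigma>] by (simp add: inj_eq)
  have inj: "inj_on (del_perm n \<sigma>) {..<n}"
  proof (rule inj_onI)
    fix i j assume "i \<in> {..<n}" "j \<in> {..<n}" "del_perm n \<sigma> i = del_perm n \<sigma> j"
    thus "i = j" using ij[of "Suc i" "Suc j"] ij[of "Suc i" 0] ij[of "Suc j" 0]
      by (auto simp: del_perm_def split: if_splits)
  qed
  moreover have "del_perm n \<sigma> ` {..<n} \<subseteq> {..<n}"
  proof
    fix k assume "k \<in> del_perm n \<sigma> ` {..<n}"
    then obtain i where i: "i < n" "k = del_perm n \<sigma> i" by auto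
    have "\<sigma> (Suc i) < Suc n" "\<sigma> 0 < Suc n" using lt i by auto
    thus "k \<in> {..<n}" using i ij[of "Suc i" 0] by (auto simp: del_perm_def)
  qed
  ultimately show "bij_betw (del_perm n \<sigma>) {..<n} {..<n}"
    by (metis bij_betw_def endo_inj_surj finite_lessThan)
qed (auto simp: del_perm_def)

text \<open>The r values below r all stand behind the front entry, which makes r new inversions;
  skipping the value r preserves the order of the others, so their inversions survive.\<close>

lemma perm_inv_ins:
  assumes \<tau>: "\<tau> permutes {..<n}" and r: "r \<le> n"
  shows "perm_inv (Suc n) (ins_perm n r \<tau>) = r + perm_inv n \<tau>"
proof -
  let ?A = "(\<lambda>k. (0::nat, Suc k)) ` {k. k < n \<and> \<tau> k < r}"
  let ?B = "map_prod Suc Suc ` {(i, k). i < k \<and> k < n \<and> \<tau> k < \<tau> i}"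
  have eq: "{(i, k). i < k \<and> k < Suc n \<and> ins_perm n r \<tau> k < ins_perm n r \<tau> i} = ?A \<union> ?B"
  proof (intro set_eqI, clarify)
    fix i k
    show "(i, k) \<in> {(i, k). i < k \<and> k < Suc n \<and> ins_perm n r \<tau> k < ins_perm n r \<tau> i} \<longleftrightarrow> (i, k) \<in> ?A \<union> ?B"
    proof (cases k)
      case (Suc k')
      thus ?thesis by (cases i) (auto simp: ins_perm_def image_iff)
    qed auto
  qed
  have "{k. k < n \<and> \<tau> k < r} = inv \<tau> ` {..<r}"
  proof (intro set_eqI iffI)
    fix k assume "k \<in> {k. k < n \<and> \<tau> k < r}"
    thus "k \<in> inv \<tau> ` {..<r}" using permutes_inverses(2)[OF \<tau>, of k] by force
  next
    fix k assume "k \<in> inv \<tau> ` {..<r}"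
    then obtain j where j: "j < r" "k = inv \<tau> j" by auto
    moreover have "inv \<tau> j < n" using j r permutes_in_image[OF permutes_inv[OF \<tau>], of j] by auto
    ultimately show "k \<in> {k. k < n \<and> \<tau> k < r}" using permutes_inverses(1)[OF \<tau>, of j] by auto
  qed
  hence cA: "card ?A = r"
    using card_image[OF inj_on_subset[OF permutes_inj[OF permutes_inv[OF \<tau>]] subset_UNIV], of "{..<r}"]
    by (subst card_image) (auto simp: inj_on_def)
  have cB: "card ?B = perm_inv n \<tau>"
    unfolding perm_inv_def by (intro card_image) (auto simp: inj_on_def)
  have fB: "finite {(i, k). i < k \<and> k < n \<and> \<tau> k < \<tau> i}"
    by (rule finite_subset[of _ "{..<n} \<times> {..<n}"]) auto
  show ?thesis unfolding perm_inv_def[of "Suc n"] eq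
    by (subst card_Un_disjoint) (use fB cA cB in auto)
qed

lemma q_inner_Nil: "q_inner q [] w = (if w = [] then 1 else 0)"
proof (cases w)
  case Nil
  have "perm_inv 0 id = 0" by (simp add: perm_inv_def)
  moreover have "{\<sigma>. \<sigma> permutes ({}::nat set)} = {id}" by auto
  ultimately show ?thesis using Nil by (simp add: q_inner_def)
qed (simp add: q_inner_def)

text \<open>Laplace expansion along the first letter, where the power of q counts the letters in
  front of the partner of f. It exhibits the annihilator as the adjoint of creation and is the
  engine of the inductions over words.\<close>

lemma q_inner_Cons:
  "q_inner q (f # v) w = (\<Sum>r<length w. of_real (q ^ r) * L2_inner f (w ! r) * q_inner q v (del r w))"
proof (cases "length w = Suc (length v)")
  case False
  thus ?thesis by (intro trans[OF _ sum.neutral[symmetric]]) (auto simp: q_inner_def length_del)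
next
  case True
  define n where "n = length v"
  define T where "T = (\<lambda>r \<tau>. of_real (q ^ r) * L2_inner f (w ! r) *
     (complex_of_real (q ^ perm_inv n \<tau>) * (\<Prod>i<n. L2_inner (v ! i) (del r w ! \<tau> i))))"
  have "q_inner q (f # v) w = (\<Sum>\<sigma> | \<sigma> permutes {..<Suc n}.
             complex_of_real (q ^ perm_inv (Suc n) \<sigma>) * (\<Prod>i<Suc n. L2_inner ((f # v) ! i) (w ! \<sigma> i)))"
    using True by (simp add: q_inner_def n_def)
  also have "\<dots> = (\<Sum>p\<in>{..<Suc n} \<times> {\<tau>. \<tau> permutes {..<n}}. T (fst p) (snd p))"
  proof (rule sum.reindex_bij_witness[where i = "\<lambda>p. ins_perm n (fst p) (snd p)" and j = "\<lambda>\<sigma>. (\<sigma> 0, del_perm n \<sigma>)"])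
    fix \<sigma> assume s: "\<sigma> \<in> {\<sigma>. \<sigma> permutes {..<Suc n}}"
    hence s': "\<sigma> permutes {..<Suc n}" by simp
    have lt: "\<sigma> i < Suc n \<longleftrightarrow> i < Suc n" for i using permutes_in_image[OF s', of i] by simp
    have ij: "\<sigma> i = \<sigma> j \<longleftrightarrow> i = j" for i j using permutes_inj[OF s'] by (simp add: inj_eq)
    show eq: "ins_perm n (fst (\<sigma> 0, del_perm n \<sigma>)) (snd (\<sigma> 0, del_perm n \<sigma>)) = \<sigma>"
    proof
      fix i show "ins_perm n (fst (\<sigma> 0, del_perm n \<sigma>)) (snd (\<sigma> 0, del_perm n \<sigma>)) i = \<sigma> i"
        using ij[of i 0] permutes_not_in[OF s', of i]
        by (auto simp: ins_perm_def del_perm_def split: nat.splits)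
    qed
    show mem: "(\<sigma> 0, del_perm n \<sigma>) \<in> {..<Suc n} \<times> {\<tau>. \<tau> permutes {..<n}}"
      using del_perm_permutes[OF s'] lt[of 0] by simp
    define r \<tau> where r: "r = \<sigma> 0" and t: "\<tau> = del_perm n \<sigma>"
    have tp: "\<tau> permutes {..<n}" "r \<le> n" using mem r t by auto
    have sg: "\<sigma> = ins_perm n r \<tau>" using eq r t by simp
    have tn: "\<tau> i < n" if "i < n" for i using permutes_in_image[OF tp(1), of i] that by simp
    have pr: "(\<Prod>i<Suc n. L2_inner ((f # v) ! i) (w ! \<sigma> i)) = L2_inner f (w ! r) * (\<Prod>i<n. L2_inner (v ! i) (del r w ! \<tau> i))"
      using True tn tp(2) unfolding prod.lessThan_Suc_shift sg
      by (intro arg_cong2[where f = "(*)"] prod.cong refl)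
        (auto simp: ins_perm_def nth_del n_def)
    show "T (fst (\<sigma> 0, del_perm n \<sigma>)) (snd (\<sigma> 0, del_perm n \<sigma>)) =
         complex_of_real (q ^ perm_inv (Suc n) \<sigma>) * (\<Prod>i<Suc n. L2_inner ((f # v) ! i) (w ! \<sigma> i))"
      unfolding pr fst_conv snd_conv r[symmetric] t[symmetric]
      by (simp add: T_def sg perm_inv_ins[OF tp] power_add mult_ac)
  next
    fix p assume "p \<in> {..<Suc n} \<times> {\<tau>. \<tau> permutes {..<n}}"
    then obtain r \<tau> where p: "p = (r, \<tau>)" "r \<le> n" "\<tau> permutes {..<n}" by auto
    have "del_perm n (ins_perm n r \<tau>) = \<tau>"
      using permutes_not_in[OF p(3)] by (auto simp: ins_perm_def del_perm_def fun_eq_iff)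
    thus "(ins_perm n (fst p) (snd p) 0, del_perm n (ins_perm n (fst p) (snd p))) = p"
      using p by (simp add: ins_perm_def)
    show "ins_perm n (fst p) (snd p) \<in> {\<sigma>. \<sigma> permutes {..<Suc n}}"
      using p ins_perm_permutes by simp
  qed
  also have "\<dots> = (\<Sum>r<Suc n. \<Sum>\<tau> | \<tau> permutes {..<n}. T r \<tau>)"
    by (simp add: sum.cartesian_product case_prod_beta)
  also have "\<dots> = (\<Sum>r<length w. of_real (q ^ r) * L2_inner f (w ! r) * q_inner q v (del r w))"
    using True by (intro sum.cong) (auto simp: T_def q_inner_def length_del n_def sum_distrib_left)
  finally show ?thesis .
qed

text \<open>Conjugation by the reversal \<rho> turns an inversion (i, k) into the inversion (\<rho>
  k, \<rho> i).\<close>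

lemma perm_inv_rev:
  assumes s: "\<sigma> permutes {..<n}"
  defines "\<rho> \<equiv> \<lambda>i. if i < n then n - 1 - i else i"
  shows "perm_inv n (\<rho> \<circ> \<sigma> \<circ> \<rho>) = perm_inv n \<sigma>"
proof -
  have lt: "\<sigma> i < n \<longleftrightarrow> i < n" for i using permutes_in_image[OF s, of i] by simp
  have "bij_betw (\<lambda>(i, k). (\<rho> k, \<rho> i)) {(i, k). i < k \<and> k < n \<and> (\<rho> \<circ> \<sigma> \<circ> \<rho>) k < (\<rho> \<circ> \<sigma> \<circ> \<rho>) i}
     {(i, k). i < k \<and> k < n \<and> \<sigma> k < \<sigma> i}"
  proof (rule bij_betw_byWitness[where f' = "\<lambda>(i, k). (\<rho> k, \<rho> i)"])
    show "(\<lambda>(i, k). (\<rho> k, \<rho> i)) ` {(i, k). i < k \<and> k < n \<and> (\<rho> \<circ> \<sigma> \<circ> \<rho>) k < (\<rho> \<circ> \<sigma> \<circ> \<rho>) i} \<subseteq> {(i, k). i < k \<and> k < n \<and> \<sigma> k < \<sigma> i}"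
    proof clarsimp
      fix i k assume h: "i < k" "k < n" "\<rho> (\<sigma> (\<rho> k)) < \<rho> (\<sigma> (\<rho> i))"
      have "\<rho> k < n" "\<rho> i < n" using h by (auto simp: \<rho>_def)
      hence "\<sigma> (\<rho> k) < n" "\<sigma> (\<rho> i) < n" using lt by auto
      thus "\<rho> k < \<rho> i \<and> \<rho> i < n \<and> \<sigma> (\<rho> i) < \<sigma> (\<rho> k)" using h by (auto simp: \<rho>_def)
    qed
    show "(\<lambda>(i, k). (\<rho> k, \<rho> i)) ` {(i, k). i < k \<and> k < n \<and> \<sigma> k < \<sigma> i} \<subseteq> {(i, k). i < k \<and> k < n \<and> (\<rho> \<circ> \<sigma> \<circ> \<rho>) k < (\<rho> \<circ> \<sigma> \<circ> \<rho>) i}"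
    proof clarsimp
      fix i k assume h: "i < k" "k < n" "\<sigma> k < \<sigma> i"
      hence "\<sigma> k < n" "\<sigma> i < n" using lt by auto
      moreover have "\<rho> (\<rho> k) = k" "\<rho> (\<rho> i) = i" using h by (auto simp: \<rho>_def)
      ultimately show "\<rho> k < \<rho> i \<and> \<rho> i < n \<and> \<rho> (\<sigma> (\<rho> (\<rho> i))) < \<rho> (\<sigma> (\<rho> (\<rho> k)))"
        using h by (auto simp: \<rho>_def)
    qed
  qed (auto simp: \<rho>_def)
  thus ?thesis unfolding perm_inv_def by (rule bij_betw_same_card)
qed

text \<open>Reversing both words conjugates every pairing by the reversal of positions. By this
  symmetry the reversal of words is unitary, and it carries operators at the left end to operators
  at the right end.\<close>

lemma q_inner_rev: "q_inner q (rev v) (rev w) = q_inner q v w"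
proof (cases "length v = length w")
  case True
  define n where "n = length v"
  define \<rho> where "\<rho> = (\<lambda>i. if i < n then n - 1 - i else i)"
  have rr: "\<rho> (\<rho> i) = i" for i by (auto simp: \<rho>_def)
  have bij: "bij_betw \<rho> {..<n} {..<n}"
    by (rule bij_betw_byWitness[where f' = \<rho>]) (auto simp: \<rho>_def)
  have \<rho>: "\<rho> permutes {..<n}" by (rule bij_imp_permutes[OF bij]) (auto simp: \<rho>_def)
  have "q_inner q (rev v) (rev w) = (\<Sum>\<sigma> | \<sigma> permutes {..<n}.
             complex_of_real (q ^ perm_inv n \<sigma>) * (\<Prod>i<n. L2_inner (rev v ! i) (rev w ! \<sigma> i)))"
    using True by (simp add: q_inner_def n_def)
  also have "\<dots> = (\<Sum>\<sigma> | \<sigma> permutes {..<n}.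
             complex_of_real (q ^ perm_inv n \<sigma>) * (\<Prod>i<n. L2_inner (v ! i) (w ! \<sigma> i)))"
  proof (rule sum.reindex_bij_witness[where i = "\<lambda>\<sigma>. \<rho> \<circ> \<sigma> \<circ> \<rho>" and j = "\<lambda>\<sigma>. \<rho> \<circ> \<sigma> \<circ> \<rho>"])
    fix \<sigma> assume "\<sigma> \<in> {\<sigma>. \<sigma> permutes {..<n}}"
    hence s: "\<sigma> permutes {..<n}" by simp
    show "\<rho> \<circ> (\<rho> \<circ> \<sigma> \<circ> \<rho>) \<circ> \<rho> = \<sigma>" by (simp add: rr fun_eq_iff)
    thus "\<rho> \<circ> (\<rho> \<circ> \<sigma> \<circ> \<rho>) \<circ> \<rho> = \<sigma>" .
    show "\<rho> \<circ> \<sigma> \<circ> \<rho> \<in> {\<sigma>. \<sigma> permutes {..<n}}" using permutes_compose[OF \<rho> permutes_compose[OF s \<rho>]]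
      by (simp add: permutes_compose \<rho> s)
    thus "\<rho> \<circ> \<sigma> \<circ> \<rho> \<in> {\<sigma>. \<sigma> permutes {..<n}}" .
    have sl: "\<sigma> i < n" if "i < n" for i using permutes_in_image[OF s, of i] that by simp
    have "(\<Prod>i<n. L2_inner (v ! i) (w ! (\<rho> \<circ> \<sigma> \<circ> \<rho>) i)) = (\<Prod>i<n. L2_inner (v ! \<rho> i) (w ! \<rho> (\<sigma> i)))"
      using prod.reindex_bij_betw[OF bij, of "\<lambda>i. L2_inner (v ! i) (w ! (\<rho> \<circ> \<sigma> \<circ> \<rho>) i)"]
      by (simp add: rr)
    also have "\<dots> = (\<Prod>i<n. L2_inner (rev v ! i) (rev w ! \<sigma> i))"
      using True sl by (intro prod.cong refl) (auto simp: rev_nth \<rho>_def n_def)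
    finally show "complex_of_real (q ^ perm_inv n (\<rho> \<circ> \<sigma> \<circ> \<rho>)) * (\<Prod>i<n. L2_inner (v ! i) (w ! (\<rho> \<circ> \<sigma> \<circ> \<rho>) i))
       = complex_of_real (q ^ perm_inv n \<sigma>) * (\<Prod>i<n. L2_inner (rev v ! i) (rev w ! \<sigma> i))"
      using perm_inv_rev[OF s] by (simp add: \<rho>_def)
  qed
  also have "\<dots> = q_inner q v w" using True by (simp add: q_inner_def n_def)
  finally show ?thesis .
qed (simp add: q_inner_def)

lemma q_inner_cong:
  assumes "length v = length v'" "length w = length w'"
    "\<And>i j. i < length v \<Longrightarrow> j < length w \<Longrightarrow> L2_inner (v ! i) (w ! j) = L2_inner (v' ! i) (w' ! j)"
  shows "q_inner q v w = q_inner q v' w'"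
proof (cases "length v = length w")
  case True
  have "\<sigma> i < length w" if "\<sigma> permutes {..<length w}" "i < length w" for \<sigma> i
    using permutes_in_image[OF that(1), of i] that(2) by simp
  thus ?thesis using assms True unfolding q_inner_def
    by (auto intro!: sum.cong prod.cong arg_cong2[where f = "(*)"])
qed (use assms in \<open>simp add: q_inner_def\<close>)

section \<open>From formal combinations of words to bounded operators; left and right fields\<close>

section \<open>Creation and annihilation operators\<close>

text \<open>Different formal combinations of words may denote the same vector, since tensors are
  multilinear. Operators are therefore first described on lists of coefficients and words, and
  descend to vectors once a norm bound is known (\<open>ext_op\<close>).\<close>

definition lin :: "('w \<Rightarrow> 'f::complex_hilbert) \<Rightarrow> (complex \<times> 'w) list \<Rightarrow> 'f" where
  "lin F xs = (\<Sum>(c, w)\<leftarrow>xs. c *\<^sub>C F w)"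

definition bindc :: "(complex \<times> 'w) list \<Rightarrow> ('w \<Rightarrow> (complex \<times> 'v) list) \<Rightarrow> (complex \<times> 'v) list" where
  "bindc xs K = concat (map (\<lambda>(c, w). map (\<lambda>(d, v). (c * d, v)) (K w)) xs)"

lemma lin_Nil [simp]: "lin F [] = 0"
  and lin_Cons [simp]: "lin F (x # xs) = fst x *\<^sub>C F (snd x) + lin F xs"
  and lin_append [simp]: "lin F (xs @ ys) = lin F xs + lin F ys"
  by (simp_all add: lin_def case_prod_beta)

lemma lin_scale: "lin F (map (\<lambda>(d, v). (c * d, v)) xs) = c *\<^sub>C lin F xs"
  by (induction xs) (auto simp: scaleC_add_right scaleC_scaleC)

lemma lin_map: "lin F (map (\<lambda>(d, v). (d, g v)) xs) = lin (\<lambda>v. F (g v)) xs"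
  by (induction xs) auto

lemma lin_bindc: "lin F (bindc xs K) = lin (\<lambda>w. lin F (K w)) xs"
  by (induction xs) (auto simp: lin_scale bindc_def)

lemma lin_cong: "(\<And>w. w \<in> snd ` set xs \<Longrightarrow> F w = G w) \<Longrightarrow> lin F xs = lin G xs"
  by (induction xs) auto

lemma lin_add: "lin (\<lambda>w. F w + G w) xs = lin F xs + lin G xs"
  by (induction xs) (auto simp: scaleC_add_right)

lemma lin_scaleC: "lin (\<lambda>w. c *\<^sub>C F w) xs = c *\<^sub>C lin F xs"
  by (induction xs) (auto simp: scaleC_add_right scaleC_scaleC mult.commute)

lemma lin_upt: "lin F (map (\<lambda>r. (c r, w r)) [0..<n]) = (\<Sum>r<n. c r *\<^sub>C F (w r))"
  by (induction n) (auto simp: add.commute)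

lemma blinfun_lin: "T \<in> clinear_ops \<Longrightarrow> T (lin F xs) = lin (\<lambda>w. T (F w)) xs"
  by (induction xs) (auto simp: blinfun.add_right clinear_opsD)

definition combos :: "(complex \<times> (real \<Rightarrow> complex) list) list set" where
  "combos = lists (UNIV \<times> lists L2_fun)"

lemma combos_simps [simp]:
  "[] \<in> combos" "(c, w) # xs \<in> combos \<longleftrightarrow> set w \<subseteq> L2_fun \<and> xs \<in> combos"
  "xs @ ys \<in> combos \<longleftrightarrow> xs \<in> combos \<and> ys \<in> combos"
  by (auto simp: combos_def)

lemma combos_iff: "xs \<in> combos \<longleftrightarrow> (\<forall>w\<in>snd ` set xs. set w \<subseteq> L2_fun)"
  by (induction xs) auto

lemma combos_scale [simp]: "map (\<lambda>(d, v). (c * d, v)) xs \<in> combos \<longleftrightarrow> xs \<in> combos"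
  by (force simp: combos_iff)

lemma bindc_combos: "(\<And>w. w \<in> snd ` set xs \<Longrightarrow> K w \<in> combos) \<Longrightarrow> bindc xs K \<in> combos"
  by (induction xs) (auto simp: bindc_def)

text \<open>Bounds the length of the words that occur; the norm estimate for creators and
  annihilators is an induction over this number.\<close>

definition degle :: "nat \<Rightarrow> (complex \<times> 'a list) list \<Rightarrow> bool" where
  "degle n xs \<longleftrightarrow> (\<forall>w\<in>snd ` set xs. length w \<le> n)"

definition prec :: "'a \<Rightarrow> (complex \<times> 'a list) list \<Rightarrow> (complex \<times> 'a list) list" where
  "prec f xs = map (\<lambda>(c, w). (c, f # w)) xs"

definition ann :: "real \<Rightarrow> (real \<Rightarrow> complex) \<Rightarrow> (real \<Rightarrow> complex) list \<Rightarrow> (complex \<times> (real \<Rightarrow> complex) list) list" where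
  "ann q f w = map (\<lambda>r. (of_real (q ^ r) * L2_inner f (w ! r), del r w)) [0..<length w]"

lemma ann_Cons: "ann q f (h # w) = (L2_inner f h, w) # map (\<lambda>(d, v). (of_real q * d, h # v)) (ann q f w)"
  unfolding ann_def length_Cons upt_conv_Cons[OF zero_less_Suc]
  by (simp add: map_Suc_upt[symmetric] comp_def mult.assoc del: upt_Suc)

lemma ann_Nil [simp]: "ann q f [] = []" by (simp add: ann_def)

lemma ann_combos: "set w \<subseteq> L2_fun \<Longrightarrow> ann q f w \<in> combos"
  using set_del by (fastforce simp: ann_def combos_iff)

lemma lin_prec: "lin F (prec f xs) = lin (\<lambda>w. F (f # w)) xs"
  unfolding prec_def by (rule lin_map)

lemma prec_combos: "f \<in> L2_fun \<Longrightarrow> xs \<in> combos \<Longrightarrow> prec f xs \<in> combos"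
  by (induction xs) (auto simp: prec_def)

abbreviation annc :: "real \<Rightarrow> (real \<Rightarrow> complex) \<Rightarrow> (complex \<times> (real \<Rightarrow> complex) list) list \<Rightarrow> (complex \<times> (real \<Rightarrow> complex) list) list" where
  "annc q f xs \<equiv> bindc xs (ann q f)"

lemma annc_combos: "xs \<in> combos \<Longrightarrow> annc q f xs \<in> combos"
  by (intro bindc_combos ann_combos) (auto simp: combos_iff)

lemma degle_annc: "degle (Suc n) xs \<Longrightarrow> degle n (annc q f xs)"
  by (fastforce simp: degle_def bindc_def ann_def length_del)

lemma degle_annc_0: "degle 0 xs \<Longrightarrow> annc q f xs = []"
  by (induction xs) (auto simp: degle_def bindc_def)

lemma of_real_eq_cmod: "complex_of_real a = z \<Longrightarrow> 0 \<le> a \<Longrightarrow> a = cmod z"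
  by auto

locale qfock =
  fixes q :: real and \<Theta> :: "(real \<Rightarrow> complex) list \<Rightarrow> 'f::complex_hilbert"
  assumes q0: "0 \<le> q" and q1: "q < 1" and fock: "q_fock_space q \<Theta>"
begin

lemma cinner_words: "set v \<subseteq> L2_fun \<Longrightarrow> set w \<subseteq> L2_fun \<Longrightarrow> cinner (\<Theta> v) (\<Theta> w) = q_inner q v w"
  using fock by (simp add: q_fock_space_def in_lists_conv_set subset_iff)

lemma dense: "closure (lin \<Theta> ` combos) = UNIV"
proof -
  have "{\<Sum>i<n. c i *\<^sub>C \<Theta> (w i) | (n::nat) c w. \<forall>i<n. w i \<in> lists L2_fun} \<subseteq> lin \<Theta> ` combos"
  proof clarify
    fix n :: nat and c w assume "\<forall>i<n. w i \<in> lists L2_fun"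
    hence "map (\<lambda>i. (c i, w i)) [0..<n] \<in> combos" by (auto simp: combos_iff in_lists_conv_set)
    thus "(\<Sum>i<n. c i *\<^sub>C \<Theta> (w i)) \<in> lin \<Theta> ` combos"
      by (intro image_eqI) (simp_all add: lin_upt)
  qed
  thus ?thesis using fock closure_mono unfolding q_fock_space_def by blast
qed

lemma dense_seq: obtains X where "\<And>n. X n \<in> combos" "(\<lambda>n. lin \<Theta> (X n)) \<longlonglongrightarrow> x"
proof -
  have "x \<in> closure (lin \<Theta> ` combos)" using dense by simp
  then obtain y where y: "\<And>n. y n \<in> lin \<Theta> ` combos" "y \<longlonglongrightarrow> x"
    unfolding closure_sequential by blast
  hence "\<forall>n. \<exists>xs. xs \<in> combos \<and> y n = lin \<Theta> xs" by blast
  then obtain X where "\<And>n. X n \<in> combos \<and> y n = lin \<Theta> (X n)" using choice by metis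
  moreover from this have "y = (\<lambda>n. lin \<Theta> (X n))" by blast
  ultimately show ?thesis using that y(2) by blast
qed

lemma dense_closed_property:
  assumes "closed {x. P x}" "\<And>xs. xs \<in> combos \<Longrightarrow> P (lin \<Theta> xs)" shows "P x"
proof -
  have "closure (lin \<Theta> ` combos) \<subseteq> {x. P x}" using assms by (intro closure_minimal) auto
  thus ?thesis using dense by blast
qed

lemma vec_eqI:
  assumes "\<And>v. set v \<subseteq> L2_fun \<Longrightarrow> cinner (\<Theta> v) x = cinner (\<Theta> v) y"
  shows "x = y"
proof (rule cinner_eqI)
  fix z
  show "cinner z x = cinner z y"
  proof (rule dense_closed_property[where P = "\<lambda>z. cinner z x = cinner z y"])
    show "closed {z. cinner z x = cinner z y}"
      by (intro closed_Collect_eq linear_continuous_on bounded_linear_cinner_left)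
    show "cinner (lin \<Theta> xs) x = cinner (lin \<Theta> xs) y" if "xs \<in> combos" for xs
      using that by (induction xs) (auto simp: cinner_add_left cinner_scaleC_left assms)
  qed
qed

lemma op_eqI:
  assumes "S \<in> clinear_ops" "T \<in> clinear_ops"
    "\<And>w. set w \<subseteq> L2_fun \<Longrightarrow> S (\<Theta> w) = T (\<Theta> w)"
  shows "S = T"
proof (rule blinfun_eqI)
  fix x show "S x = T x"
  proof (rule dense_closed_property[where P = "\<lambda>x. S x = T x"])
    show "closed {x. S x = T x}"
      by (intro closed_Collect_eq linear_continuous_on blinfun.bounded_linear_right)
    show "S (lin \<Theta> xs) = T (lin \<Theta> xs)" if "xs \<in> combos" for xs
      using that by (induction xs) (auto simp: blinfun.add_right clinear_opsD assms)
  qed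
qed

lemma norm_vac: "norm (\<Theta> []) = 1"
proof -
  have "cinner (\<Theta> []) (\<Theta> []) = 1" by (simp add: cinner_words q_inner_Nil)
  hence "(norm (\<Theta> []))\<^sup>2 = 1" by (simp add: norm_sq_Re)
  thus ?thesis using power2_eq_1_iff[of "norm (\<Theta> [])"] norm_ge_zero[of "\<Theta> []"] by linarith
qed

text \<open>Applied to a difference, the bound shows that F respects all linear relations between
  word vectors and sends Cauchy sequences to Cauchy sequences; density of the words does the
  rest.\<close>

lemma ext_op:
  assumes bnd: "\<And>xs. xs \<in> combos \<Longrightarrow> norm (lin F xs :: 'f) \<le> C * norm (lin \<Theta> xs)"
  shows "\<exists>T\<in>clinear_ops. norm T \<le> C \<and> (\<forall>w. set w \<subseteq> L2_fun \<longrightarrow> blinfun_apply T (\<Theta> w) = F w)"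
proof -
  have C0: "0 \<le> C"
  proof -
    \<comment> \<open>The empty word has norm 1, so the bound itself forces C to be
      nonnegative.\<close>
    have "norm (F []) \<le> C * norm (\<Theta> [])" using bnd[of "[(1, [])]"] by simp
    thus ?thesis using norm_ge_zero[of "F []"] unfolding norm_vac by linarith
  qed
  have diff: "norm (lin F xs - lin F ys) \<le> C * norm (lin \<Theta> xs - lin \<Theta> ys)" if "xs \<in> combos" "ys \<in> combos" for xs ys
  proof -
    let ?z = "xs @ map (\<lambda>(d, v). (-1 * d, v)) ys"
    have "lin G ?z = lin G xs - lin G ys" for G :: "_ \<Rightarrow> 'f"
      unfolding lin_append lin_scale by (simp add: scaleC_minus1)
    thus ?thesis using bnd[of ?z] that combos_scale[of "-1" ys] by simp
  qed
  have "\<exists>l. (\<lambda>n. lin F (X n)) \<longlonglongrightarrow> l" if X: "\<And>n. X n \<in> combos" "(\<lambda>n. lin \<Theta> (X n)) \<longlonglongrightarrow> x" for X x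
  proof -
    have "Cauchy (\<lambda>n. lin \<Theta> (X n))" using X(2) by (rule LIMSEQ_imp_Cauchy)
    have "Cauchy (\<lambda>n. lin F (X n))"
    proof (rule CauchyI)
      fix e :: real assume e: "0 < e"
      then obtain M where "\<And>m n. m \<ge> M \<Longrightarrow> n \<ge> M \<Longrightarrow> norm (lin \<Theta> (X m) - lin \<Theta> (X n)) < e / (C + 1)"
        using CauchyD[OF \<open>Cauchy _\<close>, of "e / (C + 1)"] C0 by auto
      hence "norm (lin F (X m) - lin F (X n)) < e" if "m \<ge> M" "n \<ge> M" for m n
      proof -
        have "norm (lin F (X m) - lin F (X n)) \<le> (C + 1) * norm (lin \<Theta> (X m) - lin \<Theta> (X n))"
          using diff[OF X(1) X(1), of m n] by (smt (verit) mult_right_mono norm_ge_zero)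
        also have "\<dots> < (C + 1) * (e / (C + 1))"
          using that C0 \<open>\<And>m n. _ \<Longrightarrow> _ \<Longrightarrow> norm (lin \<Theta> (X m) - lin \<Theta> (X n)) < _\<close>
          by (intro mult_strict_left_mono) auto
        finally show ?thesis using C0 by simp
      qed
      thus "\<exists>M. \<forall>m\<ge>M. \<forall>n\<ge>M. norm (lin F (X m) - lin F (X n)) < e" by blast
    qed
    thus ?thesis using convergent_eq_Cauchy by blast
  qed
  hence ex: "\<exists>X l. (\<forall>n. X n \<in> combos) \<and> (\<lambda>n. lin \<Theta> (X n)) \<longlonglongrightarrow> x \<and> (\<lambda>n. lin F (X n)) \<longlonglongrightarrow> l" for x
    by (metis dense_seq)
  \<comment> \<open>The closure of the graph. Linearity and the bound are proved for the relation,
    and the bound then shows that it is a function.\<close>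
  define R where "R x l \<longleftrightarrow> (\<exists>X. (\<forall>n. X n \<in> combos) \<and> (\<lambda>n. lin \<Theta> (X n)) \<longlonglongrightarrow> x \<and> (\<lambda>n. lin F (X n)) \<longlonglongrightarrow> l)" for x l
  obtain T where T: "\<And>x. R x (T x)" using ex unfolding R_def by metis
  have Rcomb: "R (c *\<^sub>C x + d *\<^sub>C y) (c *\<^sub>C l + d *\<^sub>C k)" if "R x l" "R y k" for c d x y l k
  proof -
    from that obtain X Y where XY: "\<And>n. X n \<in> combos" "(\<lambda>n. lin \<Theta> (X n)) \<longlonglongrightarrow> x" "(\<lambda>n. lin F (X n)) \<longlonglongrightarrow> l"
      "\<And>n. Y n \<in> combos" "(\<lambda>n. lin \<Theta> (Y n)) \<longlonglongrightarrow> y" "(\<lambda>n. lin F (Y n)) \<longlonglongrightarrow> k"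
      unfolding R_def by blast
    have "(\<lambda>n. lin G (map (\<lambda>(e, v). (c * e, v)) (X n) @ map (\<lambda>(e, v). (d * e, v)) (Y n))) \<longlonglongrightarrow> c *\<^sub>C a + d *\<^sub>C b"
      if "(\<lambda>n. lin G (X n)) \<longlonglongrightarrow> a" "(\<lambda>n. lin G (Y n)) \<longlonglongrightarrow> b" for G :: "_ \<Rightarrow> 'f" and a b
      unfolding lin_append lin_scale by (intro tendsto_intros tendsto_scaleC that)
    thus ?thesis unfolding R_def using XY
      by (intro exI[of _ "\<lambda>n. map (\<lambda>(e, v). (c * e, v)) (X n) @ map (\<lambda>(e, v). (d * e, v)) (Y n)"]) simp
  qed
  have Rbnd: "norm l \<le> C * norm x" if "R x l" for x l
  proof -
    from that obtain X where X: "\<And>n. X n \<in> combos" "(\<lambda>n. lin \<Theta> (X n)) \<longlonglongrightarrow> x" "(\<lambda>n. lin F (X n)) \<longlonglongrightarrow> l"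
      unfolding R_def by blast
    show ?thesis
      by (rule LIMSEQ_le[OF tendsto_norm[OF X(3)] tendsto_mult_left[OF tendsto_norm[OF X(2)]]])
        (use bnd X(1) in blast)
  qed
  have Rfun: "l = k" if "R x l" "R x k" for x l k
    using Rbnd[OF Rcomb[OF that, of 1 "-1"]] by (simp add: scaleC_minus1)
  have Teq: "T x = l" if "R x l" for x l using Rfun T that by blast
  have clin: "T (c *\<^sub>C x + d *\<^sub>C y) = c *\<^sub>C T x + d *\<^sub>C T y" for c d x y
    by (rule Teq[OF Rcomb[OF T T]])
  have bl: "bounded_linear T"
    using clin[of 1 _ 1] clin[of _ _ 0] Rbnd[OF T]
    by (intro bounded_linear_intro[where K = C]) (auto simp: scaleR_scaleC mult.commute)
  have app: "blinfun_apply (Blinfun T) = T" using bl by (rule bounded_linear_Blinfun_apply)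
  show ?thesis
  proof (intro bexI conjI allI impI)
    show "Blinfun T \<in> clinear_ops" using clin[of _ _ 0] by (simp add: clinear_ops_def app)
    show "norm (Blinfun T) \<le> C" using Rbnd[OF T] C0 by (intro norm_blinfun_bound) (auto simp: app)
    fix w :: "(real \<Rightarrow> complex) list" assume "set w \<subseteq> L2_fun"
    hence "R (\<Theta> w) (F w)" unfolding R_def by (intro exI[of _ "\<lambda>_. [(1, w)]"]) simp
    thus "blinfun_apply (Blinfun T) (\<Theta> w) = F w" by (simp add: app Teq)
  qed
qed

lemma cinner_prec:
  assumes f: "f \<in> L2_fun" and "xs \<in> combos" "ys \<in> combos"
  shows "cinner (lin \<Theta> (prec f xs)) (lin \<Theta> ys) = cinner (lin \<Theta> xs) (lin \<Theta> (annc q f ys))"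
proof -
  have w: "cinner (\<Theta> (f # v)) (\<Theta> w) = cinner (\<Theta> v) (lin \<Theta> (ann q f w))"
    if "set v \<subseteq> L2_fun" "set w \<subseteq> L2_fun" for v w
  proof -
    have "cinner (\<Theta> v) (\<Theta> (del r w)) = q_inner q v (del r w)" for r
      using that set_del[of r w] by (intro cinner_words) auto
    thus ?thesis using that f
      by (simp add: cinner_words q_inner_Cons ann_def lin_upt cinner_sum_right cinner_scaleC_right)
  qed
  have "cinner (\<Theta> (f # v)) (lin \<Theta> ys) = cinner (\<Theta> v) (lin \<Theta> (annc q f ys))" if "set v \<subseteq> L2_fun" for v
    using assms(3) unfolding lin_bindc
    by (induction ys) (auto simp: cinner_add_right cinner_scaleC_right w that)
  thus ?thesis using assms(2)
    by (induction xs) (auto simp: prec_def cinner_add_left cinner_scaleC_left)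
qed

text \<open>The q-commutation relation between annihilation by f and creation by h, at the level of
  formal combinations: the bounds that let the operators exist are derived from it.\<close>

lemma annc_prec:
  "lin F (annc q f (prec h xs)) = L2_inner f h *\<^sub>C lin F xs + of_real q *\<^sub>C lin F (prec h (annc q f xs))"
proof -
  have "lin F (ann q f (h # w)) = L2_inner f h *\<^sub>C F w + of_real q *\<^sub>C lin (\<lambda>w. F (h # w)) (ann q f w)" for w
  proof -
    have "map (\<lambda>(d, v). (of_real q * d, h # v)) (ann q f w)
       = map (\<lambda>(d, v). (of_real q * d, v)) (map (\<lambda>(d, v). (d, h # v)) (ann q f w))" by auto
    thus ?thesis by (simp only: ann_Cons lin_Cons lin_scale lin_map fst_conv snd_conv)
  qed
  thus ?thesis unfolding lin_bindc lin_prec by (simp add: lin_add lin_scaleC)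
qed

text \<open>
  Boundedness of creation operators, for a whole orthogonal family at once. The norms \<open>c n\<close> of the
  row of creation operators on words of length \<open>\<le> n\<close> satisfy \<open>c\<^sub>n\<^sup>2 \<le> \<epsilon> + q c\<^sub>n\<^sub>-\<^sub>1\<^sup>2\<close> by the
  commutation relation and Cauchy-Schwarz, with the column of annihilators as the adjoint of the row.
\<close>

lemma row_column_bound:
  fixes N :: nat
  assumes u: "\<And>i. i < N \<Longrightarrow> u i \<in> L2_fun"
    and orth: "\<And>i j. i < N \<Longrightarrow> j < N \<Longrightarrow> i \<noteq> j \<Longrightarrow> L2_inner (u i) (u j) = 0"
    and eps: "\<And>i. i < N \<Longrightarrow> cmod (L2_inner (u i) (u i)) \<le> \<epsilon>" and e0: "0 \<le> \<epsilon>"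
  defines "\<kappa> \<equiv> \<epsilon> / (1 - q)"
  shows "\<And>xs. degle n xs \<Longrightarrow> xs \<in> combos \<Longrightarrow>
            (\<Sum>i<N. (norm (lin \<Theta> (annc q (u i) xs)))\<^sup>2) \<le> \<kappa> * (norm (lin \<Theta> xs))\<^sup>2"
    and "\<And>X. (\<And>i. i < N \<Longrightarrow> degle n (X i) \<and> X i \<in> combos) \<Longrightarrow>
            (norm (\<Sum>i<N. lin \<Theta> (prec (u i) (X i))))\<^sup>2 \<le> \<kappa> * (\<Sum>i<N. (norm (lin \<Theta> (X i)))\<^sup>2)"
proof -
  let ?Q = "\<lambda>xs. (\<Sum>i<N. (norm (lin \<Theta> (annc q (u i) xs)))\<^sup>2) \<le> \<kappa> * (norm (lin \<Theta> xs))\<^sup>2"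
  let ?P = "\<lambda>X. (norm (\<Sum>i<N. lin \<Theta> (prec (u i) (X i))))\<^sup>2 \<le> \<kappa> * (\<Sum>i<N. (norm (lin \<Theta> (X i)))\<^sup>2)"
  have k0: "0 \<le> \<kappa>" using e0 q1 by (simp add: \<kappa>_def)
  \<comment> \<open>\<kappa> is the fixed point of x = \<epsilon> + q x, so the bound reproduces
    itself from one degree to the next.\<close>
  have ke: "\<epsilon> + q * \<kappa> = \<kappa>" using q1 by (simp add: \<kappa>_def field_simps)
  have QP: "?P X" if Q: "\<And>xs. degle n xs \<Longrightarrow> xs \<in> combos \<Longrightarrow> ?Q xs"
    and X: "\<And>i. i < N \<Longrightarrow> degle n (X i) \<and> X i \<in> combos" for n X
  proof -
    define x where "x i = lin \<Theta> (X i)" for i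
    define A where "A j i = lin \<Theta> (annc q (u j) (X i))" for i j
    have c: "cinner (lin \<Theta> (prec (u i) (X i))) (lin \<Theta> (prec (u j) (X j)))
        = L2_inner (u i) (u j) * cinner (x i) (x j) + of_real q * cinner (A j i) (A i j)"
      if ij: "i < N" "j < N" for i j
    proof -
      have "cinner (lin \<Theta> (prec (u i) (X i))) (lin \<Theta> (prec (u j) (X j)))
          = cinner (x i) (lin \<Theta> (annc q (u i) (prec (u j) (X j))))"
        unfolding x_def using X u ij by (intro cinner_prec prec_combos) auto
      also have "\<dots> = L2_inner (u i) (u j) * cinner (x i) (x j)
          + of_real q * cinner (x i) (lin \<Theta> (prec (u j) (annc q (u i) (X j))))"
        unfolding annc_prec by (simp add: cinner_add_right cinner_scaleC_right x_def)
      also have "cinner (x i) (lin \<Theta> (prec (u j) (annc q (u i) (X j))))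
          = cnj (cinner (lin \<Theta> (prec (u j) (annc q (u i) (X j)))) (x i))"
        by (rule cinner_commute)
      also have "cinner (lin \<Theta> (prec (u j) (annc q (u i) (X j)))) (x i) = cinner (A i j) (A j i)"
        unfolding x_def A_def using X u ij by (intro cinner_prec annc_combos) auto
      finally show ?thesis by (simp add: cinner_commute[of "A j i"])
    qed
    have "complex_of_real ((norm (\<Sum>i<N. lin \<Theta> (prec (u i) (X i))))\<^sup>2)
       = (\<Sum>i<N. \<Sum>j<N. L2_inner (u i) (u j) * cinner (x i) (x j) + of_real q * cinner (A j i) (A i j))"
      unfolding cinner_self[symmetric] cinner_sum_left cinner_sum_right
      by (subst sum.swap, intro sum.cong refl c) auto
    also have "\<dots> = (\<Sum>i<N. L2_inner (u i) (u i) * cinner (x i) (x i)) + of_real q * (\<Sum>i<N. \<Sum>j<N. cinner (A j i) (A i j))"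
    proof -
      have "(\<Sum>j<N. L2_inner (u i) (u j) * cinner (x i) (x j)) = L2_inner (u i) (u i) * cinner (x i) (x i)" if "i < N" for i
        using that orth by (subst sum.remove[of _ i]) (auto intro!: sum.neutral)
      thus ?thesis by (simp add: sum.distrib sum_distrib_left)
    qed
    finally have eq: "(norm (\<Sum>i<N. lin \<Theta> (prec (u i) (X i))))\<^sup>2 = cmod (\<dots>)"
      by (rule of_real_eq_cmod) simp
    have "cmod (\<Sum>i<N. L2_inner (u i) (u i) * cinner (x i) (x i)) \<le> (\<Sum>i<N. \<epsilon> * (norm (x i))\<^sup>2)"
      using eps by (intro sum_norm_le) (auto simp: norm_mult cinner_self norm_power intro!: mult_right_mono)
    \<comment> \<open>The two factors are the same double family with exchanged indices, so after
      Cauchy-Schwarz and the inequality of means both halves have the same sum.\<close>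
    moreover have "cmod (\<Sum>i<N. \<Sum>j<N. cinner (A j i) (A i j)) \<le> (\<Sum>i<N. \<Sum>j<N. (norm (A j i))\<^sup>2)"
    proof -
      have "cmod (\<Sum>i<N. \<Sum>j<N. cinner (A j i) (A i j)) \<le> (\<Sum>i<N. \<Sum>j<N. ((norm (A j i))\<^sup>2 + (norm (A i j))\<^sup>2) / 2)"
      proof (intro sum_norm_le)
        fix i j
        have "cmod (cinner (A j i) (A i j)) \<le> norm (A j i) * norm (A i j)" by (rule cmod_cinner_le)
        also have "\<dots> \<le> ((norm (A j i))\<^sup>2 + (norm (A i j))\<^sup>2) / 2"
          using sum_squares_bound[of "norm (A j i)" "norm (A i j)"] by simp
        finally show "cmod (cinner (A j i) (A i j)) \<le> ((norm (A j i))\<^sup>2 + (norm (A i j))\<^sup>2) / 2" .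
      qed
      also have "\<dots> = ((\<Sum>i<N. \<Sum>j<N. (norm (A j i))\<^sup>2) + (\<Sum>i<N. \<Sum>j<N. (norm (A i j))\<^sup>2)) / 2"
        by (simp add: sum.distrib sum_divide_distrib add_divide_distrib)
      also have "(\<Sum>i<N. \<Sum>j<N. (norm (A i j))\<^sup>2) = (\<Sum>i<N. \<Sum>j<N. (norm (A j i))\<^sup>2)" by (rule sum.swap)
      finally show ?thesis by simp
    qed
    moreover have "(\<Sum>i<N. \<Sum>j<N. (norm (A j i))\<^sup>2) \<le> (\<Sum>i<N. \<kappa> * (norm (x i))\<^sup>2)"
      unfolding A_def x_def using X by (intro sum_mono Q) auto
    ultimately have "cmod ((\<Sum>i<N. L2_inner (u i) (u i) * cinner (x i) (x i)) + of_real q * (\<Sum>i<N. \<Sum>j<N. cinner (A j i) (A i j)))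
       \<le> (\<Sum>i<N. \<epsilon> * (norm (x i))\<^sup>2) + q * (\<Sum>i<N. \<kappa> * (norm (x i))\<^sup>2)"
      using q0 by (intro order_trans[OF norm_triangle_ineq] add_mono) (auto simp: norm_mult intro!: mult_left_mono)
    also have "\<dots> = (\<epsilon> + q * \<kappa>) * (\<Sum>i<N. (norm (x i))\<^sup>2)"
      by (simp add: sum_distrib_left sum_distrib_right ring_distribs mult_ac sum.distrib)
    finally show ?thesis unfolding eq ke by (simp add: x_def)
  qed
  have PQ: "?Q xs" if P: "\<And>X. (\<And>i. i < N \<Longrightarrow> degle n (X i) \<and> X i \<in> combos) \<Longrightarrow> ?P X"
    and xs: "degle (Suc n) xs" "xs \<in> combos" for n xs
  proof -
    define A where "A i = annc q (u i) xs" for i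
    have A: "degle n (A i)" "A i \<in> combos" for i using xs by (auto simp: A_def degle_annc annc_combos)
    define S where "S = (\<Sum>i<N. (norm (lin \<Theta> (A i)))\<^sup>2)"
    have S0: "0 \<le> S" by (simp add: S_def sum_nonneg)
    have "complex_of_real S = (\<Sum>i<N. cinner (lin \<Theta> (A i)) (lin \<Theta> (A i)))" by (simp add: S_def cinner_self)
    also have "\<dots> = cinner (\<Sum>i<N. lin \<Theta> (prec (u i) (A i))) (lin \<Theta> xs)"
      using u A xs by (simp add: cinner_sum_left cinner_prec flip: A_def)
    finally have "S = cmod (cinner (\<Sum>i<N. lin \<Theta> (prec (u i) (A i))) (lin \<Theta> xs))"
      by (rule of_real_eq_cmod[OF _ S0])
    also have "\<dots> \<le> norm (\<Sum>i<N. lin \<Theta> (prec (u i) (A i))) * norm (lin \<Theta> xs)" by (rule cmod_cinner_le)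
    \<comment> \<open>The row bound will replace the first factor by \<kappa> S; then one S cancels,
      unless it is 0.\<close>
    finally have "S\<^sup>2 \<le> (norm (\<Sum>i<N. lin \<Theta> (prec (u i) (A i))))\<^sup>2 * (norm (lin \<Theta> xs))\<^sup>2"
      using power_mono[OF _ S0, of _ 2] by (fastforce simp: power_mult_distrib)
    also have "\<dots> \<le> \<kappa> * S * (norm (lin \<Theta> xs))\<^sup>2"
      using P[of A] A by (intro mult_right_mono) (auto simp: S_def)
    finally have "S * S \<le> S * (\<kappa> * (norm (lin \<Theta> xs))\<^sup>2)" by (simp add: power2_eq_square mult_ac)
    hence "S \<le> \<kappa> * (norm (lin \<Theta> xs))\<^sup>2"
      using S0 k0 by (cases "S = 0") (auto simp: mult_le_cancel_left)
    thus ?thesis by (simp add: S_def A_def)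
  qed
  \<comment> \<open>Columns in degree n give rows in degree n, and rows in degree n give columns in
    degree n + 1 by duality.\<close>
  have Q: "?Q xs" if "degle n xs" "xs \<in> combos" for n xs
    using that
  proof (induction n arbitrary: xs)
    case 0
    thus ?case using k0 by (simp add: degle_annc_0)
  next
    case (Suc n)
    show ?case by (rule PQ[OF QP[OF Suc.IH] Suc.prems]) auto
  qed
  show "\<And>xs. degle n xs \<Longrightarrow> xs \<in> combos \<Longrightarrow> ?Q xs" by (rule Q)
  show "?P X" if "\<And>i. i < N \<Longrightarrow> degle n (X i) \<and> X i \<in> combos" for X
    by (rule QP[OF Q that])
qed

end

lemma L2_fun_Re: "f \<in> L2_fun \<Longrightarrow> (\<lambda>x. complex_of_real (Re (f x))) \<in> L2_fun"
  and L2_fun_Im: "f \<in> L2_fun \<Longrightarrow> (\<lambda>x. complex_of_real (Im (f x))) \<in> L2_fun"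
proof -
  assume f: "f \<in> L2_fun"
  note [measurable] = L2_fun_measurable[OF f]
  have le: "(Re z)\<^sup>2 \<le> (cmod z)\<^sup>2" "(Im z)\<^sup>2 \<le> (cmod z)\<^sup>2" for z
    by (simp_all add: cmod_power2)
  show "(\<lambda>x. complex_of_real (Re (f x))) \<in> L2_fun"
    unfolding L2_fun_def
    by (auto intro!: Bochner_Integration.integrable_bound[OF L2_fun_integrable[OF f]] AE_I2 simp: le)
  show "(\<lambda>x. complex_of_real (Im (f x))) \<in> L2_fun"
    unfolding L2_fun_def
    by (auto intro!: Bochner_Integration.integrable_bound[OF L2_fun_integrable[OF f]] AE_I2 simp: le)
qed

lemma clinear_ops_uminus [simp]: "T \<in> clinear_ops \<Longrightarrow> - T \<in> clinear_ops"
  using clinear_ops_simps(7)[of T "-1"] by simp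

lemma adj_diff: "S \<in> clinear_ops \<Longrightarrow> T \<in> clinear_ops \<Longrightarrow> adj (S - T) = adj S - adj T"
  using adj_add[of S "- T"] adj_scaleR[of T "-1"] by simp

context qfock
begin

abbreviation cr :: "(real \<Rightarrow> complex) \<Rightarrow> 'f op" where "cr \<equiv> creation \<Theta>"
abbreviation an :: "(real \<Rightarrow> complex) \<Rightarrow> 'f op" where "an \<equiv> annihilation \<Theta>"
abbreviation \<Omega> :: 'f where "\<Omega> \<equiv> \<Theta> []"

text \<open>A choice among the operators with prescribed values on words; density leaves only one
  candidate as soon as F satisfies a norm bound.\<close>

definition word_op :: "((real \<Rightarrow> complex) list \<Rightarrow> 'f) \<Rightarrow> 'f op" where
  "word_op F = (SOME T. T \<in> clinear_ops \<and> (\<forall>w. set w \<subseteq> L2_fun \<longrightarrow> T (\<Theta> w) = F w))"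

lemma word_op:
  assumes "\<And>xs. xs \<in> combos \<Longrightarrow> norm (lin F xs) \<le> C * norm (lin \<Theta> xs)"
  shows "word_op F \<in> clinear_ops" "set w \<subseteq> L2_fun \<Longrightarrow> (word_op F) (\<Theta> w) = F w" "norm (word_op F) \<le> C"
proof -
  obtain T where T: "T \<in> clinear_ops" "norm T \<le> C" "\<And>w. set w \<subseteq> L2_fun \<Longrightarrow> T (\<Theta> w) = F w"
    using ext_op[OF assms] by blast
  have "\<exists>T. T \<in> clinear_ops \<and> (\<forall>w. set w \<subseteq> L2_fun \<longrightarrow> T (\<Theta> w) = F w)"
    using T(1,3) by blast
  from someI_ex[OF this, folded word_op_def]
  have *: "word_op F \<in> clinear_ops" "\<And>w. set w \<subseteq> L2_fun \<Longrightarrow> (word_op F) (\<Theta> w) = F w" by blast+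
  hence "word_op F = T" using T by (intro op_eqI) simp_all
  with * T(2) show "word_op F \<in> clinear_ops" "norm (word_op F) \<le> C"
    "set w \<subseteq> L2_fun \<Longrightarrow> (word_op F) (\<Theta> w) = F w" by simp_all
qed

lemma L2_inner_self: "f \<in> L2_fun \<Longrightarrow> L2_inner f f = of_real ((norm (\<Theta> [f]))\<^sup>2)"
  using cinner_self[of "\<Theta> [f]"] by (simp add: cinner_words q_inner_Cons q_inner_Nil)

text \<open>The L2 norm of f, read off from the one-letter word, on which the q-inner product is the
  ordinary one.\<close>

definition l2 :: "(real \<Rightarrow> complex) \<Rightarrow> real" where "l2 f = norm (\<Theta> [f])"

lemma l2_sq: "f \<in> L2_fun \<Longrightarrow> L2_inner f f = of_real ((l2 f)\<^sup>2)"
  by (simp add: l2_def L2_inner_self)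

lemma l2_nonneg [simp]: "0 \<le> l2 f" by (simp add: l2_def)

lemma l2_ivl: "0 \<le> u \<Longrightarrow> u \<le> v \<Longrightarrow> l2 (ivl u v) = sqrt (v - u)"
  using l2_sq[of "ivl u v"] L2_inner_ivl[of u v]
  by (metis L2_fun_indicator interval_lmeasurable(1) l2_nonneg of_real_eq_iff real_sqrt_unique)

lemma degle_ex: "\<exists>n. degle n xs"
proof (induction xs)
  case (Cons x xs)
  then obtain n where "degle n xs" by blast
  thus ?case by (intro exI[of _ "max n (length (snd x))"]) (auto simp: degle_def)
qed (auto simp: degle_def)

text \<open>The row estimate for a family with a single member.\<close>

lemma cr_bound_word:
  assumes "f \<in> L2_fun" "xs \<in> combos"
  shows "norm (lin (\<lambda>w. \<Theta> (f # w)) xs) \<le> l2 f / sqrt (1 - q) * norm (lin \<Theta> xs)"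
proof -
  obtain n where "degle n xs" using degle_ex by blast
  hence "(norm (\<Sum>i<1::nat. lin \<Theta> (prec f xs)))\<^sup>2 \<le> (l2 f)\<^sup>2 / (1 - q) * (\<Sum>i<1::nat. (norm (lin \<Theta> xs))\<^sup>2)"
    using assms by (intro row_column_bound(2)[where u = "\<lambda>_. f" and X = "\<lambda>_. xs" and n = n and N = 1])
      (auto simp: l2_sq norm_power)
  hence "(norm (lin (\<lambda>w. \<Theta> (f # w)) xs))\<^sup>2 \<le> (l2 f / sqrt (1 - q) * norm (lin \<Theta> xs))\<^sup>2"
    using q1 by (simp add: lin_prec power_mult_distrib power_divide)
  thus ?thesis by (rule power2_le_imp_le) (use q1 in \<open>simp add: l2_def\<close>)
qed

lemma cr_eq: "f \<in> L2_fun \<Longrightarrow> cr f = word_op (\<lambda>w. \<Theta> (f # w))"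
  unfolding creation_def
  by (rule the_equality; (intro conjI op_eqI)?)
    (auto simp: word_op[OF cr_bound_word] in_lists_conv_set subset_iff)

lemma cr_clinear [simp]: "f \<in> L2_fun \<Longrightarrow> cr f \<in> clinear_ops"
  and cr_word: "f \<in> L2_fun \<Longrightarrow> set w \<subseteq> L2_fun \<Longrightarrow> cr f (\<Theta> w) = \<Theta> (f # w)"
  and norm_cr: "f \<in> L2_fun \<Longrightarrow> norm (cr f) \<le> l2 f / sqrt (1 - q)"
  by (simp_all add: cr_eq word_op[OF cr_bound_word])

lemma an_clinear [simp]: "f \<in> L2_fun \<Longrightarrow> an f \<in> clinear_ops"
  by (simp add: annihilation_def)

lemma cinner_an: "f \<in> L2_fun \<Longrightarrow> cinner x (an f y) = cinner (cr f x) y"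
  by (simp add: annihilation_def cinner_adj')

lemma adj_an [simp]: "f \<in> L2_fun \<Longrightarrow> adj (an f) = cr f"
  and adj_cr [simp]: "f \<in> L2_fun \<Longrightarrow> adj (cr f) = an f"
  by (simp_all add: annihilation_def)

lemma norm_an: "f \<in> L2_fun \<Longrightarrow> norm (an f) \<le> l2 f / sqrt (1 - q)"
  using norm_cr[of f] norm_adj[of "cr f"] by simp

lemma an_word:
  assumes "f \<in> L2_fun" "set w \<subseteq> L2_fun"
  shows "an f (\<Theta> w) = lin \<Theta> (ann q f w)"
proof (rule vec_eqI)
  fix v :: "(real \<Rightarrow> complex) list" assume v: "set v \<subseteq> L2_fun"
  show "cinner (\<Theta> v) (an f (\<Theta> w)) = cinner (\<Theta> v) (lin \<Theta> (ann q f w))"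
    using cinner_prec[OF assms(1), of "[(1, v)]" "[(1, w)]"] assms v
    by (simp add: cinner_an cr_word prec_def bindc_def)
qed

lemma an_vac [simp]: "f \<in> L2_fun \<Longrightarrow> an f \<Omega> = 0"
  by (simp add: an_word)

lemma an_cr_apply:
  assumes "f \<in> L2_fun" "h \<in> L2_fun"
  shows "an f (cr h x)
     = L2_inner f h *\<^sub>C x + q *\<^sub>R cr h (an f x)"
proof -
  have "an f o\<^sub>L cr h = op_scaleC (L2_inner f h) id_blinfun + q *\<^sub>R (cr h o\<^sub>L an f)"
  proof (rule op_eqI)
    fix w :: "(real \<Rightarrow> complex) list" assume w: "set w \<subseteq> L2_fun"
    have "lin \<Theta> (map (\<lambda>(d, v). (of_real q * d, h # v)) (ann q f w))
       = lin \<Theta> (map (\<lambda>(d, v). (of_real q * d, v)) (map (\<lambda>(d, v). (d, h # v)) (ann q f w)))"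
      by (intro arg_cong[where f = "lin \<Theta>"]) auto
    also have "\<dots> = of_real q *\<^sub>C cr h (lin \<Theta> (ann q f w))"
      unfolding lin_scale lin_map blinfun_lin[OF cr_clinear[OF assms(2)]]
      using ann_combos[OF w, of q f] assms(2)
      by (intro arg_cong[where f = "(*\<^sub>C) _"] lin_cong, subst cr_word) (auto simp: combos_iff)
    finally show "(an f o\<^sub>L cr h) (\<Theta> w)
       = (op_scaleC (L2_inner f h) id_blinfun + q *\<^sub>R (cr h o\<^sub>L an f)) (\<Theta> w)"
      using assms w by (simp add: cr_word an_word ann_Cons blinfun.add_left blinfun.scaleR_left scaleR_scaleC)
  qed (use assms in auto)
  hence "(an f o\<^sub>L cr h) x = (op_scaleC (L2_inner f h) id_blinfun + q *\<^sub>R (cr h o\<^sub>L an f)) x"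
    by simp
  thus ?thesis by (simp add: blinfun.add_left blinfun.scaleR_left)
qed

lemma column_bound:
  fixes N :: nat
  assumes u: "\<And>i. i < N \<Longrightarrow> u i \<in> L2_fun"
    and orth: "\<And>i j. i < N \<Longrightarrow> j < N \<Longrightarrow> i \<noteq> j \<Longrightarrow> L2_inner (u i) (u j) = 0"
    and eps: "\<And>i. i < N \<Longrightarrow> (l2 (u i))\<^sup>2 \<le> \<epsilon>" and e0: "0 \<le> \<epsilon>"
  shows "(\<Sum>i<N. (norm (an (u i) x))\<^sup>2) \<le> \<epsilon> / (1 - q) * (norm x)\<^sup>2"
proof (rule dense_closed_property[where P = "\<lambda>x. (\<Sum>i<N. (norm (an (u i) x))\<^sup>2) \<le> \<epsilon> / (1 - q) * (norm x)\<^sup>2"])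
  show "closed {x. (\<Sum>i<N. (norm (an (u i) x))\<^sup>2) \<le> \<epsilon> / (1 - q) * (norm x)\<^sup>2}"
    by (intro closed_Collect_le continuous_intros linear_continuous_on blinfun.bounded_linear_right)
  fix xs assume xs: "xs \<in> combos"
  obtain n where n: "degle n xs" using degle_ex by blast
  have "an (u i) (lin \<Theta> xs) = lin \<Theta> (annc q (u i) xs)" if "i < N" for i
    using u[OF that] xs unfolding lin_bindc
    by (subst blinfun_lin) (auto intro!: lin_cong an_word simp: combos_iff)
  thus "(\<Sum>i<N. (norm (an (u i) (lin \<Theta> xs)))\<^sup>2) \<le> \<epsilon> / (1 - q) * (norm (lin \<Theta> xs))\<^sup>2"
    using row_column_bound(1)[where u = u and N = N and \<epsilon> = \<epsilon>, OF u orth _ e0 n xs] eps u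
    by (simp add: l2_sq norm_power)
qed

text \<open>A row of operators has the norm of the column of its adjoints: pair the sum z with
  itself, move the operators to the other side, use Cauchy-Schwarz and cancel the square of the norm
  of z.\<close>

lemma row_bound:
  assumes "\<And>x. (\<Sum>i<N::nat. (norm (adj (T i) x))\<^sup>2) \<le> k * (norm x)\<^sup>2"
    and T: "\<And>i. i < N \<Longrightarrow> T i \<in> clinear_ops" and k: "0 \<le> k"
  shows "(norm (\<Sum>i<N. (T i) (x i)))\<^sup>2 \<le> k * (\<Sum>i<N. (norm (x i :: 'f))\<^sup>2)"
proof -
  define z where "z = (\<Sum>i<N. (T i) (x i))"
  have "complex_of_real ((norm z)\<^sup>2) = (\<Sum>i<N. cinner (adj (T i) z) (x i))"
    unfolding cinner_self[symmetric] by (subst (2) z_def) (simp add: cinner_sum_right cinner_adj T)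
  hence "(norm z)\<^sup>2 = cmod (\<Sum>i<N. cinner (adj (T i) z) (x i))"
    by (rule of_real_eq_cmod) simp
  also have "\<dots> \<le> (\<Sum>i<N. norm (adj (T i) z) * norm (x i))"
    by (intro sum_norm_le cmod_cinner_le)
  finally have "((norm z)\<^sup>2)\<^sup>2 \<le> (\<Sum>i<N. norm (adj (T i) z) * norm (x i))\<^sup>2"
    by (intro power_mono) auto
  also have "\<dots> \<le> (\<Sum>i<N. (norm (adj (T i) z))\<^sup>2) * (\<Sum>i<N. (norm (x i))\<^sup>2)"
    by (rule Cauchy_Schwarz_ineq_sum)
  also have "\<dots> \<le> k * (norm z)\<^sup>2 * (\<Sum>i<N. (norm (x i))\<^sup>2)"
    by (intro mult_right_mono assms) (simp add: sum_nonneg)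
  finally have "(norm z)\<^sup>2 * (norm z)\<^sup>2 \<le> (norm z)\<^sup>2 * (k * (\<Sum>i<N. (norm (x i))\<^sup>2))"
    by (simp add: power2_eq_square mult_ac)
  hence "(norm z)\<^sup>2 \<le> k * (\<Sum>i<N. (norm (x i))\<^sup>2)"
    using k mult_left_le_imp_le[of "(norm z)\<^sup>2" "(norm z)\<^sup>2"]
    by (cases "z = 0") (simp_all add: sum_nonneg del: power2_eq_square)
  thus ?thesis by (simp add: z_def)
qed

lemma vec_eqI2:
  assumes "\<And>v. set v \<subseteq> L2_fun \<Longrightarrow> cinner x (\<Theta> v) = cinner y (\<Theta> v)" shows "x = y"
  using assms cinner_commute[of _ x] cinner_commute[of _ y] by (intro vec_eqI) simp

text \<open>At the first letter this is read off from the inner products with all words; creation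
  operators, being linear, carry it behind any prefix.\<close>

lemma word_linear:
  assumes "set v \<subseteq> L2_fun" "set w \<subseteq> L2_fun" "f \<in> L2_fun" "g \<in> L2_fun"
  shows "\<Theta> (v @ (\<lambda>x. f x + g x) # w) = \<Theta> (v @ f # w) + \<Theta> (v @ g # w)"
    and "\<Theta> (v @ (\<lambda>x. c * f x) # w) = c *\<^sub>C \<Theta> (v @ f # w)"
proof -
  have "\<Theta> ((\<lambda>x. f x + g x) # w) = \<Theta> (f # w) + \<Theta> (g # w)"
  proof (rule vec_eqI2)
    fix u :: "(real \<Rightarrow> complex) list" assume u: "set u \<subseteq> L2_fun"
    thus "cinner (\<Theta> ((\<lambda>x. f x + g x) # w)) (\<Theta> u) = cinner (\<Theta> (f # w) + \<Theta> (g # w)) (\<Theta> u)"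
      using assms by (simp add: cinner_words q_inner_Cons L2_inner_add_left nth_mem subset_iff
          ring_distribs sum.distrib cinner_add_left)
  qed
  thus "\<Theta> (v @ (\<lambda>x. f x + g x) # w) = \<Theta> (v @ f # w) + \<Theta> (v @ g # w)"
    using assms(1)
  proof (induction v)
    case (Cons a v)
    thus ?case using assms by (simp flip: cr_word add: blinfun.add_right)
  qed simp
  have "\<Theta> ((\<lambda>x. c * f x) # w) = c *\<^sub>C \<Theta> (f # w)"
  proof (rule vec_eqI2)
    fix u :: "(real \<Rightarrow> complex) list" assume u: "set u \<subseteq> L2_fun"
    show "cinner (\<Theta> ((\<lambda>x. c * f x) # w)) (\<Theta> u) = cinner (c *\<^sub>C \<Theta> (f # w)) (\<Theta> u)"
      using assms u by (simp add: cinner_words q_inner_Cons L2_inner_scale_left cinner_scaleC_left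
          sum_distrib_left mult_ac)
  qed
  thus "\<Theta> (v @ (\<lambda>x. c * f x) # w) = c *\<^sub>C \<Theta> (v @ f # w)"
    using assms(1)
  proof (induction v)
    case (Cons a v)
    thus ?case using assms by (simp flip: cr_word add: clinear_opsD)
  qed simp
qed

lemma cr_add: "f \<in> L2_fun \<Longrightarrow> g \<in> L2_fun \<Longrightarrow> cr (\<lambda>x. f x + g x) = cr f + cr g"
  using word_linear(1)[of "[]"] by (intro op_eqI) (auto simp: cr_word blinfun.add_left)

lemma cr_scale: "f \<in> L2_fun \<Longrightarrow> cr (\<lambda>x. c * f x) = op_scaleC c (cr f)"
  using word_linear(2)[of "[]"] by (intro op_eqI) (auto simp: cr_word)

lemma an_add: "f \<in> L2_fun \<Longrightarrow> g \<in> L2_fun \<Longrightarrow> an (\<lambda>x. f x + g x) = an f + an g"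
  unfolding annihilation_def by (simp add: cr_add adj_add del: adj_cr)

text \<open>Linearity of V is not part of the notion: preservation of inner products already fixes
  the q-inner products of the transformed words, and these determine the second
  quantisation.\<close>

definition isom :: "((real \<Rightarrow> complex) \<Rightarrow> (real \<Rightarrow> complex)) \<Rightarrow> bool" where
  "isom V \<longleftrightarrow> (\<forall>f\<in>L2_fun. V f \<in> L2_fun \<and> (\<forall>g\<in>L2_fun. L2_inner (V f) (V g) = L2_inner f g))"

lemma isomD: "isom V \<Longrightarrow> f \<in> L2_fun \<Longrightarrow> V f \<in> L2_fun"
  "isom V \<Longrightarrow> f \<in> L2_fun \<Longrightarrow> g \<in> L2_fun \<Longrightarrow> L2_inner (V f) (V g) = L2_inner f g"
  by (auto simp: isom_def)

lemma isom_map: "isom V \<Longrightarrow> set w \<subseteq> L2_fun \<Longrightarrow> set (map V w) \<subseteq> L2_fun"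
  by (auto dest: isomD)

lemma norm_lin_eq:
  assumes "\<And>v w. set v \<subseteq> L2_fun \<Longrightarrow> set w \<subseteq> L2_fun \<Longrightarrow> cinner (F v) (F w) = cinner (\<Theta> v) (\<Theta> w)" "xs \<in> combos"
  shows "norm (lin F xs :: 'f) = norm (lin \<Theta> xs)"
proof -
  have 1: "cinner (F v) (lin F ys) = cinner (\<Theta> v) (lin \<Theta> ys)" if "set v \<subseteq> L2_fun" "ys \<in> combos" for v ys
    using that by (induction ys) (auto simp: cinner_add_right cinner_scaleC_right assms)
  have "cinner (lin F ys) (lin F zs) = cinner (lin \<Theta> ys) (lin \<Theta> zs)" if "ys \<in> combos" "zs \<in> combos" for ys zs
    using that by (induction ys) (auto simp: cinner_add_left cinner_scaleC_left 1)
  thus ?thesis using assms(2) norm_sq_Re by (metis norm_ge_zero power2_eq_imp_eq)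
qed

definition Gam :: "((real \<Rightarrow> complex) \<Rightarrow> (real \<Rightarrow> complex)) \<Rightarrow> 'f op" where
  "Gam V = word_op (\<lambda>w. \<Theta> (map V w))"

lemma Gam_bound: "isom V \<Longrightarrow> xs \<in> combos \<Longrightarrow> norm (lin (\<lambda>w. \<Theta> (map V w)) xs) \<le> 1 * norm (lin \<Theta> xs)"
proof -
  assume V: "isom V" and xs: "xs \<in> combos"
  have "q_inner q (map V v) (map V w) = q_inner q v w" if "set v \<subseteq> L2_fun" "set w \<subseteq> L2_fun" for v w
    using that isomD[OF V] by (intro q_inner_cong) (auto simp: subset_iff)
  hence "norm (lin (\<lambda>w. \<Theta> (map V w)) xs) = norm (lin \<Theta> xs)"
    using isom_map[OF V] by (intro norm_lin_eq xs) (simp add: cinner_words)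
  thus ?thesis by simp
qed

lemma Gam_clinear [simp]: "isom V \<Longrightarrow> Gam V \<in> clinear_ops"
  and Gam_word: "isom V \<Longrightarrow> set w \<subseteq> L2_fun \<Longrightarrow> Gam V (\<Theta> w) = \<Theta> (map V w)"
  and norm_Gam: "isom V \<Longrightarrow> norm (Gam V) \<le> 1"
  by (simp_all add: Gam_def word_op[OF Gam_bound])

text \<open>Reversal of words exchanges the action at the left end with an action at the right end,
  which will furnish operators of the commutant.\<close>

definition Rv :: "'f op" where "Rv = word_op (\<lambda>w. \<Theta> (rev w))"

lemma Rv_bound: "xs \<in> combos \<Longrightarrow> norm (lin (\<lambda>w. \<Theta> (rev w)) xs) \<le> 1 * norm (lin \<Theta> xs)"
  using norm_lin_eq[of "\<lambda>w. \<Theta> (rev w)" xs] by (simp add: cinner_words q_inner_rev)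

lemma Rv_clinear [simp]: "Rv \<in> clinear_ops"
  and Rv_word: "set w \<subseteq> L2_fun \<Longrightarrow> Rv (\<Theta> w) = \<Theta> (rev w)"
  by (simp_all add: Rv_def word_op[OF Rv_bound])

lemma Rv_Rv: "Rv (Rv x) = x"
proof -
  have "Rv o\<^sub>L Rv = id_blinfun" by (rule op_eqI) (auto simp: Rv_word)
  thus ?thesis by (metis blinfun_apply_blinfun_compose id_blinfun.rep_eq)
qed

lemma adj_Rv: "adj Rv = Rv"
proof (rule op_eqI)
  fix w :: "(real \<Rightarrow> complex) list" assume w: "set w \<subseteq> L2_fun"
  show "adj Rv (\<Theta> w) = Rv (\<Theta> w)"
    using w q_inner_rev[of q _ "rev w"] by (intro vec_eqI) (simp add: cinner_adj' Rv_word cinner_words)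
qed auto

definition rcr :: "(real \<Rightarrow> complex) \<Rightarrow> 'f op" where "rcr f = Rv o\<^sub>L cr f o\<^sub>L Rv"
definition rann :: "(real \<Rightarrow> complex) \<Rightarrow> 'f op" where "rann f = Rv o\<^sub>L an f o\<^sub>L Rv"

lemma rcr_clinear [simp]: "f \<in> L2_fun \<Longrightarrow> rcr f \<in> clinear_ops"
  and rann_clinear [simp]: "f \<in> L2_fun \<Longrightarrow> rann f \<in> clinear_ops"
  by (simp_all add: rcr_def rann_def)

lemma adj_rcr: "f \<in> L2_fun \<Longrightarrow> adj (rcr f) = rann f"
  by (simp add: rcr_def rann_def adj_comp adj_Rv op_eq_iff)

lemma adj_rann: "f \<in> L2_fun \<Longrightarrow> adj (rann f) = rcr f"
  by (metis adj_adj adj_rcr rcr_clinear)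

lemma rcr_word: "f \<in> L2_fun \<Longrightarrow> set w \<subseteq> L2_fun \<Longrightarrow> rcr f (\<Theta> w) = \<Theta> (w @ [f])"
  by (simp add: rcr_def Rv_word cr_word)

lemma rann_vac [simp]: "f \<in> L2_fun \<Longrightarrow> rann f \<Omega> = 0"
  by (simp add: rann_def Rv_word blinfun.zero_right)

lemma rann_rcr_apply:
  "f \<in> L2_fun \<Longrightarrow> h \<in> L2_fun \<Longrightarrow> rann f (rcr h x)
     = L2_inner f h *\<^sub>C x + q *\<^sub>R rcr h (rann f x)"
  by (simp add: rann_def rcr_def Rv_Rv an_cr_apply blinfun.add_right blinfun.scaleR_right clinear_opsD)

lemma cr_rcr_commute:
  assumes "f \<in> L2_fun" "h \<in> L2_fun" shows "cr f o\<^sub>L rcr h = rcr h o\<^sub>L cr f"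
  using assms by (intro op_eqI) (auto simp: cr_word rcr_word)

lemma an_rann_commute:
  assumes "f \<in> L2_fun" "h \<in> L2_fun" shows "an f o\<^sub>L rann h = rann h o\<^sub>L an f"
  using arg_cong[OF cr_rcr_commute[OF assms], of adj] assms
  by (simp add: adj_comp adj_rcr)

text \<open>A left annihilator reaches the appended letter only after all letters of the word, which
  costs q to the power of the length; the rest of its action does not see that letter.\<close>

lemma an_rcr_word:
  assumes "f \<in> L2_fun" "h \<in> L2_fun" "set w \<subseteq> L2_fun"
  shows "an f (rcr h (\<Theta> w))
     = rcr h (an f (\<Theta> w)) + (of_real (q ^ length w) * L2_inner f h) *\<^sub>C \<Theta> w"
  using assms(3)
proof (induction w)
  case Nil
  thus ?case using assms by (simp add: rcr_word an_word ann_Cons ann_Nil blinfun.zero_right)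
next
  case (Cons a w)
  have [simp]: "rcr h (cr a x) = cr a (rcr h x)" for x
    using arg_cong[OF cr_rcr_commute, of a h "\<lambda>T. blinfun_apply T x"] Cons.prems assms by simp
  have "an f (rcr h (cr a (\<Theta> w)))
     = L2_inner f a *\<^sub>C rcr h (\<Theta> w) + q *\<^sub>R (cr a)
        (rcr h (an f (\<Theta> w)) + (of_real (q ^ length w) * L2_inner f h) *\<^sub>C \<Theta> w)"
    using Cons assms by (simp add: an_cr_apply)
  also have "\<dots> = rcr h (an f (cr a (\<Theta> w)))
       + (of_real (q ^ length (a # w)) * L2_inner f h) *\<^sub>C cr a (\<Theta> w)"
    using Cons assms by (simp add: an_cr_apply blinfun.add_right blinfun.scaleR_right clinear_opsD
        scaleR_add_right scaleR_scaleC scaleC_scaleC scaleC_add_right mult_ac)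
  moreover have "\<Theta> (a # w) = cr a (\<Theta> w)" using Cons.prems by (simp add: cr_word)
  ultimately show ?case by simp
qed

lemma an_rcr_commute:
  assumes "f \<in> L2_fun" "h \<in> L2_fun" "L2_inner f h = 0"
  shows "an f o\<^sub>L rcr h = rcr h o\<^sub>L an f"
  using assms by (intro op_eqI) (auto simp: an_rcr_word)

lemma rann_cr_commute:
  assumes "f \<in> L2_fun" "h \<in> L2_fun" "L2_inner f h = 0"
  shows "rann h o\<^sub>L cr f = cr f o\<^sub>L rann h"
  using arg_cong[OF an_rcr_commute[OF assms], of adj] assms by (simp add: adj_comp adj_rcr)

definition Xop :: "(real \<Rightarrow> complex) \<Rightarrow> 'f op" where "Xop f = an f + cr f"
definition Yop :: "(real \<Rightarrow> complex) \<Rightarrow> 'f op" where "Yop f = rann f + rcr f"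

definition real_fun :: "(real \<Rightarrow> complex) \<Rightarrow> bool" where "real_fun f \<longleftrightarrow> (\<forall>x. f x \<in> \<real>)"

lemma Xop_clinear [simp]: "f \<in> L2_fun \<Longrightarrow> Xop f \<in> clinear_ops"
  and Yop_clinear [simp]: "f \<in> L2_fun \<Longrightarrow> Yop f \<in> clinear_ops"
  and adj_Xop: "f \<in> L2_fun \<Longrightarrow> adj (Xop f) = Xop f"
  by (simp_all add: Xop_def Yop_def adj_add add.commute)

text \<open>Creators commute with right creators and annihilators with right annihilators. The
  commutator D of \<open>an f\<close> and \<open>rcr h\<close> is the real number \<langle>f,
  h\<rangle> times q to the number of letters, hence self-adjoint, while its adjoint is the negative
  of the commutator of \<open>cr f\<close> and \<open>rann h\<close>. So the two mixed commutators
  cancel.\<close>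

lemma Xop_Yop_commute:
  assumes f: "f \<in> L2_fun" "real_fun f" and h: "h \<in> L2_fun" "real_fun h"
  shows "Xop f o\<^sub>L Yop h = Yop h o\<^sub>L Xop f"
proof -
  define D where "D = (an f o\<^sub>L rcr h) - (rcr h o\<^sub>L an f)"
  have Dc: "D \<in> clinear_ops" using assms by (simp add: D_def)
  have Dw: "D (\<Theta> w) = (of_real (q ^ length w) * L2_inner f h) *\<^sub>C \<Theta> w" if "set w \<subseteq> L2_fun" for w
    using that assms by (simp add: D_def blinfun.diff_left an_rcr_word)
  have real: "cnj (L2_inner f h) = L2_inner f h"
    using L2_inner_real[of f h] assms by (simp add: real_fun_def Reals_cnj_iff)
  have "adj D = D"
  proof (rule op_eqI)
    fix w :: "(real \<Rightarrow> complex) list" assume w: "set w \<subseteq> L2_fun"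
    show "adj D (\<Theta> w) = D (\<Theta> w)"
    proof (rule vec_eqI)
      fix v :: "(real \<Rightarrow> complex) list" assume v: "set v \<subseteq> L2_fun"
      show "cinner (\<Theta> v) (adj D (\<Theta> w)) = cinner (\<Theta> v) (D (\<Theta> w))"
        using v w by (cases "length v = length w")
          (simp_all add: cinner_adj' Dc Dw cinner_scaleC_left cinner_scaleC_right cinner_words real q_inner_def)
    qed
  qed (use Dc in auto)
  moreover have "adj D = (rann h o\<^sub>L cr f) - (cr f o\<^sub>L rann h)"
    using assms by (simp add: D_def adj_diff adj_comp adj_rcr)
  ultimately have "(an f o\<^sub>L rcr h) - (rcr h o\<^sub>L an f) = (rann h o\<^sub>L cr f) - (cr f o\<^sub>L rann h)" by (simp add: D_def)
  moreover note an_rann_commute[OF f(1) h(1)] cr_rcr_commute[OF f(1) h(1)]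
  ultimately show ?thesis
    by (simp add: Xop_def Yop_def bounded_bilinear.add_left[OF bounded_bilinear_blinfun_compose]
        bounded_bilinear.add_right[OF bounded_bilinear_blinfun_compose] algebra_simps)
qed

text \<open>The vacuum is cyclic for the right Gaussian operators, hence separating for their commutant.\<close>

lemma vacuum_separating:
  assumes T: "T \<in> clinear_ops" and comm: "\<And>h. h \<in> L2_fun \<Longrightarrow> real_fun h \<Longrightarrow> T o\<^sub>L Yop h = Yop h o\<^sub>L T"
    and vac: "T \<Omega> = 0"
  shows "T = 0"
proof -
  have real: "T (\<Theta> w) = 0" if "set w \<subseteq> L2_fun" "\<forall>f\<in>set w. real_fun f" for w
    using that
  proof (induction "length w" arbitrary: w rule: less_induct)
    case (less w)
    show ?case
    proof (cases w rule: rev_cases)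
      case (snoc v h)
      have h: "h \<in> L2_fun" "real_fun h" "set v \<subseteq> L2_fun" using less.prems snoc by auto
      have "Rv (\<Theta> (del r (rev v))) = \<Theta> (rev (del r (rev v)))" for r
        using h set_del[of r "rev v"] by (intro Rv_word) auto
      hence "rann h (\<Theta> v) = (\<Sum>r<length v. (of_real (q ^ r) * L2_inner h (rev v ! r)) *\<^sub>C \<Theta> (rev (del r (rev v))))"
        using h by (simp add: rann_def Rv_word an_word ann_def lin_upt blinfun.sum_right clinear_opsD)
      moreover have "T (\<Theta> (rev (del r (rev v)))) = 0" if "r < length v" for r
        using that less.prems snoc set_del[of r "rev v"] by (intro less.hyps) (auto simp: length_del)
      \<comment> \<open>The annihilation part of the right field produces only shorter words, on
        which T vanishes by induction.\<close>
      ultimately have 1: "T (rann h (\<Theta> v)) = 0"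
        by (simp add: blinfun.sum_right clinear_opsD[OF T])
      have "T (\<Theta> v) = 0" using less.prems snoc by (intro less.hyps) auto
      hence "(T o\<^sub>L Yop h) (\<Theta> v) = 0" by (simp add: comm[OF h(1,2)] blinfun.zero_right)
      thus ?thesis using 1 h snoc by (simp add: Yop_def blinfun.add_left blinfun.add_right rcr_word)
    qed (use vac in simp)
  qed
  \<comment> \<open>Letters are made real one at a time, from the right end of v, by splitting into
    real and imaginary part; w collects the finished ones.\<close>
  have gen: "T (\<Theta> (v @ w)) = 0" if "set v \<subseteq> L2_fun" "set w \<subseteq> L2_fun" "\<forall>f\<in>set w. real_fun f" for v w
    using that
  proof (induction v arbitrary: w rule: rev_induct)
    case (snoc f v)
    let ?r = "\<lambda>x. complex_of_real (Re (f x))" and ?i = "\<lambda>x. complex_of_real (Im (f x))"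
    have f: "f \<in> L2_fun" "?r \<in> L2_fun" "?i \<in> L2_fun" using snoc.prems by (auto intro: L2_fun_Re L2_fun_Im)
    have "\<Theta> ((v @ [f]) @ w) = \<Theta> (v @ (\<lambda>x. ?r x + \<i> * ?i x) # w)" by (simp add: complex_eq[symmetric])
    also have "\<dots> = \<Theta> (v @ ?r # w) + \<i> *\<^sub>C \<Theta> (v @ ?i # w)"
      using f snoc.prems by (simp add: word_linear)
    finally show ?case
      using snoc.IH[of "?r # w"] snoc.IH[of "?i # w"] snoc.prems f
      by (simp add: blinfun.add_right clinear_opsD[OF T] real_fun_def)
  qed (use real in simp)
  show ?thesis using gen[of _ "[]"] by (intro op_eqI T) auto
qed

end

section \<open>A representation of words in which the lines joining future components bear
  names\<close>

section \<open>Labelled words\<close>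

text \<open>
  A letter \<open>(A, f, e)\<close> stands for a past component \<open>f\<close>, carrying a set \<open>A\<close> of tags, plus a future
  component \<open>e\<close>. A line between past components with tags \<open>A\<close> and \<open>B\<close> gets the weight \<open>q\<close> for each
  tag in the symmetric difference.
\<close>

type_synonym letter = "nat set \<times> (real \<Rightarrow> complex) \<times> (real \<Rightarrow> complex)"

definition sdiff :: "nat set \<Rightarrow> nat set \<Rightarrow> nat set" where
  "sdiff A B = (A - B) \<union> (B - A)"

definition ipK :: "real \<Rightarrow> letter \<Rightarrow> letter \<Rightarrow> complex" where
  "ipK q x y = of_real (q ^ card (sdiff (fst x) (fst y))) * L2_inner (fst (snd x)) (fst (snd y))"

definition ipE :: "letter \<Rightarrow> letter \<Rightarrow> complex" where
  "ipE x y = L2_inner (snd (snd x)) (snd (snd y))"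

definition tag :: "nat \<Rightarrow> letter \<Rightarrow> letter" where
  "tag m x = (insert m (fst x), snd x)"

text \<open>An annihilator of a named letter pays q for each named letter that it passes. The factor
  is stored in the future component, because that component appears only when the letter is
  named.\<close>

definition tau :: "real \<Rightarrow> letter \<Rightarrow> letter" where
  "tau q x = (fst x, fst (snd x), \<lambda>t. of_real q * snd (snd x) t)"

text \<open>Names are the numbers below N, and those in \<open>L\<close> are still to be given away,
  so no letter may already be tagged by them.\<close>

definition lok :: "nat \<Rightarrow> nat set \<Rightarrow> letter list \<Rightarrow> bool" where
  "lok N L w \<longleftrightarrow> (\<forall>x\<in>set w. fst x \<subseteq> {..<N} \<and> fst x \<inter> L = {} \<and> fst (snd x) \<in> L2_fun \<and> snd (snd x) \<in> L2_fun)"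

text \<open>The part of the q-form of words in which exactly \<open>k\<close> lines join future components.\<close>

primrec gform :: "real \<Rightarrow> letter list \<Rightarrow> nat \<Rightarrow> letter list \<Rightarrow> complex" where
  "gform q [] k w' = (if k = 0 \<and> w' = [] then 1 else 0)"
| "gform q (x # w) k w' = (\<Sum>r<length w'. of_real (q ^ r) *
     (ipK q x (w' ! r) * gform q w k (del r w')
      + (if k = 0 then 0 else ipE x (w' ! r) * gform q w (k - 1) (del r w'))))"

lemma prod_list_del: "r < length cs \<Longrightarrow> cs ! r * prod_list (del r cs) = prod_list (cs :: complex list)"
  by (subst (3) id_take_nth_drop) (auto simp: del_def mult_ac)

text \<open>Each pairing uses every letter of the second word exactly once, so factors attached to
  these letters come out as a product.\<close>

lemma gform_scale:
  assumes "length w1 = length w" "length v = length u" "length cs = length u"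
    "\<And>i j. i < length w \<Longrightarrow> j < length u \<Longrightarrow> ipK q (w ! i) (v ! j) = cs ! j * ipK q (w1 ! i) (u ! j)
      \<and> ipE (w ! i) (v ! j) = cs ! j * ipE (w1 ! i) (u ! j)"
  shows "gform q w k v = prod_list cs * gform q w1 k u"
  using assms
proof (induction w arbitrary: w1 k v u cs)
  case Nil
  thus ?case by (cases "u = []") auto
next
  case (Cons x w)
  obtain x1 w2 where w1: "w1 = x1 # w2" using Cons.prems(1) by (cases w1) auto
  have IH: "gform q w k' (del r v) = prod_list (del r cs) * gform q w2 k' (del r u)" if r: "r < length u" for r k'
  proof (rule Cons.IH)
    fix i j assume ij: "i < length w" "j < length (del r u)"
    hence j: "j < length u - 1" using r by (simp add: length_del)
    let ?j = "if j < r then j else Suc j"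
    have "?j < length u" using j r by auto
    thus "ipK q (w ! i) (del r v ! j) = del r cs ! j * ipK q (w2 ! i) (del r u ! j)
      \<and> ipE (w ! i) (del r v ! j) = del r cs ! j * ipE (w2 ! i) (del r u ! j)"
      using Cons.prems(4)[of "Suc i" ?j] Cons.prems(2,3) ij j r by (simp add: nth_del w1)
  qed (use Cons.prems r w1 in \<open>auto simp: length_del\<close>)
  have hd: "ipK q x (v ! r) = cs ! r * ipK q x1 (u ! r) \<and> ipE x (v ! r) = cs ! r * ipE x1 (u ! r)" if "r < length u" for r
    using Cons.prems(4)[of 0 r] that by (simp add: w1)
  have "gform q (x # w) k v = (\<Sum>r<length u. prod_list cs * (of_real (q ^ r) *
     (ipK q x1 (u ! r) * gform q w2 k (del r u)
      + (if k = 0 then 0 else ipE x1 (u ! r) * gform q w2 (k - 1) (del r u)))))"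
    unfolding gform.simps Cons.prems(2)
  proof (intro sum.cong refl)
    fix r assume "r \<in> {..<length u}"
    hence r: "r < length u" by simp
    have c: "cs ! r * prod_list (del r cs) = prod_list cs" using r Cons.prems(3) by (simp add: prod_list_del)
    thus "of_real (q ^ r) * (ipK q x (v ! r) * gform q w k (del r v)
      + (if k = 0 then 0 else ipE x (v ! r) * gform q w (k - 1) (del r v)))
      = prod_list cs * (of_real (q ^ r) * (ipK q x1 (u ! r) * gform q w2 k (del r u)
      + (if k = 0 then 0 else ipE x1 (u ! r) * gform q w2 (k - 1) (del r u))))"
      using hd[OF r] by (simp add: IH[OF r] ring_distribs flip: c)
  qed
  thus ?case by (simp add: w1 sum_distrib_left)
qed

lemma gform_cong:
  assumes "length w1 = length w" "length v = length u"
    "\<And>i j. i < length w \<Longrightarrow> j < length u \<Longrightarrow> ipK q (w ! i) (v ! j) = ipK q (w1 ! i) (u ! j)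
      \<and> ipE (w ! i) (v ! j) = ipE (w1 ! i) (u ! j)"
  shows "gform q w k v = gform q w1 k u"
  using gform_scale[of w1 w v u "replicate (length u) 1" q k] assms by simp

text \<open>Each line of a pairing joins either the past or the future components of its two ends;
  expanding the product sorts the pairings by the number of future lines.\<close>

lemma q_inner_gform:
  assumes "\<And>x y. x \<in> set w \<Longrightarrow> y \<in> set w' \<Longrightarrow> L2_inner (emb x) (emb y) = ipK q x y + ipE x y"
    and "length w \<le> n"
  shows "q_inner q (map emb w) (map emb w') = (\<Sum>k\<le>n. gform q w k w')"
  using assms
proof (induction w arbitrary: w' n)
  case Nil
  show ?case by (cases "w' = []") (simp_all add: q_inner_Nil)
next
  case (Cons x w)
  then obtain n' where n: "n = Suc n'" "length w \<le> n'" by (cases n) auto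
  have le: "length w \<le> n" "length w \<le> n'" using n by auto
  have IH: "q_inner q (map emb w) (map emb (del r w')) = (\<Sum>k\<le>N. gform q w k (del r w'))" if "length w \<le> N" for r N
    using Cons.prems(1) set_del[of r w'] that by (intro Cons.IH) auto
  have "(\<Sum>k\<le>n. gform q (x # w) k w') = (\<Sum>r<length w'. \<Sum>k\<le>n. of_real (q ^ r) *
     (ipK q x (w' ! r) * gform q w k (del r w')
      + (if k = 0 then 0 else ipE x (w' ! r) * gform q w (k - 1) (del r w'))))"
    unfolding gform.simps by (rule sum.swap)
  also have "\<dots> = (\<Sum>r<length w'. of_real (q ^ r) * (ipK q x (w' ! r) * (\<Sum>k\<le>n. gform q w k (del r w'))
      + ipE x (w' ! r) * (\<Sum>k\<le>n'. gform q w k (del r w'))))"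
  proof (intro sum.cong refl)
    fix r
    have "(\<Sum>k\<le>n. if k = 0 then 0 else ipE x (w' ! r) * gform q w (k - 1) (del r w'))
       = ipE x (w' ! r) * (\<Sum>k\<le>n'. gform q w k (del r w'))"
      unfolding n(1) sum.atMost_Suc_shift by (simp add: sum_distrib_left)
    thus "(\<Sum>k\<le>n. of_real (q ^ r) * (ipK q x (w' ! r) * gform q w k (del r w')
      + (if k = 0 then 0 else ipE x (w' ! r) * gform q w (k - 1) (del r w'))))
      = of_real (q ^ r) * (ipK q x (w' ! r) * (\<Sum>k\<le>n. gform q w k (del r w'))
      + ipE x (w' ! r) * (\<Sum>k\<le>n'. gform q w k (del r w')))"
      by (simp add: sum_distrib_left[symmetric] sum.distrib)
  qed
  also have "\<dots> = (\<Sum>r<length w'. of_real (q ^ r) * L2_inner (emb x) (emb (w' ! r)) * q_inner q (map emb w) (map emb (del r w')))"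
    using Cons.prems(1) by (intro sum.cong refl)
      (simp add: IH[OF le(1), symmetric] IH[OF le(2), symmetric] ring_distribs)
  finally show ?case by (simp add: q_inner_Cons del_map)
qed

abbreviation "S0 \<equiv> spread 0 0"
abbreviation "S1 \<equiv> spread 0 1"

text \<open>Realises the weight q for each tag in the symmetric difference by actual functions: for
  each possible tag, its presence and its absence are encoded by two isometries whose mixed inner
  products carry a factor q.\<close>

primrec bitE :: "real \<Rightarrow> nat \<Rightarrow> nat set \<Rightarrow> (real \<Rightarrow> complex) \<Rightarrow> real \<Rightarrow> complex" where
  "bitE q 0 A f = f"
| "bitE q (Suc n) A f = (if n \<in> A
     then (\<lambda>t. of_real q * S0 (bitE q n A f) t + of_real (sqrt (1 - q\<^sup>2)) * S1 (bitE q n A f) t)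
     else S0 (bitE q n A f))"

text \<open>Past components live in the range of \<open>S0\<close>. Future components live in the
  range of \<open>S1\<close>, where each name m has its own orthogonal copy.\<close>

definition iK :: "real \<Rightarrow> nat \<Rightarrow> letter \<Rightarrow> real \<Rightarrow> complex" where
  "iK q N x = S0 (bitE q N (fst x) (fst (snd x)))"

definition iE :: "nat \<Rightarrow> letter \<Rightarrow> real \<Rightarrow> complex" where
  "iE m x = S1 ((S1 ^^ m) (S0 (snd (snd x))))"

lemma bitE_L2: "f \<in> L2_fun \<Longrightarrow> bitE q n A f \<in> L2_fun"
  by (induction n) auto

text \<open>If exactly one of the two sets contains n, only the \<open>S0\<close> parts meet and
  give q; if both contain it, q^2 + (1 - q^2) = 1.\<close>

lemma L2_inner_bitE:
  assumes q: "0 \<le> q" "q < 1" and f: "f \<in> L2_fun" "g \<in> L2_fun"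
  shows "L2_inner (bitE q n A f) (bitE q n B g) = of_real (q ^ card (sdiff A B \<inter> {..<n})) * L2_inner f g"
proof (induction n)
  case (Suc n)
  have c: "sqrt (1 - q\<^sup>2) * sqrt (1 - q\<^sup>2) = 1 - q\<^sup>2" using q by (simp add: power_le_one)
  have cc: "complex_of_real (sqrt (1 - q\<^sup>2)) * complex_of_real (sqrt (1 - q\<^sup>2)) = 1 - of_real q * of_real q"
    unfolding of_real_mult[symmetric] c by (simp add: power2_eq_square)
  have b: "bitE q n A f \<in> L2_fun" "bitE q n B g \<in> L2_fun" using f by (auto intro: bitE_L2)
  have "card (sdiff A B \<inter> {..<Suc n}) = card (sdiff A B \<inter> {..<n}) + (if n \<in> sdiff A B then 1 else 0)"
    by (auto simp: lessThan_Suc Int_insert_right)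
  moreover have "L2_inner (bitE q (Suc n) A f) (bitE q (Suc n) B g)
     = (if n \<in> sdiff A B then of_real q else 1) * L2_inner (bitE q n A f) (bitE q n B g)"
    using b cc by (auto simp: sdiff_def L2_inner_add_left L2_inner_add_right L2_inner_scale_left L2_inner_scale_right
        L2_inner_spread L2_inner_spread_orth ring_distribs mult.assoc[symmetric])
  ultimately show ?case using Suc by simp
qed simp

lemma S1_pow_L2: "f \<in> L2_fun \<Longrightarrow> (S1 ^^ m) f \<in> L2_fun"
  by (induction m) auto

lemma iK_L2: "fst (snd x) \<in> L2_fun \<Longrightarrow> iK q N x \<in> L2_fun"
  by (simp add: iK_def bitE_L2)

lemma iE_L2: "snd (snd x) \<in> L2_fun \<Longrightarrow> iE m x \<in> L2_fun"
  by (simp add: iE_def S1_pow_L2)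

lemma L2_inner_iK:
  assumes "0 \<le> q" "q < 1" "fst (snd x) \<in> L2_fun" "fst (snd y) \<in> L2_fun" "fst x \<subseteq> {..<N}" "fst y \<subseteq> {..<N}"
  shows "L2_inner (iK q N x) (iK q N y) = ipK q x y"
proof -
  have "sdiff (fst x) (fst y) \<inter> {..<N} = sdiff (fst x) (fst y)" using assms by (auto simp: sdiff_def)
  thus ?thesis using assms by (simp add: iK_def ipK_def L2_inner_spread L2_inner_bitE bitE_L2)
qed

lemma L2_inner_iE:
  assumes "snd (snd x) \<in> L2_fun" "snd (snd y) \<in> L2_fun"
  shows "L2_inner (iE m x) (iE k y) = (if m = k then ipE x y else 0)"
proof -
  have "L2_inner ((S1 ^^ m) (S0 f)) ((S1 ^^ k) (S0 g)) = (if m = k then L2_inner f g else 0)"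
    if "f \<in> L2_fun" "g \<in> L2_fun" for f g
  proof (induction m arbitrary: k)
    case 0
    show ?case using that by (cases k) (auto simp: L2_inner_spread L2_inner_spread_orth S1_pow_L2)
  next
    case (Suc m)
    thus ?case using that by (cases k) (auto simp: L2_inner_spread L2_inner_spread_orth S1_pow_L2)
  qed
  thus ?thesis using assms by (simp add: iE_def ipE_def L2_inner_spread S1_pow_L2)
qed

lemma L2_inner_iE_iK: "L2_inner (iE m x) (iK q N y) = 0"
  by (simp add: iE_def iK_def L2_inner_spread_orth)

lemma iE_tau: "iE m (tau q x) = (\<lambda>t. of_real q * iE m x t)"
proof -
  have "(S1 ^^ m) (\<lambda>t. c * f t) = (\<lambda>t. c * (S1 ^^ m) f t)" for c f
    by (induction m) (auto simp: spread_scale)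
  thus ?thesis by (simp add: iE_def tau_def spread_scale)
qed

lemma letter_simps [simp]:
  "iK q N (tau q' x) = iK q N x" "tag m (tau q' x) = tau q' (tag m x)" "ipE x (tag m y) = ipE x y"
  "ipE (tag m x) y = ipE x y" "iE k (tag m x) = iE k x" "tag m (tag k x) = tag k (tag m x)"
  by (simp_all add: iK_def tau_def tag_def ipE_def iE_def insert_commute)

lemma ipK_tag:
  assumes "m \<notin> fst x" "m \<notin> fst y" "finite (fst x)" "finite (fst y)"
  shows "ipK q (tag m x) y = of_real q * ipK q x y" "ipK q x (tag m y) = of_real q * ipK q x y"
    "ipK q (tag m x) (tag m y) = ipK q x y"
proof -
  have "sdiff (insert m (fst x)) (fst y) = insert m (sdiff (fst x) (fst y))"
    "sdiff (fst x) (insert m (fst y)) = insert m (sdiff (fst x) (fst y))"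
    "sdiff (insert m (fst x)) (insert m (fst y)) = sdiff (fst x) (fst y)"
    "m \<notin> sdiff (fst x) (fst y)" "finite (sdiff (fst x) (fst y))"
    using assms by (auto simp: sdiff_def)
  thus "ipK q (tag m x) y = of_real q * ipK q x y" "ipK q x (tag m y) = of_real q * ipK q x y"
    "ipK q (tag m x) (tag m y) = ipK q x y" by (simp_all add: ipK_def tag_def)
qed

lemma ip_tau: "ipK q x (tau q' y) = ipK q x y" "ipE x (tau q' y) = of_real q' * ipE x y"
  by (simp_all add: ipK_def ipE_def tau_def L2_inner_scale_right)

lemma lok_simps: "lok N L (x # w) \<longleftrightarrow> lok N L [x] \<and> lok N L w" "lok N L []"
  "lok N L (v @ w) \<longleftrightarrow> lok N L v \<and> lok N L w"
  by (auto simp: lok_def)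

lemma lok_tag: "lok N L w \<Longrightarrow> m \<in> L \<Longrightarrow> m < N \<Longrightarrow> lok N (L - {m}) (map (tag m) w)"
  by (auto simp: lok_def tag_def)

lemma lok_tau: "lok N L w \<Longrightarrow> lok N L (map (tau q) w)"
  by (auto simp: lok_def tau_def)

lemma lok_mono: "lok N L w \<Longrightarrow> set v \<subseteq> set w \<Longrightarrow> L' \<subseteq> L \<Longrightarrow> lok N L' v"
  by (force simp: lok_def)

text \<open>What is left after the letter at position r has been contracted under the name m:
  letters in front were passed and receive \<open>tau\<close>, letters behind remember by the tag
  that they stood behind this line.\<close>

definition avw :: "real \<Rightarrow> nat \<Rightarrow> nat \<Rightarrow> letter list \<Rightarrow> letter list" where
  "avw q m r w = map (tau q) (take r w) @ map (tag m) (drop (Suc r) w)"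

lemma avw_simps: "avw q m 0 (x # w) = map (tag m) w" "avw q m (Suc r) (x # w) = tau q x # avw q m r w"
  by (simp_all add: avw_def)

lemma avw_tag: "avw q m r (map (tag k) w) = map (tag k) (avw q m r w)"
  by (simp add: avw_def take_map drop_map)

context qfock
begin

text \<open>The names in \<open>L\<close> are distributed over the letters. A named letter goes to
  the left end with its future component, in order; an unnamed one goes to the right end with its
  past component, in reverse order. In a pairing of two such words named and unnamed lines no longer
  cross, so the factors q of their original crossings must be restored. An unnamed letter receives
  the tag m exactly if it stood behind the letter named m; the two ends of its line disagree about m
  exactly if the line crossed the line named m. This is why the symmetric difference of tags is
  weighted.\<close>

function labJ :: "nat \<Rightarrow> nat set \<Rightarrow> letter list \<Rightarrow> 'f" where
  "labJ N L [] = (if L = {} then \<Omega> else 0)"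
| "labJ N L (x # w) = rcr (iK q N x) (labJ N L w)
     + (\<Sum>m\<in>L. (cr (iE m x)) (labJ N (L - {m}) (map (tag m) w)))"
  by pat_completeness auto
termination by (relation "Wellfounded.measure (\<lambda>(N, L, w). length w)") auto

text \<open>Right annihilation of a past component commutes with the named letters, since the two
  kinds are orthogonal. The factor q for a letter in front arises either way: from the commutation
  relation if that letter is unnamed, from a mismatch of tags if it is named.\<close>

lemma rann_labJ:
  assumes "finite L" "L \<subseteq> {..<N}" "lok N L w" "lok N L [x]"
  shows "rann (iK q N x) (labJ N L w) = (\<Sum>r<length w. (of_real (q ^ r) * ipK q x (w ! r)) *\<^sub>C labJ N L (del r w))"
  using assms
proof (induction N L w rule: labJ.induct)
  case (1 N L)
  thus ?case by (auto simp: lok_def iK_L2 blinfun.zero_right)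
next
  case (2 N L y w)
  have x: "fst (snd x) \<in> L2_fun" "fst x \<subseteq> {..<N}" "fst x \<inter> L = {}" and y: "fst (snd y) \<in> L2_fun" "snd (snd y) \<in> L2_fun" "fst y \<subseteq> {..<N}"
    and w: "lok N L w" using 2(3-) by (auto simp: lok_def)
  have IH1: "rann (iK q N x) (labJ N L w) = (\<Sum>r<length w. (of_real (q ^ r) * ipK q x (w ! r)) *\<^sub>C labJ N L (del r w))"
    using 2(1)[OF 2(3,4) w 2(6)] .
  have IH2: "rann (iK q N x) (labJ N (L - {m}) (map (tag m) w))
     = (\<Sum>r<length w. (of_real (q ^ Suc r) * ipK q x (w ! r)) *\<^sub>C labJ N (L - {m}) (map (tag m) (del r w)))" if m: "m \<in> L" for m
  proof -
    have "m < N" using m 2(4) by auto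
    hence "rann (iK q N x) (labJ N (L - {m}) (map (tag m) w))
     = (\<Sum>r<length (map (tag m) w). (of_real (q ^ r) * ipK q x (map (tag m) w ! r)) *\<^sub>C labJ N (L - {m}) (del r (map (tag m) w)))"
      using m 2(3-) by (intro 2(2) lok_tag w) (auto simp: lok_def)
    also have "\<dots> = (\<Sum>r<length w. (of_real (q ^ Suc r) * ipK q x (w ! r)) *\<^sub>C labJ N (L - {m}) (map (tag m) (del r w)))"
      unfolding length_map
    proof (intro sum.cong refl)
      fix r assume "r \<in> {..<length w}"
      hence r: "r < length w" by simp
      have "fst (w ! r) \<subseteq> {..<N} \<and> fst (w ! r) \<inter> L = {}" using w r by (auto simp: lok_def)
      hence "ipK q x (tag m (w ! r)) = of_real q * ipK q x (w ! r)"
        using x m by (intro ipK_tag) (auto intro: finite_subset)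
      thus "(of_real (q ^ r) * ipK q x (map (tag m) w ! r)) *\<^sub>C labJ N (L - {m}) (del r (map (tag m) w))
        = (of_real (q ^ Suc r) * ipK q x (w ! r)) *\<^sub>C labJ N (L - {m}) (map (tag m) (del r w))"
        using r by (simp add: del_map mult_ac)
    qed
    finally show ?thesis .
  qed
  have comm: "rann (iK q N x) (cr (iE m y) z) = cr (iE m y) (rann (iK q N x) z)" for m z
    using arg_cong[OF rann_cr_commute[of "iE m y" "iK q N x"], of "\<lambda>T. blinfun_apply T z"] x y
    by (simp add: iE_L2 iK_L2 L2_inner_iE_iK)
  have "rann (iK q N x) (labJ N L (y # w))
     = ipK q x y *\<^sub>C labJ N L w
       + (q *\<^sub>R rcr (iK q N y) (rann (iK q N x) (labJ N L w))
       + (\<Sum>m\<in>L. (cr (iE m y)) (rann (iK q N x) (labJ N (L - {m}) (map (tag m) w)))))"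
    using x y by (simp add: blinfun.add_right blinfun.sum_right comm rann_rcr_apply iK_L2 L2_inner_iK q0 q1)
  also have "q *\<^sub>R rcr (iK q N y) (rann (iK q N x) (labJ N L w))
     = (\<Sum>r<length w. (of_real (q ^ Suc r) * ipK q x (w ! r)) *\<^sub>C rcr (iK q N y) (labJ N L (del r w)))"
    unfolding IH1 using y by (simp add: blinfun.sum_right clinear_opsD iK_L2 scaleR_scaleC scaleC_sum_right scaleC_scaleC mult_ac)
  also have "(\<Sum>m\<in>L. (cr (iE m y)) (rann (iK q N x) (labJ N (L - {m}) (map (tag m) w))))
     = (\<Sum>r<length w. (of_real (q ^ Suc r) * ipK q x (w ! r)) *\<^sub>C (\<Sum>m\<in>L. (cr (iE m y)) (labJ N (L - {m}) (map (tag m) (del r w)))))"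
    using y by (simp add: IH2 blinfun.sum_right clinear_opsD iE_L2 scaleC_sum_right cong: sum.cong) (rule sum.swap)
  finally show ?case
    by (simp add: sum.lessThan_Suc_shift scaleC_add_right sum.distrib del: sum.lessThan_Suc)
qed

text \<open>Only the letter named m can be contracted. Passing an earlier named letter costs q,
  passing an unnamed one costs nothing; \<open>avw\<close> records this asymmetry.\<close>

lemma an_labJ:
  assumes "finite L" "L \<subseteq> {..<N}" "lok N L w" "snd (snd x) \<in> L2_fun"
  shows "an (iE m x) (labJ N L w)
     = (if m \<in> L then \<Sum>r<length w. ipE x (w ! r) *\<^sub>C labJ N (L - {m}) (avw q m r w) else 0)"
  using assms
proof (induction N L w rule: labJ.induct)
  case (1 N L)
  thus ?case by (auto simp: iE_L2 blinfun.zero_right)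
next
  case (2 N L y w)
  have y: "fst (snd y) \<in> L2_fun" "snd (snd y) \<in> L2_fun" "fst y \<subseteq> {..<N}" and w: "lok N L w"
    using 2(3-) by (auto simp: lok_def)
  note x = 2(6)
  have IH1: "an (iE m x) (labJ N L w)
     = (if m \<in> L then \<Sum>r<length w. ipE x (w ! r) *\<^sub>C labJ N (L - {m}) (avw q m r w) else 0)"
    using 2(1)[OF 2(3,4) w x] .
  have IH2: "an (iE m x) (labJ N (L - {k}) (map (tag k) w))
     = (if m \<in> L - {k} then \<Sum>r<length w. ipE x (w ! r) *\<^sub>C labJ N (L - {k} - {m}) (map (tag k) (avw q m r w)) else 0)"
    if k: "k \<in> L" for k
  proof -
    have "k < N" using k 2(4) by auto
    hence "an (iE m x) (labJ N (L - {k}) (map (tag k) w))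
      = (if m \<in> L - {k} then \<Sum>r<length (map (tag k) w). ipE x (map (tag k) w ! r) *\<^sub>C labJ N (L - {k} - {m}) (avw q m r (map (tag k) w)) else 0)"
      using k 2(3-) by (intro 2(2) lok_tag w) auto
    thus ?thesis by (simp add: avw_tag)
  qed
  have comm: "an (iE m x) (rcr (iK q N y) z) = rcr (iK q N y) (an (iE m x) z)" for z
    using arg_cong[OF an_rcr_commute[of "iE m x" "iK q N y"], of "\<lambda>T. blinfun_apply T z"] x y
    by (simp add: iE_L2 iK_L2 L2_inner_iE_iK)
  have eq: "an (iE m x) (labJ N L (y # w))
     = rcr (iK q N y) (an (iE m x) (labJ N L w))
       + (\<Sum>k\<in>L. (if m = k then ipE x y else 0) *\<^sub>C labJ N (L - {k}) (map (tag k) w)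
          + q *\<^sub>R cr (iE k y) (an (iE m x) (labJ N (L - {k}) (map (tag k) w))))"
    using x y by (simp add: blinfun.add_right blinfun.sum_right comm an_cr_apply iE_L2 L2_inner_iE)
  show ?case
  proof (cases "m \<in> L")
    case False
    thus ?thesis unfolding eq IH1 using IH2 by (auto simp: blinfun.zero_right intro!: sum.neutral)
  next
    case m: True
    have "(\<Sum>k\<in>L. (if m = k then ipE x y else 0) *\<^sub>C labJ N (L - {k}) (map (tag k) w)
          + q *\<^sub>R cr (iE k y) (an (iE m x) (labJ N (L - {k}) (map (tag k) w))))
       = ipE x y *\<^sub>C labJ N (L - {m}) (map (tag m) w)
         + (\<Sum>k\<in>L - {m}. \<Sum>r<length w. ipE x (w ! r) *\<^sub>C cr (iE k (tau q y)) (labJ N (L - {m} - {k}) (map (tag k) (avw q m r w))))"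
    proof -
      have kk: "L - {k} - {m} = L - {m} - {k}" for k by auto
      have k: "q *\<^sub>R cr (iE k y) (an (iE m x) (labJ N (L - {k}) (map (tag k) w)))
         = (\<Sum>r<length w. ipE x (w ! r) *\<^sub>C cr (iE k (tau q y)) (labJ N (L - {m} - {k}) (map (tag k) (avw q m r w))))"
        if "k \<in> L - {m}" for k
        using that m y by (simp add: IH2 iE_tau cr_scale iE_L2 kk blinfun.sum_right clinear_opsD scaleR_scaleC
            scaleC_sum_right scaleC_scaleC mult_ac)
      show ?thesis
        using 2(3) m k IH2[OF m] by (subst sum.remove[OF 2(3) m]) (simp add: blinfun.zero_right)
    qed
    moreover have "rcr (iK q N y) (an (iE m x) (labJ N L w))
       = (\<Sum>r<length w. ipE x (w ! r) *\<^sub>C rcr (iK q N (tau q y)) (labJ N (L - {m}) (avw q m r w)))"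
      unfolding IH1 using m y by (simp add: blinfun.sum_right clinear_opsD iK_L2)
    moreover have "(\<Sum>k\<in>L - {m}. \<Sum>r<length w. ipE x (w ! r) *\<^sub>C cr (iE k (tau q y)) (labJ N (L - {m} - {k}) (map (tag k) (avw q m r w))))
       = (\<Sum>r<length w. \<Sum>k\<in>L - {m}. ipE x (w ! r) *\<^sub>C cr (iE k (tau q y)) (labJ N (L - {m} - {k}) (map (tag k) (avw q m r w))))"
      by (rule sum.swap)
    ultimately show ?thesis unfolding eq using m
      by (simp add: sum.lessThan_Suc_shift avw_simps scaleC_add_right sum.distrib scaleC_sum_right
          del: sum.lessThan_Suc)
  qed
qed

text \<open>The expansion of \<open>gform\<close> along the first letter is matched term by term:
  leaving the letter unnamed gives its past contractions, and each name in \<open>L\<close> gives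
  the same future contractions with one name fewer. The choice of names accumulates to the
  factorial.\<close>

lemma labJ_isometry:
  assumes "finite L" "L \<subseteq> {..<N}" "lok N L w" "lok N L w'"
  shows "cinner (labJ N L w) (labJ N L w') = of_nat (fact (card L)) * gform q w (card L) w'"
  using assms
proof (induction "length w" arbitrary: L w w' rule: less_induct)
  case less
  show ?case
  proof (cases w)
    case Nil
    show ?thesis
    proof (cases w')
      case Nil
      thus ?thesis using \<open>w = []\<close> less.prems(1) cinner_words[of "[]" "[]"] by (auto simp: q_inner_Nil)
    next
      case (Cons y w'')
      have y: "fst (snd y) \<in> L2_fun" "snd (snd y) \<in> L2_fun" using less.prems Cons by (auto simp: lok_def)
      have "cinner \<Omega> (labJ N {} w') = 0"
        using y Cons cinner_adj[of "rcr (iK q N y)" \<Omega>] by (simp add: iK_L2 adj_rcr flip: adj_rann)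
      thus ?thesis using \<open>w = []\<close> Cons less.prems(1) by auto
    qed
  next
    case (Cons x v)
    have x: "fst (snd x) \<in> L2_fun" "snd (snd x) \<in> L2_fun" "fst x \<subseteq> {..<N}" and v: "lok N L v" and lx: "lok N L [x]"
      using less.prems Cons by (auto simp: lok_def)
    note L = less.prems(1,2) and w' = less.prems(4)
    let ?F = "complex_of_nat (fact (card L))"
    have del': "lok N L (del r w')" for r using w' set_del[of r w'] by (rule lok_mono) auto
    have A: "cinner (rcr (iK q N x) (labJ N L v)) (labJ N L w')
      = ?F * (\<Sum>r<length w'. of_real (q ^ r) * (ipK q x (w' ! r) * gform q v (card L) (del r w')))"
    proof -
      have "cinner (rcr (iK q N x) (labJ N L v)) (labJ N L w')
         = cinner (labJ N L v) (rann (iK q N x) (labJ N L w'))"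
        using x by (simp add: cinner_adj'[symmetric] iK_L2 adj_rcr)
      also have "\<dots> = (\<Sum>r<length w'. (of_real (q ^ r) * ipK q x (w' ! r)) * cinner (labJ N L v) (labJ N L (del r w')))"
        by (simp add: rann_labJ L w' lx cinner_sum_right cinner_scaleC_right)
      also have "\<dots> = (\<Sum>r<length w'. (of_real (q ^ r) * ipK q x (w' ! r)) * (?F * gform q v (card L) (del r w')))"
        using less.hyps[of v] Cons L v del' by simp
      finally show ?thesis by (simp add: sum_distrib_left mult_ac)
    qed
    have B: "cinner (cr (iE m x) (labJ N (L - {m}) (map (tag m) v))) (labJ N L w')
      = of_nat (fact (card L - 1)) * (\<Sum>r<length w'. of_real (q ^ r) * (ipE x (w' ! r) * gform q v (card L - 1) (del r w')))"
      if m: "m \<in> L" for m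
    proof -
      have mN: "m < N" using m L by auto
      have lok': "lok N (L - {m}) (avw q m r w')" for r
        unfolding avw_def lok_simps
      proof
        show "lok N (L - {m}) (map (tau q) (take r w'))"
          by (rule lok_tau[OF lok_mono[OF w']]) (auto dest: in_set_takeD)
        show "lok N (L - {m}) (map (tag m) (drop (Suc r) w'))"
          by (rule lok_tag[OF lok_mono[OF w'] m mN]) (auto dest: in_set_dropD)
      qed
      have g: "gform q (map (tag m) v) k (avw q m r w') = of_real (q ^ r) * gform q v k (del r w')" if r: "r < length w'" for r k
      proof -
        \<comment> \<open>In front of r the past parts differ in the tag m and the future parts were
          scaled by \<open>tau\<close>, so q comes out in both cases; behind r the tags
          agree.\<close>
        let ?cs = "replicate r (complex_of_real q) @ replicate (length w' - Suc r) 1"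
        have "gform q (map (tag m) v) k (avw q m r w') = prod_list ?cs * gform q v k (del r w')"
        proof (rule gform_scale)
          fix i j assume ij: "i < length (map (tag m) v)" "j < length (del r w')"
          have tags: "m \<notin> fst (v ! i)" "finite (fst (v ! i))" "\<And>j. j < length w' \<Longrightarrow> m \<notin> fst (w' ! j) \<and> finite (fst (w' ! j))"
            using v w' ij(1) m by (auto simp: lok_def intro!: finite_subset[OF _ finite_lessThan[of N]])
          show "ipK q (map (tag m) v ! i) (avw q m r w' ! j) = ?cs ! j * ipK q (v ! i) (del r w' ! j)
            \<and> ipE (map (tag m) v ! i) (avw q m r w' ! j) = ?cs ! j * ipE (v ! i) (del r w' ! j)"
          proof (cases "j < r")
            case True
            thus ?thesis using ij r tags(3)[of j] tags(1,2)
              by (simp add: avw_def nth_append nth_del length_del ip_tau ipK_tag)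
          next
            case False
            thus ?thesis using ij r tags(3)[of "Suc j"] tags(1,2)
              by (simp add: avw_def nth_append nth_del length_del ipK_tag)
          qed
        qed (use r in \<open>auto simp: avw_def length_del\<close>)
        thus ?thesis by simp
      qed
      have "cinner (cr (iE m x) (labJ N (L - {m}) (map (tag m) v))) (labJ N L w')
        = (\<Sum>r<length w'. ipE x (w' ! r) * cinner (labJ N (L - {m}) (map (tag m) v)) (labJ N (L - {m}) (avw q m r w')))"
        using x m by (simp add: cinner_an[symmetric] iE_L2 an_labJ L w' cinner_sum_right cinner_scaleC_right)
      also have "\<dots> = (\<Sum>r<length w'. ipE x (w' ! r) * (of_nat (fact (card L - 1)) * gform q (map (tag m) v) (card L - 1) (avw q m r w')))"
      proof (intro sum.cong refl arg_cong2[where f = "(*)"])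
        fix r
        have "cinner (labJ N (L - {m}) (map (tag m) v)) (labJ N (L - {m}) (avw q m r w'))
          = of_nat (fact (card (L - {m}))) * gform q (map (tag m) v) (card (L - {m})) (avw q m r w')"
          using L lok_tag[OF v m mN] lok' Cons by (intro less.hyps) auto
        thus "cinner (labJ N (L - {m}) (map (tag m) v)) (labJ N (L - {m}) (avw q m r w'))
          = of_nat (fact (card L - 1)) * gform q (map (tag m) v) (card L - 1) (avw q m r w')" using L m by simp
      qed
      also have "\<dots> = (\<Sum>r<length w'. ipE x (w' ! r) * (of_nat (fact (card L - 1)) * (of_real (q ^ r) * gform q v (card L - 1) (del r w'))))"
        by (simp add: g)
      finally show ?thesis by (simp add: sum_distrib_left mult_ac)
    qed
    have "cinner (labJ N L w) (labJ N L w') = ?F * (\<Sum>r<length w'. of_real (q ^ r) * (ipK q x (w' ! r) * gform q v (card L) (del r w')))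
      + of_nat (card L * fact (card L - 1)) * (\<Sum>r<length w'. of_real (q ^ r) * (ipE x (w' ! r) * gform q v (card L - 1) (del r w')))"
      unfolding Cons labJ.simps cinner_add_left cinner_sum_left A by (simp add: B)
    also have "\<dots> = ?F * gform q w (card L) w'"
    proof (cases "card L = 0")
      case False
      hence "card L * fact (card L - 1) = (fact (card L) :: nat)" by (simp add: fact_reduce)
      thus ?thesis using False by (simp add: Cons sum_distrib_left ring_distribs sum.distrib del: of_nat_mult)
    qed (simp add: Cons)
    finally show ?thesis .
  qed
qed

end

section \<open>Operators that contract a future letter and commute with the past\<close>

section \<open>Twisted annihilation operators\<close>

definition lo :: "real \<Rightarrow> (real \<Rightarrow> complex) \<Rightarrow> real \<Rightarrow> complex" where
  "lo s h = (\<lambda>x. indicator {..s} x * h x)"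
definition hi :: "real \<Rightarrow> (real \<Rightarrow> complex) \<Rightarrow> real \<Rightarrow> complex" where
  "hi s h = (\<lambda>x. indicator {s<..} x * h x)"
definition lowf :: "real \<Rightarrow> (real \<Rightarrow> complex) \<Rightarrow> bool" where
  "lowf s f \<longleftrightarrow> f \<in> L2_fun \<and> (\<forall>t>s. f t = 0)"
definition highf :: "real \<Rightarrow> (real \<Rightarrow> complex) \<Rightarrow> bool" where
  "highf s f \<longleftrightarrow> f \<in> L2_fun \<and> (\<forall>t\<le>s. f t = 0)"

lemma lowf_lo [simp]: "h \<in> L2_fun \<Longrightarrow> lowf s (lo s h)"
  and highf_hi [simp]: "h \<in> L2_fun \<Longrightarrow> highf s (hi s h)"
  by (auto simp: lowf_def highf_def lo_def hi_def)

lemma lowf_L2: "lowf s f \<Longrightarrow> f \<in> L2_fun" and highf_L2: "highf s f \<Longrightarrow> f \<in> L2_fun"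
  by (auto simp: lowf_def highf_def)

lemma lo_L2 [simp]: "h \<in> L2_fun \<Longrightarrow> lo s h \<in> L2_fun" and hi_L2 [simp]: "h \<in> L2_fun \<Longrightarrow> hi s h \<in> L2_fun"
  by (auto simp: lo_def hi_def)

lemma lo_add_hi: "lo s h x + hi s h x = h x"
  by (auto simp: lo_def hi_def indicator_def)

lemma lowf_eqs: "lowf s f \<Longrightarrow> lo s f = f" "lowf s f \<Longrightarrow> hi s f = (\<lambda>x. 0)"
  "highf s f \<Longrightarrow> lo s f = (\<lambda>x. 0)" "highf s f \<Longrightarrow> hi s f = f"
  by (auto simp: lo_def hi_def lowf_def highf_def indicator_def fun_eq_iff)

lemma inner_low_high: "lowf s f \<Longrightarrow> highf s g \<Longrightarrow> L2_inner f g = 0" "lowf s f \<Longrightarrow> highf s g \<Longrightarrow> L2_inner g f = 0"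
  by (auto intro!: L2_inner_disjoint simp: lowf_def highf_def) (meson not_le)+

lemma inner_low_spread: "lowf s f \<Longrightarrow> L2_inner f (spread (s + 1) j g) = 0" "lowf s f \<Longrightarrow> L2_inner (spread (s + 1) j g) f = 0"
  by (auto intro!: L2_inner_disjoint simp: lowf_def) (metis not_le less_add_one order_le_less_trans spread_support)+

lemma inner_lo_hi:
  assumes "f \<in> L2_fun" "g \<in> L2_fun"
  shows "L2_inner f g = L2_inner (lo s f) (lo s g) + L2_inner (hi s f) (hi s g)"
proof -
  have "L2_inner f g = L2_inner (\<lambda>x. lo s f x + hi s f x) (\<lambda>x. lo s g x + hi s g x)"
    by (simp add: lo_add_hi)
  thus ?thesis using assms
    by (simp add: L2_inner_add_left L2_inner_add_right inner_low_high[of s "lo s f" "hi s g"] inner_low_high[of s "lo s g" "hi s f"])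
qed

lemma inner_highf: "highf s e \<Longrightarrow> h \<in> L2_fun \<Longrightarrow> L2_inner e (hi s h) = L2_inner e h"
  using inner_lo_hi[of e h s] by (simp add: highf_L2 lowf_eqs)

lemma inner_lowf: "lowf s f \<Longrightarrow> h \<in> L2_fun \<Longrightarrow> L2_inner f (lo s h) = L2_inner f h"
  using inner_lo_hi[of f h s] by (simp add: lowf_L2 lowf_eqs)

definition lett :: "real \<Rightarrow> (real \<Rightarrow> complex) \<Rightarrow> letter" where
  "lett s h = ({}, lo s h, hi s h)"

text \<open>Letters with at most one tag are realised inside the original one-particle space. A
  tagged past part is rotated towards a fresh copy, so that it meets untagged parts with a factor q
  but keeps its length. The fresh copies begin at s + 1 and are therefore orthogonal to functions
  that live up to s.\<close>

definition emb :: "real \<Rightarrow> real \<Rightarrow> letter \<Rightarrow> real \<Rightarrow> complex" where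
  "emb q s x = (\<lambda>t. (if fst x = {} then fst (snd x) t
      else of_real q * fst (snd x) t + of_real (sqrt (1 - q\<^sup>2)) * spread (s + 1) 1 (fst (snd x)) t)
    + spread (s + 1) 0 (snd (snd x)) t)"

text \<open>The image of a letter that was passed: its past part is untouched, its future part is
  scaled by q and moved by the same isometry as in \<open>Vf\<close>.\<close>

definition tf :: "real \<Rightarrow> real \<Rightarrow> (real \<Rightarrow> complex) \<Rightarrow> real \<Rightarrow> complex" where
  "tf q s h = (\<lambda>t. lo s h t + of_real q * spread (s + 1) 0 (hi s h) t)"

text \<open>An isometry whose compression to the functions up to s is multiplication by q; the
  future part is merely moved to a fresh copy.\<close>

definition Vf :: "real \<Rightarrow> real \<Rightarrow> (real \<Rightarrow> complex) \<Rightarrow> real \<Rightarrow> complex" where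
  "Vf q s h = (\<lambda>t. (of_real q * lo s h t + of_real (sqrt (1 - q\<^sup>2)) * spread (s + 1) 1 (lo s h) t)
      + spread (s + 1) 0 (hi s h) t)"

lemma emb_tau: "emb q s (tau q (lett s h)) = tf q s h" and emb_tag: "emb q s (tag m (lett s h)) = Vf q s h"
  by (auto simp: emb_def tau_def tag_def lett_def tf_def Vf_def spread_scale)

lemma emb_L2: "0 \<le> s \<Longrightarrow> fst (snd x) \<in> L2_fun \<Longrightarrow> snd (snd x) \<in> L2_fun \<Longrightarrow> emb q s x \<in> L2_fun"
  by (cases "fst x = {}") (simp_all add: emb_def)

lemma inner_emb:
  assumes q: "0 \<le> q" "q < 1" and s: "0 \<le> s" and x: "fst x \<in> {{}, {m}}" "lowf s (fst (snd x))" "snd (snd x) \<in> L2_fun"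
    and y: "fst y \<in> {{}, {m}}" "lowf s (fst (snd y))" "snd (snd y) \<in> L2_fun"
  shows "L2_inner (emb q s x) (emb q s y) = ipK q x y + ipE x y"
proof -
  have c: "sqrt (1 - q\<^sup>2) * sqrt (1 - q\<^sup>2) = 1 - q\<^sup>2" using q by (simp add: power_le_one)
  have cc: "complex_of_real (sqrt (1 - q\<^sup>2)) * complex_of_real (sqrt (1 - q\<^sup>2)) = 1 - of_real q * of_real q"
    unfolding of_real_mult[symmetric] c by (simp add: power2_eq_square)
  define f e g h where d: "f = fst (snd x)" "e = snd (snd x)" "g = fst (snd y)" "h = snd (snd y)"
  have L: "f \<in> L2_fun" "g \<in> L2_fun" "e \<in> L2_fun" "h \<in> L2_fun" "lowf s f" "lowf s g" using x y lowf_L2 by (auto simp: d)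
  have sp: "spread (s + 1) j k \<in> L2_fun" if "k \<in> L2_fun" "j \<in> {0, 1}" for j k using that s by simp
  have 1: "ipK q x y = (if fst x = fst y then 1 else of_real q) * L2_inner f g"
    using x(1) y(1) by (auto simp: ipK_def sdiff_def d)
  have "L2_inner (emb q s x) (emb q s y) = (if fst x = fst y then 1 else of_real q) * L2_inner f g + L2_inner e h"
    using x(1) y(1) L sp s cc unfolding emb_def d[symmetric]
    by (auto simp: L2_inner_add_left L2_inner_add_right L2_inner_scale_left L2_inner_scale_right
        L2_inner_spread L2_inner_spread_orth inner_low_spread ring_distribs mult.assoc[symmetric])
  thus ?thesis unfolding 1 by (simp add: ipE_def d)
qed

lemma lett_inner:
  assumes "f \<in> L2_fun" "g \<in> L2_fun"
  shows "L2_inner f g = ipK q (lett s f) (lett s g) + ipE (lett s f) (lett s g)"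
  using inner_lo_hi[OF assms, of s] by (simp add: ipK_def ipE_def lett_def sdiff_def)

lemma avw_letters:
  assumes "x \<in> set (avw q m r (map (lett s) w))" "set w \<subseteq> L2_fun"
  shows "fst x \<in> {{}, {m}} \<and> lowf s (fst (snd x)) \<and> snd (snd x) \<in> L2_fun"
proof -
  have "h \<in> L2_fun" if "h \<in> set w" for h using that assms(2) by blast
  thus ?thesis using assms(1)
    by (auto simp: avw_def tau_def tag_def lett_def dest!: in_set_takeD in_set_dropD)
qed

lemma lok_lett: "set w \<subseteq> L2_fun \<Longrightarrow> lok N L (map (lett s) w)"
  by (auto simp: lok_def lett_def)

lemma cinner_sum_sum:
  "cinner (\<Sum>r\<in>A. c r *\<^sub>C F r) (\<Sum>r'\<in>B. d r' *\<^sub>C G r')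
    = (\<Sum>r\<in>A. \<Sum>r'\<in>B. cnj (c r) * d r' * cinner (F r) (G r' :: 'f::complex_hilbert))"
  by (simp add: cinner_sum_left cinner_sum_right cinner_scaleC_left cinner_scaleC_right
      sum_distrib_left mult_ac) (rule sum.swap)

text \<open>A decomposition of the Gram kernel on words passes to the norms of all their
  combinations by sesquilinearity.\<close>

lemma norm_lin_sum:
  fixes G :: "'k \<Rightarrow> 'w \<Rightarrow> 'f::complex_hilbert" and F :: "'w \<Rightarrow> 'f"
  assumes "\<And>v w. v \<in> snd ` set xs \<Longrightarrow> w \<in> snd ` set xs \<Longrightarrow>
      cinner (F v) (F w) = (\<Sum>k\<in>K. of_real (c k) * cinner (G k v) (G k w))"
  shows "(norm (lin F xs))\<^sup>2 = (\<Sum>k\<in>K. c k * (norm (lin (G k) xs))\<^sup>2)"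
proof -
  have 1: "cinner (F v) (lin F zs) = (\<Sum>k\<in>K. of_real (c k) * cinner (G k v) (lin (G k) zs))"
    if "v \<in> snd ` set xs" "set zs \<subseteq> set xs" for v zs
    using that(2)
  proof (induction zs)
    case (Cons z zs)
    thus ?case using assms[OF that(1), of "snd z"]
      by (simp add: cinner_add_right cinner_scaleC_right ring_distribs sum.distrib sum_distrib_left mult_ac)
  qed simp
  have "cinner (lin F ys) (lin F zs) = (\<Sum>k\<in>K. of_real (c k) * cinner (lin (G k) ys) (lin (G k) zs))"
    if "set ys \<subseteq> set xs" "set zs \<subseteq> set xs" for ys zs
    using that(1)
  proof (induction ys)
    case (Cons y ys)
    thus ?case using 1[of "snd y" zs] that(2)
      by (simp add: cinner_add_left cinner_scaleC_left ring_distribs sum.distrib sum_distrib_left mult_ac)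
  qed simp
  from this[of xs xs] have "complex_of_real ((norm (lin F xs))\<^sup>2) = complex_of_real (\<Sum>k\<in>K. c k * (norm (lin (G k) xs))\<^sup>2)"
    by (simp add: cinner_self)
  thus ?thesis using of_real_eq_iff by blast
qed

context qfock
begin

lemma column_bound_set:
  assumes I: "finite I" and u: "\<And>i. i \<in> I \<Longrightarrow> u i \<in> L2_fun"
    and orth: "\<And>i j. i \<in> I \<Longrightarrow> j \<in> I \<Longrightarrow> i \<noteq> j \<Longrightarrow> L2_inner (u i) (u j) = 0"
    and eps: "\<And>i. i \<in> I \<Longrightarrow> (l2 (u i))\<^sup>2 \<le> \<epsilon>" and e0: "0 \<le> \<epsilon>"
  shows "(\<Sum>i\<in>I. (norm (an (u i) x))\<^sup>2) \<le> \<epsilon> / (1 - q) * (norm x)\<^sup>2"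
proof -
  obtain h where h: "bij_betw h {..<card I} I"
    using ex_bij_betw_nat_finite[OF I] by (auto simp: atLeast0LessThan)
  have hI: "h i \<in> I" if "i < card I" for i using h that by (auto dest: bij_betwE)
  have hj: "h i \<noteq> h j" if "i < card I" "j < card I" "i \<noteq> j" for i j
    using h that by (auto simp: bij_betw_def inj_on_def)
  have "(\<Sum>i<card I. (norm (an (u (h i)) x))\<^sup>2) \<le> \<epsilon> / (1 - q) * (norm x)\<^sup>2"
    by (rule column_bound) (use u eps hI e0 orth hj in simp_all)
  thus ?thesis using sum.reindex_bij_betw[OF h, of "\<lambda>i. (norm (an (u i) x))\<^sup>2"] by simp
qed

text \<open>\<open>Vf\<close> embeds the letters tagged by one fixed name, and a tag carried by both
  letters leaves their inner product unchanged.\<close>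

lemma isom_Vf: "0 \<le> s \<Longrightarrow> isom (Vf q s)"
  unfolding isom_def
proof (intro ballI conjI)
  fix f g assume s: "0 \<le> s" and f: "f \<in> L2_fun" and g: "g \<in> L2_fun"
  show "Vf q s f \<in> L2_fun" using f s by (simp add: Vf_def)
  have "L2_inner (emb q s (tag 0 (lett s f))) (emb q s (tag 0 (lett s g)))
      = ipK q (tag 0 (lett s f)) (tag 0 (lett s g)) + ipE (tag 0 (lett s f)) (tag 0 (lett s g))"
    using f g s by (intro inner_emb[where m = 0] q0 q1) (auto simp: tag_def lett_def)
  also have "ipK q (tag 0 (lett s f)) (tag 0 (lett s g)) = ipK q (lett s f) (lett s g)"
    by (rule ipK_tag) (auto simp: lett_def)
  finally show "L2_inner (Vf q s f) (Vf q s g) = L2_inner f g"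
    using lett_inner[OF f g, of q s] by (simp add: emb_tag)
qed

text \<open>Here, in contrast to \<open>ann\<close>, past letters in front of the contracted one
  cost nothing, and the letters behind it are changed instead. Since past operators act at the front
  of a word, this is what makes the operator commute with them.\<close>

definition AVw :: "real \<Rightarrow> (real \<Rightarrow> complex) \<Rightarrow> (real \<Rightarrow> complex) list \<Rightarrow> 'f" where
  "AVw s e w = (\<Sum>r<length w. L2_inner e (w ! r) *\<^sub>C \<Theta> (map (tf q s) (take r w) @ map (Vf q s) (drop (Suc r) w)))"

lemma tf_L2 [simp]: "0 \<le> s \<Longrightarrow> h \<in> L2_fun \<Longrightarrow> tf q s h \<in> L2_fun"
  and Vf_L2 [simp]: "0 \<le> s \<Longrightarrow> h \<in> L2_fun \<Longrightarrow> Vf q s h \<in> L2_fun"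
  by (simp_all add: tf_def Vf_def)

lemma AVw_emb: "AVw s e w = (\<Sum>r<length w. L2_inner e (w ! r) *\<^sub>C \<Theta> (map (emb q s) (avw q 0 r (map (lett s) w))))"
  unfolding AVw_def avw_def by (simp add: take_map drop_map emb_tau emb_tag comp_def)

text \<open>
  The map \<open>labJ\<close> is isometric up to factorials and turns the twisted annihilator into honest
  annihilators of labelled letters. Averaging over the label brings in the column bound.
\<close>

lemma AVw_bound:
  fixes N :: nat
  assumes s: "0 \<le> s" and e: "\<And>i. i < N \<Longrightarrow> highf s (e i)"
    and orth: "\<And>i j. i < N \<Longrightarrow> j < N \<Longrightarrow> i \<noteq> j \<Longrightarrow> L2_inner (e i) (e j) = 0"
    and eps: "\<And>i. i < N \<Longrightarrow> (l2 (e i))\<^sup>2 \<le> \<epsilon>" and e0: "0 \<le> \<epsilon>" and xs: "xs \<in> combos"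
  shows "(\<Sum>i<N. (norm (lin (AVw s (e i)) xs))\<^sup>2) \<le> \<epsilon> / (1 - q) * (norm (lin \<Theta> xs))\<^sup>2"
proof -
  obtain n where n: "degle n xs" using degle_ex by blast
  have len: "length w \<le> n" and L2: "set w \<subseteq> L2_fun" if "w \<in> snd ` set xs" for w
    using that n xs by (auto simp: degle_def combos_iff)
  \<comment> \<open>Enough names for everything below, where only the names 0, ..., n are given
    away.\<close>
  define M where "M = n + 2"
  define \<phi> where "\<phi> = map (lett s)"
  define y where "y k = lin (\<lambda>w. labJ M {..<k} (\<phi> w)) xs" for k
  have iso: "cinner (labJ M L v) (labJ M L w) = of_nat (fact (card L)) * gform q v (card L) w"
    if "L \<subseteq> {..<M}" "lok M L v" "lok M L w" for L v w
    using that finite_subset by (intro labJ_isometry) auto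
  \<comment> \<open>Pairings sorted by the number k of future lines, each class being represented by
    \<open>labJ\<close> up to k!. The sum extends to \<open>Suc n\<close> so that its tail can be
    indexed by \<open>Suc k\<close> with k at most n.\<close>
  have i: "(norm (lin \<Theta> xs))\<^sup>2 = (\<Sum>k\<le>Suc n. (1 / fact k) * (norm (y k))\<^sup>2)"
    unfolding y_def
  proof (rule norm_lin_sum)
    fix v w assume vw: "v \<in> snd ` set xs" "w \<in> snd ` set xs"
    define em :: "letter \<Rightarrow> real \<Rightarrow> complex" where "em x = (\<lambda>t. fst (snd x) t + snd (snd x) t)" for x
    have em: "em (lett s h) = h" for h by (auto simp: em_def lett_def lo_add_hi)
    have "cinner (\<Theta> v) (\<Theta> w) = q_inner q (map em (\<phi> v)) (map em (\<phi> w))"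
      using L2 vw by (simp add: cinner_words \<phi>_def comp_def em)
    also have "\<dots> = (\<Sum>k\<le>Suc n. gform q (\<phi> v) k (\<phi> w))"
      using L2[OF vw(1)] L2[OF vw(2)] len[OF vw(1)]
      by (intro q_inner_gform) (auto simp: \<phi>_def em lett_inner[of _ _ q s] subset_iff)
    also have "\<dots> = (\<Sum>k\<le>Suc n. of_real (1 / fact k) * cinner (labJ M {..<k} (\<phi> v)) (labJ M {..<k} (\<phi> w)))"
    proof (intro sum.cong refl)
      fix k assume "k \<in> {..Suc n}"
      hence "cinner (labJ M {..<k} (\<phi> v)) (labJ M {..<k} (\<phi> w)) = fact k * gform q (\<phi> v) k (\<phi> w)"
        using L2 vw by (subst iso) (auto simp: M_def \<phi>_def lok_lett)
      thus "gform q (\<phi> v) k (\<phi> w) = of_real (1 / fact k) * cinner (labJ M {..<k} (\<phi> v)) (labJ M {..<k} (\<phi> w))"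
        by simp
    qed
    finally show "cinner (\<Theta> v) (\<Theta> w) = \<dots>" .
  qed
  \<comment> \<open>Here k is the number of future lines that remain and m is the name that was
    removed. All \<open>Suc k\<close> choices of m contribute the same k! times
    \<open>gform\<close>, so dividing by the factorial of \<open>Suc k\<close> averages over
    them.\<close>
  define K where "K = (SIGMA k:{..n}. {..<Suc k})"
  define ze :: "nat \<Rightarrow> letter" where "ze i = ({}, \<lambda>_. 0, e i)" for i
  have ii: "(norm (lin (AVw s (e i)) xs))\<^sup>2
      = (\<Sum>p\<in>K. (1 / fact (Suc (fst p))) * (norm (an (iE (snd p) (ze i)) (y (Suc (fst p)))))\<^sup>2)" if i: "i < N" for i
  proof -
    let ?a = "\<lambda>m k u. an (iE m (ze i)) (labJ M {..<Suc k} (\<phi> u))"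
    have eL: "e i \<in> L2_fun" using e[OF i] by (rule highf_L2)
    have "an (iE m (ze i)) (y k) = lin (\<lambda>w. (an (iE m (ze i))) (labJ M {..<k} (\<phi> w))) xs" for m k
      unfolding y_def using eL by (intro blinfun_lin) (simp add: iE_L2 ze_def)
    hence "(\<Sum>p\<in>K. (1 / fact (Suc (fst p))) * (norm (an (iE (snd p) (ze i)) (y (Suc (fst p)))))\<^sup>2)
      = (\<Sum>p\<in>K. (1 / fact (Suc (fst p))) * (norm (lin (\<lambda>w. ?a (snd p) (fst p) w) xs))\<^sup>2)"
      by simp
    also have "\<dots> = (norm (lin (AVw s (e i)) xs))\<^sup>2"
    proof (rule norm_lin_sum[symmetric])
      fix v w assume vw: "v \<in> snd ` set xs" "w \<in> snd ` set xs"
      note Lv = L2[OF vw(1)] and Lw = L2[OF vw(2)]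
      let ?c = "\<lambda>r r'. cnj (L2_inner (e i) (v ! r)) * L2_inner (e i) (w ! r')"
      let ?g = "\<lambda>k r r'. gform q (avw q 0 r (\<phi> v)) k (avw q 0 r' (\<phi> w))"
      have lok': "lok M ({..<Suc k} - {m}) (avw q m r (map (lett s) u))" if "k \<le> n" "m \<le> k" "set u \<subseteq> L2_fun" for k m r u
        unfolding lok_def
      proof
        fix x assume "x \<in> set (avw q m r (map (lett s) u))"
        from avw_letters[OF this that(3)] show "fst x \<subseteq> {..<M} \<and> fst x \<inter> ({..<Suc k} - {m}) = {}
            \<and> fst (snd x) \<in> L2_fun \<and> snd (snd x) \<in> L2_fun"
          using that(1,2) by (auto simp: M_def lowf_L2)
      qed
      have "cinner (AVw s (e i) v) (AVw s (e i) w) = (\<Sum>r<length v. \<Sum>r'<length w. ?c r r' *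
         cinner (\<Theta> (map (emb q s) (avw q 0 r (\<phi> v)))) (\<Theta> (map (emb q s) (avw q 0 r' (\<phi> w)))))"
        unfolding AVw_emb \<phi>_def[symmetric] by (rule cinner_sum_sum)
      also have "\<dots> = (\<Sum>r<length v. \<Sum>r'<length w. ?c r r' * (\<Sum>k\<le>n. ?g k r r'))"
      proof (intro sum.cong refl)
        fix r r' assume r: "r \<in> {..<length v}"
        have emL: "set (map (emb q s) (avw q 0 r (map (lett s) u))) \<subseteq> L2_fun" if "set u \<subseteq> L2_fun" for r u
        proof -
          have "emb q s x \<in> L2_fun" if "x \<in> set (avw q 0 r (map (lett s) u))" for x
            using avw_letters[OF that \<open>set u \<subseteq> L2_fun\<close>] lowf_L2 by (intro emb_L2 s) blast+
          thus ?thesis unfolding set_map by blast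
        qed
        have "cinner (\<Theta> (map (emb q s) (avw q 0 r (\<phi> v)))) (\<Theta> (map (emb q s) (avw q 0 r' (\<phi> w))))
          = q_inner q (map (emb q s) (avw q 0 r (\<phi> v))) (map (emb q s) (avw q 0 r' (\<phi> w)))"
          unfolding \<phi>_def by (intro cinner_words emL Lv Lw)
        also have "\<dots> = (\<Sum>k\<le>n. ?g k r r')"
        proof (rule q_inner_gform)
          fix x y assume "x \<in> set (avw q 0 r (\<phi> v))" "y \<in> set (avw q 0 r' (\<phi> w))"
          thus "L2_inner (emb q s x) (emb q s y) = ipK q x y + ipE x y"
            using avw_letters[of x q 0 r s v] avw_letters[of y q 0 r' s w] Lv Lw unfolding \<phi>_def
            by (intro inner_emb[where m = 0] q0 q1 s) auto
        qed (use r len[OF vw(1)] in \<open>auto simp: avw_def \<phi>_def\<close>)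
        finally show "?c r r' * cinner (\<Theta> (map (emb q s) (avw q 0 r (\<phi> v)))) (\<Theta> (map (emb q s) (avw q 0 r' (\<phi> w))))
          = ?c r r' * (\<Sum>k\<le>n. ?g k r r')" by (simp only:)
      qed
      also have "\<dots> = (\<Sum>k\<le>n. \<Sum>r<length v. \<Sum>r'<length w. ?c r r' * ?g k r r')"
        unfolding sum_distrib_left by (subst (2) sum.swap, subst sum.swap) (rule refl)
      also have "\<dots> = (\<Sum>k\<le>n. \<Sum>m<Suc k. of_real (1 / fact (Suc k)) *
         cinner (?a m k v) (?a m k w))"
      proof (rule sum.cong[OF refl])
        fix k assume "k \<in> {..n}"
        hence k: "k \<le> n" by simp
        have "cinner (?a m k v) (?a m k w)
           = fact k * (\<Sum>r<length v. \<Sum>r'<length w. ?c r r' * ?g k r r')" if m: "m \<le> k" for m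
        proof -
          have an: "?a m k u
             = (\<Sum>r<length u. L2_inner (e i) (u ! r) *\<^sub>C labJ M ({..<Suc k} - {m}) (avw q m r (\<phi> u)))" if u: "set u \<subseteq> L2_fun" for u
          proof -
            have "ipE (ze i) (\<phi> u ! r) = L2_inner (e i) (u ! r)" if "r < length u" for r
            proof -
              have "u ! r \<in> L2_fun" using u nth_mem[OF that] by blast
              from inner_highf[OF e[OF i] this] show ?thesis
                using that by (simp add: ipE_def ze_def \<phi>_def lett_def)
            qed
            note h = this
            have "{..<Suc k} \<subseteq> {..<M}" "lok M {..<Suc k} (\<phi> u)" "snd (snd (ze i)) \<in> L2_fun" "m \<in> {..<Suc k}"
              using k m u eL by (auto simp: M_def \<phi>_def lok_lett ze_def)
            hence "?a m k u
              = (\<Sum>r<length (\<phi> u). ipE (ze i) (\<phi> u ! r) *\<^sub>C labJ M ({..<Suc k} - {m}) (avw q m r (\<phi> u)))"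
              using an_labJ[OF finite_lessThan, of "Suc k" M "\<phi> u" "ze i" m] by (simp only: if_True)
            also have "\<dots> = (\<Sum>r<length u. L2_inner (e i) (u ! r) *\<^sub>C labJ M ({..<Suc k} - {m}) (avw q m r (\<phi> u)))"
              using h by (intro sum.cong) (auto simp: \<phi>_def)
            finally show ?thesis .
          qed
          have "cinner (labJ M ({..<Suc k} - {m}) (avw q m r (\<phi> v))) (labJ M ({..<Suc k} - {m}) (avw q m r' (\<phi> w)))
             = fact k * ?g k r r'" if r: "r < length v" "r' < length w" for r r'
          proof -
            have c: "card ({..<Suc k} - {m}) = k" using m by simp
            have "gform q (avw q m r (\<phi> v)) k (avw q m r' (\<phi> w)) = ?g k r r'"
            proof (rule gform_cong)
              fix a b assume ab: "a < length (avw q m r (\<phi> v))" "b < length (avw q 0 r' (\<phi> w))"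
              have nth: "avw q m r (map (lett s) u) ! a = (if a < r then tau q (lett s (u ! a)) else tag m (lett s (u ! Suc a)))"
                if "r < length u" "a < length u - 1" for m u a r
                using that by (auto simp: avw_def nth_append min_def)
              have la: "a < length v - 1" and lb: "b < length w - 1" using ab r by (auto simp: avw_def \<phi>_def)
              show "ipK q (avw q m r (\<phi> v) ! a) (avw q m r' (\<phi> w) ! b) = ipK q (avw q 0 r (\<phi> v) ! a) (avw q 0 r' (\<phi> w) ! b)
                 \<and> ipE (avw q m r (\<phi> v) ! a) (avw q m r' (\<phi> w) ! b) = ipE (avw q 0 r (\<phi> v) ! a) (avw q 0 r' (\<phi> w) ! b)"
                unfolding \<phi>_def nth[OF r(1) la] nth[OF r(2) lb]
                by (auto simp: ipK_def ipE_def tau_def tag_def lett_def sdiff_def)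
            qed (auto simp: avw_def)
            moreover have "{..<Suc k} - {m} \<subseteq> {..<M}" using k by (auto simp: M_def)
            ultimately show ?thesis
              using iso[of "{..<Suc k} - {m}" "avw q m r (\<phi> v)" "avw q m r' (\<phi> w)"] lok'[OF k m Lv] lok'[OF k m Lw] c
              by (simp add: \<phi>_def)
          qed
          hence "(\<Sum>r<length v. \<Sum>r'<length w. ?c r r' * cinner (labJ M ({..<Suc k} - {m}) (avw q m r (\<phi> v))) (labJ M ({..<Suc k} - {m}) (avw q m r' (\<phi> w))))
             = fact k * (\<Sum>r<length v. \<Sum>r'<length w. ?c r r' * ?g k r r')"
            by (simp add: sum_distrib_left mult_ac)
          thus ?thesis unfolding an[OF Lv] an[OF Lw] cinner_sum_sum .
        qed
        note T = this
        define G where "G = (\<Sum>r<length v. \<Sum>r'<length w. ?c r r' * ?g k r r')"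
        have "(\<Sum>m<Suc k. of_real (1 / fact (Suc k)) *
         cinner (?a m k v) (?a m k w))
          = (\<Sum>m<Suc k. of_real (1 / fact (Suc k)) * (fact k * G))"
          unfolding G_def by (intro sum.cong refl, subst T) auto
        also have "\<dots> = (of_nat (Suc k) * (of_real (1 / fact (Suc k)) * fact k)) * G"
          by (simp only: sum_constant card_lessThan mult.assoc)
        also have "complex_of_nat (Suc k) * (of_real (1 / fact (Suc k)) * fact k) = 1"
          by (simp del: of_nat_Suc)
        finally show "(\<Sum>r<length v. \<Sum>r'<length w. ?c r r' * ?g k r r') = (\<Sum>m<Suc k. of_real (1 / fact (Suc k)) *
         cinner (?a m k v) (?a m k w))"
          unfolding G_def by (simp only: mult_1)
      qed
      finally show "cinner (AVw s (e i) v) (AVw s (e i) w) = (\<Sum>p\<in>K. of_real (1 / fact (Suc (fst p))) *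
         cinner (?a (snd p) (fst p) v)
           (?a (snd p) (fst p) w))"
        unfolding K_def by (subst (asm) sum.Sigma) (auto simp: case_prod_beta)
    qed
    finally show ?thesis by simp
  qed
  \<comment> \<open>For fixed k the functions \<open>iE m (ze i)\<close> are orthogonal in both
    indices jointly, so one column bound covers all names and all i without loss.\<close>
  have iii: "(\<Sum>i<N. \<Sum>m<Suc k. (norm (an (iE m (ze i)) (y (Suc k))))\<^sup>2) \<le> \<epsilon> / (1 - q) * (norm (y (Suc k)))\<^sup>2" for k
  proof -
    have ip: "L2_inner (iE m (ze i)) (iE m' (ze j)) = (if m = m' then L2_inner (e i) (e j) else 0)" if "i < N" "j < N" for m i m' j
      using e[OF that(1)] e[OF that(2)] by (subst L2_inner_iE) (auto simp: ze_def ipE_def highf_L2)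
    have L: "iE m (ze i) \<in> L2_fun" if "i < N" for i m using e[OF that] by (intro iE_L2) (auto simp: ze_def highf_L2)
    have "(l2 (iE m (ze i)))\<^sup>2 \<le> \<epsilon>" if "i < N" for i m
    proof -
      have "complex_of_real ((l2 (iE m (ze i)))\<^sup>2) = complex_of_real ((l2 (e i))\<^sup>2)"
        using l2_sq[OF L[OF that]] l2_sq[OF highf_L2[OF e[OF that]]] ip[OF that that] by simp
      thus ?thesis using eps[OF that] of_real_eq_iff by metis
    qed
    thus ?thesis unfolding sum.cartesian_product
      using column_bound_set[of "{..<N} \<times> {..<Suc k}" "\<lambda>p. iE (snd p) (ze (fst p))" \<epsilon> "y (Suc k)"] e0 ip L orth
      by (force simp: case_prod_beta)
  qed
  have "(\<Sum>i<N. (norm (lin (AVw s (e i)) xs))\<^sup>2)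
     = (\<Sum>k\<le>n. (1 / fact (Suc k)) * (\<Sum>i<N. \<Sum>m<Suc k. (norm (an (iE m (ze i)) (y (Suc k))))\<^sup>2))"
  proof -
    have "(\<Sum>i<N. (norm (lin (AVw s (e i)) xs))\<^sup>2) = (\<Sum>i<N. \<Sum>k\<le>n. \<Sum>m<Suc k. (1 / fact (Suc k)) * (norm (an (iE m (ze i)) (y (Suc k))))\<^sup>2)"
      by (intro sum.cong refl) (subst ii, simp, unfold K_def, subst sum.Sigma, auto simp: case_prod_beta)
    thus ?thesis by (subst (asm) sum.swap) (simp only: sum_distrib_left)
  qed
  also have "\<dots> \<le> (\<Sum>k\<le>n. (1 / fact (Suc k)) * (\<epsilon> / (1 - q) * (norm (y (Suc k)))\<^sup>2))"
    by (intro sum_mono mult_left_mono iii) auto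
  also have "\<dots> = \<epsilon> / (1 - q) * (\<Sum>k\<le>n. (1 / fact (Suc k)) * (norm (y (Suc k)))\<^sup>2)"
    by (simp add: sum_distrib_left mult_ac)
  \<comment> \<open>The terms with at least one future line form the tail of the sum for the squared
    norm; the remaining term is nonnegative.\<close>
  also have "\<dots> \<le> \<epsilon> / (1 - q) * (norm (lin \<Theta> xs))\<^sup>2"
    unfolding i sum.atMost_Suc_shift using e0 q1 by (intro mult_left_mono) auto
  finally show ?thesis .
qed

end

context qfock
begin

definition AV :: "real \<Rightarrow> (real \<Rightarrow> complex) \<Rightarrow> 'f op" where
  "AV s e = word_op (AVw s e)"

lemma AVw_bound1:
  assumes "0 \<le> s" "highf s e" "xs \<in> combos"
  shows "norm (lin (AVw s e) xs) \<le> l2 e / sqrt (1 - q) * norm (lin \<Theta> xs)"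
proof -
  have "(norm (lin (AVw s e) xs))\<^sup>2 \<le> (l2 e / sqrt (1 - q) * norm (lin \<Theta> xs))\<^sup>2"
    using AVw_bound[where N = 1 and e = "\<lambda>_. e" and \<epsilon> = "(l2 e)\<^sup>2" and s = s and xs = xs] assms q1
    by (simp add: power_mult_distrib power_divide)
  thus ?thesis by (rule power2_le_imp_le) (use q1 in simp)
qed

context
  fixes s :: real assumes s0: "0 \<le> s"
begin

lemma AV_clinear [simp]: "highf s e \<Longrightarrow> AV s e \<in> clinear_ops"
  and AV_word: "highf s e \<Longrightarrow> set w \<subseteq> L2_fun \<Longrightarrow> AV s e (\<Theta> w) = AVw s e w"
  and norm_AV: "highf s e \<Longrightarrow> norm (AV s e) \<le> l2 e / sqrt (1 - q)"
  by (simp_all add: AV_def word_op[OF AVw_bound1[OF s0]])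

lemma AV_vac: "highf s e \<Longrightarrow> AV s e \<Omega> = 0"
  by (simp add: AV_word AVw_def)

lemma AV_column_bound:
  fixes N :: nat
  assumes e: "\<And>i. i < N \<Longrightarrow> highf s (e i)"
    and orth: "\<And>i j. i < N \<Longrightarrow> j < N \<Longrightarrow> i \<noteq> j \<Longrightarrow> L2_inner (e i) (e j) = 0"
    and eps: "\<And>i. i < N \<Longrightarrow> (l2 (e i))\<^sup>2 \<le> \<epsilon>" and e0: "0 \<le> \<epsilon>"
  shows "(\<Sum>i<N. (norm (AV s (e i) x))\<^sup>2) \<le> \<epsilon> / (1 - q) * (norm x)\<^sup>2"
proof (rule dense_closed_property[where P = "\<lambda>x. (\<Sum>i<N. (norm (AV s (e i) x))\<^sup>2) \<le> \<epsilon> / (1 - q) * (norm x)\<^sup>2"])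
  show "closed {x. (\<Sum>i<N. (norm (AV s (e i) x))\<^sup>2) \<le> \<epsilon> / (1 - q) * (norm x)\<^sup>2}"
    by (intro closed_Collect_le continuous_intros linear_continuous_on blinfun.bounded_linear_right)
  fix xs assume xs: "xs \<in> combos"
  have "AV s (e i) (lin \<Theta> xs) = lin (AVw s (e i)) xs" if "i < N" for i
    using e[OF that] xs by (subst blinfun_lin) (auto intro!: lin_cong AV_word simp: combos_iff)
  thus "(\<Sum>i<N. (norm (AV s (e i) (lin \<Theta> xs)))\<^sup>2) \<le> \<epsilon> / (1 - q) * (norm (lin \<Theta> xs))\<^sup>2"
    using AVw_bound[where N = N and e = e, OF s0 e orth eps e0 xs] by simp
qed

abbreviation G :: "'f op" where "G \<equiv> Gam (Vf q s)"

lemmas isomV = isom_Vf[OF s0]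
lemmas G_clinear [simp] = Gam_clinear[OF isomV]

lemma G_word: "set w \<subseteq> L2_fun \<Longrightarrow> G (\<Theta> w) = \<Theta> (map (Vf q s) w)"
  by (rule Gam_word[OF isomV])

lemma G_cr: "h \<in> L2_fun \<Longrightarrow> G (cr h x) = cr (Vf q s h) (G x)"
proof -
  assume h: "h \<in> L2_fun"
  have "G o\<^sub>L cr h = cr (Vf q s h) o\<^sub>L G"
    using h s0 isom_map[OF isomV] by (intro op_eqI) (auto simp: cr_word G_word)
  thus ?thesis by (metis blinfun_apply_blinfun_compose)
qed

text \<open>An annihilator passes \<open>G\<close> as soon as its contractions with transformed
  letters are a fixed multiple of other contractions, because the commutation relation is the only
  input. The cases of interest are c = q, for past functions and for \<open>tf\<close>, and c = 1,
  for \<open>Vf\<close>.\<close>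

lemma an_G:
  assumes k: "k \<in> L2_fun" and h: "h \<in> L2_fun"
    and kh: "\<And>g. g \<in> L2_fun \<Longrightarrow> L2_inner k (Vf q s g) = of_real c * L2_inner h g"
  shows "an k o\<^sub>L G = c *\<^sub>R (G o\<^sub>L an h)"
proof (rule op_eqI)
  fix w :: "(real \<Rightarrow> complex) list" assume w: "set w \<subseteq> L2_fun"
  have "an k (G (\<Theta> w)) = c *\<^sub>R G (an h (\<Theta> w))"
    using w
  proof (induction w)
    case Nil
    thus ?case using k h by (simp add: G_word blinfun.zero_right)
  next
    case (Cons g w)
    have g: "g \<in> L2_fun" and w: "set w \<subseteq> L2_fun" using Cons.prems by auto
    have "an k (G (cr g (\<Theta> w)))
       = c *\<^sub>R G (an h (cr g (\<Theta> w)))"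
      using Cons.IH[OF w] g k h s0
      by (simp add: G_cr an_cr_apply kh blinfun.add_right blinfun.scaleR_right clinear_opsD
          scaleR_add_right scaleR_scaleC scaleC_scaleC scaleC_add_right mult_ac)
    thus ?case using g w by (simp add: cr_word)
  qed
  thus "(an k o\<^sub>L G) (\<Theta> w) = (c *\<^sub>R (G o\<^sub>L an h)) (\<Theta> w)"
    by (simp add: blinfun.scaleR_left)
qed (use k h in auto)

lemma sp_L2 [simp]: "g \<in> L2_fun \<Longrightarrow> spread (s + 1) 0 g \<in> L2_fun" "g \<in> L2_fun \<Longrightarrow> spread (s + 1) 1 g \<in> L2_fun"
  using s0 by simp_all

lemma inner_lowf_Vf: "lowf s f \<Longrightarrow> g \<in> L2_fun \<Longrightarrow> L2_inner f (Vf q s g) = of_real q * L2_inner f g"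
  by (simp add: Vf_def L2_inner_add_right L2_inner_scale_right inner_low_spread lowf_L2 inner_lowf)

lemma inner_tf_Vf:
  assumes "h \<in> L2_fun" "g \<in> L2_fun" shows "L2_inner (tf q s h) (Vf q s g) = of_real q * L2_inner h g"
proof -
  have "L2_inner (tf q s h) (Vf q s g) = of_real q * L2_inner (lo s h) (lo s g) + of_real q * L2_inner (hi s h) (hi s g)"
    using assms s0 inner_low_spread[of s "lo s h"] inner_low_spread[of s "lo s g"]
    by (simp add: tf_def Vf_def L2_inner_add_left L2_inner_add_right L2_inner_scale_left L2_inner_scale_right
        L2_inner_spread L2_inner_spread_orth)
  thus ?thesis using inner_lo_hi[OF assms, of s] by (simp add: ring_distribs)
qed

lemma an_G_apply:
  "lowf s f \<Longrightarrow> an f (G x) = q *\<^sub>R G (an f x)"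
  "h \<in> L2_fun \<Longrightarrow> an (tf q s h) (G x) = q *\<^sub>R G (an h x)"
  using arg_cong[OF an_G[of f f q], of "\<lambda>T. blinfun_apply T x"] arg_cong[OF an_G[of "tf q s h" h q], of "\<lambda>T. blinfun_apply T x"] s0
  by (simp_all add: inner_lowf_Vf inner_tf_Vf blinfun.scaleR_left lowf_L2)

text \<open>Either the new front letter is passed, which applies \<open>tf\<close> to it, or it is
  contracted, and then all other letters stand behind it and are transformed by
  \<open>G\<close>.\<close>

lemma AV_cr:
  assumes e: "highf s e" and h: "h \<in> L2_fun"
  shows "AV s e (cr h x)
    = cr (tf q s h) (AV s e x) + L2_inner e h *\<^sub>C G x"
proof -
  have "AV s e o\<^sub>L cr h = (cr (tf q s h) o\<^sub>L AV s e) + op_scaleC (L2_inner e h) G"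
  proof (rule op_eqI)
    fix w :: "(real \<Rightarrow> complex) list" assume w: "set w \<subseteq> L2_fun"
    have "set (map (tf q s) (take r w) @ map (Vf q s) (drop (Suc r) w)) \<subseteq> L2_fun" for r
      using w s0 by (auto dest!: in_set_takeD in_set_dropD)
    hence "cr (tf q s h) (AVw s e w)
      = (\<Sum>r<length w. L2_inner e (w ! r) *\<^sub>C \<Theta> (tf q s h # map (tf q s) (take r w) @ map (Vf q s) (drop (Suc r) w)))"
      using h s0 unfolding AVw_def by (simp add: blinfun.sum_right clinear_opsD cr_word)
    thus "(AV s e o\<^sub>L cr h) (\<Theta> w) = ((cr (tf q s h) o\<^sub>L AV s e) + op_scaleC (L2_inner e h) G) (\<Theta> w)"
      using w h e by (simp add: cr_word AV_word G_word blinfun.add_left)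
        (simp add: AVw_def sum.lessThan_Suc_shift del: sum.lessThan_Suc)
  qed (use e h s0 in auto)
  hence "(AV s e o\<^sub>L cr h) x = ((cr (tf q s h) o\<^sub>L AV s e) + op_scaleC (L2_inner e h) G) x" by simp
  thus ?thesis by (simp add: blinfun.add_left)
qed

lemma tf_lowf: "lowf s f \<Longrightarrow> tf q s f = f"
proof -
  have "spread (s + 1) 0 (\<lambda>x. 0) = (\<lambda>x. 0)" by (auto simp: spread_def)
  thus "lowf s f \<Longrightarrow> tf q s f = f" by (simp add: tf_def lowf_eqs)
qed

lemma tf_highf: "highf s f \<Longrightarrow> tf q s f = (\<lambda>t. of_real q * spread (s + 1) 0 f t)"
  by (simp add: tf_def lowf_eqs)

text \<open>Induction over the word. In both orders the front letter is contracted with f, passed,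
  or contracted with e. The first case agrees since \<open>tf\<close> keeps past parts, the last
  since the past annihilator passes \<open>G\<close> with the very factor q that it pays for passing
  the letter.\<close>

lemma AV_an:
  assumes e: "highf s e" and f: "lowf s f"
  shows "AV s e o\<^sub>L an f = an f o\<^sub>L AV s e"
proof (rule op_eqI)
  have fL: "f \<in> L2_fun" using f by (rule lowf_L2)
  fix w :: "(real \<Rightarrow> complex) list" assume w: "set w \<subseteq> L2_fun"
  thus "(AV s e o\<^sub>L an f) (\<Theta> w) = (an f o\<^sub>L AV s e) (\<Theta> w)"
  proof (induction w)
    case Nil
    thus ?case using fL e by (simp add: AV_vac blinfun.zero_right)
  next
    case (Cons h w)
    have h: "h \<in> L2_fun" and w: "set w \<subseteq> L2_fun" using Cons.prems by auto
    have "L2_inner f (tf q s h) = L2_inner f (lo s h)"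
      using f h by (simp add: tf_def L2_inner_add_right L2_inner_scale_right inner_low_spread fL)
    hence ip: "L2_inner f (tf q s h) = L2_inner f h" using inner_lowf[OF f h] by simp
    have "AV s e (an f (cr h (\<Theta> w)))
       = an f (AV s e (cr h (\<Theta> w)))"
      using Cons.IH[OF w] h fL e s0 f
      by (simp add: AV_cr an_cr_apply an_G_apply ip blinfun.add_right blinfun.scaleR_right clinear_opsD
          scaleR_add_right scaleR_scaleC scaleC_scaleC scaleC_add_right mult_ac)
    thus ?case using h w by (simp add: cr_word)
  qed
qed (use e f lowf_L2 in auto)

lemma AV_Xop:
  assumes e: "highf s e" and f: "lowf s f"
  shows "AV s e o\<^sub>L Xop f = Xop f o\<^sub>L AV s e"
proof (rule blinfun_eqI)
  fix x
  have "AV s e (an f x) = an f (AV s e x)"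
    using arg_cong[OF AV_an[OF e f], of "\<lambda>T. blinfun_apply T x"] by simp
  thus "(AV s e o\<^sub>L Xop f) x = (Xop f o\<^sub>L AV s e) x"
    using f e by (simp add: Xop_def blinfun.add_left blinfun.add_right AV_cr lowf_L2 tf_lowf inner_low_high)
qed

lemma adjG_G: "adj G (G x) = x"
proof -
  have "adj G o\<^sub>L G = id_blinfun"
  proof (rule op_eqI)
    fix w :: "(real \<Rightarrow> complex) list" assume w: "set w \<subseteq> L2_fun"
    show "(adj G o\<^sub>L G) (\<Theta> w) = id_blinfun (\<Theta> w)"
    proof (rule vec_eqI)
      fix v :: "(real \<Rightarrow> complex) list" assume v: "set v \<subseteq> L2_fun"
      have "q_inner q (map (Vf q s) v) (map (Vf q s) w) = q_inner q v w"
        using v w isomD[OF isomV] by (intro q_inner_cong) (auto simp: subset_iff)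
      thus "cinner (\<Theta> v) ((adj G o\<^sub>L G) (\<Theta> w)) = cinner (\<Theta> v) (id_blinfun (\<Theta> w))"
        using v w isom_map[OF isomV v] isom_map[OF isomV w] by (simp add: cinner_adj' G_word cinner_words)
    qed
  qed auto
  thus ?thesis by (metis blinfun_apply_blinfun_compose id_blinfun.rep_eq)
qed

text \<open>The adjoint of the relation by which \<open>an (tf q s h)\<close> passes
  \<open>G\<close>.\<close>

lemma adjG_cr:
  assumes "h \<in> L2_fun"
  shows "adj G (cr (tf q s h) x) = q *\<^sub>R cr h (adj G x)"
proof (rule vec_eqI)
  fix v :: "(real \<Rightarrow> complex) list"
  have "cinner (\<Theta> v) (adj G (cr (tf q s h) x))
    = cinner (an (tf q s h) (G (\<Theta> v))) x"
    using assms s0 by (simp add: cinner_adj' cinner_adj[of "cr (tf q s h)", symmetric])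
  also have "\<dots> = of_real q * cinner (\<Theta> v) (cr h (adj G x))"
    using assms s0 by (simp add: an_G_apply cinner_scaleR_left cinner_adj' cinner_adj[of "cr h", symmetric])
  finally show "cinner (\<Theta> v) (adj G (cr (tf q s h) x))
    = cinner (\<Theta> v) (q *\<^sub>R cr h (adj G x))"
    by (simp add: cinner_scaleR_right)
qed

text \<open>After multiplication by \<open>adj G\<close>, the recursion of \<open>AV s e\<close>
  along the front letter becomes that of \<open>an e\<close>: a passed letter regains its factor q,
  and \<open>adj G\<close> times \<open>G\<close> is the identity.\<close>

lemma adjG_AV:
  assumes e: "highf s e" shows "adj G o\<^sub>L AV s e = an e"
proof (rule op_eqI)
  have eL: "e \<in> L2_fun" using e by (rule highf_L2)
  fix w :: "(real \<Rightarrow> complex) list" assume w: "set w \<subseteq> L2_fun"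
  thus "(adj G o\<^sub>L AV s e) (\<Theta> w) = an e (\<Theta> w)"
  proof (induction w)
    case Nil
    thus ?case using eL e by (simp add: AV_vac blinfun.zero_right)
  next
    case (Cons h w)
    have h: "h \<in> L2_fun" and w: "set w \<subseteq> L2_fun" using Cons.prems by auto
    have "adj G (AV s e (cr h (\<Theta> w))) = an e (cr h (\<Theta> w))"
      using Cons.IH[OF w] h eL e by (simp add: AV_cr an_cr_apply blinfun.add_right adjG_cr adjG_G clinear_opsD)
    thus ?case using h w by (simp add: cr_word)
  qed
qed (use e highf_L2 in auto)

text \<open>
  Compression to \<open>s\<close> of \<open>b\<close> between two future increments. On operators of the past it is the
  honest product, but it is defined and satisfies the same bounds for every bounded operator \<open>b\<close>.
\<close>

definition Gt :: "'f op \<Rightarrow> 'f op" where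
  "Gt b = adj G o\<^sub>L b o\<^sub>L G"

definition Qt :: "'f op \<Rightarrow> (real \<Rightarrow> complex) \<Rightarrow> (real \<Rightarrow> complex) \<Rightarrow> 'f op" where
  "Qt b u v = (cr u o\<^sub>L b o\<^sub>L an v) + (cr u o\<^sub>L b o\<^sub>L cr v) + (an u o\<^sub>L b o\<^sub>L an v)
     + op_scaleC (L2_inner u v) (Gt b) + q *\<^sub>R (adj G o\<^sub>L b o\<^sub>L cr (spread (s + 1) 0 v) o\<^sub>L AV s u)"

text \<open>Characterised by the very commutation that the product formula uses; by
  \<open>B_past\<close> it contains the von Neumann algebra of the fields up to s.\<close>

definition past :: "'f op set" where
  "past = {b. b \<in> clinear_ops \<and> (\<forall>e. highf s e \<longrightarrow> AV s e o\<^sub>L b = b o\<^sub>L AV s e)}"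

text \<open>Write \<open>an u\<close> as \<open>adj G\<close> times \<open>AV s u\<close>, move
  \<open>AV s u\<close> through b and let it meet \<open>cr v\<close>: passing v gives the last term
  of \<open>Qt\<close>, contracting v gives the multiple \<langle>u, v\<rangle> of the
  compression.\<close>

lemma Qt_eq:
  assumes b: "b \<in> past" and u: "highf s u" and v: "highf s v"
  shows "Qt b u v = Xop u o\<^sub>L b o\<^sub>L Xop v"
proof (rule blinfun_eqI)
  fix x
  have uL: "u \<in> L2_fun" and vL: "v \<in> L2_fun" using u v highf_L2 by auto
  have bc: "b \<in> clinear_ops" using b by (simp add: past_def)
  have AVb: "AV s u (b y) = b (AV s u y)" for y
  proof -
    have "AV s u o\<^sub>L b = b o\<^sub>L AV s u" using b u by (simp add: past_def)
    from arg_cong[OF this, of "\<lambda>T. blinfun_apply T y"] show ?thesis by simp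
  qed
  have "an u (b (cr v x))
     = adj G (AV s u (b (cr v x)))"
    unfolding adjG_AV[OF u, symmetric] by simp
  also have "\<dots> = q *\<^sub>R adj G (b (cr (spread (s + 1) 0 v) (AV s u x)))
      + L2_inner u v *\<^sub>C adj G (b (G x))"
    using vL bc by (simp add: AVb AV_cr[OF u] tf_highf[OF v] cr_scale blinfun.add_right clinear_opsD scaleR_scaleC)
  finally show "(Qt b u v) x = (Xop u o\<^sub>L b o\<^sub>L Xop v) x"
    by (simp add: Qt_def Gt_def Xop_def blinfun.add_left blinfun.add_right blinfun.scaleR_left algebra_simps)
qed

lemma norm_Gt: "norm (Gt b) \<le> norm b"
proof -
  have "norm (Gt b) \<le> norm (adj G) * norm b * norm G" unfolding Gt_def
    by (meson mult_right_mono norm_blinfun_compose norm_ge_zero order_trans)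
  also have "\<dots> \<le> 1 * norm b * 1"
    using norm_Gam[OF isomV] norm_adj[of G] by (intro mult_mono) auto
  finally show ?thesis by simp
qed

lemma norm_adjG: "norm (adj G x) \<le> norm x"
proof -
  have "norm (adj G x) \<le> norm (adj G) * norm x" by (rule norm_blinfun)
  also have "\<dots> \<le> 1 * norm x" using norm_Gam[OF isomV] norm_adj[of G] by (intro mult_right_mono) auto
  finally show ?thesis by simp
qed

lemma row_cr:
  fixes N :: nat
  assumes "\<And>i. i < N \<Longrightarrow> u i \<in> L2_fun"
    "\<And>i j. i < N \<Longrightarrow> j < N \<Longrightarrow> i \<noteq> j \<Longrightarrow> L2_inner (u i) (u j) = 0"
    "\<And>i. i < N \<Longrightarrow> (l2 (u i))\<^sup>2 \<le> \<epsilon>" "0 \<le> \<epsilon>"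
    "(\<Sum>i<N. (norm (x i))\<^sup>2) \<le> B\<^sup>2" "0 \<le> B"
  shows "norm (\<Sum>i<N. (cr (u i)) (x i)) \<le> sqrt (\<epsilon> / (1 - q)) * B"
proof (rule power2_le_imp_le)
  have "(norm (\<Sum>i<N. (cr (u i)) (x i)))\<^sup>2 \<le> \<epsilon> / (1 - q) * (\<Sum>i<N. (norm (x i))\<^sup>2)"
    using assms q1 column_bound[of N u \<epsilon>] by (intro row_bound) auto
  also have "\<dots> \<le> \<epsilon> / (1 - q) * B\<^sup>2" using assms q1 by (intro mult_left_mono) auto
  finally show "(norm (\<Sum>i<N. (cr (u i)) (x i)))\<^sup>2 \<le> (sqrt (\<epsilon> / (1 - q)) * B)\<^sup>2"
    using assms q1 by (simp add: power_mult_distrib)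
qed (use assms q1 in simp)

text \<open>In each product at least one factor runs through a bounded row or column, so N terms
  cost at most the square root of N. The contractions of \<open>u i\<close> with \<open>v i\<close>
  have to vanish: their terms are multiples of one and the same operator and could add up to order
  N.\<close>

lemma norm_sum_Qt:
  fixes N :: nat
  assumes u: "\<And>i. i < N \<Longrightarrow> highf s (u i)" and v: "\<And>i. i < N \<Longrightarrow> highf s (v i)"
    and uo: "\<And>i j. i < N \<Longrightarrow> j < N \<Longrightarrow> i \<noteq> j \<Longrightarrow> L2_inner (u i) (u j) = 0"
    and vo: "\<And>i j. i < N \<Longrightarrow> j < N \<Longrightarrow> i \<noteq> j \<Longrightarrow> L2_inner (v i) (v j) = 0"
    and ue: "\<And>i. i < N \<Longrightarrow> (l2 (u i))\<^sup>2 \<le> \<epsilon>" and ve: "\<And>i. i < N \<Longrightarrow> (l2 (v i))\<^sup>2 \<le> \<epsilon>" and e0: "0 \<le> \<epsilon>"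
    and uv: "\<And>i. i < N \<Longrightarrow> L2_inner (u i) (v i) = 0"
  shows "norm (\<Sum>i<N. Qt b (u i) (v i)) \<le> 4 / (1 - q) * \<epsilon> * sqrt (real N) * norm b"
proof (cases "N = 0")
  case False
  define \<kappa> where "\<kappa> = \<epsilon> / (1 - q)"
  have k0: "0 \<le> \<kappa>" using e0 q1 by (simp add: \<kappa>_def)
  have N1: "1 \<le> sqrt (real N)" using False by simp
  have uL: "u i \<in> L2_fun" and vL: "v i \<in> L2_fun" if "i < N" for i using u v that highf_L2 by blast+
  have small: "norm T \<le> sqrt \<kappa>" if T: "norm T \<le> l2 f / sqrt (1 - q)" "(l2 f)\<^sup>2 \<le> \<epsilon>" for f and T :: "'f op"
  proof -
    have "l2 f \<le> sqrt \<epsilon>" using T(2) by (simp add: real_le_rsqrt)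
    thus ?thesis using T(1) q1 by (simp add: \<kappa>_def real_sqrt_divide divide_right_mono order_trans)
  qed
  show ?thesis
  proof (rule norm_blinfun_bound)
    fix x :: 'f
    let ?b = "norm b" and ?x = "norm x"
    have anv: "(\<Sum>i<N. (norm (an (v i) x))\<^sup>2) \<le> \<kappa> * ?x\<^sup>2"
      unfolding \<kappa>_def by (rule column_bound) (auto intro: vL vo ve e0)
    have AVu: "(\<Sum>i<N. (norm (AV s (u i) x))\<^sup>2) \<le> \<kappa> * ?x\<^sup>2"
      unfolding \<kappa>_def by (rule AV_column_bound) (auto intro: u uo ue e0)
    have 1: "norm (\<Sum>i<N. (cr (u i)) (b (an (v i) x))) \<le> sqrt \<kappa> * (?b * sqrt \<kappa> * ?x)"
      unfolding \<kappa>_def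
    proof (rule row_cr)
      have "(\<Sum>i<N. (norm (b (an (v i) x)))\<^sup>2) \<le> (\<Sum>i<N. ?b\<^sup>2 * (norm (an (v i) x))\<^sup>2)"
        by (intro sum_mono) (metis norm_blinfun norm_ge_zero power_mono power_mult_distrib)
      also have "\<dots> \<le> ?b\<^sup>2 * (\<kappa> * ?x\<^sup>2)" unfolding sum_distrib_left[symmetric] by (intro mult_left_mono anv) auto
      finally show "(\<Sum>i<N. (norm (b (an (v i) x)))\<^sup>2) \<le> (?b * sqrt (\<epsilon> / (1 - q)) * ?x)\<^sup>2"
        using k0 by (simp add: power_mult_distrib \<kappa>_def mult_ac)
    qed (use uL uo ue e0 k0 in \<open>auto simp: \<kappa>_def\<close>)
    have 2: "norm (\<Sum>i<N. (cr (u i)) (b (cr (v i) x))) \<le> sqrt \<kappa> * (?b * sqrt \<kappa> * sqrt (real N) * ?x)"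
      unfolding \<kappa>_def
    proof (rule row_cr)
      have "(\<Sum>i<N. (norm (b (cr (v i) x)))\<^sup>2) \<le> (\<Sum>i<N. (?b * (sqrt \<kappa> * ?x))\<^sup>2)"
      proof (intro sum_mono power_mono)
        fix i assume "i \<in> {..<N}"
        hence "norm (cr (v i)) \<le> sqrt \<kappa>" using small[OF norm_cr ve] vL by simp
        hence "norm (cr (v i) x) \<le> sqrt \<kappa> * ?x"
          by (meson mult_right_mono norm_blinfun norm_ge_zero order_trans)
        thus "norm (b (cr (v i) x)) \<le> ?b * (sqrt \<kappa> * ?x)"
          by (meson mult_left_mono norm_blinfun norm_ge_zero order_trans)
      qed auto
      thus "(\<Sum>i<N. (norm (b (cr (v i) x)))\<^sup>2) \<le> (?b * sqrt (\<epsilon> / (1 - q)) * sqrt (real N) * ?x)\<^sup>2"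
        by (simp add: power_mult_distrib \<kappa>_def mult_ac)
    qed (use uL uo ue e0 k0 in \<open>auto simp: \<kappa>_def\<close>)
    have 3: "norm (\<Sum>i<N. (an (u i)) (b (an (v i) x))) \<le> sqrt \<kappa> * (?b * (sqrt (real N) * (sqrt \<kappa> * ?x)))"
    proof -
      have "norm (\<Sum>i<N. (an (u i)) (b (an (v i) x)))
        \<le> (\<Sum>i<N. sqrt \<kappa> * (?b * norm (an (v i) x)))"
      proof (intro sum_norm_le)
        fix i assume "i \<in> {..<N}"
        hence "norm (an (u i)) \<le> sqrt \<kappa>" using small[OF norm_an ue] uL by simp
        hence "norm (an (u i)) * norm (b (an (v i) x)) \<le> sqrt \<kappa> * (?b * norm (an (v i) x))"
          using k0 by (intro mult_mono norm_blinfun) auto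
        thus "norm (an (u i) (b (an (v i) x))) \<le> sqrt \<kappa> * (?b * norm (an (v i) x))"
          by (rule order_trans[OF norm_blinfun])
      qed
      also have "\<dots> = sqrt \<kappa> * (?b * (\<Sum>i<N. 1 * norm (an (v i) x)))"
        by (simp add: sum_distrib_left)
      also have "(\<Sum>i<N. 1 * norm (an (v i) x)) \<le> sqrt (real N) * (sqrt \<kappa> * ?x)"
      proof (rule power2_le_imp_le)
        have "(\<Sum>i<N. 1 * norm (an (v i) x))\<^sup>2 \<le> (\<Sum>i<N. 1\<^sup>2) * (\<Sum>i<N. (norm (an (v i) x))\<^sup>2)"
          by (rule Cauchy_Schwarz_ineq_sum)
        also have "\<dots> \<le> real N * (\<kappa> * ?x\<^sup>2)" using anv by (simp add: mult_left_mono)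
        finally show "(\<Sum>i<N. 1 * norm (an (v i) x))\<^sup>2 \<le> (sqrt (real N) * (sqrt \<kappa> * ?x))\<^sup>2"
          using k0 by (simp add: power_mult_distrib mult_ac)
      qed (use k0 in simp)
      finally show ?thesis using k0 by (simp add: mult_left_mono)
    qed
    \<comment> \<open>Both factors are bounded families here: the column of the
      \<open>AV s (u i)\<close> feeds the row of creators, uniformly in N.\<close>
    have 5: "norm (adj G (b (\<Sum>i<N. (cr (spread (s + 1) 0 (v i))) (AV s (u i) x))))
        \<le> ?b * (sqrt \<kappa> * (sqrt \<kappa> * ?x))"
    proof -
      have "norm (\<Sum>i<N. (cr (spread (s + 1) 0 (v i))) (AV s (u i) x)) \<le> sqrt (\<epsilon> / (1 - q)) * (sqrt \<kappa> * ?x)"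
      proof (rule row_cr)
        have ip: "L2_inner (spread (s + 1) 0 (v i)) (spread (s + 1) 0 (v j)) = L2_inner (v i) (v j)" if "i < N" "j < N" for i j
          using s0 vL that by (simp add: L2_inner_spread)
        show "L2_inner (spread (s + 1) 0 (v i)) (spread (s + 1) 0 (v j)) = 0" if "i < N" "j < N" "i \<noteq> j" for i j
          using ip vo that by simp
        show "(l2 (spread (s + 1) 0 (v i)))\<^sup>2 \<le> \<epsilon>" if "i < N" for i
        proof -
          have "complex_of_real ((l2 (spread (s + 1) 0 (v i)))\<^sup>2) = complex_of_real ((l2 (v i))\<^sup>2)"
            using l2_sq[OF sp_L2(1)[OF vL[OF that]]] l2_sq[OF vL[OF that]] ip[OF that that] by simp
          thus ?thesis using ve[OF that] of_real_eq_iff by metis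
        qed
        show "(\<Sum>i<N. (norm (AV s (u i) x))\<^sup>2) \<le> (sqrt \<kappa> * ?x)\<^sup>2"
          using AVu k0 by (simp add: power_mult_distrib)
      qed (use vL e0 k0 in auto)
      thus ?thesis unfolding \<kappa>_def[symmetric]
        by (intro order_trans[OF norm_adjG] order_trans[OF norm_blinfun] mult_left_mono) auto
    qed
    have sq: "sqrt \<kappa> * sqrt \<kappa> = \<kappa>" using k0 by simp
    have "(\<Sum>i<N. Qt b (u i) (v i)) x
      = (\<Sum>i<N. (cr (u i)) (b (an (v i) x)))
      + (\<Sum>i<N. (cr (u i)) (b (cr (v i) x)))
      + (\<Sum>i<N. (an (u i)) (b (an (v i) x)))
      + q *\<^sub>R adj G (b (\<Sum>i<N. (cr (spread (s + 1) 0 (v i))) (AV s (u i) x)))"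
      using uv by (simp add: blinfun.sum_left Qt_def blinfun.add_left blinfun.scaleR_left sum.distrib
          blinfun.sum_right scaleR_sum_right)
    also have "norm \<dots> \<le> sqrt \<kappa> * (?b * sqrt \<kappa> * ?x) + sqrt \<kappa> * (?b * sqrt \<kappa> * sqrt (real N) * ?x)
      + sqrt \<kappa> * (?b * (sqrt (real N) * (sqrt \<kappa> * ?x))) + 1 * (?b * (sqrt \<kappa> * (sqrt \<kappa> * ?x)))"
      using q0 q1 by (intro norm_triangle_mono 1 2 3, unfold norm_scaleR) (intro mult_mono 5, auto)
    also have "\<dots> = \<kappa> * ?b * ?x * (2 + 2 * sqrt (real N))"
    proof -
      have "a * (?b * a * ?x) + a * (?b * a * m * ?x) + a * (?b * (m * (a * ?x))) + 1 * (?b * (a * (a * ?x)))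
        = (a * a) * ?b * ?x * (2 + 2 * m)" for a m :: real by (simp add: algebra_simps)
      from this[of "sqrt \<kappa>" "sqrt (real N)"] show ?thesis unfolding sq .
    qed
    also have "\<dots> \<le> \<kappa> * ?b * ?x * (4 * sqrt (real N))"
      using N1 k0 by (intro mult_left_mono) auto
    finally show "norm ((\<Sum>i<N. Qt b (u i) (v i)) x) \<le> 4 / (1 - q) * \<epsilon> * sqrt (real N) * ?b * ?x"
      by (simp add: \<kappa>_def mult_ac)
  qed (use e0 q1 in simp)
qed simp

text \<open>The constant 5 counts the terms of \<open>Qt\<close>; each of them is at most
  \<open>l2 u * l2 v * norm b / (1 - q)\<close>.\<close>

lemma norm_Qt:
  assumes u: "highf s u" and v: "highf s v"
  shows "norm (Qt b u v) \<le> 5 / (1 - q) * l2 u * l2 v * norm b"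
proof -
  have uL: "u \<in> L2_fun" and vL: "v \<in> L2_fun" using u v highf_L2 by blast+
  define r where "r = 1 / sqrt (1 - q)"
  have r0: "0 \<le> r" and r1: "1 \<le> r * r" and rr: "r * r = 1 / (1 - q)" using q0 q1 by (simp_all add: r_def)
  have c3: "norm (A o\<^sub>L b o\<^sub>L B) \<le> (l2 u * r) * norm b * (l2 v * r)"
    if "norm A \<le> l2 u * r" "norm B \<le> l2 v * r" for A B :: "'f op"
  proof -
    have "norm (A o\<^sub>L b o\<^sub>L B) \<le> norm A * norm b * norm B"
      by (meson mult_right_mono norm_blinfun_compose norm_ge_zero order_trans)
    also have "\<dots> \<le> (l2 u * r) * norm b * (l2 v * r)"
      using that r0 by (intro mult_mono) auto
    finally show ?thesis .
  qed
  have lv: "l2 (spread (s + 1) 0 v) = l2 v"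
  proof -
    have "complex_of_real ((l2 (spread (s + 1) 0 v))\<^sup>2) = complex_of_real ((l2 v)\<^sup>2)"
      using l2_sq[OF sp_L2(1)[OF vL]] l2_sq[OF vL] s0 vL by (simp add: L2_inner_spread)
    thus ?thesis using l2_nonneg power2_eq_imp_eq of_real_eq_iff by metis
  qed
  have 5: "norm (adj G o\<^sub>L b o\<^sub>L cr (spread (s + 1) 0 v) o\<^sub>L AV s u) \<le> 1 * norm b * (l2 v * r) * (l2 u * r)"
  proof -
    have "norm (adj G o\<^sub>L b o\<^sub>L cr (spread (s + 1) 0 v) o\<^sub>L AV s u) \<le> norm (adj G) * norm b * norm (cr (spread (s + 1) 0 v)) * norm (AV s u)"
      by (meson mult_right_mono norm_blinfun_compose norm_ge_zero order_trans)
    also have "\<dots> \<le> 1 * norm b * (l2 v * r) * (l2 u * r)"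
      using norm_Gam[OF isomV] norm_adj[of G] norm_cr[OF sp_L2(1)[OF vL]] norm_AV[OF u] lv r0
      by (intro mult_mono) (auto simp: r_def)
    finally show ?thesis .
  qed
  have 4: "norm (op_scaleC (L2_inner u v) (Gt b)) \<le> l2 u * l2 v * norm b"
  proof -
    have "cmod (L2_inner u v) \<le> l2 u * l2 v"
      using cmod_cinner_le[of "\<Theta> [u]" "\<Theta> [v]"] uL vL
      by (simp add: l2_def cinner_words q_inner_Cons q_inner_Nil)
    thus ?thesis by (intro order_trans[OF norm_op_scaleC] mult_mono norm_Gt) auto
  qed
  have "norm (Qt b u v) \<le> (l2 u * r) * norm b * (l2 v * r) + (l2 u * r) * norm b * (l2 v * r) + (l2 u * r) * norm b * (l2 v * r)
     + l2 u * l2 v * norm b + 1 * (1 * norm b * (l2 v * r) * (l2 u * r))"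
    unfolding Qt_def
  proof (intro norm_triangle_mono c3 4)
    show "norm (q *\<^sub>R (adj G o\<^sub>L b o\<^sub>L cr (spread (s + 1) 0 v) o\<^sub>L AV s u)) \<le> 1 * (1 * norm b * (l2 v * r) * (l2 u * r))"
      unfolding norm_scaleR using q0 q1 5 by (intro mult_mono) auto
  qed (use norm_cr[OF uL] norm_cr[OF vL] norm_an[OF uL] norm_an[OF vL] in \<open>simp_all add: r_def\<close>)
  also have "\<dots> = l2 u * l2 v * norm b * (4 * (r * r) + 1)" by (simp add: algebra_simps)
  also have "\<dots> \<le> l2 u * l2 v * norm b * (5 * (r * r))" using r1 by (intro mult_left_mono) auto
  finally show ?thesis by (simp add: rr mult_ac)
qed

end

end

section \<open>The algebras of the past, and second quantisation as a compression\<close>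

section \<open>The past algebras and the second quantisation\<close>

lemma adj_alg: 
  assumes "X \<subseteq> clinear_ops" "\<And>T. T \<in> X \<Longrightarrow> adj T = T" "T \<in> alg_generated X"
  shows "T \<in> clinear_ops \<and> adj T \<in> alg_generated X"
  using assms(3)
proof (induction rule: alg_generated.induct)
  case (gen T)
  thus ?case using assms by (auto intro: alg_generated.gen)
qed (use assms in \<open>auto simp: adj_scaleC adj_add adj_comp intro: alg_generated.intros\<close>)

lemma closure_alg_limit:
  assumes "T \<in> closure (alg_generated X)" 
  obtains f where "\<And>n. f n \<in> alg_generated X" "f \<longlonglongrightarrow> T"
  using assms unfolding closure_sequential by blast

lemma closure_alg_closed:
  fixes X :: "'f::complex_hilbert op set"
  defines "A \<equiv> closure (alg_generated X)"
  shows "id_blinfun \<in> A" "S \<in> A \<Longrightarrow> T \<in> A \<Longrightarrow> S + T \<in> A" "S \<in> A \<Longrightarrow> T \<in> A \<Longrightarrow> S o\<^sub>L T \<in> A"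
    "T \<in> A \<Longrightarrow> op_scaleC c T \<in> A" "T \<in> X \<Longrightarrow> T \<in> A"
    "X \<subseteq> clinear_ops \<Longrightarrow> (\<And>T. T \<in> X \<Longrightarrow> adj T = T) \<Longrightarrow> T \<in> A \<Longrightarrow> T \<in> clinear_ops \<and> adj T \<in> A"
proof -
  show "id_blinfun \<in> A" "T \<in> X \<Longrightarrow> T \<in> A"
    unfolding A_def by (rule subsetD[OF closure_subset], rule alg_generated.unit)
      (rule subsetD[OF closure_subset], rule alg_generated.gen)
  show "S + T \<in> A" "S o\<^sub>L T \<in> A" if ST: "S \<in> A" "T \<in> A"
  proof -
    obtain f where f: "\<And>n. f n \<in> alg_generated X" "f \<longlonglongrightarrow> S"
      using closure_alg_limit[OF ST(1)[unfolded A_def]] by blast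
    obtain g where g: "\<And>n. g n \<in> alg_generated X" "g \<longlonglongrightarrow> T"
      using closure_alg_limit[OF ST(2)[unfolded A_def]] by blast
    show "S + T \<in> A" unfolding A_def closure_sequential
      by (rule exI[of _ "\<lambda>n. f n + g n"]) (intro conjI allI alg_generated.add f g tendsto_add)
    show "S o\<^sub>L T \<in> A" unfolding A_def closure_sequential
      by (rule exI[of _ "\<lambda>n. f n o\<^sub>L g n"])
        (intro conjI allI alg_generated.mult f g bounded_bilinear.tendsto[OF bounded_bilinear_blinfun_compose])
  qed
  show "op_scaleC c T \<in> A" if T: "T \<in> A"
  proof -
    obtain f where f: "\<And>n. f n \<in> alg_generated X" "f \<longlonglongrightarrow> T"
      using closure_alg_limit[OF T[unfolded A_def]] by blast
    show ?thesis unfolding A_def closure_sequential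
      by (rule exI[of _ "\<lambda>n. op_scaleC c (f n)"])
        (intro conjI allI alg_generated.scale f bounded_linear.tendsto[OF bounded_linear_op_scaleC])
  qed
  show "T \<in> clinear_ops \<and> adj T \<in> A" if X: "X \<subseteq> clinear_ops" "\<And>T. T \<in> X \<Longrightarrow> adj T = T" and T: "T \<in> A"
  proof -
    obtain f where f: "\<And>n. f n \<in> alg_generated X" "f \<longlonglongrightarrow> T"
      using closure_alg_limit[OF T[unfolded A_def]] by blast
    have c: "f n \<in> clinear_ops" "adj (f n) \<in> alg_generated X" for n using adj_alg[OF X f(1)] by auto
    have "T \<in> clinear_ops" by (rule clinear_ops_limit[OF _ f(2) c(1)]) simp
    moreover have "(\<lambda>n. adj (f n)) \<longlonglongrightarrow> adj T" by (rule adj_limit[OF _ f(2) c(1)]) simp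
    ultimately show ?thesis unfolding A_def closure_sequential
      by (intro conjI exI[of _ "\<lambda>n. adj (f n)"]) (auto intro: c)
  qed
qed

context qfock
begin

abbreviation A_upto :: "real \<Rightarrow> 'f op set" where "A_upto \<equiv> qA_upto \<Theta>"
abbreviation B_upto :: "real \<Rightarrow> 'f op set" where "B_upto \<equiv> qB_upto \<Theta>"
abbreviation AA :: "'f op set" where "AA \<equiv> qA \<Theta>"
abbreviation ind :: "real \<Rightarrow> real \<Rightarrow> complex" where "ind t \<equiv> indicator {0..t}"

lemma qBM_Xop: "qBM \<Theta> t = Xop (ind t)"
  by (simp add: qBM_def Xop_def)

lemma Xop_add: "f \<in> L2_fun \<Longrightarrow> g \<in> L2_fun \<Longrightarrow> Xop (\<lambda>x. f x + g x) = Xop f + Xop g"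
  by (simp add: Xop_def an_add cr_add)

lemma dX_Xop: "0 \<le> u \<Longrightarrow> u \<le> v \<Longrightarrow> dX \<Theta> u v = Xop (ivl u v)"
proof -
  assume "0 \<le> u" "u \<le> v"
  hence "ind v = (\<lambda>x. ind u x + ivl u v x)" by (auto simp: indicator_def)
  thus ?thesis using Xop_add[of "ind u" "ivl u v"] by (simp add: dX_def qBM_Xop)
qed

lemma lowf_ind: "t \<le> s \<Longrightarrow> lowf s (ind t)"
  by (auto simp: lowf_def indicator_def)

lemma highf_ivl: "s \<le> u \<Longrightarrow> highf s (ivl u v)"
  by (auto simp: highf_def indicator_def)

lemma real_ind: "real_fun (ind t)"
  by (auto simp: real_fun_def indicator_def)

lemma qBM_sa: "qBM \<Theta> ` I \<subseteq> clinear_ops" "T \<in> qBM \<Theta> ` I \<Longrightarrow> adj T = T" "adj ` qBM \<Theta> ` I \<subseteq> qBM \<Theta> ` I"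
  by (auto simp: qBM_Xop adj_Xop)

lemma alg_subset_vN: "alg_generated X \<subseteq> vN_generated X"
proof
  fix T assume "T \<in> alg_generated X"
  thus "T \<in> vN_generated X"
    by induction (auto intro: vN_generated_closed(1-4) vN_generated_mem)
qed

lemma A_subset_B: "A_upto s \<subseteq> B_upto s"
proof
  fix T assume "T \<in> A_upto s"
  then obtain f where f: "\<And>n. f n \<in> alg_generated (qBM \<Theta> ` {0..s})" "f \<longlonglongrightarrow> T"
    unfolding qA_upto_def by (rule closure_alg_limit) blast
  show "T \<in> B_upto s" unfolding qB_upto_def
    by (rule vN_generated_closed(5)[OF _ f(2)]) (use f(1) alg_subset_vN in auto)
qed

lemma B_subset_AA: "B_upto s \<subseteq> AA"
  unfolding qB_upto_def qA_def by (intro vN_generated_mono) auto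

lemma A_subset_AA: "T \<in> A_upto s \<Longrightarrow> T \<in> AA"
  using A_subset_B B_subset_AA by blast

lemma A_mono: "s \<le> t \<Longrightarrow> A_upto s \<subseteq> A_upto t"
proof -
  assume "s \<le> t"
  have "alg_generated X \<subseteq> alg_generated Y" if "X \<subseteq> Y" for X Y :: "'f op set"
  proof
    fix T assume "T \<in> alg_generated X"
    thus "T \<in> alg_generated Y" by induction (use that in \<open>auto intro: alg_generated.intros\<close>)
  qed
  moreover have "qBM \<Theta> ` {0..s} \<subseteq> qBM \<Theta> ` {0..t}" using \<open>s \<le> t\<close> by (intro image_mono) auto
  ultimately show ?thesis unfolding qA_upto_def by (intro closure_mono) blast
qed

lemma A_closed:
  "id_blinfun \<in> A_upto s" "S \<in> A_upto s \<Longrightarrow> T \<in> A_upto s \<Longrightarrow> S + T \<in> A_upto s"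
  "S \<in> A_upto s \<Longrightarrow> T \<in> A_upto s \<Longrightarrow> S o\<^sub>L T \<in> A_upto s" "T \<in> A_upto s \<Longrightarrow> op_scaleC c T \<in> A_upto s"
  "T \<in> qBM \<Theta> ` {0..s} \<Longrightarrow> T \<in> A_upto s"
  unfolding qA_upto_def by (fact closure_alg_closed)+

lemma A_adj: "T \<in> A_upto s \<Longrightarrow> adj T \<in> A_upto s" and A_clinear: "T \<in> A_upto s \<Longrightarrow> T \<in> clinear_ops"
  using closure_alg_closed(6)[of "qBM \<Theta> ` {0..s}" T] qBM_sa unfolding qA_upto_def by blast+

lemma A_scaleR: "T \<in> A_upto s \<Longrightarrow> r *\<^sub>R T \<in> A_upto s"
  using A_closed(4)[of T s "of_real r"] by (simp add: op_scaleC_real)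

lemma A_diff: "S \<in> A_upto s \<Longrightarrow> T \<in> A_upto s \<Longrightarrow> S - T \<in> A_upto s"
  using A_closed(2)[of S s "- 1 *\<^sub>R T"] A_scaleR[of T s "-1"] by simp

lemma A_zero: "0 \<in> A_upto s"
  using A_scaleR[OF A_closed(1), of 0] by simp

lemma A_lim: "F \<noteq> bot \<Longrightarrow> (f \<longlongrightarrow> T) F \<Longrightarrow> (\<And>x. f x \<in> A_upto s) \<Longrightarrow> T \<in> A_upto s"
  by (rule Lim_in_closed_set[of "A_upto s" f F]) (auto simp: qA_upto_def)

lemma qBM_A: "0 \<le> t \<Longrightarrow> t \<le> s \<Longrightarrow> qBM \<Theta> t \<in> A_upto s"
  by (intro A_closed(5)) auto

lemma dX_A: "0 \<le> u \<Longrightarrow> 0 \<le> v \<Longrightarrow> u \<le> s \<Longrightarrow> v \<le> s \<Longrightarrow> dX \<Theta> u v \<in> A_upto s"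
  unfolding dX_def by (intro A_diff qBM_A)

lemma AA_closed:
  "id_blinfun \<in> AA" "S \<in> AA \<Longrightarrow> T \<in> AA \<Longrightarrow> S + T \<in> AA" "S \<in> AA \<Longrightarrow> T \<in> AA \<Longrightarrow> S o\<^sub>L T \<in> AA"
  "T \<in> AA \<Longrightarrow> op_scaleC c T \<in> AA" "F \<noteq> bot \<Longrightarrow> (f \<longlongrightarrow> T) F \<Longrightarrow> (\<And>x. f x \<in> AA) \<Longrightarrow> T \<in> AA" "T \<in> AA \<Longrightarrow> adj T \<in> AA"
  unfolding qA_def by (blast intro: vN_generated_closed)+

lemma AA_clinear: "T \<in> AA \<Longrightarrow> T \<in> clinear_ops"
  unfolding qA_def using vN_generated_clinear[OF qBM_sa(1,3)] .

lemma AA_scaleR: "T \<in> AA \<Longrightarrow> r *\<^sub>R T \<in> AA"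
  using AA_closed(4)[of T "of_real r"] by (simp add: op_scaleC_real)

lemma AA_diff: "S \<in> AA \<Longrightarrow> T \<in> AA \<Longrightarrow> S - T \<in> AA"
  using AA_closed(2)[of S "-1 *\<^sub>R T"] AA_scaleR[of T "-1"] by simp

lemma AA_zero: "0 \<in> AA"
  using AA_scaleR[OF AA_closed(1), of 0] by simp

lemma AA_dX: "0 \<le> u \<Longrightarrow> 0 \<le> v \<Longrightarrow> dX \<Theta> u v \<in> AA"
  using dX_A[of u v "max u v"] A_subset_AA by auto

text \<open>Right fields commute with the generators, hence with their bicommutant.\<close>

lemma AA_Yop:
  assumes "T \<in> AA" "h \<in> L2_fun" "real_fun h" shows "T o\<^sub>L Yop h = Yop h o\<^sub>L T"
proof -
  have "Yop h \<in> commutant (qBM \<Theta> ` {0..})"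
    using assms(2,3) Xop_Yop_commute real_ind by (auto simp: commutant_def qBM_Xop)
  moreover have "T \<in> commutant (commutant (qBM \<Theta> ` {0..}))"
    using assms(1) vN_generated_subset_bicommutant[OF qBM_sa(1,3)] unfolding qA_def by blast
  ultimately show ?thesis by (auto simp: commutant_def)
qed

lemma AA_separating:
  assumes "S \<in> AA" "T \<in> AA" "S \<Omega> = T \<Omega>" shows "S = T"
proof -
  have "S - T = 0"
  proof (rule vacuum_separating)
    show "(S - T) \<Omega> = 0" using assms by (simp add: blinfun.diff_left)
  qed (use assms AA_diff AA_clinear AA_Yop in auto)
  thus ?thesis by simp
qed

text \<open>Each \<open>AV s e\<close> commutes with the fields up to s and so lies in their
  commutant, while the past algebra lies in the bicommutant.\<close>

lemma B_past: assumes s: "0 \<le> s" shows "B_upto s \<subseteq> past s"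
proof
  fix T assume "T \<in> B_upto s"
  hence T: "T \<in> commutant (commutant (qBM \<Theta> ` {0..s}))"
    using vN_generated_subset_bicommutant[OF qBM_sa(1,3)] unfolding qB_upto_def by blast
  have "AV s e \<in> commutant (qBM \<Theta> ` {0..s})" if "highf s e" for e
    using that s AV_Xop[OF s that lowf_ind] by (auto simp: commutant_def qBM_Xop AV_clinear)
  thus "T \<in> past s" using T s by (auto simp: past_def commutant_def)
qed

lemma A_past: "0 \<le> s \<Longrightarrow> T \<in> A_upto s \<Longrightarrow> T \<in> past s"
  using B_past A_subset_B by blast

text \<open>Vectors invisible to future annihilation, phrased through \<open>AV s e\<close> so that
  invariance under past operators is immediate.\<close>

definition pastvec :: "real \<Rightarrow> 'f set" where
  "pastvec s = {x. \<forall>e. highf s e \<longrightarrow> (AV s e) x = 0}"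

lemma past_pastvec:
  assumes "0 \<le> s" "T \<in> past s" "x \<in> pastvec s" shows "T x \<in> pastvec s"
  unfolding pastvec_def
proof clarify
  fix e assume e: "highf s e"
  have "AV s e o\<^sub>L T = T o\<^sub>L AV s e" using assms e by (simp add: past_def)
  from arg_cong[OF this, of "\<lambda>S. blinfun_apply S x"] show "AV s e (T x) = 0"
    using assms e by (simp add: pastvec_def blinfun.zero_right)
qed

lemma vac_pastvec: "0 \<le> s \<Longrightarrow> \<Omega> \<in> pastvec s"
  by (simp add: pastvec_def AV_vac)

text \<open>Past vectors are killed by \<open>an e\<close>, which factors through
  \<open>AV s e\<close>. So every term of \<open>Qt\<close> with a creator on its left, or with an
  annihilator or \<open>AV s u\<close> on its right, drops out.\<close>

lemma cinner_Qt_past: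
  assumes s: "0 \<le> s" and u: "highf s u" and v: "highf s v" and x: "x \<in> pastvec s" and y: "y \<in> pastvec s"
  shows "cinner x ((Qt s b u v) y) = L2_inner u v * cinner x (Gt s b y)"
proof -
  have an0: "an e z = 0" "AV s e z = 0" if "highf s e" "z \<in> pastvec s" for e z
  proof -
    show AV0: "AV s e z = 0" using that by (simp add: pastvec_def)
    show "an e z = 0"
      using arg_cong[OF adjG_AV[OF s that(1)], of "\<lambda>S. blinfun_apply S z"] AV0 by (simp add: blinfun.zero_right)
  qed
  have "cinner x (cr u z) = 0" for z
    using cinner_adj'[of "an u" x z] an0(1)[OF u x] u highf_L2 by simp
  thus ?thesis using an0[OF u] an0[OF v] x y s
    by (simp add: Qt_def blinfun.add_left blinfun.scaleR_left cinner_add_right cinner_scaleC_right blinfun.zero_right)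
qed

text \<open>Second quantisation commutes with reversal, so its relations with the left operators
  carry over to the right ones.\<close>

lemma G_Yop:
  assumes s: "0 \<le> s" and h: "h \<in> L2_fun"
  shows "Gam (Vf q s) o\<^sub>L Yop h = Yop (Vf q s h) o\<^sub>L Gam (Vf q s)"
proof -
  have GR: "Gam (Vf q s) (Rv x) = Rv (Gam (Vf q s) x)" for x
  proof -
    have "Gam (Vf q s) o\<^sub>L Rv = Rv o\<^sub>L Gam (Vf q s)"
      using isom_map[OF isom_Vf[OF s]] by (intro op_eqI) (auto simp: Rv_word G_word[OF s] rev_map isom_Vf[OF s])
    from arg_cong[OF this, of "\<lambda>S. blinfun_apply S x"] show ?thesis by simp
  qed
  have E: "an (Vf q s h) o\<^sub>L Gam (Vf q s) = 1 *\<^sub>R (Gam (Vf q s) o\<^sub>L an h)"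
    using h isomD[OF isom_Vf[OF s]] by (intro an_G[OF s]) auto
  have "an (Vf q s h) (Gam (Vf q s) x) = Gam (Vf q s) (an h x)" for x
    using arg_cong[OF E, of "\<lambda>S. blinfun_apply S x"] by simp
  thus ?thesis using h
    by (intro blinfun_eqI) (simp add: Yop_def rann_def rcr_def blinfun.add_left blinfun.add_right GR[symmetric]
        G_cr[OF s, symmetric])
qed

lemma Yop_adj: "h \<in> L2_fun \<Longrightarrow> adj (Yop h) = Yop h"
  by (simp add: Yop_def adj_add adj_rcr adj_rann add.commute)

lemma Vf_real: "real_fun h \<Longrightarrow> real_fun (Vf q s h)"
  unfolding real_fun_def Vf_def lo_def hi_def
  by (intro allI Reals_add Reals_mult spread_real) (auto simp: indicator_def)

text \<open>\<open>G\<close> intertwines the right field of h with that of its image, and U commutes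
  with the latter. Thus the compression is determined by its value at the vacuum, even before it is
  known to lie in the algebra.\<close>

lemma Gt_Yop:
  assumes s: "0 \<le> s" and U: "U \<in> AA" and h: "h \<in> L2_fun" "real_fun h"
  shows "Gt s U o\<^sub>L Yop h = Yop h o\<^sub>L Gt s U"
proof -
  let ?G = "Gam (Vf q s)"
  have V: "Vf q s h \<in> L2_fun" "real_fun (Vf q s h)" using s h Vf_real by auto
  have G: "?G \<in> clinear_ops" by (rule G_clinear[OF s])
  have 1: "?G o\<^sub>L Yop h = Yop (Vf q s h) o\<^sub>L ?G" by (rule G_Yop[OF s h(1)])
  have 2: "adj ?G o\<^sub>L Yop (Vf q s h) = Yop h o\<^sub>L adj ?G"
    using arg_cong[OF 1, of adj] G h V by (simp add: adj_comp Yop_adj)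
  have 3: "U o\<^sub>L Yop (Vf q s h) = Yop (Vf q s h) o\<^sub>L U" by (rule AA_Yop[OF U V])
  show ?thesis
    using arg_cong[OF 1, of "\<lambda>S. blinfun_apply S x" for x] arg_cong[OF 2, of "\<lambda>S. blinfun_apply S x" for x]
      arg_cong[OF 3, of "\<lambda>S. blinfun_apply S x" for x]
    by (intro blinfun_eqI) (simp add: Gt_def[OF s])
qed

definition pastwords :: "real \<Rightarrow> (complex \<times> (real \<Rightarrow> complex) list) list set" where
  "pastwords s = {xs. \<forall>w\<in>snd ` set xs. set w \<subseteq> ind ` {0..s}}"

lemma pastwords_combos: "xs \<in> pastwords s \<Longrightarrow> xs \<in> combos"
  by (fastforce simp: pastwords_def combos_iff)

lemma pastwords_append: "xs \<in> pastwords s \<Longrightarrow> ys \<in> pastwords s \<Longrightarrow> xs @ ys \<in> pastwords s"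
  and pastwords_scale: "xs \<in> pastwords s \<Longrightarrow> map (\<lambda>(d, v). (c * d, v)) xs \<in> pastwords s"
  by (force simp: pastwords_def)+

lemma alg_pastwords:
  assumes "U \<in> alg_generated (qBM \<Theta> ` {0..s})" "xs \<in> pastwords s"
  shows "\<exists>ys\<in>pastwords s. U (lin \<Theta> xs) = lin \<Theta> ys"
  using assms
proof (induction arbitrary: xs)
  case (gen T)
  then obtain t where t: "t \<in> {0..s}" "T = Xop (ind t)" by (auto simp: qBM_Xop)
  have "annc q (ind t) xs \<in> pastwords s"
    using gen(2) set_del by (fastforce simp: pastwords_def bindc_def ann_def)
  moreover have "prec (ind t) xs \<in> pastwords s"
    using gen(2) t(1) by (fastforce simp: pastwords_def prec_def)
  moreover have "T (lin \<Theta> xs) = lin \<Theta> (annc q (ind t) xs @ prec (ind t) xs)"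
  proof -
    have "an (ind t) (lin \<Theta> xs) = lin \<Theta> (annc q (ind t) xs)"
      unfolding lin_bindc using pastwords_combos[OF gen(2)]
      by (subst blinfun_lin) (auto intro!: lin_cong an_word simp: combos_iff)
    moreover have "cr (ind t) (lin \<Theta> xs) = lin \<Theta> (prec (ind t) xs)"
      unfolding lin_prec using pastwords_combos[OF gen(2)]
      by (subst blinfun_lin) (auto intro!: lin_cong cr_word simp: combos_iff)
    ultimately show ?thesis by (simp add: t Xop_def blinfun.add_left)
  qed
  ultimately show ?case using pastwords_append by blast
next
  case (scale T c)
  then obtain ys where "ys \<in> pastwords s" "T (lin \<Theta> xs) = lin \<Theta> ys" by blast
  thus ?case using pastwords_scale[of ys s c] by (intro bexI[of _ "map (\<lambda>(d, v). (c * d, v)) ys"]) (simp_all add: lin_scale)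
next
  case (add T T')
  then obtain ys zs where "ys \<in> pastwords s" "T (lin \<Theta> xs) = lin \<Theta> ys"
    "zs \<in> pastwords s" "T' (lin \<Theta> xs) = lin \<Theta> zs" by blast
  thus ?case using pastwords_append by (intro bexI[of _ "ys @ zs"]) (simp_all add: blinfun.add_left)
next
  case (mult T T')
  then obtain ys where "ys \<in> pastwords s" "T' (lin \<Theta> xs) = lin \<Theta> ys" by blast
  thus ?case using mult.IH(1)[of ys] by simp
qed auto

text \<open>Wick polynomials: a field applied to a shorter word gives the wanted word plus its
  contractions, which are combinations of still shorter words and can be subtracted.\<close>

lemma pastword_alg:
  assumes "set w \<subseteq> ind ` {0..s}"
  shows "\<exists>T\<in>alg_generated (qBM \<Theta> ` {0..s}). T \<Omega> = \<Theta> w"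
  using assms
proof (induction "length w" arbitrary: w rule: less_induct)
  case less
  let ?A = "alg_generated (qBM \<Theta> ` {0..s})"
  show ?case
  proof (cases w)
    case Nil
    thus ?thesis by (intro bexI[of _ id_blinfun]) (auto intro: alg_generated.unit)
  next
    case (Cons f v)
    obtain t where t: "t \<in> {0..s}" "f = ind t" using less.prems Cons by auto
    have vL: "set v \<subseteq> L2_fun" using less.prems Cons by auto
    have "\<exists>T\<in>?A. T \<Omega> = \<Theta> v" using less Cons by auto
    then obtain T where T: "T \<in> ?A" "T \<Omega> = \<Theta> v" by blast
    have "\<exists>T\<in>?A. T \<Omega> = (\<Sum>r<n. c r *\<^sub>C \<Theta> (del r v))" if "n \<le> length v" for n c
      using that
    proof (induction n)
      case 0
      show ?case by (intro bexI[of _ "op_scaleC 0 id_blinfun"]) (auto intro: alg_generated.intros)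
    next
      case (Suc n)
      then obtain S where S: "S \<in> ?A" "S \<Omega> = (\<Sum>r<n. c r *\<^sub>C \<Theta> (del r v))" by auto
      have "\<exists>T\<in>?A. T \<Omega> = \<Theta> (del n v)"
        using Suc.prems less.prems Cons set_del[of n v] by (intro less.hyps) (auto simp: length_del)
      then obtain R where R: "R \<in> ?A" "R \<Omega> = \<Theta> (del n v)" by blast
      show ?case using S R
        by (intro bexI[of _ "S + op_scaleC (c n) R"]) (auto intro: alg_generated.intros simp: blinfun.add_left)
    qed
    from this[of "length v" "\<lambda>r. of_real (q ^ r) * L2_inner f (v ! r)"]
    obtain S where S: "S \<in> ?A" "S \<Omega> = an f (\<Theta> v)"
      using vL t by (auto simp: an_word ann_def lin_upt)
    have "(qBM \<Theta> t o\<^sub>L T) + op_scaleC (-1) S \<in> ?A"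
      by (intro alg_generated.add alg_generated.mult alg_generated.scale T(1) S(1))
        (intro alg_generated.gen imageI t(1))
    moreover have "((qBM \<Theta> t o\<^sub>L T) + op_scaleC (-1) S) \<Omega> = \<Theta> w"
      using T S vL t Cons by (simp add: qBM_Xop Xop_def blinfun.add_left cr_word scaleC_minus1)
    ultimately show ?thesis by blast
  qed
qed

lemma pastwords_alg:
  "xs \<in> pastwords s \<Longrightarrow> \<exists>T\<in>alg_generated (qBM \<Theta> ` {0..s}). T \<Omega> = lin \<Theta> xs"
proof (induction xs)
  case Nil
  show ?case by (intro bexI[of _ "op_scaleC 0 id_blinfun"]) (auto intro: alg_generated.intros)
next
  case (Cons x xs)
  then obtain S where S: "S \<in> alg_generated (qBM \<Theta> ` {0..s})" "S \<Omega> = lin \<Theta> xs" by (auto simp: pastwords_def)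
  obtain R where R: "R \<in> alg_generated (qBM \<Theta> ` {0..s})" "R \<Omega> = \<Theta> (snd x)"
    using pastword_alg[of "snd x" s] Cons.prems by (auto simp: pastwords_def)
  show ?case using S R
    by (intro bexI[of _ "op_scaleC (fst x) R + S"]) (auto intro: alg_generated.intros simp: blinfun.add_left)
qed

text \<open>Past letters are fixed by \<open>tf\<close>, so each of them comes out of
  \<open>adj G\<close> with a factor q.\<close>

lemma adjG_word:
  assumes s: "0 \<le> s" "set w \<subseteq> ind ` {0..s}"
  shows "adj (Gam (Vf q s)) (\<Theta> w) = of_real (q ^ length w) *\<^sub>C \<Theta> w"
  using s(2)
proof (induction w)
  case Nil
  show ?case using adjG_G[OF s(1), of \<Omega>] G_word[OF s(1), of "[]"] by simp
next
  case (Cons f w)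
  then obtain t where t: "t \<in> {0..s}" "f = ind t" by auto
  have f: "lowf s f" "f \<in> L2_fun" using t lowf_ind lowf_L2 by auto
  have wL: "set w \<subseteq> L2_fun" using Cons.prems by auto
  have "adj (Gam (Vf q s)) (cr f (\<Theta> w)) = q *\<^sub>R cr f (adj (Gam (Vf q s)) (\<Theta> w))"
    using adjG_cr[OF s(1) f(2), of "\<Theta> w"] by (simp add: tf_lowf[OF s(1) f(1)])
  thus ?case using Cons f wL by (simp add: cr_word clinear_opsD scaleR_scaleC scaleC_scaleC)
qed

text \<open>At the vacuum the compression multiplies the words of length n in U \<Omega> by q^n,
  whatever the time. The result is again a combination of past words, hence Z \<Omega> for some Z of
  the algebra, and the compression equals Z because the vacuum separates.\<close>

lemma Gt_alg:
  assumes s: "0 \<le> s" "s \<le> s'" and U: "U \<in> alg_generated (qBM \<Theta> ` {0..s})"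
  shows "Gt s U \<in> alg_generated (qBM \<Theta> ` {0..s})" "Gt s' U = Gt s U"
proof -
  have "[(1, [])] \<in> pastwords s" by (simp add: pastwords_def)
  from alg_pastwords[OF U this] obtain xs where xs: "xs \<in> pastwords s" "U \<Omega> = lin \<Theta> xs" by auto
  define ys where "ys = map (\<lambda>(c, w). (c * of_real (q ^ length w), w)) xs"
  have ys: "ys \<in> pastwords s" using xs(1) by (force simp: ys_def pastwords_def)
  have lys: "lin \<Theta> ys = lin (\<lambda>w. of_real (q ^ length w) *\<^sub>C \<Theta> w) zs" if "ys = map (\<lambda>(c, w). (c * of_real (q ^ length w), w)) zs" for zs ys
    unfolding that by (induction zs) (auto simp: scaleC_scaleC)
  obtain Z where Z: "Z \<in> alg_generated (qBM \<Theta> ` {0..s})" "Z \<Omega> = lin \<Theta> ys"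
    using pastwords_alg[OF ys] by blast
  have sub: "alg_generated (qBM \<Theta> ` {0..s}) \<subseteq> A_upto s" unfolding qA_upto_def by (rule closure_subset)
  have UA: "U \<in> AA" and ZA: "Z \<in> AA" using U Z sub A_subset_AA by blast+
  have eq: "Gt r U = Z" if r: "s \<le> r" for r
  proof -
    have r0: "0 \<le> r" using s r by simp
    have G: "Gam (Vf q r) \<in> clinear_ops" by (rule G_clinear[OF r0])
    have "Gt r U \<Omega> = adj (Gam (Vf q r)) (lin \<Theta> xs)"
      using G_word[OF r0, of "[]"] by (simp add: Gt_def[OF r0] xs)
    also have "\<dots> = lin (\<lambda>w. of_real (q ^ length w) *\<^sub>C \<Theta> w) xs"
      using xs(1) r by (subst blinfun_lin[OF adj_clinear[OF G]], intro lin_cong adjG_word r0)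
        (fastforce simp: pastwords_def)
    finally have "Gt r U \<Omega> = Z \<Omega>" using lys[OF ys_def] Z by simp
    hence "(Gt r U - Z) \<Omega> = 0" by (simp add: blinfun.diff_left)
    moreover have "(Gt r U - Z) o\<^sub>L Yop h = Yop h o\<^sub>L (Gt r U - Z)" if "h \<in> L2_fun" "real_fun h" for h
      using Gt_Yop[OF r0 UA that] AA_Yop[OF ZA that]
      by (simp add: bounded_bilinear.diff_left[OF bounded_bilinear_blinfun_compose] bounded_bilinear.diff_right[OF bounded_bilinear_blinfun_compose])
    ultimately have "Gt r U - Z = 0"
      using AA_clinear[OF UA] AA_clinear[OF ZA] G by (intro vacuum_separating) (auto simp: Gt_def[OF r0])
    thus ?thesis by simp
  qed
  show "Gt s U \<in> alg_generated (qBM \<Theta> ` {0..s})" "Gt s' U = Gt s U" using eq[of s] eq[of s'] Z s by auto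
qed

lemma bounded_linear_Gt: assumes s: "0 \<le> s" shows "bounded_linear (Gt s)"
proof (rule bounded_linear_intro[where K = 1])
  show "norm (Gt s b) \<le> norm b * 1" for b using norm_Gt[OF s, of b] by simp
qed (auto simp: Gt_def[OF s] op_eq_iff blinfun.add_left blinfun.add_right blinfun.scaleR_left blinfun.scaleR_right)

lemma Gt_A:
  assumes s: "0 \<le> s" "s \<le> s'" and U: "U \<in> A_upto s"
  shows "Gt s U \<in> A_upto s" "Gt s' U = Gt s U"
proof -
  obtain f where f: "\<And>n. f n \<in> alg_generated (qBM \<Theta> ` {0..s})" "f \<longlonglongrightarrow> U"
    using closure_alg_limit[OF U[unfolded qA_upto_def]] by blast
  have l: "(\<lambda>n. Gt r (f n)) \<longlonglongrightarrow> Gt r U" if "s \<le> r" for r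
    using bounded_linear.tendsto[OF bounded_linear_Gt f(2)] that s by simp
  have "Gt s (f n) \<in> A_upto s" for n
    using Gt_alg(1)[OF s(1) order_refl f(1)] closure_subset unfolding qA_upto_def by blast
  thus "Gt s U \<in> A_upto s" by (intro A_lim[OF _ l]) auto
  show "Gt s' U = Gt s U"
    using l[OF s(2)] l[of s] Gt_alg(2)[OF s f(1)] LIMSEQ_unique by auto
qed

text \<open>The indicator of (s, s + 1] has norm 1, so by \<open>cinner_Qt_past\<close> the past
  sees exactly the compression. Uniqueness is the faithfulness of the vacuum state: the state of D
  times \<open>adj D\<close> is the squared norm of \<open>adj D\<close> at the vacuum.\<close>

lemma cond_exp_dX:
  assumes s: "0 \<le> s" and U: "U \<in> A_upto s"
  shows "cond_exp \<Theta> (B_upto s) (dX \<Theta> s (s + 1) o\<^sub>L U o\<^sub>L dX \<Theta> s (s + 1)) = Gt s U"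
  unfolding cond_exp_def
proof (rule the_equality)
  let ?e = "ivl s (s + 1)"
  have e: "highf s ?e" by (rule highf_ivl) simp
  have dU: "dX \<Theta> s (s + 1) o\<^sub>L U o\<^sub>L dX \<Theta> s (s + 1) = Qt s U ?e ?e"
    using s by (simp add: dX_Xop Qt_eq[OF s A_past[OF s U] e e])
  have QG: "vacuum_state \<Theta> (Qt s U ?e ?e o\<^sub>L adj W) = vacuum_state \<Theta> (Gt s U o\<^sub>L adj W)" if "W \<in> B_upto s" for W
  proof -
    have "adj W \<in> B_upto s" using that unfolding qB_upto_def by (rule vN_generated_closed(6))
    hence "blinfun_apply (adj W) \<Omega> \<in> pastvec s" using B_past[OF s] past_pastvec[OF s _ vac_pastvec[OF s]] by blast
    from cinner_Qt_past[OF s e e vac_pastvec[OF s] this, of U] show ?thesis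
      unfolding vacuum_state_def using L2_inner_ivl[of s "s + 1"] s by simp
  qed
  have GB: "Gt s U \<in> B_upto s" using Gt_A(1)[OF s order_refl U] A_subset_B by blast
  show ok: "Gt s U \<in> B_upto s \<and> (\<forall>W\<in>B_upto s. vacuum_state \<Theta> (Gt s U o\<^sub>L adj W)
      = vacuum_state \<Theta> (dX \<Theta> s (s + 1) o\<^sub>L U o\<^sub>L dX \<Theta> s (s + 1) o\<^sub>L adj W))"
    unfolding dU using GB QG by metis
  fix Z assume Z: "Z \<in> B_upto s \<and> (\<forall>W\<in>B_upto s. vacuum_state \<Theta> (Z o\<^sub>L adj W)
      = vacuum_state \<Theta> (dX \<Theta> s (s + 1) o\<^sub>L U o\<^sub>L dX \<Theta> s (s + 1) o\<^sub>L adj W))"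
  define D where "D = Z - Gt s U"
  have "Z + op_scaleC (-1) (Gt s U) \<in> B_upto s" using Z GB unfolding qB_upto_def by (intro vN_generated_closed(2,4)) auto
  moreover have "op_scaleC (-1) (Gt s U) = - Gt s U" by (simp add: op_eq_iff scaleC_minus1 blinfun.minus_left)
  ultimately have D: "D \<in> B_upto s" by (simp add: D_def)
  hence DA: "D \<in> AA" and Dc: "D \<in> clinear_ops" using B_subset_AA AA_clinear by blast+
  have "vacuum_state \<Theta> (Z o\<^sub>L adj D) = vacuum_state \<Theta> (Gt s U o\<^sub>L adj D)" using Z ok D by simp
  hence "vacuum_state \<Theta> (D o\<^sub>L adj D) = 0"
    by (simp add: D_def vacuum_state_def blinfun.diff_left cinner_diff_right)
  hence "blinfun_apply (adj D) \<Omega> = blinfun_apply 0 \<Omega>"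
    using Dc by (simp add: vacuum_state_def cinner_adj[symmetric] cinner_self)
  hence "adj D = 0" using AA_separating[OF AA_closed(6)[OF DA] AA_zero] by blast
  hence "adj (adj D) = adj 0" by simp
  moreover have "adj (0 :: 'f op) = 0" by (rule adj_unique) simp
  ultimately show "Z = Gt s U" using Dc by (simp add: D_def)
qed

text \<open>\<open>Gamma_q\<close> asks for one value that is right at all admissible times;
  compressions at different times agree by \<open>Gt_A\<close>.\<close>

lemma Gamma_q_eq:
  assumes s: "0 \<le> s" and U: "U \<in> A_upto s" shows "Gamma_q \<Theta> U = Gt s U"
  unfolding Gamma_q_def
proof (rule the_equality)
  show "\<forall>r\<ge>0. U \<in> A_upto r \<longrightarrow> Gt s U = cond_exp \<Theta> (B_upto r) (dX \<Theta> r (r + 1) o\<^sub>L U o\<^sub>L dX \<Theta> r (r + 1))"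
  proof (intro allI impI)
    fix r :: real assume r: "0 \<le> r" "U \<in> A_upto r"
    have "Gt s U = Gt r U"
      using Gt_A(2)[OF s _ U, of r] Gt_A(2)[OF r(1) _ r(2), of s] by (cases "s \<le> r") auto
    thus "Gt s U = cond_exp \<Theta> (B_upto r) (dX \<Theta> r (r + 1) o\<^sub>L U o\<^sub>L dX \<Theta> r (r + 1))"
      using cond_exp_dX[OF r] by simp
  qed
qed (use cond_exp_dX[OF s U] s U in auto)

end

section \<open>Dyadic sums of biadditive interval functions and their convergence\<close>

section \<open>Dyadic area sums\<close>

text \<open>Abstracts the product of an increment over [x, y] and an increment over [v, w] with a
  fixed operator in between. Both \<open>QB\<close> and \<open>XB\<close> are instances.\<close>

definition additive2 :: "real \<Rightarrow> (real \<Rightarrow> real \<Rightarrow> real \<Rightarrow> real \<Rightarrow> 'b::real_normed_vector) \<Rightarrow> bool" where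
  "additive2 s B \<longleftrightarrow> (\<forall>x y z v w. s \<le> x \<and> x \<le> y \<and> y \<le> z \<and> s \<le> v \<and> v \<le> w \<longrightarrow>
      B x z v w = B x y v w + B y z v w \<and> B v w x z = B v w x y + B v w y z)"

abbreviation dy :: "nat \<Rightarrow> nat \<Rightarrow> real" where "dy n j \<equiv> real j / 2 ^ n"

text \<open>The iterated integral of a path that is linear on each cell: on a cell, the increment
  accumulated so far meets the new one, and the cell meets itself with weight 1/2.\<close>

definition dsum :: "(real \<Rightarrow> real \<Rightarrow> real \<Rightarrow> real \<Rightarrow> 'b::real_normed_vector) \<Rightarrow> nat \<Rightarrow> nat \<Rightarrow> nat \<Rightarrow> 'b" where
  "dsum B n a c = (\<Sum>j\<in>{a..<c}. B (dy n a) (dy n j) (dy n j) (dy n (Suc j))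
       + (1/2) *\<^sub>R B (dy n j) (dy n (Suc j)) (dy n j) (dy n (Suc j)))"

lemma additive2D:
  assumes "additive2 s B" "s \<le> x" "x \<le> y" "y \<le> z" "s \<le> v" "v \<le> w"
  shows "B x z v w = B x y v w + B y z v w" "B v w x z = B v w x y + B v w y z"
  using assms unfolding additive2_def by blast+

lemma additive2_zero:
  assumes "additive2 s B" "s \<le> x" "s \<le> v" "v \<le> w"
  shows "B x x v w = 0" "B v w x x = 0"
  using additive2D[OF assms(1), of x x x v w] assms by simp_all

lemma dsum_empty [simp]: "c \<le> a \<Longrightarrow> dsum B n a c = 0"
  by (simp add: dsum_def)

lemma dy_mono [simp]: "dy n a \<le> dy n c \<longleftrightarrow> a \<le> c"
  by (simp add: divide_le_cancel)

lemma dsum_Suc: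
  assumes "additive2 s B" "s \<le> dy n a" "a \<le> c"
  shows "dsum B n a (Suc c) = dsum B n a c + B (dy n a) (dy n c) (dy n c) (dy n (Suc c))
     + (1/2) *\<^sub>R B (dy n c) (dy n (Suc c)) (dy n c) (dy n (Suc c))"
  using assms(3) by (simp add: dsum_def)

text \<open>Chen's relation: for the cells behind m the increment from a to m is a constant
  contribution to the first factor.\<close>

lemma dsum_chen:
  assumes B: "additive2 s B" and a: "s \<le> dy n a" and "a \<le> m" "m \<le> c"
  shows "dsum B n a c = dsum B n a m + dsum B n m c + B (dy n a) (dy n m) (dy n m) (dy n c)"
  using \<open>m \<le> c\<close>
proof (induction c rule: dec_induct)
  case base
  have "s \<le> dy n m" using a \<open>a \<le> m\<close> dy_mono order_trans by blast
  thus ?case using additive2_zero(2)[OF B, of "dy n m" "dy n a" "dy n m"] a \<open>a \<le> m\<close> by simp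
next
  case (step c)
  have m: "s \<le> dy n m" using a \<open>a \<le> m\<close> dy_mono order_trans by blast
  have 1: "B (dy n a) (dy n c) (dy n c) (dy n (Suc c))
     = B (dy n a) (dy n m) (dy n c) (dy n (Suc c)) + B (dy n m) (dy n c) (dy n c) (dy n (Suc c))"
    by (rule additive2D(1)[OF B]) (use a m step \<open>a \<le> m\<close> in \<open>auto intro: order_trans[OF m] simp del: of_nat_Suc\<close>)
  have 2: "B (dy n a) (dy n m) (dy n m) (dy n (Suc c))
     = B (dy n a) (dy n m) (dy n m) (dy n c) + B (dy n a) (dy n m) (dy n c) (dy n (Suc c))"
    by (rule additive2D(2)[OF B]) (use a m step \<open>a \<le> m\<close> in \<open>auto simp del: of_nat_Suc\<close>)
  have ac: "a \<le> c" using step \<open>a \<le> m\<close> by simp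
  show ?case unfolding dsum_Suc[OF B a ac] dsum_Suc[OF B m step(1)] step.IH 1 2 by simp
qed

text \<open>Half of the square of a cell contains both mixed products of its two halves with weight
  1/2; the finer sum has only left-right, with weight 1. So half of the antisymmetric difference is
  new.\<close>

lemma dsum_refine:
  fixes B :: "real \<Rightarrow> real \<Rightarrow> real \<Rightarrow> real \<Rightarrow> 'b::real_normed_vector"
  assumes B: "additive2 s B" and a: "s \<le> dy n a" and "a \<le> c"
  defines "p \<equiv> dy (Suc n)"
  shows "dsum B (Suc n) (2 * a) (2 * c) = dsum B n a c + (1/2) *\<^sub>R (\<Sum>j\<in>{a..<c}.
     B (p (2 * j)) (p (2 * j + 1)) (p (2 * j + 1)) (p (2 * j + 2))
     - B (p (2 * j + 1)) (p (2 * j + 2)) (p (2 * j)) (p (2 * j + 1)))"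
  using \<open>a \<le> c\<close>
proof (induction c rule: dec_induct)
  case (step c)
  define x y z w where "x = p (2 * a)" "y = p (2 * c)" "z = p (2 * c + 1)" "w = p (2 * c + 2)"
  have o: "s \<le> x" "x \<le> y" "y \<le> z" "z \<le> w" "s \<le> y"
    using a step(1) by (auto simp: x_y_z_w_def p_def divide_simps)
  have n: "dy n a = x" "dy n c = y" "dy n (Suc c) = w" by (auto simp: x_y_z_w_def p_def divide_simps)
  have n1: "dy (Suc n) (2 * a) = x" "dy (Suc n) (2 * c) = y" "dy (Suc n) (Suc (2 * c)) = z"
    "dy (Suc n) (Suc (Suc (2 * c))) = w" by (auto simp: x_y_z_w_def p_def)
  have a': "s \<le> dy (Suc n) (2 * a)" using o n1 by simp
  have c: "2 * a \<le> Suc (2 * c)" "2 * a \<le> 2 * c" using step(1) by simp_all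
  have e: "2 * Suc c = Suc (Suc (2 * c))" by simp
  have A: "B x z z w = B x y z w + B y z z w" "B x y y w = B x y y z + B x y z w"
    "B y w y w = B y z y z + B y z z w + (B z w y z + B z w z w)"
    using additive2D(1)[OF B, of x y z z w] additive2D(2)[OF B, of y z w x y] additive2D(1)[OF B, of y z w y w]
      additive2D(2)[OF B, of y z w y z] additive2D(2)[OF B, of y z w z w] o by auto
  have S: "(\<Sum>j\<in>{a..<Suc c}. B (p (2 * j)) (p (2 * j + 1)) (p (2 * j + 1)) (p (2 * j + 2))
     - B (p (2 * j + 1)) (p (2 * j + 2)) (p (2 * j)) (p (2 * j + 1))) =
     (\<Sum>j\<in>{a..<c}. B (p (2 * j)) (p (2 * j + 1)) (p (2 * j + 1)) (p (2 * j + 2))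
     - B (p (2 * j + 1)) (p (2 * j + 2)) (p (2 * j)) (p (2 * j + 1))) + (B y z z w - B z w y z)"
    using step(1) by (simp add: x_y_z_w_def)
  \<comment> \<open>With e the product left-right and g the product right-left, this splits e into
    half of e + g and half of e - g.\<close>
  have half_alg: "D + (1/2) *\<^sub>R S' + a + (1/2) *\<^sub>R b + (c + e) + (1/2) *\<^sub>R f
      = D + (a + c) + (1/2) *\<^sub>R (b + e + (g + f)) + (1/2) *\<^sub>R (S' + (e - g))" for D S' a b c e f g :: 'b
    using scaleR_half_double[of e] by (simp add: scaleR_add_right scaleR_diff_right)
  show ?case
    unfolding e dsum_Suc[OF B a' c(1)] dsum_Suc[OF B a' c(2)] dsum_Suc[OF B a step(1)] step.IH n n1 A
    unfolding S by (rule half_alg)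
qed simp

text \<open>Indices of the first dyadic point not before s and, with \<open>dhi\<close>, of the last
  one not after t. On a short interval the second may precede the first, and then the sums are
  empty.\<close>

definition dlo :: "nat \<Rightarrow> real \<Rightarrow> nat" where "dlo n s = nat \<lceil>2 ^ n * s\<rceil>"
definition dhi :: "nat \<Rightarrow> real \<Rightarrow> nat" where "dhi n t = nat \<lfloor>2 ^ n * t\<rfloor>"

lemma dlo: assumes "0 \<le> s" shows "2 ^ n * s \<le> real (dlo n s)" "real (dlo n s) < 2 ^ n * s + 1"
proof -
  have "real (dlo n s) = of_int \<lceil>2 ^ n * s\<rceil>" using assms by (simp add: dlo_def)
  thus "2 ^ n * s \<le> real (dlo n s)" "real (dlo n s) < 2 ^ n * s + 1" by linarith+
qed

lemma dhi: assumes "0 \<le> t" shows "real (dhi n t) \<le> 2 ^ n * t" "2 ^ n * t < real (dhi n t) + 1"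
proof -
  have "real (dhi n t) = of_int \<lfloor>2 ^ n * t\<rfloor>" using assms by (simp add: dhi_def)
  thus "real (dhi n t) \<le> 2 ^ n * t" "2 ^ n * t < real (dhi n t) + 1" by linarith+
qed

lemma dlo_dy: "0 \<le> s \<Longrightarrow> s \<le> dy n (dlo n s)" and dhi_dy: "0 \<le> t \<Longrightarrow> dy n (dhi n t) \<le> t"
  using dlo(1)[of s n] dhi(1)[of t n] by (auto simp: field_simps)

lemma dlo_Suc: assumes "0 \<le> s" shows "dlo (Suc n) s \<le> 2 * dlo n s" "2 * dlo n s \<le> dlo (Suc n) s + 1"
  using dlo[OF assms, of n] dlo[OF assms, of "Suc n"] by (simp_all add: mult.assoc)

lemma dhi_Suc: assumes "0 \<le> s" shows "2 * dhi n s \<le> dhi (Suc n) s" "dhi (Suc n) s \<le> 2 * dhi n s + 1"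
  using dhi[OF assms, of n] dhi[OF assms, of "Suc n"] by (simp_all add: mult.assoc)

lemma short_no_cell:
  assumes "0 \<le> s" "s \<le> t" "(t - s) < 1 / 2 ^ n" shows "dhi n t \<le> dlo n s"
proof -
  have "2 ^ n * t - 2 ^ n * s < 1" using assms(3) by (simp add: field_simps)
  moreover have "0 \<le> t" using assms by simp
  ultimately show ?thesis using dlo(1)[OF assms(1), of n] dhi(1)[of t n] by linarith
qed

text \<open>The second clause is the cancellation: a sum of c - a mixed products, each of the order
  of the cell length, grows only like the square root of their number.\<close>

definition area_bounds :: "real \<Rightarrow> real \<Rightarrow> (real \<Rightarrow> real \<Rightarrow> real \<Rightarrow> real \<Rightarrow> 'b::real_normed_vector) \<Rightarrow> bool" where
  "area_bounds s K B \<longleftrightarrow> 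
    (\<forall>x y v w. s \<le> x \<and> x \<le> y \<and> s \<le> v \<and> v \<le> w \<longrightarrow> norm (B x y v w) \<le> K * sqrt ((y - x) * (w - v))) \<and>
    (\<forall>n a c. s \<le> dy n a \<and> a \<le> c \<longrightarrow> 
      norm (\<Sum>j\<in>{a..<c}. B (dy (Suc n) (2 * j)) (dy (Suc n) (2 * j + 1)) (dy (Suc n) (2 * j + 1)) (dy (Suc n) (2 * j + 2)))
        \<le> K / 2 ^ Suc n * sqrt (real (c - a)) \<and>
      norm (\<Sum>j\<in>{a..<c}. B (dy (Suc n) (2 * j + 1)) (dy (Suc n) (2 * j + 2)) (dy (Suc n) (2 * j)) (dy (Suc n) (2 * j + 1)))
        \<le> K / 2 ^ Suc n * sqrt (real (c - a)))"

text \<open>The next level brings in the mixed products inside the old cells, at most one new cell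
  at either end, and the products of these end cells with the rest. In units of K R these cost 1,
  two halves and 2, which is the constant 4.\<close>

lemma dsum_increment:
  assumes B: "additive2 s B" and K: "area_bounds s K B" and s: "0 \<le> s" "s \<le> t" and K0: "0 \<le> K"
    and fine: "1 / 2 ^ Suc n \<le> t - s"
  defines "D \<equiv> \<lambda>n. dsum B n (dlo n s) (dhi n t)"
  shows "norm (D (Suc n) - D n) \<le> 4 * K * sqrt ((t - s) / 2 ^ Suc n)"
proof (cases "dlo n s \<le> dhi n t")
  case False
  have t: "0 \<le> t" using s by simp
  have "dhi (Suc n) t \<le> dlo (Suc n) s" using dlo_Suc(2)[OF s(1), of n] dhi_Suc(2)[OF t, of n] False by linarith
  thus ?thesis using False s K0 by (simp add: D_def)
next
  case True
  define a c a' c' where "a = dlo n s" "c = dhi n t" "a' = dlo (Suc n) s" "c' = dhi (Suc n) t"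
  define h where "h = 1 / (2::real) ^ Suc n"
  define R where "R = sqrt ((t - s) * h)"
  have t: "0 \<le> t" using s by simp
  have h0: "0 < h" by (simp add: h_def)
  have "h * h \<le> (t - s) * h" using fine h0 by (intro mult_right_mono) (auto simp: h_def)
  \<comment> \<open>R is the geometric mean of the new cell length h and t - s, so it dominates h
    once the cells are no longer than the interval.\<close>
  hence hR: "h \<le> R" unfolding R_def by (intro real_le_rsqrt) (simp add: power2_eq_square)
  have ac: "a \<le> c" "a' \<le> 2 * a" "2 * a \<le> a' + 1" "2 * c \<le> c'" "c' \<le> 2 * c + 1"
    using True dlo_Suc[OF s(1), of n] dhi_Suc[OF t, of n] by (auto simp: a_c_a'_c'_def)
  have sa: "s \<le> dy n a" "s \<le> dy (Suc n) a'" "dy (Suc n) c' \<le> t"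
    using dlo_dy[OF s(1)] dhi_dy[OF t] by (auto simp: a_c_a'_c'_def simp del: power_Suc)
  let ?p = "dy (Suc n)"
  have K1: "norm (B x y v w) \<le> K * sqrt ((y - x) * (w - v))" if "s \<le> x" "x \<le> y" "s \<le> v" "v \<le> w" for x y v w
    using K that unfolding area_bounds_def by blast
  have dys: "s \<le> ?p j" if "a' \<le> j" for j
    using dy_mono[THEN iffD2, OF that] by (rule order_trans[OF sa(2)])
  have dyt: "?p j \<le> t" if "j \<le> c'" for j
    using dy_mono[THEN iffD2, OF that] sa(3) by (rule order_trans)
  have dyh: "?p (j + 1) - ?p j = h" for j
    by (simp add: h_def add_divide_distrib)
  have cell: "norm (dsum B (Suc n) k l) \<le> K / 2 * R" if "a' \<le> k" "k \<le> l" "l \<le> k + 1" for k l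
  proof (cases "l = k")
    case True
    thus ?thesis using K0 s h0 by (simp add: R_def)
  next
    case False
    hence l: "l = k + 1" using that by simp
    have m: "?p k \<le> ?p (k + 1)" unfolding dy_mono by simp
    have "norm (dsum B (Suc n) k l) = norm ((1/2) *\<^sub>R B (?p k) (?p (k + 1)) (?p k) (?p (k + 1)))"
      using additive2_zero(1)[OF B dys[OF that(1)] dys[OF that(1)] m]
      unfolding dsum_def l by simp
    also have "\<dots> \<le> 1/2 * (K * h)"
      using K1[OF dys[OF that(1)] m dys[OF that(1)] m] unfolding dyh using h0 by simp
    also have "\<dots> \<le> K / 2 * R" using hR K0 by (simp add: mult_left_mono)
    finally show ?thesis .
  qed
  have cross: "norm (B (?p j) (?p k) (?p l) (?p m)) \<le> K * R"
    if "a' \<le> j" "j \<le> k" "k \<le> l" "l \<le> m" "m \<le> c'" and short: "k \<le> j + 1 \<or> m \<le> l + 1" for j k l m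
  proof -
    have le: "?p j \<le> ?p k" "?p l \<le> ?p m" using that dy_mono by blast+
    have len: "?p y - ?p x \<le> h" if "y \<le> x + 1" for x y
      using dyh[of x] dy_mono[THEN iffD2, OF that, of "Suc n"] by linarith
    have all: "?p k - ?p j \<le> t - s" "?p m - ?p l \<le> t - s"
      using dys[of j] dys[of l] dyt[of k] dyt[of m] that by linarith+
    have "(?p k - ?p j) * (?p m - ?p l) \<le> (t - s) * h"
    proof (cases "k \<le> j + 1")
      case True
      have "(?p k - ?p j) * (?p m - ?p l) \<le> h * (t - s)"
        using len[OF True] all le h0 by (intro mult_mono) auto
      thus ?thesis by (simp add: mult.commute)
    next
      case False
      thus ?thesis using len[of m l] short all le s by (intro mult_mono) auto
    qed
    hence "K * sqrt ((?p k - ?p j) * (?p m - ?p l)) \<le> K * R"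
      unfolding R_def using K0 by (intro mult_left_mono real_sqrt_le_mono) auto
    moreover have "a' \<le> l" using that by simp
    ultimately show ?thesis using K1[OF dys[OF that(1)] le(1) dys le(2)] by (meson order_trans)
  qed
  let ?S1 = "\<Sum>j\<in>{a..<c}. B (?p (2 * j)) (?p (2 * j + 1)) (?p (2 * j + 1)) (?p (2 * j + 2))"
  let ?S2 = "\<Sum>j\<in>{a..<c}. B (?p (2 * j + 1)) (?p (2 * j + 2)) (?p (2 * j)) (?p (2 * j + 1))"
  \<comment> \<open>At most 2^n (t - s) old cells fit into the interval.\<close>
  have N: "K / 2 ^ Suc n * sqrt (real (c - a)) \<le> K * R"
  proof -
    have "real c - real a \<le> 2 ^ n * (t - s)" using dlo(1)[OF s(1), of n] dhi(1)[OF t, of n]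
      by (simp add: a_c_a'_c'_def algebra_simps)
    hence "h\<^sup>2 * real (c - a) \<le> h\<^sup>2 * (2 ^ n * (t - s))" using ac by (intro mult_left_mono) (auto simp: of_nat_diff)
    also have "\<dots> = (t - s) * h / 2" by (simp add: h_def power2_eq_square field_simps)
    also have "\<dots> \<le> (t - s) * h" using s h0 by simp
    finally have "h * sqrt (real (c - a)) \<le> R"
      unfolding R_def using h0 by (intro real_le_rsqrt) (simp add: power_mult_distrib)
    from mult_left_mono[OF this K0] show ?thesis by (simp add: h_def)
  qed
  have S: "norm ?S1 \<le> K * R" "norm ?S2 \<le> K * R"
  proof -
    from K sa(1) ac(1) have "norm ?S1 \<le> K / 2 ^ Suc n * sqrt (real (c - a)) \<and> norm ?S2 \<le> K / 2 ^ Suc n * sqrt (real (c - a))"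
      unfolding area_bounds_def by blast
    with N show "norm ?S1 \<le> K * R" "norm ?S2 \<le> K * R" by linarith+
  qed
  have "D (Suc n) = dsum B (Suc n) a' (2 * a) + (dsum B (Suc n) (2 * a) (2 * c) + dsum B (Suc n) (2 * c) c'
      + B (?p (2 * a)) (?p (2 * c)) (?p (2 * c)) (?p c'))
      + B (?p a') (?p (2 * a)) (?p (2 * a)) (?p c')"
  proof -
    have "D (Suc n) = dsum B (Suc n) a' c'" by (simp add: D_def a_c_a'_c'_def)
    also have "\<dots> = dsum B (Suc n) a' (2 * a) + dsum B (Suc n) (2 * a) c'
      + B (?p a') (?p (2 * a)) (?p (2 * a)) (?p c')"
      using ac by (intro dsum_chen[OF B sa(2)]) auto
    also have "dsum B (Suc n) (2 * a) c' = dsum B (Suc n) (2 * a) (2 * c) + dsum B (Suc n) (2 * c) c'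
      + B (?p (2 * a)) (?p (2 * c)) (?p (2 * c)) (?p c')"
      using ac by (intro dsum_chen[OF B] dys) auto
    finally show ?thesis .
  qed
  moreover have "dsum B (Suc n) (2 * a) (2 * c) = D n + (1/2) *\<^sub>R (?S1 - ?S2)"
    unfolding dsum_refine[OF B sa(1) ac(1)] sum_subtractf[symmetric] by (simp add: D_def a_c_a'_c'_def)
  ultimately have DD: "D (Suc n) - D n = (1/2) *\<^sub>R (?S1 - ?S2) + dsum B (Suc n) a' (2 * a) + dsum B (Suc n) (2 * c) c'
      + B (?p (2 * a)) (?p (2 * c)) (?p (2 * c)) (?p c')
      + B (?p a') (?p (2 * a)) (?p (2 * a)) (?p c')" by simp
  have "norm (D (Suc n) - D n) \<le> (1/2) * (K * R + K * R) + K / 2 * R + K / 2 * R + K * R + K * R"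
    unfolding DD
  proof (intro norm_triangle_mono)
    have "norm (?S1 - ?S2) \<le> K * R + K * R" by (rule norm_triangle_le_diff) (use S in simp)
    thus "norm ((1/2) *\<^sub>R (?S1 - ?S2)) \<le> (1/2) * (K * R + K * R)" by simp
    show "norm (dsum B (Suc n) a' (2 * a)) \<le> K / 2 * R" "norm (dsum B (Suc n) (2 * c) c') \<le> K / 2 * R"
      by (rule cell; use ac in linarith)+
    show "norm (B (?p (2 * a)) (?p (2 * c)) (?p (2 * c)) (?p c')) \<le> K * R"
      "norm (B (?p a') (?p (2 * a)) (?p (2 * a)) (?p c')) \<le> K * R"
      by (rule cross; use ac in linarith)+
  qed
  also have "\<dots> = 4 * K * R" by (simp add: field_simps)
  finally show ?thesis by (simp add: R_def h_def)
qed

text \<open>The increments decay like the powers of the square root of 1/2. The series starts at a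
  level m whose cells are longer than t - s, but at most twice as long: there the sum is empty, and
  the first increment is already of order t - s. This makes the bound linear in t - s.\<close>

lemma dsum_converges:
  fixes B :: "real \<Rightarrow> real \<Rightarrow> real \<Rightarrow> real \<Rightarrow> 'b::banach"
  assumes B: "additive2 s B" and K: "area_bounds s K B" and s: "0 \<le> s" "s < t" "t - s < 1" and K0: "0 \<le> K"
  shows "\<exists>L. (\<lambda>n. dsum B n (dlo n s) (dhi n t)) \<longlonglongrightarrow> L \<and> norm L \<le> 16 * K * (t - s)"
proof -
  define D where "D n = dsum B n (dlo n s) (dhi n t)" for n
  \<comment> \<open>The geometric series contributes 1 / (1 - r), at most 4, to the final constant
    16; the other 4 is that of \<open>dsum_increment\<close>.\<close>
  define r where "r = sqrt (1/2)"
  have r: "0 < r" "r < 1" "1 / (1 - r) \<le> 4"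
  proof -
    have "r \<le> 3/4" unfolding r_def by (rule real_le_lsqrt) (auto simp: power2_eq_square)
    thus "0 < r" "r < 1" "1 / (1 - r) \<le> 4" by (auto simp: r_def field_simps)
  qed
  define m where "m = (LEAST n. 1 / (2::real) ^ Suc n \<le> t - s)"
  have "\<exists>n. (1/2) ^ n < t - s" using s by (intro real_arch_pow_inv) auto
  then obtain n where n: "(1/2) ^ n < t - s" by blast
  have "1 / (2::real) ^ Suc n \<le> (1/2) ^ n" by (simp add: power_one_over field_simps)
  hence fn: "1 / (2::real) ^ Suc n \<le> t - s" using n by linarith
  have m: "1 / 2 ^ Suc m \<le> t - s" unfolding m_def by (rule LeastI[of "\<lambda>n. 1 / (2::real) ^ Suc n \<le> t - s", OF fn])
  have m': "t - s < 1 / 2 ^ m"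
  proof (cases m)
    case 0
    thus ?thesis using s by simp
  next
    case (Suc k)
    thus ?thesis using not_less_Least[of k "\<lambda>n. 1 / (2::real) ^ Suc n \<le> t - s"] unfolding m_def[symmetric] by simp
  qed
  define E where "E k = D (k + m)" for k
  have E0: "E 0 = 0" unfolding E_def D_def using short_no_cell[OF s(1) _ m'] s by simp
  have inc: "norm (E (Suc k) - E k) \<le> 4 * K * (t - s) * r ^ k" for k
  proof -
    have "1 / (2::real) ^ Suc (k + m) \<le> 1 / 2 ^ Suc m" by (intro divide_left_mono power_increasing) auto
    hence fine: "1 / 2 ^ Suc (k + m) \<le> t - s" using m by (rule order_trans)
    have "norm (E (Suc k) - E k) \<le> 4 * K * sqrt ((t - s) / 2 ^ Suc (k + m))"
      using dsum_increment[OF B K s(1) _ K0 fine] s by (simp add: E_def D_def)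
    also have "(t - s) / 2 ^ Suc (k + m) = (t - s) * (1 / 2 ^ Suc m) * (1/2) ^ k"
      by (simp add: power_add power_one_over field_simps)
    also have "\<dots> \<le> (t - s) * (t - s) * (1/2) ^ k" using m s by (intro mult_right_mono mult_left_mono) auto
    also have "sqrt \<dots> = (t - s) * r ^ k" using s by (simp add: real_sqrt_mult r_def real_sqrt_power)
    finally show ?thesis using K0 by (simp add: mult_left_mono mult.assoc)
  qed
  have summ: "summable (\<lambda>k. 4 * K * (t - s) * r ^ k)" using r by (intro summable_mult summable_geometric) auto
  have sE: "summable (\<lambda>k. E (Suc k) - E k)" by (rule summable_comparison_test'[OF summ]) (use inc in auto)
  define L where "L = (\<Sum>k. E (Suc k) - E k)"
  have "(\<lambda>k. \<Sum>i<k. E (Suc i) - E i) \<longlonglongrightarrow> L" unfolding L_def using sE by (rule summable_LIMSEQ)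
  hence "E \<longlonglongrightarrow> L" by (simp add: sum_lessThan_telescope E0)
  hence "D \<longlonglongrightarrow> L" unfolding E_def by (rule LIMSEQ_offset)
  moreover have "norm L \<le> (\<Sum>k. 4 * K * (t - s) * r ^ k)"
    unfolding L_def by (rule norm_suminf_le[OF inc summ])
  moreover have "\<dots> = 4 * K * (t - s) * (1 / (1 - r))"
    using r by (subst suminf_mult) (auto intro: summable_geometric simp: suminf_geometric)
  moreover have "\<dots> \<le> 4 * K * (t - s) * 4" using r s K0 by (intro mult_left_mono) auto
  ultimately show ?thesis unfolding D_def[symmetric] by (intro exI[of _ L]) auto
qed

section \<open>Tensors as functionals on bounded forms, and extension from elementary
  tensors\<close>

section \<open>Projective tensor powers\<close>

lemma forms_sums:
  assumes B: "B \<in> bounded_forms A n" and r: "represents A n S as u" and S: "S \<subseteq> A"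
  shows "(\<lambda>i. B (as i)) sums u B"
proof -
  obtain C where C: "\<And>as. length as = n \<Longrightarrow> set as \<subseteq> A \<Longrightarrow> cmod (B as) \<le> C * prod_list (map norm as)"
    using B unfolding bounded_forms_def by blast
  have "summable (\<lambda>i. B (as i))"
  proof (rule summable_comparison_test')
    show "summable (\<lambda>i. C * prod_list (map norm (as i)))"
      using r by (intro summable_mult) (simp add: represents_def)
    show "norm (B (as i)) \<le> C * prod_list (map norm (as i))" for i
      using r S by (intro C) (auto simp: represents_def)
  qed
  thus ?thesis using B r by (simp add: represents_def summable_sums)
qed

lemma represents_mono: "represents A n S as u \<Longrightarrow> S \<subseteq> S' \<Longrightarrow> represents A n S' as u"
  by (auto simp: represents_def)

lemma proj_tensor_mono: "S \<subseteq> S' \<Longrightarrow> proj_tensor A n S \<subseteq> proj_tensor A n S'"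
  unfolding proj_tensor_def using represents_mono by blast

text \<open>Enough bounded forms on the whole of \<open>A\<close> restrict to coefficients of \<open>\<Phi>\<close> on \<open>S\<close> to separate points.\<close>

definition formable :: "'f::complex_hilbert op set \<Rightarrow> nat \<Rightarrow> 'f op set \<Rightarrow> ('f op list \<Rightarrow> 'b::real_normed_vector) \<Rightarrow> bool" where
  "formable A n S \<Phi> \<longleftrightarrow> S \<subseteq> A \<and>
     (\<exists>C. \<forall>as. length as = n \<and> set as \<subseteq> S \<longrightarrow> norm (\<Phi> as) \<le> C * prod_list (map norm as)) \<and>
     (\<forall>x y. x \<noteq> y \<longrightarrow> (\<exists>F::'b \<Rightarrow> complex. \<exists>B\<in>bounded_forms A n. bounded_linear F \<and> F x \<noteq> F y \<and>
        (\<forall>as. length as = n \<and> set as \<subseteq> S \<longrightarrow> F (\<Phi> as) = B as)))"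

lemma formable_summable:
  fixes \<Phi> :: "'f::complex_hilbert op list \<Rightarrow> 'b::banach"
  assumes "formable A n S \<Phi>" "represents A n S as u"
  shows "summable (\<lambda>i. \<Phi> (as i))"
proof -
  obtain C where C: "\<And>as. length as = n \<Longrightarrow> set as \<subseteq> S \<Longrightarrow> norm (\<Phi> as) \<le> C * prod_list (map norm as)"
    using assms(1) unfolding formable_def by blast
  show ?thesis
  proof (rule summable_comparison_test')
    show "summable (\<lambda>i. C * prod_list (map norm (as i)))"
      using assms(2) by (intro summable_mult) (simp add: represents_def)
    show "norm (\<Phi> (as i)) \<le> C * prod_list (map norm (as i))" for i
      using assms(2) by (intro C) (auto simp: represents_def)
  qed
qed

text \<open>If the two sums differed, a functional F would separate them; but F of either sum is the
  value of the tensor at one and the same form.\<close>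

lemma formable_unique:
  fixes \<Phi> :: "'f::complex_hilbert op list \<Rightarrow> 'b::banach"
  assumes f: "formable A n S \<Phi>" and r: "represents A n S as u" "represents A n S bs u"
  shows "(\<Sum>i. \<Phi> (as i)) = (\<Sum>i. \<Phi> (bs i))"
proof (rule ccontr)
  assume "(\<Sum>i. \<Phi> (as i)) \<noteq> (\<Sum>i. \<Phi> (bs i))"
  then obtain F :: "'b \<Rightarrow> complex" and B where F: "B \<in> bounded_forms A n" "bounded_linear F"
    "F (\<Sum>i. \<Phi> (as i)) \<noteq> F (\<Sum>i. \<Phi> (bs i))"
    "\<And>as. length as = n \<Longrightarrow> set as \<subseteq> S \<Longrightarrow> F (\<Phi> as) = B as"
    using f unfolding formable_def by metis
  have "F (\<Sum>i. \<Phi> (cs i)) = u B" if c: "represents A n S cs u" for cs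
  proof -
    have "(\<lambda>i. F (\<Phi> (cs i))) sums F (\<Sum>i. \<Phi> (cs i))"
      by (intro bounded_linear.sums[OF F(2)] summable_sums formable_summable[OF f c])
    moreover have "(\<lambda>i. F (\<Phi> (cs i))) = (\<lambda>i. B (cs i))" using c F(4) by (auto simp: represents_def)
    moreover have "(\<lambda>i. B (cs i)) sums u B" using forms_sums[OF F(1) c] f by (simp add: formable_def)
    ultimately show ?thesis using sums_unique2 by metis
  qed
  thus False using F(3) r by simp
qed

text \<open>The definite description quantifies over all members of \<S>; representations over two
  of them are compared inside a common larger one.\<close>

lemma tensor_ext_sums:
  fixes \<Phi> :: "'f::complex_hilbert op list \<Rightarrow> 'b::banach"
  assumes f: "\<And>S. S \<in> \<S> \<Longrightarrow> formable A n S \<Phi>"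
    and dir: "\<And>S S'. S \<in> \<S> \<Longrightarrow> S' \<in> \<S> \<Longrightarrow> \<exists>S''\<in>\<S>. S \<subseteq> S'' \<and> S' \<subseteq> S''"
    and S: "S \<in> \<S>" and r: "represents A n S as u"
  shows "(\<lambda>i. \<Phi> (as i)) sums tensor_ext A n \<S> \<Phi> u"
proof -
  have s: "(\<lambda>i. \<Phi> (bs i)) sums (\<Sum>i. \<Phi> (as i))" if S': "S' \<in> \<S>" and b: "represents A n S' bs u" for S' bs
  proof -
    obtain S'' where "S'' \<in> \<S>" "S \<subseteq> S''" "S' \<subseteq> S''" using dir[OF S S'] by blast
    hence "(\<Sum>i. \<Phi> (bs i)) = (\<Sum>i. \<Phi> (as i))"
      using formable_unique[OF f] represents_mono[OF b] represents_mono[OF r] by blast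
    thus ?thesis using summable_sums[OF formable_summable[OF f[OF S'] b]] by simp
  qed
  have "tensor_ext A n \<S> \<Phi> u = (\<Sum>i. \<Phi> (as i))"
    unfolding tensor_ext_def
    by (rule the_equality) (use s S r in \<open>auto simp: sums_unique\<close>)
  thus ?thesis using s[OF S r] by simp
qed

lemma tensor_ext_sums1:
  fixes \<Phi> :: "'f::complex_hilbert op list \<Rightarrow> 'b::banach"
  assumes "formable A n S \<Phi>" "represents A n S as u"
  shows "(\<lambda>i. \<Phi> (as i)) sums tensor_ext A n {S} \<Phi> u"
  by (rule tensor_ext_sums[of "{S}" A n \<Phi> S]) (use assms in auto)

text \<open>Every representation over A bounds the value of the form by C times its cost, so the
  infimum of the costs does as well.\<close>

lemma proj_norm_bound:
  assumes B: "B \<in> bounded_forms A n" and C: "\<And>as. length as = n \<Longrightarrow> set as \<subseteq> A \<Longrightarrow> cmod (B as) \<le> C * prod_list (map norm as)"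
    and C0: "0 \<le> C" and u: "u \<in> proj_tensor A n A"
  shows "cmod (u B) \<le> C * proj_norm A n u"
proof -
  have le: "cmod (u B) \<le> C * (\<Sum>i. prod_list (map norm (as i)))" if r: "represents A n A as u" for as
  proof -
    have s: "summable (\<lambda>i. C * prod_list (map norm (as i)))"
      using r by (intro summable_mult) (simp add: represents_def)
    have "cmod (\<Sum>i. B (as i)) \<le> (\<Sum>i. C * prod_list (map norm (as i)))"
      using r by (intro norm_suminf_le[OF _ s] C) (auto simp: represents_def)
    thus ?thesis using sums_unique[OF forms_sums[OF B r order_refl]] r
      by (simp add: represents_def suminf_mult)
  qed
  show ?thesis
  proof (cases "C = 0")
    case True
    thus ?thesis using le u by (auto simp: proj_tensor_def)
  next
    case False
    have "cmod (u B) / C \<le> proj_norm A n u" unfolding proj_norm_def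
    proof (rule cInf_greatest)
      show "{\<Sum>i. prod_list (map norm (as i)) |as. represents A n A as u} \<noteq> {}"
        using u by (auto simp: proj_tensor_def)
      fix x assume "x \<in> {\<Sum>i. prod_list (map norm (as i)) |as. represents A n A as u}"
      thus "cmod (u B) / C \<le> x" using le False C0 by (auto simp: field_simps)
    qed
    thus ?thesis using False C0 by (simp add: field_simps)
  qed
qed

lemma prod_list_nonneg': "0 \<le> prod_list (map norm (as :: 'b::real_normed_vector list))"
  by (induction as) auto

lemma proj_norm_le:
  assumes "represents A n A as u" shows "proj_norm A n u \<le> (\<Sum>i. prod_list (map norm (as i)))"
  unfolding proj_norm_def
proof (rule cInf_lower)
  show "bdd_below {\<Sum>i. prod_list (map norm (as i)) |as. represents A n A as u}"
    by (rule bdd_belowI[of _ 0]) (auto intro!: suminf_nonneg prod_list_nonneg' simp: represents_def)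
qed (use assms in blast)

lemma proj_norm_nonneg:
  assumes "u \<in> proj_tensor A n A" shows "0 \<le> proj_norm A n u"
  unfolding proj_norm_def
  by (rule cInf_greatest)
    (use assms in \<open>auto intro!: suminf_nonneg prod_list_nonneg' simp: proj_tensor_def represents_def\<close>)

text \<open>Merges two series into one, so that a sum of two tensors is again given by a single
  series whose cost is the sum of the costs.\<close>

definition interleave :: "(nat \<Rightarrow> 'b) \<Rightarrow> (nat \<Rightarrow> 'b) \<Rightarrow> nat \<Rightarrow> 'b" where
  "interleave a b i = (if even i then a (i div 2) else b ((i - 1) div 2))"

lemma interleave_sums:
  fixes f :: "nat \<Rightarrow> 'b::real_normed_vector"
  assumes f: "f sums x" and g: "g sums y" shows "interleave f g sums (x + y)"
proof -
  have 1: "(\<lambda>i. if even i then f (i div 2) else 0) sums x"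
    using f by (subst sums_mono_reindex[where g = "\<lambda>n. 2 * n", symmetric])
      (auto simp: strict_mono_def elim!: oddE intro: evenE)
  have 2: "(\<lambda>i. if even i then 0 else g ((i - 1) div 2)) sums y"
    using g by (subst sums_mono_reindex[where g = "\<lambda>n. Suc (2 * n)", symmetric])
      (auto simp: strict_mono_def elim!: oddE)
  show ?thesis
    using sums_add[OF 1 2] by (rule back_subst[where P = "\<lambda>h. h sums (x + y)"]) (auto simp: interleave_def)
qed

lemma interleave_map: "h (interleave a b i) = interleave (\<lambda>i. h (a i)) (\<lambda>i. h (b i)) i"
  by (simp add: interleave_def)

lemma represents_add:
  assumes r: "represents A n S as u" "represents A n S bs v" and S: "S \<subseteq> A"
  shows "represents A n S (interleave as bs) (u + v)"
    "(\<Sum>i. prod_list (map norm (interleave as bs i)))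
      = (\<Sum>i. prod_list (map norm (as i))) + (\<Sum>i. prod_list (map norm (bs i)))"
proof -
  have s: "(\<lambda>i. prod_list (map norm (interleave as bs i))) sums
      ((\<Sum>i. prod_list (map norm (as i))) + (\<Sum>i. prod_list (map norm (bs i))))"
    using interleave_sums[OF summable_sums summable_sums, of "\<lambda>i. prod_list (map norm (as i))" "\<lambda>i. prod_list (map norm (bs i))"] r
    by (simp add: represents_def interleave_map[where h = "\<lambda>l. prod_list (map norm l)"])
  show "(\<Sum>i. prod_list (map norm (interleave as bs i)))
      = (\<Sum>i. prod_list (map norm (as i))) + (\<Sum>i. prod_list (map norm (bs i)))"
    using sums_unique[OF s] by simp
  have "(u + v) B = (if B \<in> bounded_forms A n then \<Sum>i. B (interleave as bs i) else 0)" for B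
  proof (cases "B \<in> bounded_forms A n")
    case True
    have "interleave (\<lambda>i. B (as i)) (\<lambda>i. B (bs i)) sums (u B + v B)"
      by (rule interleave_sums[OF forms_sums[OF True r(1) S] forms_sums[OF True r(2) S]])
    hence "(\<lambda>i. B (interleave as bs i)) sums (u B + v B)" by (simp add: interleave_map[where h = B])
    thus ?thesis using True by (simp add: sums_unique)
  qed (use r in \<open>simp add: represents_def\<close>)
  moreover have "length (interleave as bs i) = n \<and> set (interleave as bs i) \<subseteq> S" for i
    using r by (auto simp: represents_def interleave_def)
  ultimately show "represents A n S (interleave as bs) (u + v)"
    using sums_summable[OF s] unfolding represents_def by blast
qed

lemma proj_tensor_add: "u \<in> proj_tensor A n S \<Longrightarrow> v \<in> proj_tensor A n S \<Longrightarrow> S \<subseteq> A \<Longrightarrow> u + v \<in> proj_tensor A n S"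
  unfolding proj_tensor_def using represents_add(1) by blast

lemma proj_norm_triangle:
  assumes u: "u \<in> proj_tensor A n A" and v: "v \<in> proj_tensor A n A"
  shows "proj_norm A n (u + v) \<le> proj_norm A n u + proj_norm A n v"
proof -
  let ?N = "\<lambda>u. {\<Sum>i. prod_list (map norm (as i)) |as. represents A n A as u}"
  have ne: "?N u \<noteq> {}" "?N v \<noteq> {}" using u v by (auto simp: proj_tensor_def)
  have "proj_norm A n (u + v) - y \<le> x" if xy: "x \<in> ?N u" "y \<in> ?N v" for x y
  proof -
    obtain as bs where r: "represents A n A as u" "represents A n A bs v"
      and e: "x = (\<Sum>i. prod_list (map norm (as i)))" "y = (\<Sum>i. prod_list (map norm (bs i)))" using xy by auto
    show ?thesis using proj_norm_le[OF represents_add(1)[OF r order_refl]] represents_add(2)[OF r order_refl]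
      unfolding e by linarith
  qed
  hence "proj_norm A n (u + v) - y \<le> proj_norm A n u" if "y \<in> ?N v" for y
    unfolding proj_norm_def[of A n u] using ne(1) that by (intro cInf_greatest) auto
  hence "proj_norm A n (u + v) - proj_norm A n u \<le> proj_norm A n v"
    unfolding proj_norm_def[of A n v] using ne(2) by (intro cInf_greatest) (auto simp: algebra_simps)
  thus ?thesis by simp
qed

lemma op_scaleC_m1: "op_scaleC (-1) T = - T"
  by (simp add: op_eq_iff scaleC_minus1 blinfun.minus_left)

lemma form_uminus:
  assumes "B \<in> bounded_forms A (Suc n)" "set (a # as) \<subseteq> A" "length as = n"
  shows "B (- a # as) = - B (a # as)"
proof -
  have "length (a # as) = Suc n \<and> set (a # as) \<subseteq> A" "a \<in> A" "0 < Suc n" using assms by simp_all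
  hence "B ((a # as)[0 := op_scaleC (-1) a]) = (-1) * B ((a # as)[0 := a])"
    using assms(1) unfolding bounded_forms_def by blast
  thus ?thesis by (simp add: op_scaleC_m1)
qed

text \<open>The sign is absorbed by the first entry, which exists because the number of factors is
  \<open>Suc n\<close>.\<close>

lemma represents_uminus:
  assumes r: "represents A (Suc n) S as u" and S: "S \<subseteq> A" "\<And>x. x \<in> S \<Longrightarrow> - x \<in> S"
  shows "represents A (Suc n) S (\<lambda>i. - hd (as i) # tl (as i)) (- u)"
proof -
  have as: "\<exists>a bs. as i = a # bs \<and> a \<in> S \<and> set bs \<subseteq> S \<and> length bs = n" for i
  proof -
    have "length (as i) = Suc n" "set (as i) \<subseteq> S" using r by (auto simp: represents_def)
    thus ?thesis by (cases "as i") auto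
  qed
  have "(- u) B = (if B \<in> bounded_forms A (Suc n) then \<Sum>i. B (- hd (as i) # tl (as i)) else 0)" for B
  proof (cases "B \<in> bounded_forms A (Suc n)")
    case True
    have "B (- hd (as i) # tl (as i)) = - B (as i)" for i
    proof -
      obtain a bs where "as i = a # bs" "a \<in> S" "set bs \<subseteq> S" "length bs = n" using as by blast
      thus ?thesis using form_uminus[OF True, of a bs] S by auto
    qed
    thus ?thesis using sums_unique[OF sums_minus[OF forms_sums[OF True r S(1)]]] True by simp
  qed (use r in \<open>simp add: represents_def\<close>)
  moreover have "length (- hd (as i) # tl (as i)) = Suc n \<and> set (- hd (as i) # tl (as i)) \<subseteq> S" for i
    using as[of i] S(2) by auto
  moreover have "prod_list (map norm (- hd (as i) # tl (as i))) = prod_list (map norm (as i))" for i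
    using as[of i] by auto
  ultimately show ?thesis using r unfolding represents_def by auto
qed

lemma proj_tensor_uminus:
  "u \<in> proj_tensor A (Suc n) S \<Longrightarrow> S \<subseteq> A \<Longrightarrow> (\<And>x. x \<in> S \<Longrightarrow> - x \<in> S) \<Longrightarrow> - u \<in> proj_tensor A (Suc n) S"
  unfolding proj_tensor_def using represents_uminus by blast

lemma proj_tensor_diff:
  assumes "u \<in> proj_tensor A (Suc n) S" "v \<in> proj_tensor A (Suc n) S" "S \<subseteq> A" "\<And>x. x \<in> S \<Longrightarrow> - x \<in> S"
  shows "u - v \<in> proj_tensor A (Suc n) S"
  using proj_tensor_add[OF assms(1) proj_tensor_uminus[OF assms(2-4)] assms(3)] by simp

lemma tensor_ext_add:
  fixes \<Phi> :: "'f::complex_hilbert op list \<Rightarrow> 'b::banach"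
  assumes f: "formable A n S \<Phi>" and u: "u \<in> proj_tensor A n S" and v: "v \<in> proj_tensor A n S"
  shows "tensor_ext A n {S} \<Phi> (u + v) = tensor_ext A n {S} \<Phi> u + tensor_ext A n {S} \<Phi> v"
proof -
  obtain as bs where r: "represents A n S as u" "represents A n S bs v" using u v by (auto simp: proj_tensor_def)
  have "S \<subseteq> A" using f by (simp add: formable_def)
  from tensor_ext_sums1[OF f represents_add(1)[OF r this]]
  have "interleave (\<lambda>i. \<Phi> (as i)) (\<lambda>i. \<Phi> (bs i)) sums tensor_ext A n {S} \<Phi> (u + v)"
    by (simp add: interleave_map[where h = \<Phi>])
  with interleave_sums[OF tensor_ext_sums1[OF f r(1)] tensor_ext_sums1[OF f r(2)]]
  show ?thesis using sums_unique2 by metis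
qed

lemma length2E: "length as = 2 \<Longrightarrow> \<exists>a b. as = [a, b]"
  and length3E: "length as = 3 \<Longrightarrow> \<exists>a b c. as = [a, b, c]"
  by (auto simp: numeral_2_eq_2 numeral_3_eq_3 length_Suc_conv)

lemma bounded_forms_2I:
  assumes T: "\<And>a a' b. a \<in> A \<Longrightarrow> a' \<in> A \<Longrightarrow> b \<in> A \<Longrightarrow> T (a + a') b = T a b + T a' b"
    "\<And>a b b'. a \<in> A \<Longrightarrow> b \<in> A \<Longrightarrow> b' \<in> A \<Longrightarrow> T a (b + b') = T a b + T a b'"
    "\<And>a b z. a \<in> A \<Longrightarrow> b \<in> A \<Longrightarrow> T (op_scaleC z a) b = z * T a b \<and> T a (op_scaleC z b) = z * T a b"
    and C: "\<And>a b. a \<in> A \<Longrightarrow> b \<in> A \<Longrightarrow> cmod (T a b) \<le> C * (norm a * norm b)"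
  shows "(\<lambda>as. T (as ! 0) (as ! 1)) \<in> bounded_forms A 2"
  unfolding bounded_forms_def
proof (intro CollectI conjI allI impI ballI exI[of _ C])
  fix as :: "'a op list" and i :: nat and x y :: "'a op" and c
  assume as: "length as = 2 \<and> set as \<subseteq> A"
  then obtain a b where ab: "as = [a, b]" using length2E by blast
  show "cmod (T (as ! 0) (as ! 1)) \<le> C * prod_list (map norm as)" using C as by (simp add: ab)
  assume "i < 2" and xy: "x \<in> A" "y \<in> A"
  hence "i = 0 \<or> i = 1" by auto
  thus "T (as[i := x + y] ! 0) (as[i := x + y] ! 1) = T (as[i := x] ! 0) (as[i := x] ! 1) + T (as[i := y] ! 0) (as[i := y] ! 1)"
    "T (as[i := op_scaleC c x] ! 0) (as[i := op_scaleC c x] ! 1) = c * T (as[i := x] ! 0) (as[i := x] ! 1)"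
    using as xy T by (auto simp: ab)
qed

lemma bounded_forms_3I:
  assumes T: "\<And>a a' b c. a \<in> A \<Longrightarrow> a' \<in> A \<Longrightarrow> b \<in> A \<Longrightarrow> c \<in> A \<Longrightarrow> T (a + a') b c = T a b c + T a' b c"
    "\<And>a b b' c. a \<in> A \<Longrightarrow> b \<in> A \<Longrightarrow> b' \<in> A \<Longrightarrow> c \<in> A \<Longrightarrow> T a (b + b') c = T a b c + T a b' c"
    "\<And>a b c c'. a \<in> A \<Longrightarrow> b \<in> A \<Longrightarrow> c \<in> A \<Longrightarrow> c' \<in> A \<Longrightarrow> T a b (c + c') = T a b c + T a b c'"
    "\<And>a b c z. a \<in> A \<Longrightarrow> b \<in> A \<Longrightarrow> c \<in> A \<Longrightarrow> T (op_scaleC z a) b c = z * T a b c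
      \<and> T a (op_scaleC z b) c = z * T a b c \<and> T a b (op_scaleC z c) = z * T a b c"
    and C: "\<And>a b c. a \<in> A \<Longrightarrow> b \<in> A \<Longrightarrow> c \<in> A \<Longrightarrow> cmod (T a b c) \<le> C * (norm a * (norm b * norm c))"
  shows "(\<lambda>as. T (as ! 0) (as ! 1) (as ! 2)) \<in> bounded_forms A 3"
  unfolding bounded_forms_def
proof (intro CollectI conjI allI impI ballI exI[of _ C])
  fix as :: "'a op list" and i :: nat and x y :: "'a op" and z
  assume as: "length as = 3 \<and> set as \<subseteq> A"
  then obtain a b c where ab: "as = [a, b, c]" using length3E by blast
  let ?T = "\<lambda>bs. T (bs ! 0) (bs ! 1) (bs ! 2)"
  show "cmod (?T as) \<le> C * prod_list (map norm as)" using C as by (simp add: ab numeral_2_eq_2)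
  assume "i < 3" and xy: "x \<in> A" "y \<in> A"
  hence "i = 0 \<or> i = 1 \<or> i = 2" by auto
  thus "?T (as[i := x + y]) = ?T (as[i := x]) + ?T (as[i := y])" "?T (as[i := op_scaleC z x]) = z * ?T (as[i := x])"
    using as xy T by (auto simp: ab numeral_2_eq_2)
qed

lemma bounded_forms_2D:
  assumes B: "B \<in> bounded_forms A 2"
  shows "a \<in> A \<Longrightarrow> a' \<in> A \<Longrightarrow> b \<in> A \<Longrightarrow> B [a + a', b] = B [a, b] + B [a', b]"
    "a \<in> A \<Longrightarrow> b \<in> A \<Longrightarrow> b' \<in> A \<Longrightarrow> B [a, b + b'] = B [a, b] + B [a, b']"
    "a \<in> A \<Longrightarrow> b \<in> A \<Longrightarrow> B [op_scaleC z a, b] = z * B [a, b]"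
    "a \<in> A \<Longrightarrow> b \<in> A \<Longrightarrow> B [a, op_scaleC z b] = z * B [a, b]"
    "\<exists>C\<ge>0. \<forall>a\<in>A. \<forall>b\<in>A. cmod (B [a, b]) \<le> C * (norm a * norm b)"
proof -
  have l: "B (as[i := x + y]) = B (as[i := x]) + B (as[i := y])" "B (as[i := op_scaleC c x]) = c * B (as[i := x])"
    if "length as = 2" "set as \<subseteq> A" "i < 2" "x \<in> A" "y \<in> A" for as i x y c
    using B that unfolding bounded_forms_def by blast+
  show "a \<in> A \<Longrightarrow> a' \<in> A \<Longrightarrow> b \<in> A \<Longrightarrow> B [a + a', b] = B [a, b] + B [a', b]"
    "a \<in> A \<Longrightarrow> b \<in> A \<Longrightarrow> B [op_scaleC z a, b] = z * B [a, b]"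
    using l[of "[a, b]" 0] by simp_all
  show "a \<in> A \<Longrightarrow> b \<in> A \<Longrightarrow> b' \<in> A \<Longrightarrow> B [a, b + b'] = B [a, b] + B [a, b']"
    "a \<in> A \<Longrightarrow> b \<in> A \<Longrightarrow> B [a, op_scaleC z b] = z * B [a, b]"
    using l[of "[a, b]" 1] by simp_all
  obtain C where C: "\<And>as. length as = 2 \<Longrightarrow> set as \<subseteq> A \<Longrightarrow> cmod (B as) \<le> C * prod_list (map norm as)"
    using B unfolding bounded_forms_def by blast
  show "\<exists>C\<ge>0. \<forall>a\<in>A. \<forall>b\<in>A. cmod (B [a, b]) \<le> C * (norm a * norm b)"
  proof (intro exI[of _ "\<bar>C\<bar>"] conjI ballI)
    fix a b assume "a \<in> A" "b \<in> A"
    hence "cmod (B [a, b]) \<le> C * (norm a * norm b)" using C[of "[a, b]"] by simp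
    also have "\<dots> \<le> \<bar>C\<bar> * (norm a * norm b)" by (intro mult_right_mono) auto
    finally show "cmod (B [a, b]) \<le> \<bar>C\<bar> * (norm a * norm b)" .
  qed simp
qed

section \<open>The limit of the dyadic areas as a bounded map on all operators\<close>

section \<open>The extended area operators\<close>

context qfock
begin

lemma AV_add:
  assumes s: "0 \<le> s" and e: "highf s e" and f: "highf s f"
  shows "AV s (\<lambda>x. e x + f x) = AV s e + AV s f"
proof -
  have L: "e \<in> L2_fun" "f \<in> L2_fun" using e f highf_L2 by auto
  have ef: "highf s (\<lambda>x. e x + f x)" using e f L by (auto simp: highf_def)
  show ?thesis
  proof (rule op_eqI)
    fix w :: "(real \<Rightarrow> complex) list" assume w: "set w \<subseteq> L2_fun"
    hence "w ! r \<in> L2_fun" if "r < length w" for r using that nth_mem by blast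
    thus "AV s (\<lambda>x. e x + f x) (\<Theta> w) = (AV s e + AV s f) (\<Theta> w)"
      using s e f ef w L
      by (simp add: AV_word blinfun.add_left AVw_def L2_inner_add_left scaleC_add_left sum.distrib)
  qed (use s e f ef in \<open>auto simp: AV_clinear\<close>)
qed

lemma Qt_add:
  assumes s: "0 \<le> s" and u: "highf s u" and v: "highf s v"
  shows "highf s u' \<Longrightarrow> Qt s b (\<lambda>x. u x + u' x) v = Qt s b u v + Qt s b u' v"
    "highf s v' \<Longrightarrow> Qt s b u (\<lambda>x. v x + v' x) = Qt s b u v + Qt s b u v'"
proof -
  have L: "u \<in> L2_fun" "v \<in> L2_fun" using u v highf_L2 by auto
  show "Qt s b (\<lambda>x. u x + u' x) v = Qt s b u v + Qt s b u' v" if u': "highf s u'"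
  proof -
    have "u' \<in> L2_fun" using u' highf_L2 by auto
    thus ?thesis using L s u' by (simp add: op_eq_iff Qt_def cr_add an_add AV_add[OF s u] L2_inner_add_left blinfun.add_left
        blinfun.add_right blinfun.scaleR_left scaleC_add_left scaleR_add_right algebra_simps)
  qed
  show "Qt s b u (\<lambda>x. v x + v' x) = Qt s b u v + Qt s b u v'" if v': "highf s v'"
  proof -
    have "v' \<in> L2_fun" "spread (s + 1) 0 v' \<in> L2_fun" "spread (s + 1) 0 v \<in> L2_fun" using v' L highf_L2 s by auto
    thus ?thesis using L s by (simp add: op_eq_iff Qt_def cr_add an_add L2_inner_add_right spread_add blinfun.add_left
        blinfun.add_right blinfun.scaleR_left scaleC_add_left scaleR_add_right algebra_simps)
  qed
qed

lemma Qt_clinear: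
  assumes s: "0 \<le> s" and u: "highf s u" and v: "highf s v" and b: "b \<in> clinear_ops"
  shows "Qt s b u v \<in> clinear_ops"
proof -
  have L: "u \<in> L2_fun" "v \<in> L2_fun" using u v highf_L2 by auto
  have sp: "spread (s + 1) 0 v \<in> L2_fun" using s L by auto
  show ?thesis using s u b L sp by (simp add: Qt_def Gt_def AV_clinear G_clinear)
qed

lemma Qt_linear:
  assumes s: "0 \<le> s" and u: "highf s u" and v: "highf s v"
  shows "Qt s (b + b') u v = Qt s b u v + Qt s b' u v" "Qt s (op_scaleC c b) u v = op_scaleC c (Qt s b u v)"
proof -
  have L: "u \<in> L2_fun" "v \<in> L2_fun" using u v highf_L2 by auto
  have G: "adj (Gam (Vf q s)) \<in> clinear_ops" using G_clinear[OF s] by simp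
  show "Qt s (b + b') u v = Qt s b u v + Qt s b' u v"
    using s by (simp add: op_eq_iff Qt_def Gt_def blinfun.add_left blinfun.add_right blinfun.scaleR_left
        scaleC_add_right scaleR_add_right algebra_simps)
  show "Qt s (op_scaleC c b) u v = op_scaleC c (Qt s b u v)"
    using s L G by (simp add: op_eq_iff Qt_def Gt_def blinfun.add_left blinfun.add_right blinfun.scaleR_left
        scaleC_add_right clinear_opsD scaleC_scaleC scaleR_scaleC mult.commute)
qed

abbreviation QB :: "real \<Rightarrow> 'f op \<Rightarrow> real \<Rightarrow> real \<Rightarrow> real \<Rightarrow> real \<Rightarrow> 'f op" where
  "QB s b x y v w \<equiv> Qt s b (ivl x y) (ivl v w)"

lemma ivl_add: "x \<le> y \<Longrightarrow> y \<le> z \<Longrightarrow> ivl x z = (\<lambda>t. ivl x y t + ivl y z t)"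
  by (auto simp: indicator_def)

lemma QB_additive2: assumes s: "0 \<le> s" shows "additive2 s (QB s b)"
  unfolding additive2_def
proof (intro allI impI)
  fix x y z v w assume o: "s \<le> x \<and> x \<le> y \<and> y \<le> z \<and> s \<le> v \<and> v \<le> w"
  have e: "ivl x z = (\<lambda>t. ivl x y t + ivl y z t)" using o by (intro ivl_add) auto
  show "QB s b x z v w = QB s b x y v w + QB s b y z v w \<and> QB s b v w x z = QB s b v w x y + QB s b v w y z"
    unfolding e using o by (intro conjI Qt_add[OF s] highf_ivl) auto
qed

lemma ivl_orth: "y \<le> v \<Longrightarrow> L2_inner (ivl x y) (ivl v w) = 0"
  and ivl_orth': "y \<le> v \<Longrightarrow> L2_inner (ivl v w) (ivl x y) = 0"
  by (rule L2_inner_disjoint, auto simp: indicator_def)+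

lemma ivl_cells_orth: "i \<noteq> j \<Longrightarrow> L2_inner (ivl (dy n (k + 2 * i)) (dy n (Suc (k + 2 * i)))) (ivl (dy n (k + 2 * j)) (dy n (Suc (k + 2 * j)))) = 0"
proof (cases "i < j")
  case True
  hence "dy n (Suc (k + 2 * i)) \<le> dy n (k + 2 * j)" unfolding dy_mono by simp
  thus ?thesis by (rule ivl_orth)
next
  case False
  assume "i \<noteq> j"
  hence "dy n (Suc (k + 2 * j)) \<le> dy n (k + 2 * i)" using False unfolding dy_mono by simp
  thus ?thesis by (rule ivl_orth')
qed

text \<open>Left halves of different cells are orthogonal, so are right halves, and the two halves
  of a cell are orthogonal to each other; hence \<open>norm_sum_Qt\<close> applies. Its constant 4
  is enlarged to the 5 of \<open>norm_Qt\<close> so that one K serves both clauses.\<close>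

lemma QB_bounds: 
  assumes s: "0 \<le> s" shows "area_bounds s (5 / (1 - q) * norm b) (QB s b)"
  unfolding area_bounds_def
proof (intro conjI allI impI)
  fix x y v w assume o: "s \<le> x \<and> x \<le> y \<and> s \<le> v \<and> v \<le> w"
  have "norm (QB s b x y v w) \<le> 5 / (1 - q) * l2 (ivl x y) * l2 (ivl v w) * norm b"
    using o by (intro norm_Qt[OF s] highf_ivl) auto
  thus "norm (QB s b x y v w) \<le> 5 / (1 - q) * norm b * sqrt ((y - x) * (w - v))"
    using o s by (simp add: l2_ivl real_sqrt_mult mult_ac)
next
  fix n a c assume o: "s \<le> dy n a \<and> a \<le> c"
  let ?p = "dy (Suc n)"
  define k where "k = 2 * a"
  let ?e = "\<lambda>i. ivl (?p (k + 2 * i)) (?p (Suc (k + 2 * i)))"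
  let ?f = "\<lambda>i. ivl (?p (Suc k + 2 * i)) (?p (Suc (Suc k + 2 * i)))"
  have len: "?p (Suc j) - ?p j = 1 / 2 ^ Suc n" for j by (simp add: add_divide_distrib)
  have pos: "s \<le> ?p j" if "k \<le> j" for j
  proof -
    have "s \<le> ?p k" using o by (simp add: k_def)
    also have "?p k \<le> ?p j" using that unfolding dy_mono .
    finally show ?thesis .
  qed
  have m: "?p j \<le> ?p (Suc j)" for j unfolding dy_mono by simp
  have sq: "(l2 (ivl (?p j) (?p (Suc j))))\<^sup>2 \<le> 1 / 2 ^ Suc n" if "k \<le> j" for j
    using pos[OF that] m[of j] s len[of j] by (subst l2_ivl) auto
  have hf: "highf s (ivl (?p j) (?p (Suc j)))" if "k \<le> j" for j using pos[OF that] by (rule highf_ivl)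
  have he: "highf s (?e i)" "highf s (?f i)" for i by (rule hf, simp)+
  have se: "(l2 (?e i))\<^sup>2 \<le> 1 / 2 ^ Suc n" "(l2 (?f i))\<^sup>2 \<le> 1 / 2 ^ Suc n" for i by (rule sq, simp)+
  have orth: "L2_inner (?e i) (?f i) = 0" "L2_inner (?f i) (?e i) = 0" for i
    using ivl_orth[of "?p (Suc (k + 2 * i))" "?p (Suc k + 2 * i)"] ivl_orth'[of "?p (Suc (k + 2 * i))" "?p (Suc k + 2 * i)"] by simp_all
  have bd: "4 / (1 - q) * (1 / 2 ^ Suc n) * sqrt (real (c - a)) * norm b \<le> 5 / (1 - q) * norm b / 2 ^ Suc n * sqrt (real (c - a))"
  proof -
    have "4 / (1 - q) \<le> 5 / (1 - q)" using q1 by (intro divide_right_mono) auto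
    from mult_right_mono[OF this, of "norm b / 2 ^ Suc n * sqrt (real (c - a))"] show ?thesis by (simp add: mult_ac)
  qed
  have 1: "norm (\<Sum>i<c - a. Qt s b (?e i) (?f i)) \<le> 4 / (1 - q) * (1 / 2 ^ Suc n) * sqrt (real (c - a)) * norm b"
    by (rule norm_sum_Qt[OF s]; (rule he se orth | (rule ivl_cells_orth, assumption) | simp))
  have 2: "norm (\<Sum>i<c - a. Qt s b (?f i) (?e i)) \<le> 4 / (1 - q) * (1 / 2 ^ Suc n) * sqrt (real (c - a)) * norm b"
    by (rule norm_sum_Qt[OF s]; (rule he se orth | (rule ivl_cells_orth, assumption) | simp))
  have sh: "(\<Sum>j\<in>{a..<c}. g j) = (\<Sum>i<c - a. g (a + i))" for g :: "nat \<Rightarrow> 'f op"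
    using sum.shift_bounds_nat_ivl[of g 0 a "c - a"] o by (simp add: atLeast0LessThan add.commute)
  show "norm (\<Sum>j\<in>{a..<c}. QB s b (?p (2 * j)) (?p (2 * j + 1)) (?p (2 * j + 1)) (?p (2 * j + 2)))
        \<le> 5 / (1 - q) * norm b / 2 ^ Suc n * sqrt (real (c - a))"
    using order_trans[OF 1 bd] unfolding sh by (simp add: k_def algebra_simps)
  show "norm (\<Sum>j\<in>{a..<c}. QB s b (?p (2 * j + 1)) (?p (2 * j + 2)) (?p (2 * j)) (?p (2 * j + 1)))
        \<le> 5 / (1 - q) * norm b / 2 ^ Suc n * sqrt (real (c - a))"
    using order_trans[OF 2 bd] unfolding sh by (simp add: k_def algebra_simps)
qed

text \<open>The area with its left factor stripped off: by \<open>area_S_elem\<close> the area of a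
  \<otimes> b is a times \<open>Lt s t b\<close> for past b. The formula makes sense for every b,
  because \<open>QB\<close> does.\<close>

definition Lt :: "real \<Rightarrow> real \<Rightarrow> 'f op \<Rightarrow> 'f op" where
  "Lt s t b = lim (\<lambda>n. dsum (QB s b) n (dlo n s) (dhi n t))"

lemma dsum_QB_clinear:
  assumes s: "0 \<le> s" "b \<in> clinear_ops" "s \<le> dy n a" shows "dsum (QB s b) n a c \<in> clinear_ops"
proof -
  have hf: "highf s (ivl (dy n i) y)" if "a \<le> i" for i y
    using order_trans[OF s(3) dy_mono[THEN iffD2, OF that]] by (rule highf_ivl)
  show ?thesis unfolding dsum_def
    using hf by (intro clinear_ops_sum clinear_ops_simps Qt_clinear[OF s(1) _ _ s(2)]) auto
qed

lemma dsum_QB_linear: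
  assumes s: "0 \<le> s" "s \<le> dy n a"
  shows "dsum (QB s (b + b')) n a c = dsum (QB s b) n a c + dsum (QB s b') n a c"
    "dsum (QB s (op_scaleC z b)) n a c = op_scaleC z (dsum (QB s b) n a c)"
proof -
  have hf: "highf s (ivl (dy n i) y)" if "a \<le> i" for i y
    using order_trans[OF s(2) dy_mono[THEN iffD2, OF that]] by (rule highf_ivl)
  show "dsum (QB s (b + b')) n a c = dsum (QB s b) n a c + dsum (QB s b') n a c"
    unfolding dsum_def sum.distrib[symmetric]
    by (rule sum.cong[OF refl]) (use hf in \<open>simp add: Qt_linear[OF s(1)] scaleR_add_right del: of_nat_Suc\<close>)
  have lin: "linear (op_scaleC z :: 'f op \<Rightarrow> 'f op)" using bounded_linear_op_scaleC bounded_linear.linear by blast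
  show "dsum (QB s (op_scaleC z b)) n a c = op_scaleC z (dsum (QB s b) n a c)"
    unfolding dsum_def linear_sum[OF lin]
    by (rule sum.cong[OF refl]) (use hf in \<open>simp add: Qt_linear[OF s(1)] linear_add[OF lin] linear_scale[OF lin] del: of_nat_Suc\<close>)
qed

text \<open>The 16 of \<open>dsum_converges\<close> times the 5 of \<open>norm_Qt\<close>.\<close>

definition lbd :: real where "lbd = 80 / (1 - q)"

lemma lbd_nonneg: "0 \<le> lbd" using q1 by (simp add: lbd_def)

context
  fixes s t :: real
  assumes st: "0 \<le> s" "s < t" "t - s < 1"
begin

lemma Lt_lim: "(\<lambda>n. dsum (QB s b) n (dlo n s) (dhi n t)) \<longlonglongrightarrow> Lt s t b"
  and norm_Lt: "norm (Lt s t b) \<le> lbd * (t - s) * norm b"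
proof -
  have K0: "0 \<le> 5 / (1 - q) * norm b" using q1 by simp
  obtain L where L: "(\<lambda>n. dsum (QB s b) n (dlo n s) (dhi n t)) \<longlonglongrightarrow> L" "norm L \<le> 16 * (5 / (1 - q) * norm b) * (t - s)"
    using dsum_converges[OF QB_additive2 QB_bounds st K0] st by blast
  moreover have "Lt s t b = L" unfolding Lt_def using L(1) by (rule limI)
  ultimately show "(\<lambda>n. dsum (QB s b) n (dlo n s) (dhi n t)) \<longlonglongrightarrow> Lt s t b" "norm (Lt s t b) \<le> lbd * (t - s) * norm b"
    by (simp_all add: lbd_def mult_ac)
qed

lemma Lt_clinear: "b \<in> clinear_ops \<Longrightarrow> Lt s t b \<in> clinear_ops"
  by (rule clinear_ops_limit[OF _ Lt_lim]) (use st dsum_QB_clinear dlo_dy in auto)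

lemma Lt_linear: "Lt s t (b + b') = Lt s t b + Lt s t b'" "Lt s t (op_scaleC z b) = op_scaleC z (Lt s t b)"
proof -
  show "Lt s t (b + b') = Lt s t b + Lt s t b'"
    using tendsto_add[OF Lt_lim[of b] Lt_lim[of b']] Lt_lim[of "b + b'"] dsum_QB_linear(1)[OF st(1) dlo_dy[OF st(1)]]
    by (simp add: LIMSEQ_unique)
  show "Lt s t (op_scaleC z b) = op_scaleC z (Lt s t b)"
    using bounded_linear.tendsto[OF bounded_linear_op_scaleC Lt_lim[of b], of z] Lt_lim[of "op_scaleC z b"]
      dsum_QB_linear(2)[OF st(1) dlo_dy[OF st(1)]]
    by (simp add: LIMSEQ_unique)
qed

end

lemma dy_err: assumes "0 \<le> t" shows "\<bar>dy n (dhi n t) - t\<bar> \<le> (1/2) ^ n" "\<bar>dy n (dlo n t) - t\<bar> \<le> (1/2) ^ n"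
proof -
  have "\<bar>dy n c - t\<bar> \<le> (1/2) ^ n" if "\<bar>real c - 2 ^ n * t\<bar> \<le> 1" for c
  proof -
    have "dy n c - t = (real c - 2 ^ n * t) / 2 ^ n" by (simp add: field_simps)
    thus ?thesis using that by (simp add: abs_divide power_one_over divide_right_mono)
  qed
  thus "\<bar>dy n (dhi n t) - t\<bar> \<le> (1/2) ^ n" "\<bar>dy n (dlo n t) - t\<bar> \<le> (1/2) ^ n"
    using dhi[OF assms, of n] dlo[OF assms, of n] by auto
qed

lemma dy_lim: assumes "0 \<le> t" shows "(\<lambda>n. dy n (dhi n t)) \<longlonglongrightarrow> t" "(\<lambda>n. dy n (dlo n t)) \<longlonglongrightarrow> t"
proof -
  have z: "(\<lambda>n. (1/2::real) ^ n) \<longlonglongrightarrow> 0" by (rule LIMSEQ_power_zero) simp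
  show "(\<lambda>n. dy n (dhi n t)) \<longlonglongrightarrow> t" "(\<lambda>n. dy n (dlo n t)) \<longlonglongrightarrow> t"
    using dy_err[OF assms] by (intro LIM_zero_cancel[OF Lim_null_comparison[OF _ z]] always_eventually; simp)+
qed

lemma dlo_le_dhi:
  assumes "0 \<le> s" "s < t" shows "eventually (\<lambda>n. dlo n s \<le> dhi n t) sequentially"
proof -
  have t: "0 \<le> t" using assms by simp
  have "eventually (\<lambda>n. 0 < dy n (dhi n t) - dy n (dlo n s)) sequentially"
    using tendsto_diff[OF dy_lim(1)[OF t] dy_lim(2)[OF assms(1)]] by (rule order_tendstoD) (use assms in simp)
  thus ?thesis by eventually_elim (simp add: divide_less_cancel field_simps)
qed

text \<open>Between past vectors only the contraction of a cell with itself survives. It carries the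
  weight 1/2 of the diagonal terms, and the cells exhaust [s, t]: this is the origin of the 1/2 in
  the correction.\<close>

lemma cinner_Lt:
  assumes st: "0 \<le> s" "s < t" "t - s < 1" and x: "x \<in> pastvec s" and y: "y \<in> pastvec s"
  shows "cinner x (Lt s t b y) = of_real ((t - s) / 2) * cinner x (Gt s b y)"
proof -
  let ?g = "cinner x (Gt s b y)"
  have t: "0 \<le> t" using st by simp
  have 1: "(\<lambda>n. cinner x ((dsum (QB s b) n (dlo n s) (dhi n t)) y)) \<longlonglongrightarrow> cinner x (Lt s t b y)"
    by (intro tendsto_cinner_right bounded_linear.tendsto[OF blinfun.bounded_linear_left] Lt_lim st)
  have 2: "eventually (\<lambda>n. cinner x ((dsum (QB s b) n (dlo n s) (dhi n t)) y)
      = of_real ((dy n (dhi n t) - dy n (dlo n s)) / 2) * ?g) sequentially"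
    using dlo_le_dhi[OF st(1,2)]
  proof eventually_elim
    case (elim n)
    define a c where "a = dlo n s" "c = dhi n t"
    have sa: "s \<le> dy n j" if "a \<le> j" for j
      using dlo_dy[OF st(1), of n] dy_mono[THEN iffD2, OF that, of n] unfolding a_c_def by (rule order_trans)
    have hf: "highf s (ivl (dy n j) y)" if "a \<le> j" for j y by (rule highf_ivl[OF sa[OF that]])
    have "cinner x ((dsum (QB s b) n a c) y) = (\<Sum>j\<in>{a..<c}. of_real (1 / 2 ^ n / 2) * ?g)"
      unfolding dsum_def blinfun.sum_left cinner_sum_right
    proof (rule sum.cong[OF refl])
      fix j assume j: "j \<in> {a..<c}"
      have 1: "L2_inner (ivl (dy n a) (dy n j)) (ivl (dy n j) (dy n (Suc j))) = 0" by (rule ivl_orth) simp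
      have "dy n j \<le> dy n (Suc j)" unfolding dy_mono by simp
      hence 2: "L2_inner (ivl (dy n j) (dy n (Suc j))) (ivl (dy n j) (dy n (Suc j))) = of_real (1 / 2 ^ n)"
        using sa[of j] st j by (subst L2_inner_ivl) (auto simp: add_divide_distrib)
      have q: "cinner x ((QB s b (dy n i) w (dy n j) w') y) = L2_inner (ivl (dy n i) w) (ivl (dy n j) w') * ?g"
        if "a \<le> i" for i w w'
        using j that by (intro cinner_Qt_past[OF st(1) hf hf x y]) auto
      show "cinner x ((QB s b (dy n a) (dy n j) (dy n j) (dy n (Suc j))
         + (1/2) *\<^sub>R QB s b (dy n j) (dy n (Suc j)) (dy n j) (dy n (Suc j))) y) = of_real (1 / 2 ^ n / 2) * ?g"
        using j unfolding blinfun.add_left blinfun.scaleR_left cinner_add_right cinner_scaleR_right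
        by (subst q, simp, subst q, simp, unfold 1 2) simp
    qed
    also have "\<dots> = of_real (real (c - a) / 2 ^ n / 2) * ?g" by simp
    also have "real (c - a) / 2 ^ n = dy n c - dy n a" using elim by (simp add: a_c_def of_nat_diff diff_divide_distrib)
    finally show ?case by (simp add: a_c_def)
  qed
  have 3: "(\<lambda>n. of_real ((dy n (dhi n t) - dy n (dlo n s)) / 2) * ?g) \<longlonglongrightarrow> of_real ((t - s) / 2) * ?g"
    using st t by (intro tendsto_intros dy_lim) auto
  show ?thesis by (rule LIMSEQ_unique[OF 1]) (use tendsto_cong[OF 2] 3 in simp)
qed

end

lemma op_comp_simps:
  "(S + T) o\<^sub>L R = (S o\<^sub>L R) + (T o\<^sub>L R)" "R o\<^sub>L (S + T) = (R o\<^sub>L S) + (R o\<^sub>L T)"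
  "(S - T) o\<^sub>L R = (S o\<^sub>L R) - (T o\<^sub>L R)" "R o\<^sub>L (S - T) = (R o\<^sub>L S) - (R o\<^sub>L T)"
  "(r *\<^sub>R S) o\<^sub>L R = r *\<^sub>R (S o\<^sub>L R)" "R o\<^sub>L (r *\<^sub>R S) = r *\<^sub>R (R o\<^sub>L S)"
  "0 o\<^sub>L R = 0" "R o\<^sub>L 0 = 0" "(Q o\<^sub>L S) o\<^sub>L T = Q o\<^sub>L (S o\<^sub>L T)"
  for Q R S T :: "'b::real_normed_vector \<Rightarrow>\<^sub>L 'b"
  by (rule bounded_bilinear.add_left bounded_bilinear.add_right bounded_bilinear.diff_left bounded_bilinear.diff_right
      bounded_bilinear.scaleR_left bounded_bilinear.scaleR_right bounded_bilinear.zero_left bounded_bilinear.zero_right,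
      rule bounded_bilinear_blinfun_compose)+ (simp add: blinfun_eqI)

lemmas tendsto_comp [tendsto_intros] = bounded_bilinear.tendsto[OF bounded_bilinear_blinfun_compose]

context qfock
begin

definition xbd :: real where "xbd = 2 / sqrt (1 - q)"

lemma xbd_nonneg: "0 \<le> xbd" using q1 by (simp add: xbd_def)

lemma norm_dX: assumes "0 \<le> u" "u \<le> v" shows "norm (dX \<Theta> u v) \<le> xbd * sqrt (v - u)"
proof -
  have L: "ivl u v \<in> L2_fun" using highf_ivl[of u u v] highf_L2 by blast
  have "norm (dX \<Theta> u v) \<le> norm (an (ivl u v)) + norm (cr (ivl u v))"
    using assms by (simp add: dX_Xop Xop_def norm_triangle_ineq)
  also have "\<dots> \<le> sqrt (v - u) / sqrt (1 - q) + sqrt (v - u) / sqrt (1 - q)"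
    using norm_an[OF L] norm_cr[OF L] assms by (simp add: l2_ivl)
  finally show ?thesis by (simp add: xbd_def)
qed

lemma qBM_lim:
  assumes f: "(f \<longlongrightarrow> x) F" "\<And>n. 0 \<le> f n" and x: "0 \<le> x" shows "((\<lambda>n. qBM \<Theta> (f n)) \<longlongrightarrow> qBM \<Theta> x) F"
proof (rule LIM_zero_cancel, rule Lim_null_comparison)
  have "norm (qBM \<Theta> (f n) - qBM \<Theta> x) \<le> xbd * sqrt \<bar>f n - x\<bar>" for n
    using norm_dX[of "f n" x] norm_dX[of x "f n"] f(2)[of n] x
    by (cases "f n \<le> x") (auto simp: dX_def norm_minus_commute)
  thus "\<forall>\<^sub>F n in F. norm (qBM \<Theta> (f n) - qBM \<Theta> x) \<le> xbd * sqrt \<bar>f n - x\<bar>" by simp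
  have "((\<lambda>n. xbd * sqrt \<bar>f n - x\<bar>) \<longlongrightarrow> xbd * sqrt \<bar>x - x\<bar>) F" by (intro tendsto_intros f)
  thus "((\<lambda>n. xbd * sqrt \<bar>f n - x\<bar>) \<longlongrightarrow> 0) F" by simp
qed

lemma dX_lim:
  assumes "(f \<longlongrightarrow> x) F" "\<And>n. 0 \<le> f n" "0 \<le> x" "(g \<longlongrightarrow> y) F" "\<And>n. 0 \<le> g n" "0 \<le> y"
  shows "((\<lambda>n. dX \<Theta> (f n) (g n)) \<longlongrightarrow> dX \<Theta> x y) F"
  unfolding dX_def by (intro tendsto_diff qBM_lim assms)

text \<open>The honest product. It agrees with \<open>QB\<close> for past b after time s and is
  additive at all times, so that a cell straddling an intermediate time can be handled.\<close>

abbreviation XB :: "'f op \<Rightarrow> real \<Rightarrow> real \<Rightarrow> real \<Rightarrow> real \<Rightarrow> 'f op" where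
  "XB b x y v w \<equiv> dX \<Theta> x y o\<^sub>L (b o\<^sub>L dX \<Theta> v w)"

lemma XB_additive2: "additive2 s (XB b)"
  unfolding additive2_def by (simp add: dX_def op_comp_simps)

lemma dsum_QB_XB:
  assumes s: "0 \<le> s" and b: "b \<in> A_upto s" and a: "s \<le> dy n a"
  shows "dsum (QB s b) n a c = dsum (XB b) n a c"
proof -
  have e: "QB s b (dy n i) (dy n i') (dy n j) (dy n j') = XB b (dy n i) (dy n i') (dy n j) (dy n j')"
    if "a \<le> i" "i \<le> i'" "a \<le> j" "j \<le> j'" for i i' j j'
  proof -
    have o: "s \<le> dy n i" "s \<le> dy n j" "dy n i \<le> dy n i'" "dy n j \<le> dy n j'"
      using a that order_trans[OF a dy_mono[THEN iffD2]] unfolding dy_mono by auto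
    hence "0 \<le> dy n i" "0 \<le> dy n j" by simp_all
    thus ?thesis using o s by (simp only: Qt_eq[OF s A_past[OF s b] highf_ivl highf_ivl] dX_Xop op_comp_simps)
  qed
  show ?thesis unfolding dsum_def by (rule sum.cong[OF refl]) (simp add: e del: of_nat_Suc)
qed

lemma Lt_XB_lim:
  assumes "0 \<le> s" "s < t" "t - s < 1" "b \<in> A_upto s"
  shows "(\<lambda>n. dsum (XB b) n (dlo n s) (dhi n t)) \<longlonglongrightarrow> Lt s t b"
  using Lt_lim[OF assms(1-3), of b] dsum_QB_XB[OF assms(1,4) dlo_dy[OF assms(1)]] by simp

lemma A_sum: "(\<And>i. i \<in> I \<Longrightarrow> f i \<in> A_upto s) \<Longrightarrow> sum f I \<in> A_upto s"
  by (induction I rule: infinite_finite_induct) (auto intro: A_zero A_closed(2))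

lemma Lt_A:
  assumes st: "0 \<le> s" "s < t" "t - s < 1" and b: "b \<in> A_upto s"
  shows "Lt s t b \<in> A_upto t"
proof (rule A_lim[OF _ Lt_XB_lim[OF assms]])
  fix n
  have b': "b \<in> A_upto t" using b A_mono[of s t] st by auto
  have le: "dy n j \<le> t" if "j \<le> dhi n t" for j
    using order_trans[OF dy_mono[THEN iffD2, OF that] dhi_dy[of t n]] st by simp
  have X: "dX \<Theta> (dy n i) (dy n j) \<in> A_upto t" if "i \<le> dhi n t" "j \<le> dhi n t" for i j
    using le[OF that(1)] le[OF that(2)] by (intro dX_A) auto
  show "dsum (XB b) n (dlo n s) (dhi n t) \<in> A_upto t" unfolding dsum_def
    by (intro A_sum A_closed(2,3) A_scaleR b' X) auto
qed simp

text \<open>The time u need not be dyadic: sums up to u stop at \<open>dhi n u\<close>, and sums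
  from u start at \<open>dlo n u\<close>, at most one cell later. The straddling cell and its
  products vanish in the limit by continuity of the field.\<close>

lemma Lt_chen:
  assumes o: "0 \<le> s" "s < u" "u < t" "t - s < 1" and b: "b \<in> A_upto s"
  shows "Lt s t b = Lt s u b + Lt u t b + (dX \<Theta> s u o\<^sub>L b o\<^sub>L dX \<Theta> u t)"
proof -
  have u0: "0 \<le> u" and t0: "0 \<le> t" using o by auto
  have bu: "b \<in> A_upto u" using b A_mono[of s u] o by auto
  define E where "E n = dsum (XB b) n (dhi n u) (dlo n u)" for n
  define F where "F n = XB b (dy n (dhi n u)) (dy n (dlo n u)) (dy n (dlo n u)) (dy n (dhi n t))" for n
  define H where "H n = XB b (dy n (dlo n s)) (dy n (dhi n u)) (dy n (dhi n u)) (dy n (dhi n t))" for n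
  have pos: "0 \<le> dy n j" for n j by simp
  have ev: "eventually (\<lambda>n. dsum (XB b) n (dlo n s) (dhi n t)
      = dsum (XB b) n (dlo n s) (dhi n u) + (E n + dsum (XB b) n (dlo n u) (dhi n t) + F n) + H n) sequentially"
    using dlo_le_dhi[OF o(1,2)] dlo_le_dhi[OF u0 o(3)]
  proof eventually_elim
    case (elim n)
    have m: "dhi n u \<le> dlo n u" "dlo n u \<le> dhi n u + 1" using dhi[OF u0, of n] dlo[OF u0, of n] by linarith+
    have s1: "0 \<le> dy n (dlo n s)" "0 \<le> dy n (dhi n u)" by simp_all
    show ?case unfolding E_def F_def H_def
      using dsum_chen[OF XB_additive2 s1(1) elim(1) order_trans[OF m(1) elim(2)], of b]
        dsum_chen[OF XB_additive2 s1(2) m(1) elim(2), of b] by (simp only:)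
  qed
  have E0: "E \<longlonglongrightarrow> 0"
  proof -
    have "E n = (1/2) *\<^sub>R XB b (dy n (dhi n u)) (dy n (dlo n u)) (dy n (dhi n u)) (dy n (dlo n u))" for n
    proof -
      have m: "dlo n u = dhi n u \<or> dlo n u = Suc (dhi n u)" using dhi[OF u0, of n] dlo[OF u0, of n] by linarith
      thus ?thesis by (elim disjE) (simp_all add: E_def dsum_def dX_def op_comp_simps)
    qed
    hence e: "E = (\<lambda>n. (1/2) *\<^sub>R XB b (dy n (dhi n u)) (dy n (dlo n u)) (dy n (dhi n u)) (dy n (dlo n u)))"
      by (rule ext)
    have "E \<longlonglongrightarrow> (1/2) *\<^sub>R XB b u u u u"
      unfolding e using u0 by (intro tendsto_intros dX_lim dy_lim pos)
    thus ?thesis by (simp add: dX_def op_comp_simps)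
  qed
  have FH: "F \<longlonglongrightarrow> XB b u u u t" "H \<longlonglongrightarrow> XB b s u u t"
    unfolding F_def H_def by (intro tendsto_intros dX_lim dy_lim pos u0 t0 o(1))+
  have L: "(\<lambda>n. dsum (XB b) n (dlo n s) (dhi n u)) \<longlonglongrightarrow> Lt s u b"
    "(\<lambda>n. dsum (XB b) n (dlo n u) (dhi n t)) \<longlonglongrightarrow> Lt u t b"
    "(\<lambda>n. dsum (XB b) n (dlo n s) (dhi n t)) \<longlonglongrightarrow> Lt s t b"
    using o b bu by (auto intro!: Lt_XB_lim)
  have *: "(\<lambda>n. dsum (XB b) n (dlo n s) (dhi n u) + (E n + dsum (XB b) n (dlo n u) (dhi n t) + F n) + H n)
      \<longlonglongrightarrow> Lt s u b + (0 + Lt u t b + XB b u u u t) + XB b s u u t"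
    by (intro tendsto_add L E0 FH)
  have "Lt s t b = Lt s u b + (0 + Lt u t b + XB b u u u t) + XB b s u u t"
    by (rule LIMSEQ_unique[OF L(3)]) (use tendsto_cong[OF ev] * in simp)
  thus ?thesis by (simp add: dX_def op_comp_simps)
qed

section \<open>Integrals against the piecewise linear path\<close>

section \<open>The area of the dyadic interpolation\<close>

abbreviation Xn :: "nat \<Rightarrow> real \<Rightarrow> 'f op" where "Xn \<equiv> qBM_interp \<Theta>"

text \<open>The right end point is included, since the next cell starts there with the same
  value.\<close>

lemma Xn_cell:
  assumes u: "dy n k \<le> u" "u \<le> dy n (Suc k)"
  shows "Xn n u = qBM \<Theta> (dy n k) + (2 ^ n * u - real k) *\<^sub>R dX \<Theta> (dy n k) (dy n (Suc k))"
proof (cases "u = dy n (Suc k)")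
  case True
  hence "2 ^ n * u = real (Suc k)" by simp
  thus ?thesis by (simp add: qBM_interp_def Let_def dX_def) 
next
  case False
  hence "real k \<le> 2 ^ n * u" "2 ^ n * u < real k + 1" using u by (simp_all add: field_simps)
  hence "\<lfloor>2 ^ n * u\<rfloor> = int k" by (intro floor_unique) auto
  thus ?thesis by (simp add: qBM_interp_def Let_def add.commute)
qed

lemma Xn_dy: "Xn n (dy n k) = qBM \<Theta> (dy n k)"
  using Xn_cell[of k n "dy n k"] by (simp add: divide_right_mono)

lemma Xn_diff_cell:
  assumes "dy n k \<le> u" "u \<le> v" "v \<le> dy n (Suc k)"
  shows "Xn n v - Xn n u = (v - u) *\<^sub>R (2 ^ n *\<^sub>R dX \<Theta> (dy n k) (dy n (Suc k)))"
  using assms Xn_cell[of k n u] Xn_cell[of k n v]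
  by (simp add: algebra_simps del: of_nat_Suc flip: scaleR_diff_left)

lemma Xn_lim: assumes t: "0 \<le> t" shows "(\<lambda>n. Xn n t) \<longlonglongrightarrow> qBM \<Theta> t"
proof -
  let ?k = "\<lambda>n. dhi n t"
  have z: "(\<lambda>n. (1/2::real) ^ n) \<longlonglongrightarrow> 0" by (rule LIMSEQ_power_zero) simp
  have cell: "dy n (?k n) \<le> t" "t \<le> dy n (Suc (?k n))" for n
    using dhi[OF t, of n] by (auto simp: field_simps)
  have S: "(\<lambda>n. dy n (Suc (?k n))) \<longlonglongrightarrow> t"
    using tendsto_add[OF dy_lim(1)[OF t] z] by (simp add: add_divide_distrib power_one_over add.commute)
  have pos: "0 \<le> dy n j" for n j by simp
  have D: "(\<lambda>n. dX \<Theta> (dy n (?k n)) (dy n (Suc (?k n)))) \<longlonglongrightarrow> dX \<Theta> t t"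
    by (intro dX_lim dy_lim S t pos)
  have "(\<lambda>n. (2 ^ n * t - real (?k n)) *\<^sub>R dX \<Theta> (dy n (?k n)) (dy n (Suc (?k n)))) \<longlonglongrightarrow> 0"
  proof (rule Lim_null_comparison)
    have "norm ((2 ^ n * t - real (?k n)) *\<^sub>R dX \<Theta> (dy n (?k n)) (dy n (Suc (?k n)))) \<le> 1 * norm (dX \<Theta> (dy n (?k n)) (dy n (Suc (?k n))))" for n
      unfolding norm_scaleR using dhi[OF t, of n] by (intro mult_right_mono) auto
    thus "\<forall>\<^sub>F n in sequentially. norm ((2 ^ n * t - real (?k n)) *\<^sub>R dX \<Theta> (dy n (?k n)) (dy n (Suc (?k n)))) \<le> 1 * norm (dX \<Theta> (dy n (?k n)) (dy n (Suc (?k n))))"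
      by simp
    show "(\<lambda>n. 1 * norm (dX \<Theta> (dy n (?k n)) (dy n (Suc (?k n))))) \<longlonglongrightarrow> 0"
      using tendsto_norm[OF D] by (simp add: dX_def)
  qed
  from tendsto_add[OF qBM_lim[OF dy_lim(1)[OF t] pos t] this] show ?thesis
    by (simp add: Xn_cell[OF cell])
qed

text \<open>Inside a cell the derivative is a constant D, so the integrand is affine in u and has a
  quadratic primitive. At the two end points the derivative may fail to exist, which the integral
  does not notice.\<close>

lemma area_cell:
  fixes a b :: "'f op" and s :: real and n k :: nat
  assumes o: "dy n k \<le> u0" "u0 \<le> u1" "u1 \<le> dy n (Suc k)"
  defines "f \<equiv> \<lambda>u. (a o\<^sub>L (Xn n u - Xn n s) o\<^sub>L b) o\<^sub>L vector_derivative (Xn n) (at u)"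
  shows "(f has_integral (a o\<^sub>L (Xn n u0 - Xn n s) o\<^sub>L b o\<^sub>L (Xn n u1 - Xn n u0))
      + (1/2) *\<^sub>R (a o\<^sub>L (Xn n u1 - Xn n u0) o\<^sub>L b o\<^sub>L (Xn n u1 - Xn n u0))) {u0..u1}"
proof -
  define D where "D = 2 ^ n *\<^sub>R dX \<Theta> (dy n k) (dy n (Suc k))"
  define M1 where "M1 = (a o\<^sub>L (Xn n u0 - Xn n s) o\<^sub>L b o\<^sub>L D)"
  define M2 where "M2 = (a o\<^sub>L D o\<^sub>L b o\<^sub>L D)"
  let ?F = "\<lambda>u. (u - u0) *\<^sub>R M1 + ((u - u0)\<^sup>2 / 2) *\<^sub>R M2"
  have dif: "Xn n v - Xn n u = (v - u) *\<^sub>R D" if "dy n k \<le> u" "u \<le> v" "v \<le> dy n (Suc k)" for u v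
    unfolding D_def by (rule Xn_diff_cell[OF that])
  have "((\<lambda>u. M1 + (u - u0) *\<^sub>R M2) has_integral (?F u1 - ?F u0)) {u0..u1}"
  proof (rule fundamental_theorem_of_calculus[OF o(2)])
    fix u
    show "(?F has_vector_derivative M1 + (u - u0) *\<^sub>R M2) (at u within {u0..u1})"
      by (auto intro!: derivative_eq_intros simp: has_real_derivative_iff_has_vector_derivative[symmetric])
  qed
  hence "(f has_integral (?F u1 - ?F u0)) {u0..u1}"
  proof (rule has_integral_spike_finite[of "{u0, u1}", rotated 2])
    fix u assume u: "u \<in> {u0..u1} - {u0, u1}"
    have uin: "u \<in> {dy n k<..<dy n (Suc k)}" using u o by auto
    have "((\<lambda>u. qBM \<Theta> (dy n k) + (2 ^ n * u - real k) *\<^sub>R dX \<Theta> (dy n k) (dy n (Suc k))) has_vector_derivative D) (at u)"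
      unfolding D_def by (auto intro!: derivative_eq_intros)
    hence "(Xn n has_vector_derivative D) (at u)"
      by (rule has_vector_derivative_transform_within_open[OF _ open_greaterThanLessThan uin])
        (simp add: Xn_cell[of k n] less_imp_le del: of_nat_Suc)
    hence vd: "vector_derivative (Xn n) (at u) = D" by (rule vector_derivative_at)
    have "Xn n u - Xn n s = (Xn n u0 - Xn n s) + (u - u0) *\<^sub>R D" using dif[of u0 u] u o by (simp add: algebra_simps)
    thus "f u = M1 + (u - u0) *\<^sub>R M2" by (simp add: f_def vd M1_def M2_def op_comp_simps)
  qed simp
  moreover have "?F u1 - ?F u0 = (a o\<^sub>L (Xn n u0 - Xn n s) o\<^sub>L b o\<^sub>L (Xn n u1 - Xn n u0))
      + (1/2) *\<^sub>R (a o\<^sub>L (Xn n u1 - Xn n u0) o\<^sub>L b o\<^sub>L (Xn n u1 - Xn n u0))"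
    unfolding dif[OF o] M1_def M2_def by (simp add: op_comp_simps power2_eq_square)
  ultimately show ?thesis by simp
qed

lemma area_cells:
  fixes a b :: "'f op" and s :: real and n k :: nat
  assumes kc: "k \<le> c"
  defines "f \<equiv> \<lambda>u. (a o\<^sub>L (Xn n u - Xn n s) o\<^sub>L b) o\<^sub>L vector_derivative (Xn n) (at u)"
  shows "(f has_integral (a o\<^sub>L (qBM \<Theta> (dy n k) - Xn n s) o\<^sub>L b o\<^sub>L dX \<Theta> (dy n k) (dy n c)) + (a o\<^sub>L dsum (XB b) n k c)) {dy n k..dy n c}"
  using kc
proof (induction c rule: dec_induct)
  case base
  have "(f has_integral 0) {dy n k..dy n k}" using has_integral_refl(2)[of f "dy n k"] by simp
  thus ?case by (simp add: dX_def op_comp_simps)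
next
  case (step c)
  have m: "dy n c \<le> dy n (Suc c)" "dy n k \<le> dy n c" using step(1) unfolding dy_mono by auto
  have k0: "0 \<le> dy n k" by simp
  show ?case
    using has_integral_combine[OF m(2) m(1) step.IH area_cell[OF order_refl m(1) order_refl, of a s b, folded f_def]]
    unfolding dsum_Suc[OF XB_additive2 k0 step(1)] Xn_dy
    by (simp add: dX_def op_comp_simps algebra_simps del: of_nat_Suc)
qed

text \<open>The interval is cut at its outermost dyadic points. The end pieces involve increments of
  the interpolation within one cell, which tend to 0; the middle piece is a dyadic sum.\<close>

lemma area_elem_lim:
  fixes a b :: "'f op" and s :: real and n k :: nat
  assumes st: "0 \<le> s" "s < t" "t - s < 1" and b: "b \<in> A_upto s"
  shows "(\<lambda>n. integral {s..t} (\<lambda>u. (a o\<^sub>L (Xn n u - Xn n s) o\<^sub>L b) o\<^sub>L vector_derivative (Xn n) (at u)))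
    \<longlonglongrightarrow> (a o\<^sub>L Lt s t b)"
proof -
  have t0: "0 \<le> t" using st by simp
  have pos: "0 \<le> dy n j" for n j by simp
  define x where "x n = qBM \<Theta> (dy n (dlo n s)) - Xn n s" for n
  define z where "z n = Xn n t - qBM \<Theta> (dy n (dhi n t))" for n
  define y where "y n = dX \<Theta> (dy n (dlo n s)) (dy n (dhi n t))" for n
  define V where "V n = (1/2) *\<^sub>R (a o\<^sub>L x n o\<^sub>L b o\<^sub>L x n) + ((a o\<^sub>L x n o\<^sub>L b o\<^sub>L y n)
     + (a o\<^sub>L dsum (XB b) n (dlo n s) (dhi n t))) + ((a o\<^sub>L (x n + y n) o\<^sub>L b o\<^sub>L z n) + (1/2) *\<^sub>R (a o\<^sub>L z n o\<^sub>L b o\<^sub>L z n))" for n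
  have ev: "eventually (\<lambda>n. integral {s..t} (\<lambda>u. (a o\<^sub>L (Xn n u - Xn n s) o\<^sub>L b) o\<^sub>L vector_derivative (Xn n) (at u)) = V n) sequentially"
    using dlo_le_dhi[OF st(1,2)]
  proof eventually_elim
    case (elim n)
    let ?f = "\<lambda>u. (a o\<^sub>L (Xn n u - Xn n s) o\<^sub>L b) o\<^sub>L vector_derivative (Xn n) (at u)"
    have lo: "dlo n s \<le> Suc (dhi n s)" using dhi[OF st(1), of n] dlo[OF st(1), of n] by linarith
    have c1: "dy n (dhi n s) \<le> s" "s \<le> dy n (dlo n s)" "dy n (dlo n s) \<le> dy n (Suc (dhi n s))"
      using lo dhi_dy dlo_dy st unfolding dy_mono by auto
    have c3: "dy n (dhi n t) \<le> dy n (dhi n t)" "dy n (dhi n t) \<le> t" "t \<le> dy n (Suc (dhi n t))"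
      using dhi_dy[OF t0] dhi[OF t0, of n] by (auto simp: field_simps)
    have c2: "dy n (dlo n s) \<le> dy n (dhi n t)" using elim unfolding dy_mono .
    have i1: "(?f has_integral (1/2) *\<^sub>R (a o\<^sub>L x n o\<^sub>L b o\<^sub>L x n)) {s..dy n (dlo n s)}"
      using area_cell[OF c1, of a s b] unfolding Xn_dy x_def by (simp add: op_comp_simps)
    have i2: "(?f has_integral (a o\<^sub>L x n o\<^sub>L b o\<^sub>L y n) + (a o\<^sub>L dsum (XB b) n (dlo n s) (dhi n t))) {dy n (dlo n s)..dy n (dhi n t)}"
      unfolding x_def y_def by (rule area_cells[OF elim])
    have i3: "(?f has_integral (a o\<^sub>L (x n + y n) o\<^sub>L b o\<^sub>L z n) + (1/2) *\<^sub>R (a o\<^sub>L z n o\<^sub>L b o\<^sub>L z n)) {dy n (dhi n t)..t}"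
    proof -
      have "qBM \<Theta> (dy n (dhi n t)) - Xn n s = x n + y n" by (simp add: x_def y_def dX_def)
      thus ?thesis using area_cell[OF c3, of a s b] unfolding Xn_dy z_def by simp
    qed
    have "(?f has_integral V n) {s..t}" unfolding V_def
      by (rule has_integral_combine[OF _ c3(2) has_integral_combine[OF c1(2) c2 i1 i2] i3]) (use c1(2) c2 in linarith)
    thus ?case by (rule integral_unique)
  qed
  have X: "x \<longlonglongrightarrow> qBM \<Theta> s - qBM \<Theta> s" unfolding x_def by (intro tendsto_diff qBM_lim dy_lim Xn_lim pos st(1))
  have Z: "z \<longlonglongrightarrow> qBM \<Theta> t - qBM \<Theta> t" unfolding z_def by (intro tendsto_diff qBM_lim dy_lim Xn_lim pos t0)
  have Y: "y \<longlonglongrightarrow> dX \<Theta> s t" unfolding y_def by (intro dX_lim dy_lim pos st(1) t0)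
  have x0: "x \<longlonglongrightarrow> 0" and z0: "z \<longlonglongrightarrow> 0" using X Z by simp_all
  have "V \<longlonglongrightarrow> (1/2) *\<^sub>R (a o\<^sub>L 0 o\<^sub>L b o\<^sub>L 0) + ((a o\<^sub>L 0 o\<^sub>L b o\<^sub>L dX \<Theta> s t) + (a o\<^sub>L Lt s t b))
     + ((a o\<^sub>L (0 + dX \<Theta> s t) o\<^sub>L b o\<^sub>L 0) + (1/2) *\<^sub>R (a o\<^sub>L 0 o\<^sub>L b o\<^sub>L 0))"
    unfolding V_def by (intro tendsto_intros x0 z0 Y Lt_XB_lim st b)
  hence "V \<longlonglongrightarrow> (a o\<^sub>L Lt s t b)" by (simp add: op_comp_simps)
  thus ?thesis using tendsto_cong[OF ev] by simp
qed

end

section \<open>Extension of operator-valued maps with bounds in the projective norm\<close>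

section \<open>Operator-valued extensions\<close>

text \<open>Matrix coefficients separate operators, and as \<Phi> is bounded on lists from all of A,
  they are bounded forms on A although the tensors in question are built from S.\<close>

lemma formable_opI:
  fixes \<Phi> :: "'f::complex_hilbert op list \<Rightarrow> 'f op"
  assumes S: "S \<subseteq> A" and C: "\<And>as. length as = n \<Longrightarrow> set as \<subseteq> A \<Longrightarrow> norm (\<Phi> as) \<le> C * prod_list (map norm as)"
    and B: "\<And>x y. (\<lambda>as. cinner y (blinfun_apply (\<Phi> as) x)) \<in> bounded_forms A n"
  shows "formable A n S \<Phi>"
  unfolding formable_def
proof (intro conjI allI impI)
  show "\<exists>C. \<forall>as. length as = n \<and> set as \<subseteq> S \<longrightarrow> norm (\<Phi> as) \<le> C * prod_list (map norm as)"
    using S C by blast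
  fix X Y :: "'f op" assume "X \<noteq> Y"
  then obtain v where v: "blinfun_apply X v \<noteq> blinfun_apply Y v" using blinfun_eqI by blast
  define d where "d = blinfun_apply X v - blinfun_apply Y v"
  have d: "cinner d d \<noteq> 0" using v by (simp add: d_def cinner_self)
  show "\<exists>F::'f op \<Rightarrow> complex. \<exists>B\<in>bounded_forms A n. bounded_linear F \<and> F X \<noteq> F Y \<and>
        (\<forall>as. length as = n \<and> set as \<subseteq> S \<longrightarrow> F (\<Phi> as) = B as)"
  proof (intro exI[of _ "\<lambda>T. cinner d (blinfun_apply T v)"] bexI[OF _ B[of d v]] conjI allI impI refl)
    show "bounded_linear (\<lambda>T. cinner d (blinfun_apply T v))"
      by (rule bounded_linear_compose[OF bounded_linear_cinner_right blinfun.bounded_linear_left])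
    have "cinner d (blinfun_apply X v) - cinner d (blinfun_apply Y v) = cinner d d"
      by (simp add: d_def flip: cinner_diff_right)
    thus "cinner d (blinfun_apply X v) \<noteq> cinner d (blinfun_apply Y v)" using d by auto
  qed
qed (rule S)

text \<open>The cost of a representation with entries in S is not controlled by
  \<open>proj_norm\<close>, an infimum over representations in A. The estimate is therefore made for
  matrix coefficients, which are forms on A, and only then passed to the operator norm.\<close>

lemma norm_tensor_ext:
  fixes \<Phi> :: "'f::complex_hilbert op list \<Rightarrow> 'f op"
  assumes S: "S \<subseteq> A" and C: "\<And>as. length as = n \<Longrightarrow> set as \<subseteq> A \<Longrightarrow> norm (\<Phi> as) \<le> C * prod_list (map norm as)"
    and B: "\<And>x y. (\<lambda>as. cinner y ((\<Phi> as) x)) \<in> bounded_forms A n"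
    and C0: "0 \<le> C" and u: "u \<in> proj_tensor A n S"
  shows "norm (tensor_ext A n {S} \<Phi> u) \<le> C * proj_norm A n u"
proof (rule norm_blinfun_bound)
  have uA: "u \<in> proj_tensor A n A" using u proj_tensor_mono[OF S] by blast
  show P0: "0 \<le> C * proj_norm A n u" using C0 proj_norm_nonneg[OF uA] by simp
  fix x :: 'f
  obtain as where r: "represents A n S as u" using u by (auto simp: proj_tensor_def)
  let ?T = "tensor_ext A n {S} \<Phi> u"
  have s: "(\<lambda>i. \<Phi> (as i)) sums ?T" by (rule tensor_ext_sums1[OF formable_opI[OF S C B] r])
  have "cmod (cinner y (?T x)) \<le> (C * proj_norm A n u * norm x) * norm y" for y
  proof -
    let ?B = "\<lambda>as. cinner y ((\<Phi> as) x)"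
    have "(\<lambda>i. ?B (as i)) sums cinner y (?T x)"
      by (rule bounded_linear.sums[OF bounded_linear_compose[OF bounded_linear_cinner_right blinfun.bounded_linear_left] s])
    hence "u ?B = cinner y (?T x)" using forms_sums[OF B r S] sums_unique2 by blast
    moreover have "cmod (u ?B) \<le> (norm y * C * norm x) * proj_norm A n u"
    proof (rule proj_norm_bound[OF B _ _ uA])
      fix bs :: "'f op list" assume bs: "length bs = n" "set bs \<subseteq> A"
      have "cmod (?B bs) \<le> norm y * norm ((\<Phi> bs) x)" by (rule cmod_cinner_le)
      also have "\<dots> \<le> norm y * (C * prod_list (map norm bs) * norm x)"
        by (intro mult_left_mono order_trans[OF norm_blinfun] mult_right_mono C bs) auto
      finally show "cmod (?B bs) \<le> norm y * C * norm x * prod_list (map norm bs)" by (simp add: mult_ac)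
    qed (use C0 in simp)
    ultimately show ?thesis by (simp add: mult_ac)
  qed
  thus "norm (?T x) \<le> C * proj_norm A n u * norm x"
    by (rule norm_le_if_cinner_le) (use P0 in simp)
qed

lemma tensor_ext_cong:
  assumes "\<And>S as. S \<in> \<S> \<Longrightarrow> length as = n \<Longrightarrow> set as \<subseteq> S \<Longrightarrow> \<Phi> as = \<Psi> as"
  shows "tensor_ext A n \<S> \<Phi> u = tensor_ext A n \<S> \<Psi> u"
proof -
  have "(\<lambda>i. \<Phi> (as i)) = (\<lambda>i. \<Psi> (as i))" if "S \<in> \<S>" "represents A n S as u" for S as
    using assms[OF that(1)] that(2) by (auto simp: represents_def)
  thus ?thesis unfolding tensor_ext_def by metis
qed

context qfock
begin

lemma AA_subset: "A_upto s \<subseteq> AA" using A_subset_AA by blast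

lemma norm_comp3: "norm (a o\<^sub>L Y o\<^sub>L (b :: 'f op)) \<le> norm Y * (norm a * norm b)"
proof -
  have "norm (a o\<^sub>L Y o\<^sub>L b) \<le> norm a * norm Y * norm b"
    by (meson mult_right_mono norm_blinfun_compose norm_ge_zero order_trans)
  thus ?thesis by (simp add: mult_ac)
qed

lemma norm_list2:
  assumes "length as = 2" shows "norm (as ! 0 o\<^sub>L Y o\<^sub>L (as ! 1 :: 'f op)) \<le> norm Y * prod_list (map norm as)"
  using length2E[OF assms] norm_comp3 by fastforce

lemma cmod_cinner_op: "norm T \<le> K * r \<Longrightarrow> cmod (cinner y (T x)) \<le> norm y * K * norm x * r" for T :: "'f op"
proof -
  assume T: "norm T \<le> K * r"
  have "cmod (cinner y (T x)) \<le> norm y * (K * r * norm x)"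
    by (intro order_trans[OF cmod_cinner_le] mult_left_mono order_trans[OF norm_blinfun] mult_right_mono T) auto
  thus ?thesis by (simp add: mult_ac)
qed

lemma form2:
  assumes Y: "Y \<in> clinear_ops"
  shows "(\<lambda>as. cinner y ((as ! 0 o\<^sub>L Y o\<^sub>L as ! 1) x)) \<in> bounded_forms AA 2"
  by (rule bounded_forms_2I[where T = "\<lambda>a b. cinner y ((a o\<^sub>L Y o\<^sub>L b) x)", OF _ _ _ cmod_cinner_op[OF norm_comp3]])
    (use Y AA_clinear in \<open>auto simp: blinfun.add_left blinfun.add_right cinner_add_right cinner_scaleC_right clinear_opsD\<close>)

lemmas formable2 = formable_opI[OF _ norm_list2 form2]

lemma sharp_sums:
  assumes "represents AA 2 S as u" "S \<subseteq> AA" "Y \<in> clinear_ops"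
  shows "(\<lambda>i. as i ! 0 o\<^sub>L Y o\<^sub>L as i ! 1) sums sharp AA u Y"
  unfolding sharp_def
  by (rule tensor_ext_sums1[OF formable2 represents_mono[OF assms(1,2)]]) (use assms in auto)

lemma norm_sharp:
  assumes "u \<in> proj_tensor AA 2 AA" "Y \<in> clinear_ops"
  shows "norm (sharp AA u Y) \<le> norm Y * proj_norm AA 2 u"
  unfolding sharp_def by (rule norm_tensor_ext[OF order_refl norm_list2 form2]) (use assms in auto)

lemma sharp_add:
  assumes "u \<in> proj_tensor AA 2 AA" "v \<in> proj_tensor AA 2 AA" "Y \<in> clinear_ops"
  shows "sharp AA (u + v) Y = sharp AA u Y + sharp AA v Y"
  unfolding sharp_def by (rule tensor_ext_add[OF formable2]) (use assms in auto)

lemma sharp_add_right: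
  assumes u: "u \<in> proj_tensor AA 2 AA" and Y: "Y \<in> clinear_ops" "Z \<in> clinear_ops"
  shows "sharp AA u (Y + Z) = sharp AA u Y + sharp AA u Z"
proof -
  obtain as where r: "represents AA 2 AA as u" using u by (auto simp: proj_tensor_def)
  show ?thesis
    using sharp_sums[OF r order_refl, of "Y + Z"] sums_add[OF sharp_sums[OF r order_refl Y(1)] sharp_sums[OF r order_refl Y(2)]] Y
    by (intro sums_unique2[of "\<lambda>i. as i ! 0 o\<^sub>L (Y + Z) o\<^sub>L as i ! 1"]) (auto simp: op_comp_simps)
qed

lemma sums_A: "(\<And>i. f i \<in> A_upto t) \<Longrightarrow> f sums T \<Longrightarrow> T \<in> A_upto t"
  unfolding sums_def by (rule A_lim[where F = sequentially]) (auto intro: A_sum)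

lemma represents_nth: "represents A n S as u \<Longrightarrow> j < n \<Longrightarrow> as i ! j \<in> S"
  unfolding represents_def by (metis nth_mem subsetD)

lemma sharp_A:
  assumes u: "u \<in> proj_tensor AA 2 (A_upto s)" and "s \<le> t" and Y: "Y \<in> A_upto t"
  shows "sharp AA u Y \<in> A_upto t"
proof -
  obtain as where r: "represents AA 2 (A_upto s) as u" using u by (auto simp: proj_tensor_def)
  show ?thesis
    by (rule sums_A[OF _ sharp_sums[OF r AA_subset A_clinear[OF Y]]])
      (use represents_nth[OF r] A_mono[OF \<open>s \<le> t\<close>] Y in \<open>auto intro!: A_closed(3)\<close>)
qed

lemma elem_represents:
  assumes "a \<in> AA" "b \<in> AA"
  shows "represents AA 2 AA (\<lambda>i. if i = (0::nat) then [a, b] else [0, 0]) (elem_tensor AA [a, b])"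
proof -
  have z: "B [0, 0] = 0" if "B \<in> bounded_forms AA 2" for B
    using bounded_forms_2D(1)[OF that AA_zero AA_zero AA_zero] by simp
  have "elem_tensor AA [a, b] = (\<lambda>B. if B \<in> bounded_forms AA 2 then \<Sum>i. B (if i = (0::nat) then [a, b] else [0, 0]) else 0)"
  proof
    fix B :: "'f op list \<Rightarrow> complex"
    have "(\<lambda>i. B (if i = (0::nat) then [a, b] else [0, 0])) = (\<lambda>i. if i = 0 then B [a, b] else 0)" if "B \<in> bounded_forms AA 2"
      using z[OF that] by auto
    thus "elem_tensor AA [a, b] B = (if B \<in> bounded_forms AA 2 then \<Sum>i. B (if i = (0::nat) then [a, b] else [0, 0]) else 0)"
      using sums_unique[OF sums_single[of 0 "\<lambda>_. B [a, b]"]] by (simp add: elem_tensor_def numeral_2_eq_2)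
  qed
  moreover have "summable (\<lambda>i. prod_list (map norm (if i = (0::nat) then [a, b] else [0, 0])))"
    by (rule summable_finite[of "{0}"]) auto
  ultimately show ?thesis using assms AA_zero by (auto simp: represents_def)
qed

lemma sharp_elem:
  assumes "a \<in> AA" "b \<in> AA" "Y \<in> clinear_ops"
  shows "sharp AA (elem_tensor AA [a, b]) Y = a o\<^sub>L Y o\<^sub>L b"
proof -
  have "(\<lambda>i. if i = (0::nat) then a o\<^sub>L Y o\<^sub>L b else 0) sums sharp AA (elem_tensor AA [a, b]) Y"
    using sharp_sums[OF elem_represents[OF assms(1,2)] order_refl assms(3)]
    by (rule back_subst[where P = "\<lambda>f. f sums _"]) (auto simp: op_comp_simps)
  thus ?thesis using sums_unique2 sums_single[of 0 "\<lambda>_. a o\<^sub>L Y o\<^sub>L b"] by blast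
qed

text \<open>The bound is asked on all complex-linear operators rather than on past ones, so that
  \<open>norm_tensor_ext\<close> applies with L in the middle factor.\<close>

definition clin :: "real \<Rightarrow> ('f op \<Rightarrow> 'f op) \<Rightarrow> bool" where
  "clin K L \<longleftrightarrow> 0 \<le> K \<and> (\<forall>b\<in>clinear_ops. \<forall>c\<in>clinear_ops. L (b + c) = L b + L c) \<and>
     (\<forall>b\<in>clinear_ops. \<forall>z. L (op_scaleC z b) = op_scaleC z (L b)) \<and>
     (\<forall>b\<in>clinear_ops. L b \<in> clinear_ops \<and> norm (L b) \<le> K * norm b)"

text \<open>The common form of both area corrections and of the term with \<open>Gamma_q\<close>:
  each of them touches only the middle factor.\<close>

definition tens3 :: "'f op set \<Rightarrow> ('f op \<Rightarrow> 'f op) \<Rightarrow> 'f tensor \<Rightarrow> 'f op" where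
  "tens3 S L u = tensor_ext AA 3 {S} (\<lambda>as. as ! 0 o\<^sub>L L (as ! 1) o\<^sub>L as ! 2) u"

lemma norm_list3:
  assumes L: "clin K L" and as: "length as = 3" "set as \<subseteq> AA"
  shows "norm (as ! 0 o\<^sub>L L (as ! 1) o\<^sub>L as ! 2) \<le> K * prod_list (map norm as)"
proof -
  obtain a b c where e: "as = [a, b, c]" using length3E[OF as(1)] by blast
  have "norm (L b) \<le> K * norm b" using L as AA_clinear unfolding clin_def e by auto
  hence "norm (L b) * (norm a * norm c) \<le> K * norm b * (norm a * norm c)" by (intro mult_right_mono) auto
  thus ?thesis using norm_comp3[of a "L b" c] by (simp add: e mult_ac)
qed

lemma form3:
  assumes L: "clin K L"
  shows "(\<lambda>as. cinner y ((as ! 0 o\<^sub>L L (as ! 1) o\<^sub>L as ! 2) x)) \<in> bounded_forms AA 3"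
proof -
  have N: "norm (a o\<^sub>L L b o\<^sub>L c) \<le> K * (norm a * (norm b * norm c))" if "a \<in> AA" "b \<in> AA" "c \<in> AA" for a b c
    using norm_list3[OF L, of "[a, b, c]"] that by (simp add: numeral_2_eq_2)
  have Lc: "b \<in> AA \<Longrightarrow> L b \<in> clinear_ops" "b \<in> AA \<Longrightarrow> b' \<in> AA \<Longrightarrow> L (b + b') = L b + L b'"
    "b \<in> AA \<Longrightarrow> L (op_scaleC z b) = op_scaleC z (L b)" for b b' z
    using L AA_clinear by (auto simp: clin_def)
  show ?thesis
    by (rule bounded_forms_3I[where T = "\<lambda>a b c. cinner y ((a o\<^sub>L L b o\<^sub>L c) x)", OF _ _ _ _ cmod_cinner_op[OF N]])
      (simp_all add: Lc AA_clinear blinfun.add_left blinfun.add_right cinner_add_right cinner_scaleC_right clinear_opsD)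
qed

lemma formable3: "clin K L \<Longrightarrow> formable AA 3 (A_upto s) (\<lambda>as. as ! 0 o\<^sub>L L (as ! 1) o\<^sub>L as ! 2)"
  by (rule formable_opI[OF AA_subset norm_list3 form3])

lemma tens3_sums:
  assumes L: "clin K L" and r: "represents AA 3 (A_upto s) as u"
  shows "(\<lambda>i. as i ! 0 o\<^sub>L L (as i ! 1) o\<^sub>L as i ! 2) sums tens3 (A_upto s) L u"
  unfolding tens3_def by (rule tensor_ext_sums1[OF formable3[OF L] r])

lemma norm_tens3:
  assumes L: "clin K L" and u: "u \<in> proj_tensor AA 3 (A_upto s)"
  shows "norm (tens3 (A_upto s) L u) \<le> K * proj_norm AA 3 u"
  unfolding tens3_def
  by (rule norm_tensor_ext[OF AA_subset norm_list3[OF L] form3[OF L] _ u]) (use L in \<open>auto simp: clin_def\<close>)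

lemma tens3_add:
  assumes L: "clin K L" and u: "u \<in> proj_tensor AA 3 (A_upto s)" "v \<in> proj_tensor AA 3 (A_upto s)"
  shows "tens3 (A_upto s) L (u + v) = tens3 (A_upto s) L u + tens3 (A_upto s) L v"
  unfolding tens3_def by (rule tensor_ext_add[OF formable3[OF L] u])

lemma tens3_A:
  assumes L: "clin K L" and u: "u \<in> proj_tensor AA 3 (A_upto s)" and "s \<le> t"
    and LA: "\<And>b. b \<in> A_upto s \<Longrightarrow> L b \<in> A_upto t"
  shows "tens3 (A_upto s) L u \<in> A_upto t"
proof -
  obtain as where r: "represents AA 3 (A_upto s) as u" using u by (auto simp: proj_tensor_def)
  show ?thesis
    by (rule sums_A[OF _ tens3_sums[OF L r]])
      (use represents_nth[OF r] A_mono[OF \<open>s \<le> t\<close>] LA in \<open>auto intro!: A_closed(3)\<close>)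
qed

text \<open>The adjoint area of b \<otimes> c is \<open>starL s t b\<close> times c, so in a triple
  again only the middle factor is affected.\<close>

definition starL :: "real \<Rightarrow> real \<Rightarrow> 'f op \<Rightarrow> 'f op" where
  "starL s t b = adj (Lt s t (adj b))"

lemma clin_Lt: "0 \<le> s \<Longrightarrow> s < t \<Longrightarrow> t - s < 1 \<Longrightarrow> clin (lbd * (t - s)) (Lt s t)"
  using lbd_nonneg by (auto simp: clin_def Lt_linear Lt_clinear norm_Lt)

lemma clin_starL:
  assumes "0 \<le> s" "s < t" "t - s < 1" shows "clin (lbd * (t - s)) (starL s t)"
  unfolding clin_def
proof (intro conjI ballI allI)
  show "0 \<le> lbd * (t - s)" using assms lbd_nonneg by simp
  fix b :: "'f op" assume b: "b \<in> clinear_ops"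
  show "starL s t b \<in> clinear_ops" using b Lt_clinear[OF assms] by (simp add: starL_def)
  show "norm (starL s t b) \<le> lbd * (t - s) * norm b"
    using b Lt_clinear[OF assms] norm_Lt[OF assms, of "adj b"] by (simp add: starL_def norm_adj)
  show "starL s t (op_scaleC z b) = op_scaleC z (starL s t b)" for z
    using b Lt_clinear[OF assms] by (simp add: starL_def adj_scaleC Lt_linear[OF assms])
  show "starL s t (b + c) = starL s t b + starL s t c" if "c \<in> clinear_ops" for c
    using b that Lt_clinear[OF assms] by (simp add: starL_def adj_add Lt_linear[OF assms])
qed

lemma clin_Gt: "0 \<le> s \<Longrightarrow> clin 1 (Gt s)"
  using bounded_linear.linear[OF bounded_linear_Gt[of s]] norm_Gt[of s]
  by (auto simp: clin_def linear_add Gt_def G_clinear op_eq_iff clinear_opsD)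

end

section \<open>Chen's relation and matrix elements for the corrections of tensors\<close>

section \<open>Increments of the compensated sums\<close>

context qfock
begin

lemma qBM_clinear [simp]: "qBM \<Theta> t \<in> clinear_ops"
  using qBM_sa(1)[of "{t}"] by simp

lemma dX_clinear [simp]: "dX \<Theta> s t \<in> clinear_ops"
  by (simp add: dX_def)

lemma Xn_clinear [simp]: "Xn n t \<in> clinear_ops"
  by (simp add: qBM_interp_def Let_def)

lemma area_S_elem:
  assumes st: "0 \<le> s" "s < t" "t - s < 1" and a: "a \<in> AA" and b: "b \<in> A_upto s"
  shows "area_S \<Theta> s t (elem_tensor AA [a, b]) = a o\<^sub>L Lt s t b"
proof -
  have "b \<in> AA" using b A_subset_AA by blast
  hence "area_n \<Theta> n s t (elem_tensor AA [a, b])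
      = integral {s..t} (\<lambda>u. (a o\<^sub>L (Xn n u - Xn n s) o\<^sub>L b) o\<^sub>L vector_derivative (Xn n) (at u))" for n
    using a by (simp add: area_n_def sharp_elem)
  thus ?thesis using area_elem_lim[OF st b, of a] by (simp add: area_S_def limI)
qed

lemma area_S_id_tens3:
  assumes st: "0 \<le> s" "s < t" "t - s < 1"
  shows "area_S_id \<Theta> s t u = tens3 (A_upto s) (Lt s t) u"
  unfolding area_S_id_def tens3_def
proof (rule tensor_ext_cong)
  fix S as assume S: "S \<in> {A_upto s}" and as: "length as = 3" "set as \<subseteq> S"
  obtain a b c where e: "as = [a, b, c]" using length3E[OF as(1)] by blast
  hence "a \<in> AA" "b \<in> A_upto s" using S as A_subset_AA by auto
  from area_S_elem[OF st this] show "area_S \<Theta> s t (elem_tensor AA [as ! 0, as ! 1]) o\<^sub>L as ! 2 = as ! 0 o\<^sub>L Lt s t (as ! 1) o\<^sub>L as ! 2"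
    by (simp add: e numeral_2_eq_2)
qed

lemma id_area_S_star_tens3:
  assumes st: "0 \<le> s" "s < t" "t - s < 1"
  shows "id_area_S_star \<Theta> s t u = tens3 (A_upto s) (starL s t) u"
  unfolding id_area_S_star_def tens3_def
proof (rule tensor_ext_cong)
  fix S as assume S: "S \<in> {A_upto s}" and as: "length as = 3" "set as \<subseteq> S"
  obtain a b c where e: "as = [a, b, c]" using length3E[OF as(1)] by blast
  have bc: "b \<in> A_upto s" "c \<in> A_upto s" using S as e by auto
  have "area_S_star \<Theta> s t b c = adj (adj c o\<^sub>L Lt s t (adj b))"
    unfolding area_S_star_def using area_S_elem[OF st A_subset_AA[OF A_adj[OF bc(2)]] A_adj[OF bc(1)]] by simp
  also have "\<dots> = starL s t b o\<^sub>L c"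
    using A_clinear[OF bc(1)] A_clinear[OF bc(2)] Lt_clinear[OF st] by (simp add: adj_comp starL_def)
  finally show "as ! 0 o\<^sub>L area_S_star \<Theta> s t (as ! 1) (as ! 2) = as ! 0 o\<^sub>L starL s t (as ! 1) o\<^sub>L as ! 2"
    by (simp add: e op_comp_simps numeral_2_eq_2)
qed

text \<open>The contracted tensor evaluates a form B by evaluating u at the form in three arguments
  that B and the contraction define. This depends on u alone, so the definite description is met by
  every representation.\<close>

lemma contraction_represents:
  fixes g h :: "'f op list \<Rightarrow> 'f op"
  assumes r: "represents AA 3 AA as u"
    and g: "\<And>cs. length cs = 3 \<Longrightarrow> set cs \<subseteq> AA \<Longrightarrow> g cs \<in> AA \<and> h cs \<in> AA \<and> norm (g cs) * norm (h cs) \<le> K * prod_list (map norm cs)"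
    and form: "\<And>B. B \<in> bounded_forms AA 2 \<Longrightarrow> (\<lambda>cs. B [g cs, h cs]) \<in> bounded_forms AA 3"
  shows "represents AA 2 AA (\<lambda>i. [g (as i), h (as i)]) (THE z. \<forall>as. represents AA 3 AA as u \<longrightarrow> represents AA 2 AA (\<lambda>i. [g (as i), h (as i)]) z)"
proof -
  define z where "z = (\<lambda>B. if B \<in> bounded_forms AA 2 then u (\<lambda>cs. B [g cs, h cs]) else 0)"
  have z: "represents AA 2 AA (\<lambda>i. [g (bs i), h (bs i)]) z" if b: "represents AA 3 AA bs u" for bs
    unfolding represents_def
  proof (intro conjI allI)
    have bs: "length (bs i) = 3" "set (bs i) \<subseteq> AA" for i using b by (auto simp: represents_def)
    show "length [g (bs i), h (bs i)] = 2" "set [g (bs i), h (bs i)] \<subseteq> AA" for i using g[OF bs] by auto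
    show "summable (\<lambda>i. prod_list (map norm [g (bs i), h (bs i)]))"
    proof (rule summable_comparison_test')
      show "summable (\<lambda>i. K * prod_list (map norm (bs i)))" using b by (intro summable_mult) (simp add: represents_def)
      show "norm (prod_list (map norm [g (bs i), h (bs i)])) \<le> K * prod_list (map norm (bs i))" for i
        using g[OF bs, of i] by simp
    qed
    show "z = (\<lambda>B. if B \<in> bounded_forms AA 2 then \<Sum>i. B [g (bs i), h (bs i)] else 0)"
      unfolding z_def using sums_unique[OF forms_sums[OF form b order_refl]] by auto
  qed
  have "(THE z. \<forall>as. represents AA 3 AA as u \<longrightarrow> represents AA 2 AA (\<lambda>i. [g (as i), h (as i)]) z) = z"
  proof (rule the_equality)
    fix z' assume "\<forall>as. represents AA 3 AA as u \<longrightarrow> represents AA 2 AA (\<lambda>i. [g (as i), h (as i)]) z'"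
    thus "z' = z" using r z[OF r] by (simp add: represents_def)
  qed (use z in blast)
  thus ?thesis using z[OF r] by simp
qed

lemma op_scaleC_comp: "op_scaleC z a o\<^sub>L b = op_scaleC z (a o\<^sub>L b)" "a \<in> AA \<Longrightarrow> a o\<^sub>L op_scaleC z b = op_scaleC z (a o\<^sub>L b)"
  for z and a b :: "'f op"
  using AA_clinear by (auto simp: op_eq_iff clinear_opsD)

lemma sharp_represents:
  assumes r: "represents AA 3 AA as u" and Y: "Y \<in> AA"
  shows "represents AA 2 AA (\<lambda>i. [as i ! 0 o\<^sub>L Y o\<^sub>L as i ! 1, as i ! 2]) (sharp_left AA Y u)"
    "represents AA 2 AA (\<lambda>i. [as i ! 0, as i ! 1 o\<^sub>L Y o\<^sub>L as i ! 2]) (sharp_right AA u Y)"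
proof -
  have m: "a o\<^sub>L Y o\<^sub>L b \<in> AA" if "a \<in> AA" "b \<in> AA" for a b using that Y by (intro AA_closed(3))
  have mem3: "norm (a o\<^sub>L Y o\<^sub>L b) * norm c \<le> norm Y * (norm a * (norm b * norm c))"
    "norm a * norm (b o\<^sub>L Y o\<^sub>L c) \<le> norm Y * (norm a * (norm b * norm c))" for a b c :: "'f op"
    using mult_right_mono[OF norm_comp3[of a Y b], of "norm c"] mult_left_mono[OF norm_comp3[of b Y c], of "norm a"]
    by (simp_all add: mult_ac)
  have mem: "cs ! 0 o\<^sub>L Y o\<^sub>L cs ! 1 \<in> AA \<and> cs ! 2 \<in> AA \<and> norm (cs ! 0 o\<^sub>L Y o\<^sub>L cs ! 1) * norm (cs ! 2) \<le> norm Y * prod_list (map norm cs)"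
    "cs ! 0 \<in> AA \<and> cs ! 1 o\<^sub>L Y o\<^sub>L cs ! 2 \<in> AA \<and> norm (cs ! 0) * norm (cs ! 1 o\<^sub>L Y o\<^sub>L cs ! 2) \<le> norm Y * prod_list (map norm cs)"
    if cs: "length cs = 3" "set cs \<subseteq> AA" for cs
    using length3E[OF cs(1)] cs(2) m mem3 by (auto simp: numeral_2_eq_2)
  have form: "(\<lambda>cs. B [cs ! 0 o\<^sub>L Y o\<^sub>L cs ! 1, cs ! 2]) \<in> bounded_forms AA 3"
    "(\<lambda>cs. B [cs ! 0, cs ! 1 o\<^sub>L Y o\<^sub>L cs ! 2]) \<in> bounded_forms AA 3" if B: "B \<in> bounded_forms AA 2" for B
  proof -
    obtain C where C: "0 \<le> C" "\<And>a b. a \<in> AA \<Longrightarrow> b \<in> AA \<Longrightarrow> cmod (B [a, b]) \<le> C * (norm a * norm b)"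
      using bounded_forms_2D(5)[OF B] by blast
    have bd: "cmod (B [g, h]) \<le> C * norm Y * r" if "g \<in> AA" "h \<in> AA" "norm g * norm h \<le> norm Y * r" for g h r
      using C(2)[OF that(1,2)] mult_left_mono[OF that(3) C(1)] by (simp add: mult_ac)
    note simps = Y m op_comp_simps op_scaleC_comp AA_closed bounded_forms_2D(1-4)[OF B]
    show "(\<lambda>cs. B [cs ! 0 o\<^sub>L Y o\<^sub>L cs ! 1, cs ! 2]) \<in> bounded_forms AA 3"
      by (rule bounded_forms_3I[where T = "\<lambda>a b c. B [a o\<^sub>L Y o\<^sub>L b, c]", OF _ _ _ _ bd[OF m _ mem3(1)]])
        (simp_all add: simps)
    show "(\<lambda>cs. B [cs ! 0, cs ! 1 o\<^sub>L Y o\<^sub>L cs ! 2]) \<in> bounded_forms AA 3"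
      by (rule bounded_forms_3I[where T = "\<lambda>a b c. B [a, b o\<^sub>L Y o\<^sub>L c]", OF _ _ _ _ bd[OF _ m mem3(2)]])
        (simp_all add: simps)
  qed
  show "represents AA 2 AA (\<lambda>i. [as i ! 0 o\<^sub>L Y o\<^sub>L as i ! 1, as i ! 2]) (sharp_left AA Y u)"
    unfolding sharp_left_def by (rule contraction_represents[OF r mem(1) form(1)])
  show "represents AA 2 AA (\<lambda>i. [as i ! 0, as i ! 1 o\<^sub>L Y o\<^sub>L as i ! 2]) (sharp_right AA u Y)"
    unfolding sharp_right_def by (rule contraction_represents[OF r mem(2) form(2)])
qed

lemma starL_chen:
  assumes o: "0 \<le> s" "s < u" "u < t" "t - s < 1" and b: "b \<in> A_upto s"
  shows "starL s t b = starL s u b + starL u t b + (dX \<Theta> u t o\<^sub>L b o\<^sub>L dX \<Theta> s u)"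
proof -
  have bc: "b \<in> clinear_ops" using b by (rule A_clinear)
  have sa: "adj (dX \<Theta> x y) = dX \<Theta> x y" for x y
    using qBM_sa(2)[of _ UNIV] by (simp add: dX_def adj_diff)
  have L: "Lt s u (adj b) \<in> clinear_ops" "Lt u t (adj b) \<in> clinear_ops"
    using o bc by (auto intro!: Lt_clinear)
  show ?thesis unfolding starL_def Lt_chen[OF o A_adj[OF b]]
    using bc L by (simp add: adj_add adj_comp sa op_comp_simps)
qed

text \<open>Chen's relation inserts one increment on each side of the middle entry; contracting the
  tensor first with one of them and then with the other has the same effect.\<close>

lemma tens3_chen:
  assumes o: "0 \<le> s" "s < u" "u < t" "t - s < 1" and w: "w \<in> proj_tensor AA 3 (A_upto s)"
  shows "tens3 (A_upto s) (Lt s t) w = tens3 (A_upto s) (Lt s u) w + tens3 (A_upto u) (Lt u t) w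
      + sharp AA (sharp_left AA (dX \<Theta> s u) w) (dX \<Theta> u t)"
    "tens3 (A_upto s) (starL s t) w = tens3 (A_upto s) (starL s u) w + tens3 (A_upto u) (starL u t) w
      + sharp AA (sharp_right AA w (dX \<Theta> s u)) (dX \<Theta> u t)"
proof -
  obtain as where r: "represents AA 3 (A_upto s) as w" using w by (auto simp: proj_tensor_def)
  have rA: "represents AA 3 AA as w" by (rule represents_mono[OF r AA_subset])
  have ru: "represents AA 3 (A_upto u) as w" by (rule represents_mono[OF r A_mono]) (use o in simp)
  have mem: "as i ! 1 \<in> A_upto s" for i using represents_nth[OF r] by simp
  have X: "dX \<Theta> s u \<in> AA" using o by (intro AA_dX) auto
  have o1: "0 \<le> s" "s < u" "u - s < 1" and o2: "0 \<le> u" "u < t" "t - u < 1" and o3: "0 \<le> s" "s < t" "t - s < 1" using o by auto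
  have chen: "tens3 (A_upto s) L w = tens3 (A_upto s) L' w + tens3 (A_upto u) L'' w + Z"
    if L: "clin K L" "clin K' L'" "clin K'' L''"
      and Z: "(\<lambda>i. as i ! 0 o\<^sub>L (L (as i ! 1) - L' (as i ! 1) - L'' (as i ! 1)) o\<^sub>L as i ! 2) sums Z" for L L' L'' K K' K'' Z
    by (rule sums_unique2[OF tens3_sums[OF L(1) r]])
      (use sums_add[OF sums_add[OF tens3_sums[OF L(2) r] tens3_sums[OF L(3) ru]] Z] in \<open>simp add: op_comp_simps\<close>)
  have d: "Lt s t (as i ! 1) - Lt s u (as i ! 1) - Lt u t (as i ! 1) = dX \<Theta> s u o\<^sub>L as i ! 1 o\<^sub>L dX \<Theta> u t"
    "starL s t (as i ! 1) - starL s u (as i ! 1) - starL u t (as i ! 1) = dX \<Theta> u t o\<^sub>L as i ! 1 o\<^sub>L dX \<Theta> s u" for i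
    unfolding Lt_chen[OF o mem] starL_chen[OF o mem] by simp_all
  show "tens3 (A_upto s) (Lt s t) w = tens3 (A_upto s) (Lt s u) w + tens3 (A_upto u) (Lt u t) w
      + sharp AA (sharp_left AA (dX \<Theta> s u) w) (dX \<Theta> u t)"
    using sharp_sums[OF sharp_represents(1)[OF rA X] order_refl dX_clinear, of u t]
    by (intro chen[OF clin_Lt[OF o3] clin_Lt[OF o1] clin_Lt[OF o2]]) (unfold d(1), simp add: op_comp_simps)
  show "tens3 (A_upto s) (starL s t) w = tens3 (A_upto s) (starL s u) w + tens3 (A_upto u) (starL u t) w
      + sharp AA (sharp_right AA w (dX \<Theta> s u)) (dX \<Theta> u t)"
    using sharp_sums[OF sharp_represents(2)[OF rA X] order_refl dX_clinear, of u t]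
    by (intro chen[OF clin_starL[OF o3] clin_starL[OF o1] clin_starL[OF o2]]) (unfold d(2), simp add: op_comp_simps)
qed

lemma starL_A: "0 \<le> s \<Longrightarrow> s < t \<Longrightarrow> t - s < 1 \<Longrightarrow> b \<in> A_upto s \<Longrightarrow> starL s t b \<in> A_upto t"
  unfolding starL_def by (intro A_adj Lt_A)

text \<open>The compression respects adjoints, so conjugating \<open>cinner_Lt\<close> gives the
  same coefficient.\<close>

lemma cinner_starL:
  assumes st: "0 \<le> s" "s < t" "t - s < 1" and x: "x \<in> pastvec s" and y: "y \<in> pastvec s" and b: "b \<in> clinear_ops"
  shows "cinner x (starL s t b y) = of_real ((t - s) / 2) * cinner x (Gt s b y)"
proof -
  have G: "Gt s (adj b) = adj (Gt s b)" "Gt s b \<in> clinear_ops"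
    using b G_clinear[OF st(1)] by (simp_all add: Gt_def[OF st(1)] adj_comp op_comp_simps)
  have "cinner x (starL s t b y) = cnj (cinner y (Lt s t (adj b) x))"
    unfolding starL_def using b Lt_clinear[OF st] cinner_adj[of "Lt s t (adj b)" x y]
    by (simp add: cinner_commute[of y "Lt s t (adj b) x"] cinner_adj')
  also have "\<dots> = of_real ((t - s) / 2) * cnj (cinner y (adj (Gt s b) x))"
    by (simp add: cinner_Lt[OF st y x] G)
  also have "cnj (cinner y (adj (Gt s b) x)) = cinner x (Gt s b y)"
    using G(2) by (simp add: cinner_adj' cinner_commute[of x "Gt s b y"])
  finally show ?thesis .
qed

text \<open>The outer entries are past operators and map past vectors to past vectors, so a relation
  for the middle entries holds term by term.\<close>

lemma cinner_tens3:
  assumes s: "0 \<le> s" and L: "clin K L" "clin K' L'" and w: "w \<in> proj_tensor AA 3 (A_upto s)"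
    and e: "\<And>b x y. b \<in> A_upto s \<Longrightarrow> x \<in> pastvec s \<Longrightarrow> y \<in> pastvec s \<Longrightarrow>
      cinner x ((L b) y) = z * cinner x ((L' b) y)"
    and xy: "x \<in> pastvec s" "y \<in> pastvec s"
  shows "cinner x ((tens3 (A_upto s) L w) y) = z * cinner x ((tens3 (A_upto s) L' w) y)"
proof -
  obtain as where r: "represents AA 3 (A_upto s) as w" using w by (auto simp: proj_tensor_def)
  note bl = bounded_linear_compose[OF bounded_linear_cinner_right blinfun.bounded_linear_left, of x y]
  have mem: "as i ! 0 \<in> A_upto s" "as i ! 1 \<in> A_upto s" "as i ! 2 \<in> A_upto s" for i
    using represents_nth[OF r] by simp_all
  have pv: "T \<in> A_upto s \<Longrightarrow> v \<in> pastvec s \<Longrightarrow> T v \<in> pastvec s" for T v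
    using past_pastvec[OF s A_past[OF s]] by blast
  have eq: "cinner x ((as i ! 0 o\<^sub>L L (as i ! 1) o\<^sub>L as i ! 2) y)
      = z * cinner x ((as i ! 0 o\<^sub>L L' (as i ! 1) o\<^sub>L as i ! 2) y)" for i
    using e[OF mem(2) pv[OF A_adj[OF mem(1)] xy(1)] pv[OF mem(3) xy(2)], of i i i] A_clinear[OF mem(1), of i]
    by (simp add: cinner_adj)
  have 1: "(\<lambda>i. cinner x ((as i ! 0 o\<^sub>L L (as i ! 1) o\<^sub>L as i ! 2) y)) sums cinner x ((tens3 (A_upto s) L w) y)"
    by (rule bounded_linear.sums[OF bl tens3_sums[OF L(1) r]])
  have 2: "(\<lambda>i. cinner x ((as i ! 0 o\<^sub>L L' (as i ! 1) o\<^sub>L as i ! 2) y)) sums cinner x ((tens3 (A_upto s) L' w) y)"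
    by (rule bounded_linear.sums[OF bl tens3_sums[OF L(2) r]])
  show ?thesis using 1 sums_mult[OF 2, of z] unfolding eq by (rule sums_unique2)
qed

end

section \<open>Partitions and the filter of vanishing mesh\<close>

section \<open>Sums along partitions\<close>

lemma partition_sum_simps [simp]:
  "partition_sum F [] = 0" "partition_sum F [x] = 0"
  "partition_sum F (x # y # zs) = F x y + partition_sum F (y # zs)"
proof -
  show "partition_sum F (x # y # zs) = F x y + partition_sum F (y # zs)"
    by (simp add: partition_sum_def sum.lessThan_Suc_shift del: sum.lessThan_Suc)
qed (simp_all add: partition_sum_def)

lemma partition_sum_append: "partition_sum F (xs @ p # ys) = partition_sum F (xs @ [p]) + partition_sum F (p # ys)"
proof (induction xs)
  case (Cons x xs)
  thus ?case by (cases xs) (simp_all add: add.assoc)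
qed simp

definition finer :: "real \<Rightarrow> real list \<Rightarrow> bool" where
  "finer e ts \<longleftrightarrow> (\<forall>i<length ts - 1. ts ! Suc i - ts ! i < e)"

lemma finer_simps [simp]: "finer e [x]" "finer e (x # y # zs) \<longleftrightarrow> y - x < e \<and> finer e (y # zs)"
  by (auto simp: finer_def All_less_Suc2)

lemma eventually_mesh:
  "eventually P (mesh_to_0 s t) \<longleftrightarrow> (\<exists>e>0. \<forall>ts\<in>partitions s t. finer e ts \<longrightarrow> P ts)"
proof -
  have "eventually P (mesh_to_0 s t) \<longleftrightarrow> (\<exists>e\<in>{0<..}. eventually P (principal {ts \<in> partitions s t. finer e ts}))"
    unfolding mesh_to_0_def finer_def
  proof (rule eventually_INF_base)
    fix a b :: real assume ab: "a \<in> {0<..}" "b \<in> {0<..}"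
    show "\<exists>x\<in>{0<..}. principal {ts \<in> partitions s t. \<forall>i<length ts - 1. ts ! Suc i - ts ! i < x}
       \<le> inf (principal {ts \<in> partitions s t. \<forall>i<length ts - 1. ts ! Suc i - ts ! i < a})
         (principal {ts \<in> partitions s t. \<forall>i<length ts - 1. ts ! Suc i - ts ! i < b})"
      using ab by (intro bexI[of _ "min a b"]) auto
  qed auto
  thus ?thesis by (auto simp: eventually_principal)
qed

lemma partitions_Cons [simp]:
  "x # y # zs \<in> partitions s t \<longleftrightarrow> x = s \<and> s < y \<and> y # zs \<in> partitions y t"
  "[x] \<in> partitions s t \<longleftrightarrow> x = s \<and> x = t"
  by (auto simp: partitions_def)

lemma partitions_le: "ts \<in> partitions s t \<Longrightarrow> x \<in> set ts \<Longrightarrow> s \<le> x \<and> x \<le> t"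
proof (induction ts arbitrary: s x)
  case (Cons y ts)
  show ?case
  proof (cases ts)
    case Nil
    thus ?thesis using Cons.prems by auto
  next
    case (Cons z zs)
    hence z: "y = s" "s < z" "ts \<in> partitions z t" "x = y \<or> x \<in> set ts" using Cons.prems by auto
    have "z \<le> x' \<and> x' \<le> t" if "x' \<in> set ts" for x' using Cons.IH[OF z(3)] that z(3) by blast
    thus ?thesis using z Cons by fastforce
  qed
qed simp

lemma partitions_nonempty: "ts \<in> partitions s t \<Longrightarrow> s \<le> t"
  using partitions_le[of ts s t "hd ts"] by (auto simp: partitions_def)

text \<open>Induction from the right end with a moving left end point: what is added is always
  earlier than what is there, as telescoping and orthogonality arguments require.\<close>

lemma partition_induct [consumes 1, case_names single Cons]:
  assumes "ts \<in> partitions s t"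
    and "P t [t]"
    and "\<And>x y zs. x < y \<Longrightarrow> y \<le> t \<Longrightarrow> y # zs \<in> partitions y t \<Longrightarrow> P y (y # zs) \<Longrightarrow> P x (x # y # zs)"
  shows "P s ts"
  using assms(1)
proof (induction ts arbitrary: s)
  case Nil
  thus ?case by (simp add: partitions_def)
next
  case (Cons x ts)
  show ?case
  proof (cases ts)
    case Nil
    thus ?thesis using Cons.prems assms(2) by auto
  next
    case (Cons y zs)
    hence "x = s" "s < y" "y # zs \<in> partitions y t" using Cons.prems by auto
    thus ?thesis using assms(3)[of s y zs] Cons Cons.IH partitions_nonempty by auto
  qed
qed

lemma ex_fine_partition:
  assumes "s < t" "0 < e" shows "\<exists>ts\<in>partitions s t. finer e ts"
proof -
  obtain N :: nat where N: "(t - s) / e < real N" using reals_Archimedean2 by blast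
  have N0: "0 < real N" using N assms by (meson diff_gt_0_iff_gt divide_pos_pos less_trans)
  define p where "p i = s + real i * ((t - s) / real N)" for i
  have h: "0 < (t - s) / real N" "(t - s) / real N < e" using assms N N0 by (simp_all add: field_simps)
  have pd: "p (Suc i) - p i = (t - s) / real N" for i by (simp add: p_def algebra_simps add_divide_distrib diff_divide_distrib)
  have mono: "p i < p j" if "i < j" for i j
    using mult_strict_right_mono[OF _ h(1), of "real i" "real j"] that by (simp add: p_def)
  let ?ts = "map p [0..<Suc N]"
  have "sorted_wrt (<) ?ts" by (simp add: sorted_wrt_map sorted_wrt_iff_nth_less mono del: upt_Suc)
  moreover have "hd ?ts = s" "last ?ts = t" using N0 by (simp_all add: p_def hd_map last_map del: upt_Suc)
  moreover have "finer e ?ts" unfolding finer_def using h pd by (simp del: upt_Suc)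
  ultimately show ?thesis by (intro bexI[of _ ?ts]) (auto simp: partitions_def)
qed

lemma mesh_nonbot: "s < t \<Longrightarrow> mesh_to_0 s t \<noteq> bot"
  unfolding trivial_limit_def eventually_mesh using ex_fine_partition by blast

lemma partition_sum_add: "partition_sum (\<lambda>u v. F u v + G u v) ts = partition_sum F ts + partition_sum G ts"
  by (simp add: partition_sum_def sum.distrib)

lemma partition_sum_diff:
  fixes F G :: "real \<Rightarrow> real \<Rightarrow> 'b::ab_group_add"
  shows "partition_sum (\<lambda>u v. F u v - G u v) ts = partition_sum F ts - partition_sum G ts"
  by (simp add: partition_sum_def sum_subtractf)

lemma partition_sum_telescope:
  fixes F :: "real \<Rightarrow> 'b::ab_group_add"
  assumes "ts \<in> partitions s t" shows "partition_sum (\<lambda>u v. F v - F u) ts = F t - F s"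
proof -
  have "partition_sum (\<lambda>u v. F v - F u) ts = F (last ts) - F s"
    using assms by (induction rule: partition_induct) auto
  thus ?thesis using assms by (simp add: partitions_def)
qed

text \<open>The fixed lower limit a keeps the hypothesis on F unchanged while the left end point
  moves in the induction.\<close>

lemma partition_sum_norm:
  fixes F :: "real \<Rightarrow> real \<Rightarrow> 'b::real_normed_vector"
  assumes "ts \<in> partitions s t" "finer e ts" "a \<le> s"
    and "\<And>u v. a \<le> u \<Longrightarrow> u < v \<Longrightarrow> v \<le> t \<Longrightarrow> v - u < e \<Longrightarrow> norm (F u v) \<le> G u v"
  shows "norm (partition_sum F ts) \<le> partition_sum G ts"
  using assms
proof (induction rule: partition_induct)
  case (Cons x y zs)
  have "norm (F x y) \<le> G x y" using Cons by auto
  moreover have "norm (partition_sum F (y # zs)) \<le> partition_sum G (y # zs)" using Cons by auto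
  ultimately show ?case using norm_triangle_ineq[of "F x y" "partition_sum F (y # zs)"] by simp
qed simp

lemma partition_sum_le:
  fixes F G :: "real \<Rightarrow> real \<Rightarrow> real"
  assumes "ts \<in> partitions s t" "finer e ts" "a \<le> s"
    and "\<And>u v. a \<le> u \<Longrightarrow> u < v \<Longrightarrow> v \<le> t \<Longrightarrow> v - u < e \<Longrightarrow> F u v \<le> G u v"
  shows "partition_sum F ts \<le> partition_sum G ts"
  using assms
proof (induction rule: partition_induct)
  case (Cons x y zs)
  have "F x y \<le> G x y" "partition_sum F (y # zs) \<le> partition_sum G (y # zs)" using Cons by auto
  thus ?case by simp
qed simp

section \<open>Convergence of sums of almost additive functions\<close>

section \<open>The sewing lemma\<close>

lemma partition_split:
  assumes "xs @ p # ys \<in> partitions s t"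
  shows "xs @ [p] \<in> partitions s p" "p # ys \<in> partitions p t" "x \<in> set xs \<Longrightarrow> x < p" "y \<in> set ys \<Longrightarrow> p < y"
  using assms by (auto simp: partitions_def sorted_wrt_append hd_append split: if_splits)

text \<open>Split at the partition interval that contains the midpoint: both outer parts have at most half the length.\<close>

lemma sewing_local:
  fixes \<Xi> :: "real \<Rightarrow> real \<Rightarrow> 'b::real_normed_vector"
  assumes \<theta>: "1 < \<theta>" and C: "0 \<le> C"
    and \<Xi>: "\<And>a m c. s \<le> a \<Longrightarrow> a < m \<Longrightarrow> m < c \<Longrightarrow> c \<le> t \<Longrightarrow> c - a < 1 \<Longrightarrow>
      norm (\<Xi> a c - \<Xi> a m - \<Xi> m c) \<le> C * (c - a) powr \<theta>"
    and P: "P \<in> partitions a c" and ac: "s \<le> a" "a < c" "c \<le> t" "c - a < 1"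
  defines "K \<equiv> 2 * C / (1 - 2 powr (1 - \<theta>))"
  shows "norm (partition_sum \<Xi> P - \<Xi> a c) \<le> K * (c - a) powr \<theta>"
  using P ac
proof (induction "length P" arbitrary: P a c rule: less_induct)
  case less
  have r: "2 powr (1 - \<theta>) < 1" using \<theta> by (simp add: powr_less_one)
  have K0: "0 \<le> K" using r C by (simp add: K_def)
  \<comment> \<open>K is the fixed point of the recursion: two defects cost C each, and each outer
    part costs K times (1/2)^\<theta>, together K times 2^(1 - \<theta>).\<close>
  have KK: "2 * C + K * 2 powr (1 - \<theta>) = K"
  proof -
    have "K * (1 - 2 powr (1 - \<theta>)) = 2 * C" using r \<theta> by (simp add: K_def)
    thus ?thesis by (simp add: right_diff_distrib)
  qed
  define mid where "mid = (a + c) / 2"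
  define xs where "xs = takeWhile (\<lambda>x. x \<le> mid) P"
  define ys where "ys = dropWhile (\<lambda>x. x \<le> mid) P"
  have Pxy: "P = xs @ ys" by (simp add: xs_def ys_def)
  have hl: "hd P = a" "last P = c" "P \<noteq> []" using less.prems by (auto simp: partitions_def)
  have amc: "a \<le> mid" "mid < c" using less.prems by (auto simp: mid_def)
  have xne: "xs \<noteq> []" using hl amc by (cases P) (auto simp: xs_def)
  have yne: "ys \<noteq> []"
  proof
    assume "ys = []"
    hence "\<forall>x\<in>set P. x \<le> mid" by (simp add: ys_def dropWhile_eq_Nil_conv)
    thus False using hl(2) amc last_in_set[OF hl(3)] by auto
  qed
  define p xs' p' ys' where "p = last xs" "xs' = butlast xs" "p' = hd ys" "ys' = tl ys"
  have xs: "xs = xs' @ [p]" and ys: "ys = p' # ys'" using xne yne by (auto simp: p_xs'_p'_ys'_def)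
  have pm: "p \<le> mid" using xne set_takeWhileD[of p "\<lambda>x. x \<le> mid" P] by (simp add: p_xs'_p'_ys'_def(1) flip: xs_def)
  have pm': "mid < p'" using yne hd_dropWhile[of "\<lambda>x. x \<le> mid" P] by (simp add: p_xs'_p'_ys'_def(3) flip: ys_def)
  have P1: "xs' @ p # (p' # ys') \<in> partitions a c" "(xs' @ [p]) @ p' # ys' \<in> partitions a c"
    using less.prems(1) by (simp_all add: Pxy xs ys)
  note L = partition_split(1,2)[OF P1(1)] and R = partition_split(1,2)[OF P1(2)]
  have ap: "a \<le> p" "p' \<le> c" using partitions_nonempty[OF L(1)] partitions_nonempty[OF R(2)] by auto
  have sum: "partition_sum \<Xi> P = partition_sum \<Xi> (xs' @ [p]) + (\<Xi> p p' + partition_sum \<Xi> (p' # ys'))"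
    unfolding Pxy xs ys using partition_sum_append[of \<Xi> xs' p "p' # ys'"] by simp
  have len: "length (xs' @ [p]) < length P" "length (p' # ys') < length P"
    unfolding Pxy xs ys by simp_all
  let ?l = "(c - a) powr \<theta>"
  have half: "K * (y - x) powr \<theta> \<le> K * (2 powr (1 - \<theta>) / 2 * ?l)" if "x \<le> y" "y - x \<le> (c - a) / 2" for x y
  proof -
    have "(y - x) powr \<theta> \<le> ((c - a) / 2) powr \<theta>" using that \<theta> by (intro powr_mono2) auto
    also have "\<dots> = 2 powr (1 - \<theta>) / 2 * ?l" using less.prems by (simp add: powr_divide powr_diff)
    finally show ?thesis using K0 by (rule mult_left_mono)
  qed
  have zero: "0 \<le> K * (2 powr (1 - \<theta>) / 2 * ?l)" using K0 by simp
  \<comment> \<open>An outer part may consist of a single point, and \<Xi> is not assumed to vanish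
    there; hence 0 in place of \<Xi> a a.\<close>
  have E1: "norm (partition_sum \<Xi> (xs' @ [p]) - (if a = p then 0 else \<Xi> a p)) \<le> K * (2 powr (1 - \<theta>) / 2 * ?l)"
  proof (cases "a = p")
    case True
    hence "xs' = []" using L(1) by (cases xs') (auto simp: partitions_def)
    thus ?thesis using True zero by simp
  next
    case False
    hence "norm (partition_sum \<Xi> (xs' @ [p]) - \<Xi> a p) \<le> K * (p - a) powr \<theta>"
      using less.prems ap amc pm by (intro less.hyps[OF len(1) L(1)]) auto
    also have "\<dots> \<le> K * (2 powr (1 - \<theta>) / 2 * ?l)" using ap pm by (intro half) (auto simp: mid_def field_simps)
    finally show ?thesis using False by simp
  qed
  have E2: "norm (partition_sum \<Xi> (p' # ys') - (if p' = c then 0 else \<Xi> p' c)) \<le> K * (2 powr (1 - \<theta>) / 2 * ?l)"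
  proof (cases "p' = c")
    case True
    hence "ys' = []" using R(2) partitions_le[of _ _ c] by (cases ys') (auto dest: partitions_nonempty)
    thus ?thesis using True zero by simp
  next
    case False
    hence "norm (partition_sum \<Xi> (p' # ys') - \<Xi> p' c) \<le> K * (c - p') powr \<theta>"
      using less.prems ap amc pm' by (intro less.hyps[OF len(2) R(2)]) auto
    also have "\<dots> \<le> K * (2 powr (1 - \<theta>) / 2 * ?l)" using ap pm' by (intro half) (auto simp: mid_def field_simps)
    finally show ?thesis using False by simp
  qed
  have pp: "p < p'" using pm pm' by simp
  have CC: "C * (y - x) powr \<theta> \<le> C * ?l" if "a \<le> x" "x \<le> y" "y \<le> c" for x y
    using that \<theta> C by (intro mult_left_mono powr_mono2) auto
  have E3: "norm (\<Xi> a c - (if a = p then 0 else \<Xi> a p) - \<Xi> p c) \<le> C * ?l"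
  proof (cases "a = p")
    case True
    thus ?thesis using C by simp
  next
    case False
    thus ?thesis using \<Xi>[of a p c] less.prems ap pp by auto
  qed
  have E4: "norm (\<Xi> p c - \<Xi> p p' - (if p' = c then 0 else \<Xi> p' c)) \<le> C * ?l"
  proof (cases "p' = c")
    case True
    thus ?thesis using C by simp
  next
    case False
    hence "norm (\<Xi> p c - \<Xi> p p' - \<Xi> p' c) \<le> C * (c - p) powr \<theta>" using \<Xi>[of p p' c] less.prems ap pp by auto
    also have "\<dots> \<le> C * ?l" using ap pp by (intro CC) auto
    finally show ?thesis using False by simp
  qed
  have "partition_sum \<Xi> P - \<Xi> a c = (partition_sum \<Xi> (xs' @ [p]) - (if a = p then 0 else \<Xi> a p))
     + (partition_sum \<Xi> (p' # ys') - (if p' = c then 0 else \<Xi> p' c))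
     - (\<Xi> a c - (if a = p then 0 else \<Xi> a p) - \<Xi> p c) - (\<Xi> p c - \<Xi> p p' - (if p' = c then 0 else \<Xi> p' c))"
    unfolding sum by (simp add: algebra_simps)
  hence "norm (partition_sum \<Xi> P - \<Xi> a c) \<le> K * (2 powr (1 - \<theta>) / 2 * ?l) + K * (2 powr (1 - \<theta>) / 2 * ?l) + C * ?l + C * ?l"
    using E1 E2 E3 E4 by (smt (verit) norm_triangle_ineq norm_triangle_ineq4)
  also have "\<dots> = (2 * C + K * 2 powr (1 - \<theta>)) * ?l" by (simp add: algebra_simps)
  finally show ?case unfolding KK .
qed

text \<open>R restricts to a partition of each interval of P, and the local estimate applies
  there.\<close>

lemma partition_refine_bound:
  fixes \<Xi> :: "real \<Rightarrow> real \<Rightarrow> 'b::real_normed_vector"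
  assumes P: "P \<in> partitions a t" and "finer e P" "s \<le> a" "set P \<subseteq> set R" "R \<in> partitions a t"
    and loc: "\<And>R u v. R \<in> partitions u v \<Longrightarrow> s \<le> u \<Longrightarrow> u < v \<Longrightarrow> v \<le> t \<Longrightarrow> v - u < e \<Longrightarrow>
      norm (partition_sum \<Xi> R - \<Xi> u v) \<le> G u v"
  shows "norm (partition_sum \<Xi> R - partition_sum \<Xi> P) \<le> partition_sum G P"
  using assms(1-5)
proof (induction arbitrary: R rule: partition_induct)
  case single
  have "R = [t]"
  proof (cases R)
    case Nil
    thus ?thesis using single by (simp add: partitions_def)
  next
    case (Cons x R')
    thus ?thesis using single partitions_nonempty[of R' "hd R'" t] by (cases R') auto
  qed
  thus ?case by simp
next
  case (Cons x y zs)
  have yR: "y \<in> set R" using Cons.prems(3) by simp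
  obtain R1 R2 where R: "R = R1 @ y # R2" using split_list[OF yR] by blast
  note sp = partition_split[OF Cons.prems(4)[unfolded R]]
  have "set (y # zs) \<subseteq> set (y # R2)"
  proof
    fix z assume z: "z \<in> set (y # zs)"
    hence "y \<le> z" using partitions_le[OF Cons.hyps(3)] by auto
    moreover have "z \<in> set R" using z Cons.prems(3) by auto
    ultimately show "z \<in> set (y # R2)" using sp(3)[of z] R by auto
  qed
  hence "norm (partition_sum \<Xi> (y # R2) - partition_sum \<Xi> (y # zs)) \<le> partition_sum G (y # zs)"
    using Cons.prems(1,2) Cons.hyps(1) sp(2) by (intro Cons.IH) auto
  moreover have "norm (partition_sum \<Xi> (R1 @ [y]) - \<Xi> x y) \<le> G x y"
    using Cons.prems(1,2) Cons.hyps(1,2) sp(1) by (intro loc) auto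
  moreover have "partition_sum \<Xi> R - partition_sum \<Xi> (x # y # zs) = (partition_sum \<Xi> (R1 @ [y]) - \<Xi> x y)
      + (partition_sum \<Xi> (y # R2) - partition_sum \<Xi> (y # zs))"
    unfolding R partition_sum_append[of \<Xi> R1 y R2] by simp
  ultimately show ?case using norm_triangle_mono by (simp only: partition_sum_simps) blast
qed

lemma common_refinement:
  assumes "P \<in> partitions s t" "Q \<in> partitions s t"
  shows "\<exists>R\<in>partitions s t. set R = set P \<union> set Q"
proof -
  let ?R = "sorted_list_of_set (set P \<union> set Q)"
  have set: "set ?R = set P \<union> set Q" by simp
  have st: "s \<in> set ?R" "t \<in> set ?R" "\<And>x. x \<in> set ?R \<Longrightarrow> s \<le> x \<and> x \<le> t"
    using assms partitions_le[OF assms(1)] partitions_le[OF assms(2)] hd_in_set[of P] last_in_set[of P]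
    unfolding set by (auto simp: partitions_def)
  have so: "sorted_wrt (<) ?R" by (rule strict_sorted_list_of_set)
  have ne: "?R \<noteq> []" using st(1) by auto
  have "hd ?R = s"
  proof -
    have "hd ?R \<le> s" using so ne st(1) by (cases ?R) (auto simp: less_imp_le)
    thus ?thesis using st(3)[OF hd_in_set[OF ne]] by simp
  qed
  moreover have "last ?R = t"
  proof -
    define bs where "bs = butlast ?R"
    have R: "?R = bs @ [last ?R]" using ne by (simp add: bs_def)
    have "t \<in> set bs \<or> t = last ?R" using st(2) by (subst (asm) R) auto
    moreover have "x < last ?R" if "x \<in> set bs" for x
      using so that by (subst (asm) R) (auto simp: sorted_wrt_append)
    ultimately have "t \<le> last ?R" using less_imp_le by blast
    thus ?thesis using st(3)[OF last_in_set[OF ne]] by simp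
  qed
  ultimately show ?thesis using so ne set by (intro bexI[of _ ?R]) (auto simp: partitions_def)
qed

text \<open>Two fine partitions are compared through their common refinement, with a modulus
  \<omega> that tends to 0 because \<theta> exceeds 1. One sequence of ever finer partitions
  supplies the limit, and the same comparison shows that the whole filter follows.\<close>

lemma sewing:
  fixes \<Xi> :: "real \<Rightarrow> real \<Rightarrow> 'b::banach"
  assumes st: "s < t" and \<theta>: "1 < \<theta>" and C: "0 \<le> C"
    and \<Xi>: "\<And>a m c. s \<le> a \<Longrightarrow> a < m \<Longrightarrow> m < c \<Longrightarrow> c \<le> t \<Longrightarrow> c - a < 1 \<Longrightarrow>
      norm (\<Xi> a c - \<Xi> a m - \<Xi> m c) \<le> C * (c - a) powr \<theta>"
  shows "\<exists>I. (partition_sum \<Xi> \<longlongrightarrow> I) (mesh_to_0 s t)"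
proof -
  define K where "K = 2 * C / (1 - 2 powr (1 - \<theta>))"
  have "2 powr (1 - \<theta>) < 1" using \<theta> by (simp add: powr_less_one)
  hence K0: "0 \<le> K" using C by (simp add: K_def)
  define \<omega> where "\<omega> e = 2 * (K * e powr (\<theta> - 1) * (t - s))" for e
  have one: "norm (partition_sum \<Xi> R - partition_sum \<Xi> P) \<le> K * e powr (\<theta> - 1) * (t - s)"
    if P: "P \<in> partitions s t" "finer e P" and e: "0 < e" "e \<le> 1" and R: "R \<in> partitions s t" "set P \<subseteq> set R" for P R e
  proof -
    have "norm (partition_sum \<Xi> R - partition_sum \<Xi> P) \<le> partition_sum (\<lambda>u v. K * (v - u) powr \<theta>) P"
      by (rule partition_refine_bound[OF P order_refl R(2,1)], unfold K_def, rule sewing_local[OF \<theta> C \<Xi>]) (use e in auto)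
    also have "\<dots> \<le> partition_sum (\<lambda>u v. K * e powr (\<theta> - 1) * v - K * e powr (\<theta> - 1) * u) P"
    proof (rule partition_sum_le[OF P order_refl])
      fix u v :: real assume uv: "s \<le> u" "u < v" "v \<le> t" "v - u < e"
      \<comment> \<open>One power of v - u is kept for telescoping; the remaining power is bounded
        by the mesh.\<close>
      have "(v - u) powr \<theta> = (v - u) powr (\<theta> - 1) * (v - u)" using uv by (simp add: powr_diff)
      also have "\<dots> \<le> e powr (\<theta> - 1) * (v - u)" using uv \<theta> by (intro mult_right_mono powr_mono2) auto
      finally have "K * (v - u) powr \<theta> \<le> K * (e powr (\<theta> - 1) * (v - u))" using K0 by (rule mult_left_mono)
      thus "K * (v - u) powr \<theta> \<le> K * e powr (\<theta> - 1) * v - K * e powr (\<theta> - 1) * u" by (simp add: algebra_simps)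
    qed
    also have "\<dots> = K * e powr (\<theta> - 1) * t - K * e powr (\<theta> - 1) * s" by (rule partition_sum_telescope[OF P(1)])
    finally show ?thesis by (simp add: algebra_simps)
  qed
  have two: "norm (partition_sum \<Xi> Q - partition_sum \<Xi> P) \<le> \<omega> e"
    if P: "P \<in> partitions s t" "finer e P" and Q: "Q \<in> partitions s t" "finer e Q" and e: "0 < e" "e \<le> 1" for P Q e
  proof -
    obtain R where R: "R \<in> partitions s t" "set R = set P \<union> set Q" using common_refinement[OF P(1) Q(1)] by blast
    show ?thesis using one[OF P e R(1)] one[OF Q e R(1)] R(2)
      norm_triangle_ineq4[of "partition_sum \<Xi> R - partition_sum \<Xi> P" "partition_sum \<Xi> R - partition_sum \<Xi> Q"]
      by (simp add: \<omega>_def)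
  qed
  have \<omega>0: "(\<omega> \<longlongrightarrow> 0) (at_right 0)"
  proof -
    have "((\<lambda>e. 2 * (K * e powr (\<theta> - 1) * (t - s))) \<longlongrightarrow> 2 * (K * 0 * (t - s))) (at_right 0)"
      using \<theta> by (intro tendsto_intros tendsto_zero_powrI[where b = "\<theta> - 1"]) (auto simp: eventually_at_right_less intro!: eventually_at_rightI[of 0 1] tendsto_ident_at)
    thus ?thesis by (simp add: \<omega>_def[abs_def])
  qed
  have small: "\<exists>e>0. e \<le> 1 \<and> \<omega> e < \<epsilon>" if "0 < \<epsilon>" for \<epsilon>
  proof -
    have "eventually (\<lambda>e. \<omega> e < \<epsilon>) (at_right 0)" using \<omega>0 that by (rule order_tendstoD)
    moreover have "eventually (\<lambda>e::real. 0 < e \<and> e \<le> 1) (at_right 0)" by (rule eventually_at_rightI[of 0 1]) auto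
    ultimately have "eventually (\<lambda>e. \<omega> e < \<epsilon> \<and> 0 < e \<and> e \<le> 1) (at_right (0::real))" by (rule eventually_conj)
    from eventually_happens[OF this] show ?thesis by (auto simp: trivial_limit_at_right_real)
  qed
  define P where "P n = (SOME ts. ts \<in> partitions s t \<and> finer (1 / real (Suc n)) ts)" for n
  have P: "P n \<in> partitions s t" "finer (1 / real (Suc n)) (P n)" for n
    using someI_ex[OF ex_fine_partition[OF st, of "1 / real (Suc n)", unfolded Bex_def]] unfolding P_def by auto
  have fm: "finer e ts" if "finer e' ts" "e' \<le> e" for e e' ts using that by (force simp: finer_def)
  have Pe: "\<exists>N. \<forall>n\<ge>N. finer e (P n)" if e: "0 < e" for e
  proof -
    obtain N where N: "inverse (real (Suc N)) < e" using reals_Archimedean[OF e] by blast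
    have "finer e (P n)" if n: "n \<ge> N" for n
    proof (rule fm[OF P(2)])
      have "1 / real (Suc n) \<le> 1 / real (Suc N)" using n by (intro divide_left_mono) auto
      thus "1 / real (Suc n) \<le> e" using N by (simp add: inverse_eq_divide)
    qed
    thus ?thesis by blast
  qed
  have "Cauchy (\<lambda>n. partition_sum \<Xi> (P n))"
  proof (rule CauchyI)
    fix \<epsilon> :: real assume "0 < \<epsilon>"
    then obtain e where e: "0 < e" "e \<le> 1" "\<omega> e < \<epsilon>" using small by blast
    obtain N where "\<forall>n\<ge>N. finer e (P n)" using Pe[OF e(1)] by blast
    hence "norm (partition_sum \<Xi> (P m) - partition_sum \<Xi> (P n)) < \<epsilon>" if "m \<ge> N" "n \<ge> N" for m n
      using two[OF P(1) _ P(1) _ e(1,2), of n m] e(3) that by fastforce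
    thus "\<exists>M. \<forall>m\<ge>M. \<forall>n\<ge>M. norm (partition_sum \<Xi> (P m) - partition_sum \<Xi> (P n)) < \<epsilon>" by blast
  qed
  then obtain I where I: "(\<lambda>n. partition_sum \<Xi> (P n)) \<longlonglongrightarrow> I" using convergent_eq_Cauchy by blast
  have "(partition_sum \<Xi> \<longlongrightarrow> I) (mesh_to_0 s t)"
  proof (rule tendstoI)
    fix \<epsilon> :: real assume "0 < \<epsilon>"
    then obtain e where e: "0 < e" "e \<le> 1" "\<omega> e < \<epsilon>" using small by blast
    obtain N where N: "\<forall>n\<ge>N. finer e (P n)" using Pe[OF e(1)] by blast
    have "dist (partition_sum \<Xi> ts) I < \<epsilon>" if ts: "ts \<in> partitions s t" "finer e ts" for ts
    proof -
      have "(\<lambda>n. norm (partition_sum \<Xi> (P n) - partition_sum \<Xi> ts)) \<longlonglongrightarrow> norm (I - partition_sum \<Xi> ts)"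
        by (intro tendsto_intros I)
      moreover have "\<forall>n\<ge>N. norm (partition_sum \<Xi> (P n) - partition_sum \<Xi> ts) \<le> \<omega> e"
        using two[OF ts P(1) _ e(1,2)] N by blast
      ultimately have "norm (I - partition_sum \<Xi> ts) \<le> \<omega> e" by (intro LIMSEQ_le_const2) auto
      thus ?thesis using e(3) by (simp add: dist_norm norm_minus_commute)
    qed
    thus "eventually (\<lambda>ts. dist (partition_sum \<Xi> ts) I < \<epsilon>) (mesh_to_0 s t)"
      unfolding eventually_mesh using e(1) by blast
  qed
  thus ?thesis by blast
qed

lemma riemann_sums:
  fixes g :: "real \<Rightarrow> 'b::banach"
  assumes st: "s < t" and g: "continuous_on {s..t} g"
  shows "(partition_sum (\<lambda>u v. (v - u) *\<^sub>R g u) \<longlongrightarrow> integral {s..t} g) (mesh_to_0 s t)"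
proof (rule tendstoI)
  fix \<epsilon> :: real assume \<epsilon>: "0 < \<epsilon>"
  define \<epsilon>' where "\<epsilon>' = \<epsilon> / (2 * (t - s))"
  have e': "0 < \<epsilon>'" using \<epsilon> st by (simp add: \<epsilon>'_def)
  have "uniformly_continuous_on {s..t} g" by (rule compact_uniformly_continuous[OF g]) simp
  then obtain d where d: "0 < d" "\<And>x y. x \<in> {s..t} \<Longrightarrow> y \<in> {s..t} \<Longrightarrow> dist x y < d \<Longrightarrow> dist (g x) (g y) < \<epsilon>'"
    using e' unfolding uniformly_continuous_on_def by metis
  have int: "g integrable_on {u..v}" if "s \<le> u" "v \<le> t" for u v
    using that by (intro integrable_continuous_real continuous_on_subset[OF g]) auto
  have "dist (partition_sum (\<lambda>u v. (v - u) *\<^sub>R g u) ts) (integral {s..t} g) < \<epsilon>"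
    if ts: "ts \<in> partitions s t" "finer d ts" for ts
  proof -
    define F where "F v = integral {s..v} g" for v
    have "norm (partition_sum (\<lambda>u v. (v - u) *\<^sub>R g u - (F v - F u)) ts) \<le> partition_sum (\<lambda>u v. \<epsilon>' * v - \<epsilon>' * u) ts"
    proof (rule partition_sum_norm[OF ts order_refl])
      fix u v assume uv: "s \<le> u" "u < v" "v \<le> t" "v - u < d"
      have "F v = F u + integral {u..v} g"
        unfolding F_def using uv by (subst Henstock_Kurzweil_Integration.integral_combine) (auto intro: int)
      hence "(v - u) *\<^sub>R g u - (F v - F u) = integral {u..v} (\<lambda>x. g u - g x)"
        using uv int[of u v] by (subst Henstock_Kurzweil_Integration.integral_diff) auto
      also have "norm \<dots> \<le> \<epsilon>' * Henstock_Kurzweil_Integration.content {u..v}"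
      proof (rule integrable_bound[where 'a = real, unfolded cbox_interval])
        show "(\<lambda>x. g u - g x) integrable_on {u..v}" using uv int[of u v] by (intro integrable_diff) auto
        show "norm (g u - g x) \<le> \<epsilon>'" if "x \<in> {u..v}" for x
          using d(2)[of u x] that uv by (auto simp: dist_norm)
      qed (use e' in simp)
      finally show "norm ((v - u) *\<^sub>R g u - (F v - F u)) \<le> \<epsilon>' * v - \<epsilon>' * u" using uv by (simp add: algebra_simps)
    qed
    also have "\<dots> = \<epsilon>' * t - \<epsilon>' * s" by (rule partition_sum_telescope[OF ts(1)])
    also have "\<dots> = \<epsilon>' * (t - s)" by (simp add: algebra_simps)
    also have "\<dots> = \<epsilon> / 2" using st unfolding \<epsilon>'_def by (simp del: distrib_left_numeral right_diff_distrib_numeral)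
    finally have "norm (partition_sum (\<lambda>u v. (v - u) *\<^sub>R g u) ts - (F t - F s)) \<le> \<epsilon> / 2"
      by (simp only: partition_sum_diff[of "\<lambda>u v. (v - u) *\<^sub>R g u" "\<lambda>u v. F v - F u"] partition_sum_telescope[OF ts(1)])
    thus ?thesis using \<epsilon> by (simp add: dist_norm F_def)
  qed
  thus "eventually (\<lambda>ts. dist (partition_sum (\<lambda>u v. (v - u) *\<^sub>R g u) ts) (integral {s..t} g) < \<epsilon>) (mesh_to_0 s t)"
    unfolding eventually_mesh using d(1) by blast
qed

section \<open>Algebra elements as vectors, with the norm read off at the vacuum\<close>

section \<open>The Hilbert space of the vacuum state\<close>

context qfock
begin

context
  fixes \<eta> :: "'f op \<Rightarrow> 'l::complex_hilbert"
  assumes eta: "L2_completion \<Theta> \<eta>"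
begin

text \<open>The form applies the state to U times \<open>adj V\<close>, so \<eta> U corresponds to
  \<open>adj U\<close> at the vacuum and not to U itself. This is why adjoints appear in the norms
  below.\<close>

lemma eta_inner:
  assumes "U \<in> AA" "V \<in> AA" 
  shows "cinner (\<eta> V) (\<eta> U) = cinner (adj U \<Omega>) (adj V \<Omega>)"
  using assms eta AA_clinear by (simp add: L2_completion_def vacuum_state_def cinner_adj)

lemma eta_sep:
  assumes "\<And>W. W \<in> AA \<Longrightarrow> cinner (\<eta> W) x = cinner (\<eta> W) z" shows "x = z"
proof -
  have "closed {w. cinner w (x - z) = 0}"
    by (intro closed_Collect_eq continuous_intros linear_continuous_on bounded_linear_cinner_left)
  moreover have "\<eta> ` AA \<subseteq> {w. cinner w (x - z) = 0}" using assms by (auto simp: cinner_diff_right)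
  ultimately have "closure (\<eta> ` AA) \<subseteq> {w. cinner w (x - z) = 0}" by (rule closure_minimal[rotated])
  hence "cinner (x - z) (x - z) = 0" using eta by (auto simp: L2_completion_def)
  thus ?thesis by (simp add: cinner_self)
qed

lemma eta_add: "U \<in> AA \<Longrightarrow> V \<in> AA \<Longrightarrow> \<eta> (U + V) = \<eta> U + \<eta> V"
  by (rule eta_sep)
    (simp add: eta_inner AA_closed(2) AA_clinear adj_add blinfun.add_left cinner_add_left cinner_add_right)

lemma eta_scaleR: "U \<in> AA \<Longrightarrow> \<eta> (r *\<^sub>R U) = r *\<^sub>R \<eta> U"
  by (rule eta_sep)
    (simp add: eta_inner AA_scaleR AA_clinear adj_scaleR blinfun.scaleR_left cinner_scaleR_left cinner_scaleR_right)

lemma eta_diff: "U \<in> AA \<Longrightarrow> V \<in> AA \<Longrightarrow> \<eta> (U - V) = \<eta> U - \<eta> V"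
  using eta_add[of U "(-1) *\<^sub>R V"] eta_scaleR[of V "-1"] AA_scaleR[of V "-1"] by simp

lemma norm_eta: assumes U: "U \<in> AA" shows "norm (\<eta> U) = norm (adj U \<Omega>)"
proof -
  have "(norm (\<eta> U))\<^sup>2 = (norm (adj U \<Omega>))\<^sup>2"
    using eta_inner[OF U U] by (simp add: norm_sq_Re)
  thus ?thesis by simp
qed

lemma norm_eta_le: assumes U: "U \<in> AA" shows "norm (\<eta> U) \<le> norm U"
proof -
  have "norm (adj U \<Omega>) \<le> norm (adj U) * norm \<Omega>" by (rule norm_blinfun)
  thus ?thesis using U norm_adj[OF AA_clinear[OF U]] by (simp add: norm_eta norm_vac)
qed

lemma eta_lim:
  assumes f: "(f \<longlongrightarrow> T) F" and T: "T \<in> AA" and fA: "eventually (\<lambda>x. f x \<in> AA) F"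
  shows "((\<lambda>x. \<eta> (f x)) \<longlongrightarrow> \<eta> T) F"
proof (rule LIM_zero_cancel, rule Lim_null_comparison)
  show "eventually (\<lambda>x. norm (\<eta> (f x) - \<eta> T) \<le> norm (f x - T)) F"
    using fA by eventually_elim (metis T AA_diff eta_diff norm_eta_le)
  show "((\<lambda>x. norm (f x - T)) \<longlongrightarrow> 0) F" using f by (intro tendsto_norm_zero LIM_zero)
qed

lemma eta_sum: "(\<And>i. i \<in> I \<Longrightarrow> f i \<in> AA) \<Longrightarrow> sum f I \<in> AA \<and> \<eta> (sum f I) = (\<Sum>i\<in>I. \<eta> (f i))"
proof (induction I rule: infinite_finite_induct)
  case empty
  have "\<eta> (0 *\<^sub>R 0) = 0 *\<^sub>R \<eta> 0" by (rule eta_scaleR[OF AA_zero])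
  thus ?case using AA_zero by simp
next
  case (infinite A)
  have "\<eta> (0 *\<^sub>R 0) = 0 *\<^sub>R \<eta> 0" by (rule eta_scaleR[OF AA_zero])
  thus ?case using infinite AA_zero by simp
qed (simp add: eta_add AA_closed(2))

lemma eta_sums:
  assumes "f sums T" "T \<in> AA" "\<And>i. f i \<in> AA" shows "(\<lambda>i. \<eta> (f i)) sums \<eta> T"
  using eta_lim[OF assms(1)[unfolded sums_def] assms(2)] eta_sum[of _ f] assms(3) by (simp add: sums_def)

lemma Gt_AA: "0 \<le> s \<Longrightarrow> b \<in> A_upto s \<Longrightarrow> Gt s b \<in> AA"
  using Gt_A(1) A_subset_AA by blast

text \<open>On past operators \<open>Gamma_q\<close> is the compression \<open>Gt r\<close>, which
  is bounded on all operators; matrix coefficients between \<Omega> and vectors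
  \<open>adj W \<Omega>\<close> are the separating forms.\<close>

lemma id_Gamma_id_formable:
  assumes r: "0 \<le> r"
  shows "formable AA 3 (A_upto r) (\<lambda>as. \<eta> (as ! 0 o\<^sub>L Gamma_q \<Theta> (as ! 1) o\<^sub>L as ! 2))"
  unfolding formable_def
proof (intro conjI allI impI)
  have G: "as ! 0 o\<^sub>L Gamma_q \<Theta> (as ! 1) o\<^sub>L as ! 2 = as ! 0 o\<^sub>L Gt r (as ! 1) o\<^sub>L as ! 2"
    "as ! 0 o\<^sub>L Gt r (as ! 1) o\<^sub>L as ! 2 \<in> AA"
    if as: "length as = 3" "set as \<subseteq> A_upto r" for as
  proof -
    obtain a b c where e: "as = [a, b, c]" using length3E[OF as(1)] by blast
    have m: "a \<in> AA" "b \<in> A_upto r" "c \<in> AA" using as(2) A_subset_AA by (auto simp: e)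
    show "as ! 0 o\<^sub>L Gamma_q \<Theta> (as ! 1) o\<^sub>L as ! 2 = as ! 0 o\<^sub>L Gt r (as ! 1) o\<^sub>L as ! 2"
      using Gamma_q_eq[OF r m(2)] by (simp add: e)
    show "as ! 0 o\<^sub>L Gt r (as ! 1) o\<^sub>L as ! 2 \<in> AA"
      using m Gt_AA[OF r m(2)] by (simp add: e AA_closed numeral_2_eq_2)
  qed
  show "A_upto r \<subseteq> AA" by (rule AA_subset)
  show "\<exists>C. \<forall>as. length as = 3 \<and> set as \<subseteq> A_upto r \<longrightarrow>
      norm (\<eta> (as ! 0 o\<^sub>L Gamma_q \<Theta> (as ! 1) o\<^sub>L as ! 2)) \<le> C * prod_list (map norm as)"
  proof (intro exI[of _ 1] allI impI)
    fix as assume as: "length as = 3 \<and> set as \<subseteq> A_upto r"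
    hence "set as \<subseteq> AA" using AA_subset by blast
    thus "norm (\<eta> (as ! 0 o\<^sub>L Gamma_q \<Theta> (as ! 1) o\<^sub>L as ! 2)) \<le> 1 * prod_list (map norm as)"
      using norm_list3[OF clin_Gt[OF r], of as] norm_eta_le[OF G(2), of as] G(1)[of as] as by simp
  qed
  fix x y :: 'l assume "x \<noteq> y"
  then obtain W where W: "W \<in> AA" "cinner (\<eta> W) x \<noteq> cinner (\<eta> W) y" using eta_sep by blast
  show "\<exists>F::'l \<Rightarrow> complex. \<exists>B\<in>bounded_forms AA 3. bounded_linear F \<and> F x \<noteq> F y \<and>
      (\<forall>as. length as = 3 \<and> set as \<subseteq> A_upto r \<longrightarrow> F (\<eta> (as ! 0 o\<^sub>L Gamma_q \<Theta> (as ! 1) o\<^sub>L as ! 2)) = B as)"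
  proof (intro exI[of _ "cinner (\<eta> W)"] bexI[OF _ form3[OF clin_Gt[OF r], of \<Omega> "adj W \<Omega>"]] conjI allI impI)
    show "bounded_linear (cinner (\<eta> W))" by (rule bounded_linear_cinner_right)
    show "cinner (\<eta> W) x \<noteq> cinner (\<eta> W) y" by (rule W(2))
    fix as assume as: "length as = 3 \<and> set as \<subseteq> A_upto r"
    hence "as ! 0 o\<^sub>L Gt r (as ! 1) o\<^sub>L as ! 2 \<in> AA" using G(2) by blast
    hence "cinner (\<eta> W) (\<eta> (as ! 0 o\<^sub>L Gt r (as ! 1) o\<^sub>L as ! 2))
       = vacuum_state \<Theta> ((as ! 0 o\<^sub>L Gt r (as ! 1) o\<^sub>L as ! 2) o\<^sub>L adj W)"
      using eta W(1) unfolding L2_completion_def by blast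
    thus "cinner (\<eta> W) (\<eta> (as ! 0 o\<^sub>L Gamma_q \<Theta> (as ! 1) o\<^sub>L as ! 2))
      = cinner \<Omega> ((as ! 0 o\<^sub>L Gt r (as ! 1) o\<^sub>L as ! 2) (adj W \<Omega>))"
      using G(1) as by (simp add: vacuum_state_def)
  qed
qed

lemma id_Gamma_id_tens3:
  assumes r: "0 \<le> r" and u: "u \<in> proj_tensor AA 3 (A_upto r)"
  shows "id_Gamma_id \<Theta> \<eta> u = \<eta> (tens3 (A_upto r) (Gt r) u)"
proof -
  obtain as where rep: "represents AA 3 (A_upto r) as u" using u by (auto simp: proj_tensor_def)
  have mem: "as i ! 0 \<in> A_upto r" "as i ! 1 \<in> A_upto r" "as i ! 2 \<in> A_upto r" for i
    using represents_nth[OF rep] by simp_all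
  have "(\<lambda>i. \<eta> (as i ! 0 o\<^sub>L Gamma_q \<Theta> (as i ! 1) o\<^sub>L as i ! 2)) sums id_Gamma_id \<Theta> \<eta> u"
    unfolding id_Gamma_id_def
  proof (rule tensor_ext_sums[where S = "A_upto r"])
    show "formable AA 3 S (\<lambda>as. \<eta> (as ! 0 o\<^sub>L Gamma_q \<Theta> (as ! 1) o\<^sub>L as ! 2))" if "S \<in> qA_upto \<Theta> ` {0..}" for S
      using that id_Gamma_id_formable by auto
    fix S S' assume "S \<in> qA_upto \<Theta> ` {0..}" "S' \<in> qA_upto \<Theta> ` {0..}"
    then obtain a b where ab: "S = A_upto a" "S' = A_upto b" "0 \<le> a" "0 \<le> b" by auto
    thus "\<exists>S''\<in>qA_upto \<Theta> ` {0..}. S \<subseteq> S'' \<and> S' \<subseteq> S''"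
      using A_mono[of a "max a b"] A_mono[of b "max a b"] by (intro bexI[of _ "A_upto (max a b)"]) auto
  qed (use r rep in auto)
  moreover have "(\<lambda>i. \<eta> (as i ! 0 o\<^sub>L Gt r (as i ! 1) o\<^sub>L as i ! 2)) sums \<eta> (tens3 (A_upto r) (Gt r) u)"
  proof (rule eta_sums[OF tens3_sums[OF clin_Gt[OF r] rep]])
    show "tens3 (A_upto r) (Gt r) u \<in> AA"
      using tens3_A[OF clin_Gt[OF r] u order_refl] Gt_A(1)[OF r order_refl] A_subset_AA by blast
    show "as i ! 0 o\<^sub>L Gt r (as i ! 1) o\<^sub>L as i ! 2 \<in> AA" for i
      by (intro AA_closed(3) Gt_AA[OF r] A_subset_AA[OF mem(1)] A_subset_AA[OF mem(3)] mem(2))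
  qed
  moreover have "Gamma_q \<Theta> (as i ! 1) = Gt r (as i ! 1)" for i by (rule Gamma_q_eq[OF r mem(2)])
  ultimately show ?thesis using sums_unique2 by simp blast
qed

end

section \<open>Compensated sums, their martingale part, and the comparison of the integrals\<close>

section \<open>Controlled biprocesses\<close>

lemma proj_tensor_diff3: "u \<in> proj_tensor AA 3 (A_upto s) \<Longrightarrow> v \<in> proj_tensor AA 3 (A_upto s) \<Longrightarrow> u - v \<in> proj_tensor AA 3 (A_upto s)"
  using proj_tensor_diff[of u AA 2 "A_upto s" v] AA_subset A_scaleR[of _ s "-1"] by simp

lemma tens3_diff:
  assumes L: "clin K L" and u: "u \<in> proj_tensor AA 3 (A_upto s)" "v \<in> proj_tensor AA 3 (A_upto s)"
  shows "tens3 (A_upto s) L (u - v) = tens3 (A_upto s) L u - tens3 (A_upto s) L v"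
  using tens3_add[OF L proj_tensor_diff3[OF u] u(2)] by simp

text \<open>Compression at a later time gives the same value on earlier operators, so corrections at
  different times can be compared at the later one.\<close>

lemma tens3_Gt_mono:
  assumes "0 \<le> s" "s \<le> t" and u: "u \<in> proj_tensor AA 3 (A_upto s)"
  shows "tens3 (A_upto t) (Gt t) u = tens3 (A_upto s) (Gt s) u"
proof -
  obtain as where r: "represents AA 3 (A_upto s) as u" using u by (auto simp: proj_tensor_def)
  have t: "0 \<le> t" using assms by simp
  have "Gt t (as i ! 1) = Gt s (as i ! 1)" for i using Gt_A(2)[OF assms(1,2)] represents_nth[OF r] by simp
  thus ?thesis
    using tens3_sums[OF clin_Gt[OF assms(1)] r] tens3_sums[OF clin_Gt[OF t] represents_mono[OF r A_mono[OF assms(2)]]]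
    by (simp add: sums_unique2)
qed

lemma powr_shrink: "0 < x \<Longrightarrow> x < (1::real) \<Longrightarrow> b \<le> a \<Longrightarrow> x powr a \<le> x powr b"
  using powr_mono'[of b a x] by simp

context
  fixes s t \<gamma> :: real and U U1 U2 :: "real \<Rightarrow> 'f tensor" and Uf :: "real \<Rightarrow> real \<Rightarrow> 'f tensor"
  assumes st: "0 \<le> s" "s < t" and \<gamma>: "1/3 < \<gamma>" "\<gamma> < 1/2"
    and cb: "controlled_biprocess \<Theta> \<gamma> {s..t} U U1 U2 Uf"
begin

lemma U_mem:
  assumes "s \<le> u" "u \<le> t"
  shows "U u \<in> proj_tensor AA 2 (A_upto u)" "U1 u \<in> proj_tensor AA 3 (A_upto u)" "U2 u \<in> proj_tensor AA 3 (A_upto u)"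
  using cb assms by (auto simp: controlled_biprocess_def adapted_def)

lemma to_AA: "u \<in> proj_tensor AA n (A_upto r) \<Longrightarrow> u \<in> proj_tensor AA n AA"
  using proj_tensor_mono[OF AA_subset] by blast

lemma holder1_bound:
  assumes "holder1 AA n \<gamma> {s..t} h"
  shows "\<exists>H\<ge>0. \<forall>u v. s \<le> u \<and> u < v \<and> v \<le> t \<longrightarrow> proj_norm AA n (h v - h u) \<le> H * (v - u) powr \<gamma>"
proof -
  obtain H where H: "\<And>u v. u \<in> {s..t} \<Longrightarrow> v \<in> {s..t} \<Longrightarrow> u < v \<Longrightarrow> proj_norm AA n (h v - h u) \<le> H * \<bar>v - u\<bar> powr \<gamma>"
    using assms unfolding holder1_def by blast
  show ?thesis
  proof (intro exI[of _ "\<bar>H\<bar>"] conjI allI impI)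
    fix u v assume uv: "s \<le> u \<and> u < v \<and> v \<le> t"
    have "proj_norm AA n (h v - h u) \<le> H * \<bar>v - u\<bar> powr \<gamma>" using uv by (intro H) auto
    also have "\<dots> \<le> \<bar>H\<bar> * \<bar>v - u\<bar> powr \<gamma>" by (intro mult_right_mono) auto
    finally show "proj_norm AA n (h v - h u) \<le> \<bar>H\<bar> * (v - u) powr \<gamma>" using uv by simp
  qed simp
qed

lemma Uf_bound:
  "\<exists>H\<ge>0. \<forall>u v. s \<le> u \<and> u < v \<and> v \<le> t \<longrightarrow> Uf u v \<in> proj_tensor AA 2 AA \<and> proj_norm AA 2 (Uf u v) \<le> H * (v - u) powr (2 * \<gamma>)"
proof -
  have h: "holder2 AA 2 (2 * \<gamma>) {s..t} Uf" using cb by (simp add: controlled_biprocess_def)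
  then obtain H where H: "\<And>u v. u \<in> {s..t} \<Longrightarrow> v \<in> {s..t} \<Longrightarrow> u < v \<Longrightarrow> proj_norm AA 2 (Uf u v) \<le> H * \<bar>v - u\<bar> powr (2 * \<gamma>)"
    unfolding holder2_def by blast
  show ?thesis
  proof (intro exI[of _ "\<bar>H\<bar>"] conjI allI impI)
    fix u v assume uv: "s \<le> u \<and> u < v \<and> v \<le> t"
    show "Uf u v \<in> proj_tensor AA 2 AA" using h uv unfolding holder2_def by auto
    have "proj_norm AA 2 (Uf u v) \<le> H * \<bar>v - u\<bar> powr (2 * \<gamma>)" using uv by (intro H) auto
    also have "\<dots> \<le> \<bar>H\<bar> * \<bar>v - u\<bar> powr (2 * \<gamma>)" by (intro mult_right_mono) auto
    finally show "proj_norm AA 2 (Uf u v) \<le> \<bar>H\<bar> * (v - u) powr (2 * \<gamma>)" using uv by simp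
  qed simp
qed

text \<open>A summand of the compensated sums, with the areas written through their action on the
  middle factor; for steps shorter than 1 the two forms agree.\<close>

definition Xi :: "real \<Rightarrow> real \<Rightarrow> 'f op" where
  "Xi u v = sharp AA (U u) (dX \<Theta> u v) + tens3 (A_upto u) (Lt u v) (U1 u) + tens3 (A_upto u) (starL u v) (U2 u)"

text \<open>When the decomposition of U is inserted at the middle time, its first-order terms cancel
  against the extra products in Chen's relation. The remainder and the increments of the two
  derivatives are all that is left.\<close>

lemma Xi_increment:
  assumes o: "s \<le> a" "a < m" "m < c" "c \<le> t" "c - a < 1"
  shows "Xi a c - Xi a m - Xi m c = - (sharp AA (Uf a m) (dX \<Theta> m c)
    + tens3 (A_upto m) (Lt m c) (U1 m - U1 a) + tens3 (A_upto m) (starL m c) (U2 m - U2 a))"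
proof -
  have o': "0 \<le> a" "a < m" "m < c" "c - a < 1" "s \<le> m" "m \<le> t" "a \<le> t" and mc: "0 \<le> m" "m < c" "c - m < 1" using o st by auto
  note Ua = U_mem[OF o(1) o'(7)] and Um = U_mem[OF o'(5,6)]
  have up: "U1 a \<in> proj_tensor AA 3 (A_upto m)" "U2 a \<in> proj_tensor AA 3 (A_upto m)"
    using Ua(2,3) proj_tensor_mono[OF A_mono[of a m]] o by auto
  obtain as1 as2 where r: "represents AA 3 AA as1 (U1 a)" "represents AA 3 AA as2 (U2 a)"
    using to_AA[OF Ua(2)] to_AA[OF Ua(3)] by (auto simp: proj_tensor_def)
  have X: "dX \<Theta> a m \<in> AA" using o' mc by (intro AA_dX) auto
  let ?SL = "sharp_left AA (dX \<Theta> a m) (U1 a)" and ?SR = "sharp_right AA (U2 a) (dX \<Theta> a m)"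
  have S: "?SL \<in> proj_tensor AA 2 AA" "?SR \<in> proj_tensor AA 2 AA"
    using sharp_represents(1)[OF r(1) X] sharp_represents(2)[OF r(2) X] by (auto simp: proj_tensor_def)
  have F: "Uf a m \<in> proj_tensor AA 2 AA" using Uf_bound o o' by blast
  have "U m - U a = ?SL + ?SR + Uf a m"
    using cb o o' unfolding controlled_biprocess_def by auto
  hence Um_eq: "U m = U a + (?SL + ?SR + Uf a m)" by (simp add: algebra_simps)
  have "sharp AA (U m) (dX \<Theta> m c) = sharp AA (U a) (dX \<Theta> m c) + (sharp AA ?SL (dX \<Theta> m c) + sharp AA ?SR (dX \<Theta> m c) + sharp AA (Uf a m) (dX \<Theta> m c))"
    unfolding Um_eq using S F to_AA[OF Ua(1)] by (simp add: sharp_add proj_tensor_add)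
  moreover have "sharp AA (U a) (dX \<Theta> a c) = sharp AA (U a) (dX \<Theta> a m) + sharp AA (U a) (dX \<Theta> m c)"
    using sharp_add_right[OF to_AA[OF Ua(1)], of "dX \<Theta> a m" "dX \<Theta> m c"] by (simp add: dX_def)
  ultimately show ?thesis
    unfolding Xi_def tens3_chen[OF o'(1-4) Ua(2)] tens3_chen[OF o'(1-4) Ua(3)]
      tens3_diff[OF clin_Lt[OF mc] Um(2) up(1)] tens3_diff[OF clin_starL[OF mc] Um(3) up(2)]
    by (simp add: algebra_simps)
qed

text \<open>The remainder term is of order 1/2 + 2 \<gamma>, the two derivative terms are of order 1
  + \<gamma>. As \<gamma> > 1/3, all orders exceed 7/6 = 1/2 + 2/3, and 7/6 > 1 is what sewing
  requires.\<close>

lemma Xi_bound: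
  "\<exists>C\<ge>0. \<forall>a m c. s \<le> a \<and> a < m \<and> m < c \<and> c \<le> t \<and> c - a < 1 \<longrightarrow>
      norm (Xi a c - Xi a m - Xi m c) \<le> C * (c - a) powr (7/6)"
proof -
  have h: "holder1 AA 3 \<gamma> {s..t} U1" "holder1 AA 3 \<gamma> {s..t} U2" using cb by (simp_all add: controlled_biprocess_def)
  obtain H1 where H1: "0 \<le> H1" "\<And>u v. s \<le> u \<Longrightarrow> u < v \<Longrightarrow> v \<le> t \<Longrightarrow> proj_norm AA 3 (U1 v - U1 u) \<le> H1 * (v - u) powr \<gamma>"
    using holder1_bound[OF h(1)] by blast
  obtain H2 where H2: "0 \<le> H2" "\<And>u v. s \<le> u \<Longrightarrow> u < v \<Longrightarrow> v \<le> t \<Longrightarrow> proj_norm AA 3 (U2 v - U2 u) \<le> H2 * (v - u) powr \<gamma>"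
    using holder1_bound[OF h(2)] by blast
  obtain H where H: "0 \<le> H" "\<And>u v. s \<le> u \<Longrightarrow> u < v \<Longrightarrow> v \<le> t \<Longrightarrow> Uf u v \<in> proj_tensor AA 2 AA"
    "\<And>u v. s \<le> u \<Longrightarrow> u < v \<Longrightarrow> v \<le> t \<Longrightarrow> proj_norm AA 2 (Uf u v) \<le> H * (v - u) powr (2 * \<gamma>)"
    using Uf_bound by blast
  define C where "C = xbd * H + lbd * H1 + lbd * H2"
  have "norm (Xi a c - Xi a m - Xi m c) \<le> C * (c - a) powr (7/6)"
    if o: "s \<le> a" "a < m" "m < c" "c \<le> t" "c - a < 1" for a m c
  proof -
    let ?p = "(c - a) powr (7/6)"
    have o': "0 \<le> a" "s \<le> m" "m \<le> t" "a \<le> t" and mc: "0 \<le> m" "m < c" "c - m < 1" using o st by auto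
    note Ua = U_mem[OF o(1) o'(4)] and Um = U_mem[OF o'(2,3)]
    have up: "U1 a \<in> proj_tensor AA 3 (A_upto m)" "U2 a \<in> proj_tensor AA 3 (A_upto m)"
      using Ua(2,3) proj_tensor_mono[OF A_mono[of a m]] o by auto
    have prod: "(c - m) powr x * (m - a) powr y \<le> ?p" if "0 \<le> x" "0 \<le> y" "7/6 \<le> x + y" for x y
    proof -
      have "(c - m) powr x * (m - a) powr y \<le> (c - a) powr x * (c - a) powr y"
        using o that by (intro mult_mono powr_mono2) auto
      also have "\<dots> = (c - a) powr (x + y)" by (simp add: powr_add)
      also have "\<dots> \<le> ?p" using o that by (intro powr_shrink) auto
      finally show ?thesis .
    qed
    have 1: "norm (sharp AA (Uf a m) (dX \<Theta> m c)) \<le> xbd * H * ?p"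
    proof -
      have "norm (sharp AA (Uf a m) (dX \<Theta> m c)) \<le> norm (dX \<Theta> m c) * proj_norm AA 2 (Uf a m)"
        using H(2)[of a m] o o' by (intro norm_sharp) auto
      also have "\<dots> \<le> (xbd * sqrt (c - m)) * (H * (m - a) powr (2 * \<gamma>))"
        using norm_dX[of m c] H(3)[of a m] H(2)[of a m] o o' mc xbd_nonneg by (intro mult_mono proj_norm_nonneg) auto
      also have "\<dots> = xbd * H * ((c - m) powr (1/2) * (m - a) powr (2 * \<gamma>))" using mc by (simp add: powr_half_sqrt)
      also have "\<dots> \<le> xbd * H * ?p" using xbd_nonneg H(1) \<gamma> by (intro mult_left_mono prod) auto
      finally show ?thesis .
    qed
    have lin: "(c - m) * (m - a) powr \<gamma> \<le> ?p" using prod[of 1 \<gamma>] \<gamma> mc by simp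
    have t3: "norm (tens3 (A_upto m) L w) \<le> lbd * h * ?p"
      if "clin (lbd * (c - m)) L" "w \<in> proj_tensor AA 3 (A_upto m)" "proj_norm AA 3 w \<le> h * (m - a) powr \<gamma>" "0 \<le> h" for L w h
    proof -
      have "norm (tens3 (A_upto m) L w) \<le> lbd * (c - m) * (h * (m - a) powr \<gamma>)"
        using norm_tens3[OF that(1,2)] that(3) mc lbd_nonneg by (elim order_trans) (intro mult_left_mono; simp)
      also have "\<dots> = lbd * h * ((c - m) * (m - a) powr \<gamma>)" by simp
      also have "\<dots> \<le> lbd * h * ?p" using lbd_nonneg that(4) by (intro mult_left_mono lin) auto
      finally show ?thesis .
    qed
    have 2: "norm (tens3 (A_upto m) (Lt m c) (U1 m - U1 a)) \<le> lbd * H1 * ?p"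
      by (rule t3[OF clin_Lt[OF mc] proj_tensor_diff3[OF Um(2) up(1)] H1(2) H1(1)]) (use o o' in auto)
    have 3: "norm (tens3 (A_upto m) (starL m c) (U2 m - U2 a)) \<le> lbd * H2 * ?p"
      by (rule t3[OF clin_starL[OF mc] proj_tensor_diff3[OF Um(3) up(2)] H2(2) H2(1)]) (use o o' in auto)
    show ?thesis unfolding Xi_increment[OF o] norm_minus_cancel C_def distrib_right
      by (intro norm_triangle_mono 1 2 3)
  qed
  moreover have "0 \<le> C" using xbd_nonneg lbd_nonneg H(1) H1(1) H2(1) by (simp add: C_def)
  ultimately show ?thesis by blast
qed

text \<open>The density of the correction before the factor 1/2, as an operator;
  \<open>id_Gamma_id\<close> gives its vector.\<close>

definition Ga :: "real \<Rightarrow> 'f op" where "Ga u = tens3 (A_upto u) (Gt u) (U1 u + U2 u)"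

text \<open>What the area terms retain after the part visible to the past is subtracted: a
  martingale increment.\<close>

definition Er :: "real \<Rightarrow> real \<Rightarrow> 'f op" where
  "Er u v = tens3 (A_upto u) (Lt u v) (U1 u) + tens3 (A_upto u) (starL u v) (U2 u) - ((v - u) / 2) *\<^sub>R Ga u"

lemma sum_mem: "s \<le> u \<Longrightarrow> u \<le> t \<Longrightarrow> U1 u + U2 u \<in> proj_tensor AA 3 (A_upto u)"
  by (intro proj_tensor_add U_mem AA_subset)

lemma Ga_A: "s \<le> u \<Longrightarrow> u \<le> t \<Longrightarrow> Ga u \<in> A_upto u"
  unfolding Ga_def using st by (intro tens3_A[OF clin_Gt sum_mem order_refl Gt_A(1)]) auto

lemma Er_A:
  assumes "s \<le> u" "u < v" "v \<le> t" "v - u < 1" shows "Er u v \<in> A_upto v"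
proof -
  have u: "0 \<le> u" "u \<le> t" using assms st by auto
  note m = U_mem[OF assms(1) u(2)]
  show ?thesis unfolding Er_def
    using assms u Lt_A[OF u(1) assms(2,4)] starL_A[OF u(1) assms(2,4)] Ga_A[OF assms(1) u(2)] A_mono[of u v]
    by (intro A_diff A_closed(2) A_scaleR tens3_A[OF clin_Lt m(2)] tens3_A[OF clin_starL m(3)]) auto
qed

text \<open>The areas are bounded linearly in v - u, and the two derivatives stay bounded on [s, t]
  because they are Hoelder continuous.\<close>

lemma Er_bound: "\<exists>M. \<forall>u v. s \<le> u \<and> u < v \<and> v \<le> t \<and> v - u < 1 \<longrightarrow> norm (Er u v) \<le> M * (v - u)"
proof -
  have h: "holder1 AA 3 \<gamma> {s..t} U1" "holder1 AA 3 \<gamma> {s..t} U2" using cb by (simp_all add: controlled_biprocess_def)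
  have bd: "\<exists>B. \<forall>u. s \<le> u \<and> u \<le> t \<longrightarrow> proj_norm AA 3 (h u) \<le> B"
    if h: "holder1 AA 3 \<gamma> {s..t} h" and hm: "\<And>u. s \<le> u \<Longrightarrow> u \<le> t \<Longrightarrow> h u \<in> proj_tensor AA 3 (A_upto u)" for h
  proof -
    obtain H where H: "0 \<le> H" "\<And>u v. s \<le> u \<Longrightarrow> u < v \<Longrightarrow> v \<le> t \<Longrightarrow> proj_norm AA 3 (h v - h u) \<le> H * (v - u) powr \<gamma>"
      using holder1_bound[OF h] by blast
    have "proj_norm AA 3 (h u) \<le> proj_norm AA 3 (h s) + H * (t - s) powr \<gamma>" if u: "s \<le> u" "u \<le> t" for u
    proof (cases "u = s")
      case True
      thus ?thesis using H(1) by simp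
    next
      case False
      have hs: "h s \<in> proj_tensor AA 3 (A_upto u)" using hm[of s] u proj_tensor_mono[OF A_mono[OF u(1)]] by auto
      have "proj_norm AA 3 ((h u - h s) + h s) \<le> proj_norm AA 3 (h u - h s) + proj_norm AA 3 (h s)"
        by (rule proj_norm_triangle[OF to_AA[OF proj_tensor_diff3[OF hm[OF u] hs]] to_AA[OF hs]])
      also have "proj_norm AA 3 (h u - h s) \<le> H * (u - s) powr \<gamma>" using H(2)[of s u] u False by auto
      also have "H * (u - s) powr \<gamma> \<le> H * (t - s) powr \<gamma>" using u \<gamma> H(1) by (intro mult_left_mono powr_mono2) auto
      finally show ?thesis by simp
    qed
    thus ?thesis by blast
  qed
  obtain B1 where B1: "\<And>u. s \<le> u \<Longrightarrow> u \<le> t \<Longrightarrow> proj_norm AA 3 (U1 u) \<le> B1" using bd[OF h(1) U_mem(2)] by blast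
  obtain B2 where B2: "\<And>u. s \<le> u \<Longrightarrow> u \<le> t \<Longrightarrow> proj_norm AA 3 (U2 u) \<le> B2" using bd[OF h(2) U_mem(3)] by blast
  have "norm (Er u v) \<le> (lbd * B1 + lbd * B2 + (B1 + B2) / 2) * (v - u)" if o: "s \<le> u" "u < v" "v \<le> t" "v - u < 1" for u v
  proof -
    have u: "0 \<le> u" "u \<le> t" using o st by auto
    note m = U_mem[OF o(1) u(2)]
    have 1: "norm (tens3 (A_upto u) (Lt u v) (U1 u)) \<le> lbd * (v - u) * B1"
      using norm_tens3[OF clin_Lt[OF u(1) o(2,4)] m(2)] B1[OF o(1) u(2)] o lbd_nonneg
      by (elim order_trans) (intro mult_left_mono; simp)
    have 2: "norm (tens3 (A_upto u) (starL u v) (U2 u)) \<le> lbd * (v - u) * B2"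
      using norm_tens3[OF clin_starL[OF u(1) o(2,4)] m(3)] B2[OF o(1) u(2)] o lbd_nonneg
      by (elim order_trans) (intro mult_left_mono; simp)
    have "norm (Ga u) \<le> B1 + B2"
      using norm_tens3[OF clin_Gt[OF u(1)] sum_mem[OF o(1) u(2)]] proj_norm_triangle[OF to_AA[OF m(2)] to_AA[OF m(3)]]
        B1[OF o(1) u(2)] B2[OF o(1) u(2)] by (simp add: Ga_def)
    hence 3: "norm (((v - u) / 2) *\<^sub>R Ga u) \<le> (v - u) / 2 * (B1 + B2)" using o by (simp add: mult_left_mono)
    have "norm (Er u v) \<le> lbd * (v - u) * B1 + lbd * (v - u) * B2 + (v - u) / 2 * (B1 + B2)"
      unfolding Er_def by (intro norm_triangle_le_diff order_trans[OF add_mono[OF norm_triangle_mono[OF 1 2] 3]] order_refl)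
    thus ?thesis by (simp add: algebra_simps)
  qed
  thus ?thesis by blast
qed

text \<open>Between past vectors both areas act as (v - u) / 2 times the compression, by
  \<open>cinner_Lt\<close> and \<open>cinner_starL\<close> in the middle factor.\<close>

lemma Er_past:
  assumes o: "s \<le> u" "u < v" "v \<le> t" "v - u < 1" and S: "S \<in> A_upto u" and T: "T \<in> A_upto u"
  shows "cinner (S \<Omega>) ((Er u v) (T \<Omega>)) = 0"
proof -
  have u: "0 \<le> u" "u \<le> t" using o st by auto
  note m = U_mem[OF o(1) u(2)]
  define x y where "x = S \<Omega>" "y = T \<Omega>"
  have xy: "x \<in> pastvec u" "y \<in> pastvec u"
    unfolding x_y_def using S T A_past[OF u(1)] past_pastvec[OF u(1) _ vac_pastvec[OF u(1)]] by auto
  have "cinner x ((tens3 (A_upto u) (Lt u v) (U1 u)) y) = of_real ((v - u) / 2) * cinner x ((tens3 (A_upto u) (Gt u) (U1 u)) y)"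
    by (rule cinner_tens3[OF u(1) clin_Lt[OF u(1) o(2,4)] clin_Gt[OF u(1)] m(2) cinner_Lt[OF u(1) o(2,4)] xy])
  moreover have "cinner x ((tens3 (A_upto u) (starL u v) (U2 u)) y) = of_real ((v - u) / 2) * cinner x ((tens3 (A_upto u) (Gt u) (U2 u)) y)"
    by (rule cinner_tens3[OF u(1) clin_starL[OF u(1) o(2,4)] clin_Gt[OF u(1)] m(3) cinner_starL[OF u(1) o(2,4)] xy])
      (auto intro: A_clinear)
  moreover have "Ga u = tens3 (A_upto u) (Gt u) (U1 u) + tens3 (A_upto u) (Gt u) (U2 u)"
    unfolding Ga_def by (rule tens3_add[OF clin_Gt[OF u(1)] m(2,3)])
  ultimately show ?thesis unfolding x_y_def[symmetric] Er_def
    by (simp add: blinfun.add_left blinfun.diff_left blinfun.scaleR_left cinner_add_right cinner_diff_right cinner_scaleR_right distrib_left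
        del: of_real_divide of_real_diff)
qed

text \<open>The sum over the later intervals has no matrix elements between vectors from the past of
  y, and both \<Omega> and \<open>adj (Er x y) \<Omega>\<close> are such vectors. So each added
  increment is orthogonal, and Pythagoras applies. The vanishing of matrix elements is carried along
  in the induction.\<close>

lemma partition_Er:
  assumes "ts \<in> partitions a t" "finer 1 ts" "s \<le> a"
  shows "partition_sum Er ts \<in> AA \<and>
    (\<forall>S\<in>A_upto a. \<forall>T\<in>A_upto a. cinner (S \<Omega>) (partition_sum Er ts (T \<Omega>)) = 0) \<and>
    (norm (adj (partition_sum Er ts) \<Omega>))\<^sup>2 \<le> partition_sum (\<lambda>u v. (norm (Er u v))\<^sup>2) ts"
  using assms
proof (induction rule: partition_induct)
  case single
  have "adj (0 :: 'f op) = 0" by (rule adj_unique) simp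
  thus ?case using AA_zero by simp
next
  case (Cons x y zs)
  have o: "s \<le> x" "x < y" "y \<le> t" "y - x < 1" and y: "s \<le> y" and f: "finer 1 (y # zs)" using Cons by auto
  let ?P = "partition_sum Er (y # zs)"
  note IH = Cons.IH[OF f y]
  have E: "Er x y \<in> A_upto y" by (rule Er_A[OF o])
  have EA: "Er x y \<in> AA" using E A_subset_AA by blast
  have up: "A_upto x \<subseteq> A_upto y" using o by (intro A_mono) auto
  have c: "Er x y \<in> clinear_ops" "?P \<in> clinear_ops" using EA IH AA_clinear by auto
  have "cinner (adj ?P \<Omega>) (adj (Er x y) \<Omega>) = cinner \<Omega> (?P (adj (Er x y) \<Omega>))"
    by (rule cinner_adj[OF c(2)])
  also have "\<dots> = 0" using IH A_adj[OF E] A_closed(1)[of y] by (metis blinfun_apply_id_blinfun id_apply)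
  finally have orth: "cinner (adj ?P \<Omega>) (adj (Er x y) \<Omega>) = 0" .
  have "norm (adj (Er x y) \<Omega>) \<le> norm (Er x y)"
    using norm_blinfun[of "adj (Er x y)" \<Omega>] norm_adj[OF c(1)] by (simp add: norm_vac)
  hence n: "(norm (adj (Er x y) \<Omega>))\<^sup>2 \<le> (norm (Er x y))\<^sup>2" by (intro power_mono) auto
  have "(norm (adj (?P + Er x y) \<Omega>))\<^sup>2 = (norm (adj ?P \<Omega>))\<^sup>2 + (norm (adj (Er x y) \<Omega>))\<^sup>2"
    using norm_sq_add[of "adj ?P \<Omega>" "adj (Er x y) \<Omega>"] orth c by (simp add: adj_add blinfun.add_left)
  hence "(norm (adj (Er x y + ?P) \<Omega>))\<^sup>2 \<le> (norm (Er x y))\<^sup>2 + partition_sum (\<lambda>u v. (norm (Er u v))\<^sup>2) (y # zs)"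
    unfolding add.commute[of "Er x y" ?P] using n IH by linarith
  moreover have "cinner (S \<Omega>) ((Er x y + ?P) (T \<Omega>)) = 0" if "S \<in> A_upto x" "T \<in> A_upto x" for S T
    using Er_past[OF o that] IH that up by (auto simp: blinfun.add_left cinner_add_right)
  moreover have "Er x y + ?P \<in> AA" using EA IH by (intro AA_closed(2)) auto
  ultimately show ?case by (simp only: partition_sum_simps) blast
qed

context
  fixes \<eta> :: "'f op \<Rightarrow> 'l::complex_hilbert"
  assumes eta: "L2_completion \<Theta> \<eta>"
begin

lemma eta_partition_sum:
  assumes "ts \<in> partitions a t" "finer e ts" "s \<le> a"
    and F: "\<And>u v. s \<le> u \<Longrightarrow> u < v \<Longrightarrow> v \<le> t \<Longrightarrow> v - u < e \<Longrightarrow> F u v \<in> AA"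
  shows "partition_sum F ts \<in> AA \<and> \<eta> (partition_sum F ts) = partition_sum (\<lambda>u v. \<eta> (F u v)) ts"
  using assms(1-3)
proof (induction rule: partition_induct)
  case single
  show ?case using AA_zero eta_scaleR[OF eta AA_zero, of 0] by simp
next
  case (Cons x y zs)
  have "F x y \<in> AA" using Cons by (intro F) auto
  moreover have "partition_sum F (y # zs) \<in> AA \<and> \<eta> (partition_sum F (y # zs)) = partition_sum (\<lambda>u v. \<eta> (F u v)) (y # zs)"
    using Cons by auto
  ultimately show ?case by (simp add: eta_add[OF eta] AA_closed(2))
qed

text \<open>By orthogonality the squared norm is at most M^2 (t - s) times the mesh.\<close>

lemma Er_negligible: "((\<lambda>ts. \<eta> (partition_sum Er ts)) \<longlongrightarrow> 0) (mesh_to_0 s t)"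
proof (rule tendstoI)
  fix \<epsilon> :: real assume \<epsilon>: "0 < \<epsilon>"
  obtain M where M: "\<And>u v. s \<le> u \<Longrightarrow> u < v \<Longrightarrow> v \<le> t \<Longrightarrow> v - u < 1 \<Longrightarrow> norm (Er u v) \<le> M * (v - u)"
    using Er_bound by blast
  \<comment> \<open>The added 1 keeps D positive and makes the final estimate strict.\<close>
  define D where "D = M\<^sup>2 * (t - s) + 1"
  have D: "0 < D" using st by (simp add: D_def add_nonneg_pos)
  define e where "e = min 1 (\<epsilon>\<^sup>2 / D)"
  have e: "0 < e" "e \<le> 1" "e * D \<le> \<epsilon>\<^sup>2" using \<epsilon> D by (auto simp: e_def min_def field_simps)
  have "dist (\<eta> (partition_sum Er ts)) 0 < \<epsilon>" if ts: "ts \<in> partitions s t" "finer e ts" for ts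
  proof -
    have f1: "finer 1 ts" using ts(2) e(2) by (force simp: finer_def)
    have "(norm (\<eta> (partition_sum Er ts)))\<^sup>2 \<le> partition_sum (\<lambda>u v. (norm (Er u v))\<^sup>2) ts"
      using partition_Er[OF ts(1) f1 order_refl] by (simp add: norm_eta[OF eta])
    also have "\<dots> \<le> partition_sum (\<lambda>u v. (M\<^sup>2 * e) * v - (M\<^sup>2 * e) * u) ts"
    proof (rule partition_sum_le[OF ts order_refl])
      fix u v assume o: "s \<le> u" "u < v" "v \<le> t" "v - u < e"
      have "(norm (Er u v))\<^sup>2 \<le> (M * (v - u))\<^sup>2" using M[of u v] o e by (intro power_mono) auto
      also have "\<dots> = M\<^sup>2 * ((v - u) * (v - u))" by (simp add: power2_eq_square)
      also have "\<dots> \<le> M\<^sup>2 * (e * (v - u))" using o by (intro mult_left_mono mult_right_mono) auto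
      finally show "(norm (Er u v))\<^sup>2 \<le> (M\<^sup>2 * e) * v - (M\<^sup>2 * e) * u" by (simp add: algebra_simps)
    qed
    also have "\<dots> = (M\<^sup>2 * e) * t - (M\<^sup>2 * e) * s" by (rule partition_sum_telescope[OF ts(1)])
    also have "\<dots> < e * D" using e(1) by (simp add: D_def algebra_simps)
    also have "\<dots> \<le> \<epsilon>\<^sup>2" by (rule e(3))
    finally have "norm (\<eta> (partition_sum Er ts)) < \<epsilon>" by (rule power2_less_imp_less) (use \<epsilon> in simp)
    thus ?thesis by simp
  qed
  thus "eventually (\<lambda>ts. dist (\<eta> (partition_sum Er ts)) 0 < \<epsilon>) (mesh_to_0 s t)"
    unfolding eventually_mesh using e(1) by blast
qed

lemma Ga_continuous: "continuous_on {s..t} (\<lambda>u. \<eta> (Ga u))"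
  unfolding continuous_on_iff
proof (intro ballI allI impI)
  fix u e :: real assume u: "u \<in> {s..t}" and e: "0 < e"
  have "\<exists>d>0. \<forall>v\<in>{s..t}. \<bar>v - u\<bar> < d \<longrightarrow> proj_norm AA 3 (h v - h u) < e / 2" if "holder1 AA 3 \<gamma> {s..t} h" for h
    using that u e unfolding holder1_def by (meson half_gt_zero)
  hence "\<exists>d>0. \<forall>v\<in>{s..t}. \<bar>v - u\<bar> < d \<longrightarrow> proj_norm AA 3 (U1 v - U1 u) < e / 2"
    "\<exists>d>0. \<forall>v\<in>{s..t}. \<bar>v - u\<bar> < d \<longrightarrow> proj_norm AA 3 (U2 v - U2 u) < e / 2"
    using cb by (simp_all add: controlled_biprocess_def)
  then obtain d1 d2 where d: "0 < d1" "\<And>v. v \<in> {s..t} \<Longrightarrow> \<bar>v - u\<bar> < d1 \<Longrightarrow> proj_norm AA 3 (U1 v - U1 u) < e / 2"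
    "0 < d2" "\<And>v. v \<in> {s..t} \<Longrightarrow> \<bar>v - u\<bar> < d2 \<Longrightarrow> proj_norm AA 3 (U2 v - U2 u) < e / 2" by blast
  have "dist (\<eta> (Ga v)) (\<eta> (Ga u)) < e" if v: "v \<in> {s..t}" "dist v u < min d1 d2" for v
  proof -
    \<comment> \<open>At the later of the two times both tensors have entries in one algebra and can
      be subtracted.\<close>
    define m where "m = max u v"
    have m: "0 \<le> u" "0 \<le> v" "u \<le> m" "v \<le> m" "0 \<le> m" using u v st by (auto simp: m_def)
    have um: "s \<le> u" "u \<le> t" "s \<le> v" "v \<le> t" using u v by auto
    have up: "w \<in> proj_tensor AA 3 (A_upto m)" if "w \<in> proj_tensor AA 3 (A_upto r)" "r \<le> m" for w r
      using that proj_tensor_mono[OF A_mono] by blast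
    note mem = up[OF U_mem(2)[OF um(1,2)] m(3)] up[OF U_mem(3)[OF um(1,2)] m(3)] up[OF U_mem(2)[OF um(3,4)] m(4)]
      up[OF U_mem(3)[OF um(3,4)] m(4)]
    note sm = up[OF sum_mem[OF um(3,4)] m(4)] up[OF sum_mem[OF um(1,2)] m(3)]
    have eq: "(U1 v + U2 v) - (U1 u + U2 u) = (U1 v - U1 u) + (U2 v - U2 u)" by simp
    have "Ga v - Ga u = tens3 (A_upto m) (Gt m) ((U1 v + U2 v) - (U1 u + U2 u))"
      unfolding Ga_def tens3_diff[OF clin_Gt[OF m(5)] sm]
      using tens3_Gt_mono[OF m(1,3) sum_mem[OF um(1,2)]] tens3_Gt_mono[OF m(2,4) sum_mem[OF um(3,4)]] by simp
    also have "norm \<dots> \<le> proj_norm AA 3 ((U1 v + U2 v) - (U1 u + U2 u))"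
      using norm_tens3[OF clin_Gt[OF m(5)] proj_tensor_diff3[OF sm]] by simp
    also have "\<dots> \<le> proj_norm AA 3 (U1 v - U1 u) + proj_norm AA 3 (U2 v - U2 u)"
      unfolding eq by (intro proj_norm_triangle to_AA[OF proj_tensor_diff3[OF mem(3,1)]] to_AA[OF proj_tensor_diff3[OF mem(4,2)]])
    also have "\<dots> < e" using d(2)[OF v(1)] d(4)[OF v(1)] v(2) by (simp add: dist_real_def)
    finally have "norm (Ga v - Ga u) < e" .
    moreover have "Ga u \<in> AA" "Ga v \<in> AA" using Ga_A um A_subset_AA by blast+
    ultimately show ?thesis
      using norm_eta_le[OF eta AA_diff, of "Ga v" "Ga u"] by (simp add: dist_norm eta_diff[OF eta])
  qed
  thus "\<exists>d>0. \<forall>v\<in>{s..t}. dist v u < d \<longrightarrow> dist (\<eta> (Ga v)) (\<eta> (Ga u)) < e"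
    using d(1,3) by (intro exI[of _ "min d1 d2"]) auto
qed

text \<open>The Ito integral is a \<open>Lim\<close>, so its sums have to be shown to converge. They
  are the compensated sums minus the Riemann sums of the correction minus the martingale part, three
  families that converge along the same filter.\<close>

lemma rough_eq_ito:
  "\<eta> (rough_integral \<Theta> s t U U1 U2) = ito_integral \<Theta> \<eta> s t U
     + (1/2) *\<^sub>R integral {s..t} (\<lambda>u. id_Gamma_id \<Theta> \<eta> (U1 u + U2 u))"
proof -
  let ?F = "mesh_to_0 s t"
  let ?X = "\<lambda>u v. sharp AA (U u) (dX \<Theta> u v) + area_S_id \<Theta> u v (U1 u) + id_area_S_star \<Theta> u v (U2 u)"
  let ?R = "\<lambda>u v. (v - u) *\<^sub>R \<eta> (Ga u)" and ?G = "\<lambda>u v. ((v - u) / 2) *\<^sub>R Ga u"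
  have nb: "?F \<noteq> bot" by (rule mesh_nonbot[OF st(2)])
  obtain C where C: "0 \<le> C" "\<And>a m c. s \<le> a \<Longrightarrow> a < m \<Longrightarrow> m < c \<Longrightarrow> c \<le> t \<Longrightarrow> c - a < 1 \<Longrightarrow>
      norm (Xi a c - Xi a m - Xi m c) \<le> C * (c - a) powr (7/6)"
    using Xi_bound by blast
  obtain I where I: "(partition_sum Xi \<longlongrightarrow> I) ?F"
    using sewing[OF st(2) _ C] by fastforce
  have ev: "eventually (\<lambda>ts. ts \<in> partitions s t \<and> finer 1 ts) ?F"
    unfolding eventually_mesh by (intro exI[of _ 1]) auto
  have psum_cong: "partition_sum F ts = partition_sum G ts"
    if "ts \<in> partitions s t" "finer 1 ts" "\<And>u v. s \<le> u \<Longrightarrow> u < v \<Longrightarrow> v \<le> t \<Longrightarrow> v - u < 1 \<Longrightarrow> F u v = G u v" for F G :: "real \<Rightarrow> real \<Rightarrow> 'f op" and ts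
  proof -
    have "norm (partition_sum (\<lambda>u v. F u v - G u v) ts) \<le> partition_sum (\<lambda>u v. 0) ts"
      by (rule partition_sum_norm[OF that(1,2) order_refl]) (use that(3) in simp)
    thus ?thesis unfolding partition_sum_diff by (simp add: partition_sum_def)
  qed
  \<comment> \<open>Once the mesh is below 1, every step is short enough for the area terms to take
    the form used in \<open>Xi\<close>.\<close>
  have "eventually (\<lambda>ts. partition_sum Xi ts = partition_sum ?X ts) ?F"
    using ev
  proof eventually_elim
    case (elim ts)
    show ?case
      by (rule psum_cong) (use elim st in \<open>auto simp: Xi_def area_S_id_tens3 id_area_S_star_tens3\<close>)
  qed
  from tendsto_cong[OF this] I
  have "(partition_sum ?X \<longlongrightarrow> I) ?F"
    by simp
  hence rough: "rough_integral \<Theta> s t U U1 U2 = I" unfolding rough_integral_def by (rule tendsto_Lim[OF nb])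
  define J where "J u v = sharp AA (U u) (dX \<Theta> u v)" for u v
  have Xi_eq: "Xi u v = J u v + ((v - u) / 2) *\<^sub>R Ga u + Er u v" for u v
    by (simp add: Xi_def J_def Er_def)
  have mem: "J u v \<in> AA" "((v - u) / 2) *\<^sub>R Ga u \<in> AA" "Er u v \<in> AA" "Xi u v \<in> AA"
    if o: "s \<le> u" "u < v" "v \<le> t" "v - u < 1" for u v
  proof -
    show J: "J u v \<in> AA" unfolding J_def
      using o st U_mem(1)[of u] by (intro A_subset_AA[of _ v] sharp_A[where s = u] dX_A) auto
    show G: "((v - u) / 2) *\<^sub>R Ga u \<in> AA" using o Ga_A[of u] by (intro AA_scaleR A_subset_AA[of _ u]) auto
    show E: "Er u v \<in> AA" using Er_A[OF o] A_subset_AA by blast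
    show "Xi u v \<in> AA" unfolding Xi_eq by (intro AA_closed(2) J G E)
  qed
  have evXi: "eventually (\<lambda>ts. partition_sum Xi ts \<in> AA) ?F"
    using ev
  proof eventually_elim
    case (elim ts)
    show ?case
      by (rule eta_partition_sum[where F = Xi, THEN conjunct1, OF elim[THEN conjunct1] elim[THEN conjunct2] order_refl])
        (rule mem(4))
  qed
  have "closed AA" unfolding closed_sequential_limits using AA_closed(5)[OF sequentially_bot] by blast
  hence IA: "I \<in> AA" by (rule Lim_in_closed_set[OF _ evXi nb I])
  have etaXi: "((\<lambda>ts. \<eta> (partition_sum Xi ts)) \<longlongrightarrow> \<eta> I) ?F"
    by (rule eta_lim[OF eta I IA evXi])
  have R: "(partition_sum ?R \<longlongrightarrow> integral {s..t} (\<lambda>u. \<eta> (Ga u))) ?F"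
    by (rule riemann_sums[OF st(2) Ga_continuous])
  have "eventually (\<lambda>ts. \<eta> (partition_sum Xi ts) - (1/2) *\<^sub>R partition_sum ?R ts
      - \<eta> (partition_sum Er ts) = \<eta> (partition_sum J ts)) ?F"
    using ev
  proof eventually_elim
    case (elim ts)
    note pm = eta_partition_sum[OF elim[THEN conjunct1] elim[THEN conjunct2] order_refl]
    have J: "partition_sum J ts \<in> AA" by (rule pm[THEN conjunct1]) (rule mem(1))
    have G: "partition_sum ?G ts \<in> AA
        \<and> \<eta> (partition_sum ?G ts) = partition_sum (\<lambda>u v. \<eta> (((v - u) / 2) *\<^sub>R Ga u)) ts"
      by (rule pm) (rule mem(2))
    have E: "partition_sum Er ts \<in> AA" by (rule pm[THEN conjunct1]) (rule mem(3))
    have "partition_sum Xi ts = partition_sum J ts + partition_sum ?G ts + partition_sum Er ts"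
      unfolding Xi_eq[abs_def] partition_sum_add ..
    hence "\<eta> (partition_sum Xi ts) = \<eta> (partition_sum J ts) + \<eta> (partition_sum ?G ts) + \<eta> (partition_sum Er ts)"
      using J G E by (simp add: eta_add[OF eta] AA_closed(2))
    moreover have "\<eta> (partition_sum ?G ts) = (1/2) *\<^sub>R partition_sum ?R ts"
    proof -
      have "\<eta> (partition_sum ?G ts) = partition_sum (\<lambda>u v. \<eta> (((v - u) / 2) *\<^sub>R Ga u)) ts"
        using G by blast
      also have "\<dots> = (1/2) *\<^sub>R partition_sum ?R ts"
        unfolding partition_sum_def scaleR_sum_right
      proof (rule sum.cong[OF refl])
        fix i assume i: "i \<in> {..<length ts - 1}"
        have "ts ! i \<in> set ts" using i by simp
        hence "Ga (ts ! i) \<in> AA" using partitions_le[OF elim[THEN conjunct1]] Ga_A A_subset_AA by blast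
        thus "\<eta> (((ts ! Suc i - ts ! i) / 2) *\<^sub>R Ga (ts ! i)) = (1/2) *\<^sub>R (ts ! Suc i - ts ! i) *\<^sub>R \<eta> (Ga (ts ! i))"
          by (simp add: eta_scaleR[OF eta])
      qed
      finally show ?thesis .
    qed
    ultimately show ?case by simp
  qed
  moreover have "((\<lambda>ts. \<eta> (partition_sum Xi ts) - (1/2) *\<^sub>R partition_sum ?R ts
      - \<eta> (partition_sum Er ts)) \<longlongrightarrow> \<eta> I - (1/2) *\<^sub>R integral {s..t} (\<lambda>u. \<eta> (Ga u)) - 0) ?F"
    by (intro tendsto_diff tendsto_scaleR tendsto_const etaXi R Er_negligible)
  ultimately have "((\<lambda>ts. \<eta> (partition_sum J ts)) \<longlongrightarrow> \<eta> I - (1/2) *\<^sub>R integral {s..t} (\<lambda>u. \<eta> (Ga u)) - 0) ?F"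
    using tendsto_cong by fast
  hence ito: "ito_integral \<Theta> \<eta> s t U = \<eta> I - (1/2) *\<^sub>R integral {s..t} (\<lambda>u. \<eta> (Ga u))"
    unfolding ito_integral_def J_def[abs_def] using tendsto_Lim[OF nb] by simp
  have "integral {s..t} (\<lambda>u. id_Gamma_id \<Theta> \<eta> (U1 u + U2 u)) = integral {s..t} (\<lambda>u. \<eta> (Ga u))"
    using st by (intro integral_cong) (auto simp: Ga_def intro!: id_Gamma_id_tens3[OF eta] sum_mem)
  thus ?thesis unfolding rough ito by simp
qed

end

end

end

theorem corollary4p9:
  fixes q \<gamma> s t :: real
    and \<Theta> :: "(real \<Rightarrow> complex) list \<Rightarrow> 'f::complex_hilbert"
    and \<eta> :: "('f \<Rightarrow>\<^sub>L 'f) \<Rightarrow> 'l::complex_hilbert"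
    and U U1 U2 :: "real \<Rightarrow> 'f tensor"
    and Uflat :: "real \<Rightarrow> real \<Rightarrow> 'f tensor"
  assumes "0 \<le> q" and "q < 1"
    and "q_fock_space q \<Theta>"
    and "L2_completion \<Theta> \<eta>"
    and "1/3 < \<gamma>" and "\<gamma> < 1/2"
    and "0 \<le> s" and "s < t"
    and "controlled_biprocess \<Theta> \<gamma> {s..t} U U1 U2 Uflat"
  shows "\<eta> (rough_integral \<Theta> s t U U1 U2) =
           ito_integral \<Theta> \<eta> s t U
           + (1/2) *\<^sub>R integral {s..t} (\<lambda>u. id_Gamma_id \<Theta> \<eta> (U1 u + U2 u))"
proof -
  interpret qfock q \<Theta> by unfold_locales (use assms in auto)
  show ?thesis by (rule rough_eq_ito[OF assms(7,8,5,6,9,4)])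
qed

end
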